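(* Let $M$ be a hyperbolic manifold of finite volume with (possibly empty) totally geodesic boundary. Then every peripheral subgroup of $\pi_1(M)$ is separable in $\pi_1(M)$.
   Context: A hyperbolic $n$-manifold of finite volume with (possibly empty) totally geodesic boundary means a complete, connected hyperbolic $n$-manifold $M$ of finite volume whose boundary $\partial M$ (if non-empty) consists of totally geodesic hyperbolic $(n-1)$-manifolds, each closed or non-compact. $M$ may be compact or non-compact and is not assumed orientable. Besides $\partial M$, the periphery of $M$ consists of (internal) cusps, modelled on closed Euclidean $(n-1)$-manifolds, and $\partial$-cusps, modelled on compact Euclidean $(n-1)$-manifolds with geodesic boundary, where the boundary of a $\partial$-cusp is contained in non-compact components of $\partial M$. A subgroup of $\pi_1(M)$ is peripheral if it is conjugate either to the fundamental group of a totally geodesic boundary component of $M$, or to the fundamental group of a cusp or $\partial$-cusp of $M$. A subgroup $H$ of a group $G$ is separable in $G$ if for every $\gamma\in G\setminus H$ there is a finite index subgroup $K\le G$ with $H\le K$ and $\gamma\notin K$. *)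

theory Defs
  imports "HOL-Analysis.Analysis" "HOL-Algebra.Coset"
begin

section \<open>Fundamental group\<close>

definition loops_at :: "'m::topological_space set \<Rightarrow> 'm \<Rightarrow> (real \<Rightarrow> 'm) set" where
  "loops_at S x = {p. path p \<and> path_image p \<subseteq> S \<and> pathstart p = x \<and> pathfinish p = x}"

definition path_class :: "'m::topological_space set \<Rightarrow> (real \<Rightarrow> 'm) \<Rightarrow> (real \<Rightarrow> 'm) set" where
  "path_class S p = {q. homotopic_paths S p q}"

definition fundamental_group :: "'m::topological_space set \<Rightarrow> 'm \<Rightarrow> (real \<Rightarrow> 'm) set monoid" where
  "fundamental_group S x =
    \<lparr> carrier = path_class S ` loops_at S x,
      mult = (\<lambda>A B. \<Union>p\<in>A. \<Union>q\<in>B. path_class S (p +++ q)),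
      one = path_class S (\<lambda>_. x) \<rparr>"

text \<open>The image of the fundamental group of a subset \<open>C\<close>, based at the end point of \<open>\<gamma>\<close>, in the
  fundamental group of \<open>S\<close> based at the starting point of \<open>\<gamma>\<close>. Replacing \<open>\<gamma>\<close> by another path from the
  same base point into a path-connected \<open>C\<close> conjugates this subgroup, and every conjugate arises in
  this way.\<close>

definition pi1_image :: "'m::topological_space set \<Rightarrow> 'm set \<Rightarrow> (real \<Rightarrow> 'm) \<Rightarrow> (real \<Rightarrow> 'm) set set" where
  "pi1_image S C \<gamma> =
    {path_class S (\<gamma> +++ \<delta> +++ reversepath \<gamma>) | \<delta>. \<delta> \<in> loops_at C (pathfinish \<gamma>)}"

section \<open>Separable subgroups\<close>

definition separable_subgroup :: "('g, 'r) monoid_scheme \<Rightarrow> 'g set \<Rightarrow> bool" where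
  "separable_subgroup G H \<longleftrightarrow> subgroup H G \<and>
    (\<forall>g \<in> carrier G - H. \<exists>K. subgroup K G \<and> finite (rcosets\<^bsub>G\<^esub> K) \<and> H \<subseteq> K \<and> g \<notin> K)"

section \<open>Length spaces locally isometric to a model space\<close>

definition curve_length :: "'m metric \<Rightarrow> (real \<Rightarrow> 'm) \<Rightarrow> ennreal" where
  "curve_length X g =
    (SUP ts \<in> {ts. sorted ts \<and> set ts \<subseteq> {0..1}}.
       ennreal (\<Sum>i<length ts - 1. mdist X (g (ts ! i)) (g (ts ! Suc i))))"

text \<open>The distance is the one induced by lengths of curves, as for the Riemannian distance of a
  connected Riemannian manifold with boundary. Since distances are finite and the infimum over the
  empty set is infinite, a length space is path-connected.\<close>

definition length_space :: "'m metric \<Rightarrow> bool" where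
  "length_space X \<longleftrightarrow> (\<forall>x\<in>mspace X. \<forall>y\<in>mspace X.
     ennreal (mdist X x y) =
       (INF g \<in> {g. pathin (mtopology_of X) g \<and> g 0 = x \<and> g 1 = y}. curve_length X g))"

text \<open>Isometric charts from open subsets of \<open>X\<close> onto relatively open subsets of a model space \<open>H\<close>,
  equipped with a distance \<open>\<delta>\<close> inducing its usual topology.\<close>

definition isometric_chart ::
  "'m metric \<Rightarrow> 'b::topological_space set \<Rightarrow> ('b \<Rightarrow> 'b \<Rightarrow> real) \<Rightarrow> 'm set \<Rightarrow> ('m \<Rightarrow> 'b) \<Rightarrow> bool" where
  "isometric_chart X H \<delta> U \<phi> \<longleftrightarrow>
     openin (mtopology_of X) U \<and> openin (top_of_set H) (\<phi> ` U) \<and>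
     (\<forall>x\<in>U. \<forall>y\<in>U. \<delta> (\<phi> x) (\<phi> y) = mdist X x y)"

definition locally_isometric_to ::
  "'m metric \<Rightarrow> 'b::topological_space set \<Rightarrow> ('b \<Rightarrow> 'b \<Rightarrow> real) \<Rightarrow> bool" where
  "locally_isometric_to X H \<delta> \<longleftrightarrow>
     (\<forall>p\<in>mspace X. \<exists>U \<phi>. isometric_chart X H \<delta> U \<phi> \<and> p \<in> U)"

definition wall_points ::
  "'m metric \<Rightarrow> 'b::topological_space set \<Rightarrow> ('b \<Rightarrow> 'b \<Rightarrow> real) \<Rightarrow> 'b set \<Rightarrow> 'm set" where
  "wall_points X H \<delta> W =
     {p \<in> mspace X. \<exists>U \<phi>. isometric_chart X H \<delta> U \<phi> \<and> p \<in> U \<and> \<phi> p \<in> W}"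

section \<open>Euclidean and hyperbolic half-spaces\<close>

text \<open>Throughout, the type \<open>'a\<close> plays the role of Euclidean \<open>(n-1)\<close>-space, so that \<open>n = DIM('a) + 1 \<ge> 2\<close>,
  and hyperbolic \<open>n\<close>-space is the upper half-space of pairs \<open>(x, t)\<close> with \<open>t > 0\<close>. All half-spaces of
  these spaces bounded by a totally geodesic hyperplane are isometric, so one of them is fixed; a
  neighbourhood of an interior point is modelled on an open subset missing the wall.\<close>

definition wall_normal :: "'a::euclidean_space" where
  "wall_normal = (SOME b. b \<in> Basis)"

definition euc_half :: "'a::euclidean_space set" where
  "euc_half = {x. 0 \<le> x \<bullet> wall_normal}"

definition euc_wall :: "'a::euclidean_space set" where
  "euc_wall = {x. x \<bullet> wall_normal = 0}"

definition hyp_half :: "('a::euclidean_space \<times> real) set" where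
  "hyp_half = euc_half \<times> {0<..}"

definition hyp_wall :: "('a::euclidean_space \<times> real) set" where
  "hyp_wall = euc_wall \<times> {0<..}"

text \<open>For \<open>\<delta> = dist\<close> on Euclidean space this is the hyperbolic distance of the upper half-space. For
  the distance \<open>\<delta>\<close> of a Euclidean manifold with metric tensor \<open>g\<close> it is, for nearby points, the
  distance of the metric \<open>(g + dt\<^sup>2) / t\<^sup>2\<close>.\<close>

definition upper_dist :: "('e \<Rightarrow> 'e \<Rightarrow> real) \<Rightarrow> 'e \<times> real \<Rightarrow> 'e \<times> real \<Rightarrow> real" where
  "upper_dist \<delta> = (\<lambda>(x, t) (y, s). arcosh (1 + ((\<delta> x y)\<^sup>2 + (t - s)\<^sup>2) / (2 * t * s)))"

definition upper_volume :: "('a::euclidean_space \<times> real) measure" where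
  "upper_volume =
     density lborel (\<lambda>(x, t). if 0 < t then ennreal (1 / t ^ (DIM('a) + 1)) else 0)"

section \<open>Hyperbolic manifolds of finite volume with totally geodesic boundary\<close>

definition hyp_chart ::
  "'m::metric_space set \<Rightarrow> 'm set \<Rightarrow> ('m \<Rightarrow> 'a::euclidean_space \<times> real) \<Rightarrow> bool" where
  "hyp_chart M U \<phi> \<longleftrightarrow>
     isometric_chart (submetric euclidean_metric M) hyp_half (upper_dist dist) U \<phi>"

definition hyp_boundary :: "'a::euclidean_space itself \<Rightarrow> 'm::metric_space set \<Rightarrow> 'm set" where
  "hyp_boundary _ M =
     wall_points (submetric euclidean_metric M)
       (hyp_half :: ('a \<times> real) set) (upper_dist dist) hyp_wall"

definition hyp_volume_measure ::
  "'a::euclidean_space itself \<Rightarrow> 'm::metric_space set \<Rightarrow> 'm measure \<Rightarrow> bool" where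
  "hyp_volume_measure _ M \<mu> \<longleftrightarrow>
     sets \<mu> = sets (restrict_space borel M) \<and>
     (\<forall>U (\<phi> :: 'm \<Rightarrow> 'a \<times> real). hyp_chart M U \<phi> \<longrightarrow>
        (\<forall>B \<in> sets borel. emeasure \<mu> {x \<in> U. \<phi> x \<in> B} = emeasure upper_volume (B \<inter> \<phi> ` U)))"

text \<open>The Riemannian volume is the unique measure satisfying \<open>hyp_volume_measure\<close>.\<close>

definition finite_volume_hyperbolic_manifold ::
  "'a::euclidean_space itself \<Rightarrow> 'm::metric_space set \<Rightarrow> bool" where
  "finite_volume_hyperbolic_manifold T M \<longleftrightarrow>
     M \<noteq> {} \<and> connected M \<and> complete M \<and>
     length_space (submetric euclidean_metric M) \<and>
     locally_isometric_to (submetric euclidean_metric M)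
       (hyp_half :: ('a \<times> real) set) (upper_dist dist) \<and>
     (\<exists>\<mu>. hyp_volume_measure T M \<mu> \<and> emeasure \<mu> M < \<infinity>)"

section \<open>Cusps and boundary cusps\<close>

definition compact_euclidean_manifold :: "'a::euclidean_space itself \<Rightarrow> 'e metric \<Rightarrow> bool" where
  "compact_euclidean_manifold _ E \<longleftrightarrow>
     mspace E \<noteq> {} \<and> compact_space (mtopology_of E) \<and> length_space E \<and>
     locally_isometric_to E (euc_half :: 'a set) dist"

definition euc_boundary :: "'a::euclidean_space itself \<Rightarrow> 'e metric \<Rightarrow> 'e set" where
  "euc_boundary _ E = wall_points E (euc_half :: 'a set) dist euc_wall"

definition cusp_topology :: "'e metric \<Rightarrow> ('e \<times> real) topology" where
  "cusp_topology E = prod_topology (mtopology_of E) (top_of_set {1..})"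

text \<open>\<open>f\<close> identifies the end \<open>E \<times> [1, \<infinity>)\<close> with metric \<open>(g + dt\<^sup>2) / t\<^sup>2\<close> isometrically (for Riemannian
  metrics) with a closed subset of \<open>M\<close> which is a neighbourhood of an end of \<open>M\<close>. Starting at height
  \<open>1\<close> is a normalisation, since \<open>E\<close> may be rescaled.\<close>

definition cusp_parametrization ::
  "'a::euclidean_space itself \<Rightarrow> 'm::metric_space set \<Rightarrow> 'e metric \<Rightarrow> ('e \<times> real \<Rightarrow> 'm) \<Rightarrow> bool" where
  "cusp_parametrization T M E f \<longleftrightarrow>
     compact_euclidean_manifold T E \<and>
     embedding_map (cusp_topology E) (top_of_set M) f \<and>
     closedin (top_of_set M) (f ` (mspace E \<times> {1..})) \<and>
     openin (top_of_set M) (f ` (mspace E \<times> {1<..})) \<and>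
     f ` (mspace E \<times> {1..}) \<inter> hyp_boundary T M = f ` (euc_boundary T E \<times> {1..}) \<and>
     (\<forall>z \<in> mspace E \<times> {1..}. \<exists>W. openin (cusp_topology E) W \<and> z \<in> W \<and>
        (\<forall>u\<in>W. \<forall>v\<in>W. dist (f u) (f v) = upper_dist (mdist E) u v))"

text \<open>The cross-section \<open>E\<close> may be taken with underlying set a subset of \<open>M\<close> (for instance
  \<open>f ` (E \<times> {1})\<close>) and a metric of its own, so the type of its points is not a restriction.\<close>

definition internal_cusp :: "'a::euclidean_space itself \<Rightarrow> 'm::metric_space set \<Rightarrow> 'm set \<Rightarrow> bool" where
  "internal_cusp T M C \<longleftrightarrow>
     (\<exists>(E :: 'm metric) f. cusp_parametrization T M E f \<and> euc_boundary T E = {} \<and>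
        C = f ` (mspace E \<times> {1..}))"

definition boundary_cusp :: "'a::euclidean_space itself \<Rightarrow> 'm::metric_space set \<Rightarrow> 'm set \<Rightarrow> bool" where
  "boundary_cusp T M C \<longleftrightarrow>
     (\<exists>(E :: 'm metric) f. cusp_parametrization T M E f \<and> euc_boundary T E \<noteq> {} \<and>
        C = f ` (mspace E \<times> {1..})) \<and>
     (\<forall>B \<in> components (hyp_boundary T M). B \<inter> C \<noteq> {} \<longrightarrow> \<not> compact B)"

section \<open>Peripheral subgroups\<close>

definition peripheral_subgroup ::
  "'a::euclidean_space itself \<Rightarrow> 'm::metric_space set \<Rightarrow> 'm \<Rightarrow> (real \<Rightarrow> 'm) set set \<Rightarrow> bool" where
  "peripheral_subgroup T M x H \<longleftrightarrow>
     (\<exists>C \<gamma>. (C \<in> components (hyp_boundary T M) \<or> internal_cusp T M C \<or> boundary_cusp T M C) \<and>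
        path \<gamma> \<and> path_image \<gamma> \<subseteq> M \<and> pathstart \<gamma> = x \<and> pathfinish \<gamma> \<in> C \<and>
        H = pi1_image M C \<gamma>)"

end

theory Submission
  imports Defs "HOL-Computational_Algebra.Polynomial"
begin

text \<open>The manifold \<open>M\<close> is unfolded by a map \<open>F\<close> from the hyperboloid onto
  \<open>M\<close> which, in charts, is an isometry followed by the folding of hyperbolic space onto a
  half-space; by completeness \<open>F\<close> extends from a chart to ever larger balls. The isometries
  preserving \<open>F\<close> form a discrete group \<open>GT\<close> of Lorentz transformations,
  containing the reflections in the walls lying over the boundary. A chamber \<open>X\<close> cut out by
  these walls is convex and covers \<open>M\<close>, so \<open>\<pi>\<^sub>1(M)\<close> is isomorphic to
  the stabiliser \<open>GX\<close> of \<open>X\<close> in \<open>GT\<close>.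

  Finite volume makes \<open>GT\<close> finitely generated: short isometries commute with a shortest one,
  so the thin part consists of cusps and tubes, and the complement of the cusps is a connected set which is
  covered by the translates of a ball. Hence all matrix entries of \<open>GT\<close> and all coordinates of
  a given vector \<open>v\<close> lie in a finitely generated ring. Such a ring has, for each nonzero
  \<open>r\<close>, an ideal of finite index avoiding \<open>r\<close>; the elements fixing
  \<open>v\<close> modulo these ideals show that the stabiliser of \<open>v\<close> in \<open>GX\<close> is
  separable. Finally, peripheral subgroups are such stabilisers: of a unit normal of a wall for a boundary
  component, and of a null vector for a cusp or boundary cusp, where the horoball of the null vector is
  mapped into the cusp.\<close>

section \<open>Minkowski space and the hyperboloid model\<close>

text \<open>With boundary present the fundamental group acts on hyperbolic space with infinite
  covolume, so arguments about groups of finite covolume apply only after the reflections are added.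
  Finite generation is proved for \<open>GT\<close>; the group \<open>GX\<close> merely inherits the
  ring of matrix entries, and nothing has to be known about its own generators.

  A peripheral subgroup must be shown to be the stabiliser of a vector, not only of a line, since
  separability is obtained by reducing coordinates modulo ideals. For a wall normal the sign is
  controlled because the chamber lies on one side of the wall; for a null vector the scale is
  controlled by the height in the cusp. The coordinates of these vectors may be arbitrary reals, as
  they are simply adjoined to the ring.

  The constants for short isometries all go back to 1/8: two Lorentz maps within 1/8 of the
  identity, in the Hilbert-Schmidt norm of a common frame, have a commutator at most half as far
  from the identity as either of them. The threshold 1/64 is the square of 1/8.\<close>

class lorentz_space = euclidean_space +
  fixes tau :: 'a
  assumes tau_Basis: "tau \<in> Basis"

text \<open>The time axis is taken in the last factor, so that
  \<open>('a \<times> real) \<times> real\<close> becomes Minkowski space for hyperbolic space of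
  dimension \<open>DIM('a) + 1\<close>.\<close>

instantiation prod :: (euclidean_space, euclidean_space) lorentz_space
begin
definition tau_prod :: "'a \<times> 'b" where "tau_prod = (0, SOME b. b \<in> Basis)"
instance
proof
  have "(SOME b :: 'b. b \<in> Basis) \<in> Basis" using nonempty_Basis by (simp add: some_in_eq)
  then show "(tau :: 'a \<times> 'b) \<in> Basis" by (simp add: tau_prod_def Basis_prod_def)
qed
end

lemma tau_tau [simp]: "tau \<bullet> tau = 1" "norm tau = 1"
  by (simp_all add: tau_Basis inner_same_Basis)

lemma tim_linear [simp]:
  "(v + w) \<bullet> tau = v \<bullet> tau + w \<bullet> tau" "(v - w) \<bullet> tau = v \<bullet> tau - w \<bullet> tau"
  by (simp_all add: inner_add_left inner_diff_left)

abbreviation tim :: "'v::lorentz_space => real" where "tim v \<equiv> v \<bullet> tau"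

definition spa :: "'v::lorentz_space => 'v" where "spa v = v - tim v *\<^sub>R tau"

lemma spa_tau [simp]: "tim (spa v) = 0" "tau \<bullet> spa v = 0"
  by (simp_all add: spa_def inner_simps inner_commute[of tau v])

lemma spa_linear: "spa (v + w) = spa v + spa w" "spa (c *\<^sub>R v) = c *\<^sub>R spa v"
  by (simp_all add: spa_def inner_simps algebra_simps)

lemma spa_tim: "spa v + tim v *\<^sub>R tau = v"
  by (simp add: spa_def)

lemma spa_spa [simp]: "spa (spa v) = spa v" "spa tau = 0"
  by (simp_all add: spa_def[of "spa v"] spa_def[of tau])

lemma inner_spa: "spa v \<bullet> spa w = v \<bullet> w - tim v * tim w"
  by (simp add: spa_def inner_simps inner_commute[of tau w] inner_commute[of tau v])

lemma norm_spa: "(norm v)\<^sup>2 = (norm (spa v))\<^sup>2 + (tim v)\<^sup>2"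
  using inner_spa[of v v] by (simp add: dot_square_norm power2_eq_square)

definition lor :: "'v::lorentz_space => 'v => real" where
  "lor v w = spa v \<bullet> spa w - tim v * tim w"

lemma lor_inner: "lor v w = v \<bullet> w - 2 * tim v * tim w"
  by (simp add: lor_def inner_spa)

lemma bounded_bilinear_lor: "bounded_bilinear lor"
proof
  fix a a' b b' :: "'v::lorentz_space" and r :: real
  show "lor (a + a') b = lor a b + lor a' b" "lor a (b + b') = lor a b + lor a b'"
    by (simp_all add: lor_inner inner_simps algebra_simps)
  show "lor (r *\<^sub>R a) b = r *\<^sub>R lor a b" "lor a (r *\<^sub>R b) = r *\<^sub>R lor a b"
    by (simp_all add: lor_inner inner_simps algebra_simps)
  show "\<exists>K. \<forall>(a::'v) b. norm (lor a b) \<le> norm a * norm b * K"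
  proof (intro exI allI)
    fix a b :: 'v
    have t: "\<bar>tim v\<bar> \<le> norm v" for v :: 'v
      using Cauchy_Schwarz_ineq2[of v tau] by simp
    have "\<bar>tim a * tim b\<bar> \<le> norm a * norm b"
      unfolding abs_mult using t[of a] t[of b] by (intro mult_mono) auto
    then show "norm (lor a b) \<le> norm a * norm b * 3"
      using Cauchy_Schwarz_ineq2[of a b] unfolding lor_inner real_norm_def by linarith
  qed
qed

interpretation lor: bounded_bilinear lor by (rule bounded_bilinear_lor)

lemma lor_commute: "lor v w = lor w v"
  by (simp add: lor_def inner_commute)

lemma lor_scale [simp]: "lor (c *\<^sub>R v) w = c * lor v w" "lor v (c *\<^sub>R w) = c * lor v w"
  by (simp_all add: lor.scaleR_left lor.scaleR_right)

lemmas lor_simps = lor.add_left lor.add_right lor.diff_left lor.diff_right lor.minus_left lor.minus_right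

text \<open>Pairing \<open>v\<close> with its mirror image in the time direction gives the Euclidean
  square norm.\<close>

lemma lor_nondegenerate: assumes "\<And>w. lor v w = 0" shows "v = 0"
proof -
  have "(norm (spa v))\<^sup>2 + (tim v)\<^sup>2 = lor v (spa v - tim v *\<^sub>R tau)"
    by (simp add: lor_inner inner_simps inner_spa power2_norm_eq_inner)
       (simp add: spa_def inner_simps power2_eq_square)
  then have "(norm v)\<^sup>2 = 0" using assms norm_spa[of v] by simp
  then show ?thesis by simp
qed

definition Hyp :: "('v::lorentz_space) set" where
  "Hyp = {v. lor v v = - 1 \<and> 0 < tim v}"

lemma HypD: "y \<in> Hyp ==> lor y y = - 1" "y \<in> Hyp ==> 0 < tim y"
  by (auto simp: Hyp_def)

lemma timelike_norm: "lor y y < 0 ==> 0 < tim y ==> norm (spa y) < tim y"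
  using power2_less_imp_less[of "norm (spa y)" "tim y"]
  by (simp add: lor_def dot_square_norm power2_eq_square[symmetric])

lemma causal_norm: "lor y y \<le> 0 ==> 0 \<le> tim y ==> norm (spa y) \<le> tim y"
  using power2_le_imp_le[of "norm (spa y)" "tim y"]
  by (simp add: lor_def dot_square_norm power2_eq_square[symmetric] del: power2_norm_eq_inner)

lemma lor_causal_neg:
  assumes v: "lor v v \<le> 0" "0 < tim v" and y: "lor y y < 0" "0 < tim y"
  shows "lor v y < 0"
proof -
  have "spa v \<bullet> spa y \<le> norm (spa v) * norm (spa y)" by (rule norm_cauchy_schwarz)
  also have "\<dots> \<le> tim v * norm (spa y)" using causal_norm[OF v(1)] v by (intro mult_right_mono) auto
  also have "\<dots> < tim v * tim y" using timelike_norm[OF y] v by simp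
  finally show ?thesis by (simp add: lor_def)
qed

text \<open>Cauchy-Schwarz for the spatial parts: as \<open>y\<close> is steeper than the light
  cone, orthogonality to it forces the spatial part of \<open>e\<close> to dominate its time
  coordinate.\<close>

lemma perp_pos:
  assumes y: "lor y y < 0" "0 < tim y" and e: "lor e y = 0" "e \<noteq> 0"
  shows "0 < lor e e"
proof -
  have ye: "\<bar>tim e\<bar> * tim y \<le> norm (spa e) * norm (spa y)"
  proof -
    have "tim e * tim y = spa e \<bullet> spa y" using e by (simp add: lor_def)
    then have "\<bar>tim e\<bar> * tim y = \<bar>spa e \<bullet> spa y\<bar>" using y(2) by (metis abs_mult abs_of_pos)
    then show ?thesis using Cauchy_Schwarz_ineq2[of "spa e" "spa y"] by simp
  qed
  have f0: "spa e \<noteq> 0"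
  proof
    assume "spa e = 0"
    then have "tim e = 0" using ye y(2) by (simp add: mult_le_0_iff)
    then show False using \<open>spa e = 0\<close> e(2) using spa_tim[of e] by simp
  qed
  then have "norm (spa e) * norm (spa y) < norm (spa e) * tim y" using timelike_norm[OF y] by simp
  then have "\<bar>tim e\<bar> < norm (spa e)" using ye y(2) by (smt (verit) mult_le_cancel_right)
  then have "\<bar>tim e\<bar>\<^sup>2 < (norm (spa e))\<^sup>2" by (intro power_strict_mono) auto
  then show ?thesis by (simp add: lor_def dot_square_norm power2_eq_square[symmetric])
qed

lemma perp_nonneg: "lor y y < 0 ==> 0 < tim y ==> lor e y = 0 ==> 0 \<le> lor e e"
  using perp_pos[of y e] by (cases "e = 0") (auto simp: lor.zero_left)

text \<open>The form is positive definite on the tangent space at \<open>y\<close>, so the usual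
  argument applies: the component of \<open>e\<close> orthogonal to \<open>f\<close> has nonnegative
  square.\<close>

lemma perp_Cauchy_Schwarz:
  assumes y: "y \<in> Hyp" and e: "lor e y = 0" and f: "lor f y = 0"
  shows "(lor e f)\<^sup>2 \<le> lor e e * lor f f"
proof (cases "f = 0")
  case True then show ?thesis by (simp add: lor.zero_left lor.zero_right)
next
  case False
  have p: "0 < lor f f" using perp_pos[OF _ _ f False] y by (auto simp: Hyp_def)
  let ?t = "lor e f / lor f f"
  have "0 \<le> lor (e - ?t *\<^sub>R f) (e - ?t *\<^sub>R f)"
    using perp_nonneg[of y "e - ?t *\<^sub>R f"] y e f by (auto simp: Hyp_def lor_simps)
  also have "\<dots> = lor e e - (lor e f)\<^sup>2 / lor f f"
    using p by (simp add: lor_simps lor_commute[of f e] power2_eq_square field_simps)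
  finally show ?thesis using p by (simp add: field_simps)
qed

text \<open>Polar coordinates at \<open>y\<close>: \<open>c\<close> is the hyperbolic cosine of the
  distance to \<open>z\<close>, and \<open>e\<close> is the tangent vector at \<open>y\<close>
  pointing to \<open>z\<close> whose length is the hyperbolic sine.\<close>

lemma Hyp_decomp:
  assumes y: "y \<in> Hyp" and z: "z \<in> Hyp"
  defines "c \<equiv> - lor y z"
  obtains e where "z = c *\<^sub>R y + e" "lor e y = 0" "lor e e = c\<^sup>2 - 1" "1 \<le> c" "c = 1 ==> z = y"
proof -
  define e where "e = z - c *\<^sub>R y"
  have ey: "lor e y = 0" using HypD[OF y] by (simp add: e_def lor_simps c_def lor_commute)
  have ee: "lor e e = c\<^sup>2 - 1"
    using HypD[OF y] HypD[OF z] by (simp add: e_def lor_simps c_def lor_commute[of z y] power2_eq_square)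
  have c0: "0 < c" using lor_causal_neg[of y z] y z by (auto simp: c_def Hyp_def)
  have "0 \<le> c\<^sup>2 - 1" using perp_nonneg[OF _ _ ey] y ee by (auto simp: Hyp_def)
  then have c1: "1 \<le> c" using c0 power2_le_imp_le[of 1 c] by simp
  have "z = y" if "c = 1"
  proof -
    have "e = 0" using perp_pos[OF _ _ ey] y ee that by (auto simp: Hyp_def)
    then show ?thesis using that by (simp add: e_def)
  qed
  then show ?thesis using that[of e] ey ee c1 by (simp add: e_def)
qed

lemma Hyp_lor_le: "y \<in> Hyp ==> z \<in> Hyp ==> lor y z \<le> - 1"
  by (erule (1) Hyp_decomp) linarith

lemma Hyp_lor_eq: "y \<in> Hyp ==> z \<in> Hyp ==> lor y z = - 1 \<longleftrightarrow> y = z"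
  by (metis HypD(1) Hyp_decomp add.inverse_inverse)

definition hdist :: "'v::lorentz_space => 'v => real" where
  "hdist y z = arcosh (- lor y z)"

lemma cosh_hdist: "y \<in> Hyp ==> z \<in> Hyp ==> cosh (hdist y z) = - lor y z"
  using Hyp_lor_le[of y z] by (simp add: hdist_def)

lemma hdist_nonneg: "y \<in> Hyp ==> z \<in> Hyp ==> 0 \<le> hdist y z"
  using Hyp_lor_le[of y z] by (simp add: hdist_def)

lemma hdist_commute: "hdist y z = hdist z y"
  by (simp add: hdist_def lor_commute)

lemma hdist_eq_0: "y \<in> Hyp ==> z \<in> Hyp ==> hdist y z = 0 \<longleftrightarrow> y = z"
  by (metis Hyp_lor_eq cosh_0 cosh_hdist hdist_def HypD(1) add.inverse_inverse arcosh_1)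

lemma hdist_refl [simp]: "y \<in> Hyp ==> hdist y y = 0"
  by (simp add: hdist_eq_0)

lemma hdist_less_iff:
  assumes "y \<in> Hyp" "z \<in> Hyp" "0 \<le> r" shows "hdist y z < r \<longleftrightarrow> - lor y z < cosh r"
  using cosh_real_strict_mono[of "hdist y z" r] cosh_real_strict_mono[of r "hdist y z"] hdist_nonneg[of y z] cosh_hdist[of y z] assms
  by (smt (verit, best))

lemma hdist_le_iff:
  assumes "y \<in> Hyp" "z \<in> Hyp" "0 \<le> r" shows "hdist y z \<le> r \<longleftrightarrow> - lor y z \<le> cosh r"
  using cosh_real_strict_mono[of "hdist y z" r] cosh_real_strict_mono[of r "hdist y z"] hdist_nonneg[of y z] cosh_hdist[of y z] assms
  by (smt (verit, best))

text \<open>In polar coordinates at the middle point this is the law of cosines; bounding the cross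
  term by Cauchy-Schwarz turns it into the addition formula for \<open>cosh (a + b)\<close>.\<close>

lemma hdist_triangle:
  assumes x: "x \<in> Hyp" and y: "y \<in> Hyp" and z: "z \<in> Hyp"
  shows "hdist x z \<le> hdist x y + hdist y z"
proof -
  obtain e where e: "x = (- lor y x) *\<^sub>R y + e" "lor e y = 0" "lor e e = (- lor y x)\<^sup>2 - 1" "1 \<le> - lor y x"
    using Hyp_decomp[OF y x] by metis
  obtain f where f: "z = (- lor y z) *\<^sub>R y + f" "lor f y = 0" "lor f f = (- lor y z)\<^sup>2 - 1" "1 \<le> - lor y z"
    using Hyp_decomp[OF y z] by metis
  define a b where "a = hdist x y" and "b = hdist y z"
  have ca: "- lor y x = cosh a" "- lor y z = cosh b" using cosh_hdist[OF x y] cosh_hdist[OF y z]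
    by (simp_all add: a_def b_def lor_commute)
  have ab: "0 \<le> a" "0 \<le> b" using hdist_nonneg[OF x y] hdist_nonneg[OF y z] by (simp_all add: a_def b_def)
  have sq: "lor e e = (sinh a)\<^sup>2" "lor f f = (sinh b)\<^sup>2"
    using e(3) f(3) by (simp_all add: ca cosh_square_eq)
  have "(lor e f)\<^sup>2 \<le> (sinh a * sinh b)\<^sup>2"
    using perp_Cauchy_Schwarz[OF y e(2) f(2)] by (simp add: sq power_mult_distrib)
  then have "- lor e f \<le> sinh a * sinh b"
    using ab abs_le_square_iff[of "lor e f" "sinh a * sinh b"] by (simp add: abs_mult)
  moreover have "- lor x z = cosh a * cosh b - lor e f"
  proof -
    have "lor x z = lor (cosh a *\<^sub>R y + e) (cosh b *\<^sub>R y + f)" using e(1) f(1) ca by metis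
    then show ?thesis using HypD[OF y] e(2) f(2) by (simp add: lor_simps lor_commute[of y f])
  qed
  ultimately have "- lor x z \<le> cosh (a + b)" by (simp add: cosh_add)
  then show ?thesis using hdist_le_iff[OF x z, of "a + b"] ab by (simp add: a_def b_def)
qed

lemma Hyp_iff_snd: "y \<in> Hyp \<longleftrightarrow> tim y = sqrt (1 + (norm (spa y))\<^sup>2)"
proof
  assume "y \<in> Hyp"
  then show "tim y = sqrt (1 + (norm (spa y))\<^sup>2)"
    by (intro real_sqrt_unique[symmetric]) (auto simp: Hyp_def lor_def dot_square_norm power2_eq_square)
next
  assume s: "tim y = sqrt (1 + (norm (spa y))\<^sup>2)"
  then have "(tim y)\<^sup>2 = 1 + (norm (spa y))\<^sup>2" by simp
  moreover have "0 < tim y" unfolding s by (intro real_sqrt_gt_zero add_pos_nonneg) auto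
  ultimately show "y \<in> Hyp" by (simp add: Hyp_def lor_def dot_square_norm power2_eq_square)
qed

lemma Hyp_norm: "y \<in> Hyp ==> (norm y)\<^sup>2 = 2 * (tim y)\<^sup>2 - 1"
  using norm_spa[of y] by (simp add: Hyp_def lor_def dot_square_norm power2_eq_square)

lemma closed_Hyp: "closed (Hyp :: ('v::lorentz_space) set)"
proof -
  have "Hyp = {y :: 'v. tim y = sqrt (1 + (norm (spa y))\<^sup>2)}" using Hyp_iff_snd by auto
  also have "closed \<dots>" unfolding spa_def by (intro closed_Collect_eq continuous_intros)
  finally show ?thesis .
qed

abbreviation hyp0 :: "'v::lorentz_space" where "hyp0 \<equiv> tau"

lemma hyp0_Hyp [simp]: "hyp0 \<in> Hyp"
  by (simp add: Hyp_def lor_def)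

lemma lor_hyp0: "lor y hyp0 = - tim y" "lor hyp0 y = - tim y"
  by (simp_all add: lor_def)

section \<open>Isometries of the hyperboloid\<close>

definition isoH :: "('v::lorentz_space => 'v) => bool" where
  "isoH A \<longleftrightarrow> linear A \<and> (\<forall>v w. lor (A v) (A w) = lor v w) \<and> A ` Hyp \<subseteq> Hyp"

lemma isoH_linear: "isoH A ==> linear A"
  and isoH_lor [simp]: "isoH A ==> lor (A v) (A w) = lor v w"
  and isoH_Hyp [simp]: "isoH A ==> y \<in> Hyp ==> A y \<in> Hyp"
  unfolding isoH_def by blast+

lemma isoH_hdist [simp]: "isoH A ==> hdist (A y) (A z) = hdist y z"
  by (simp add: hdist_def)

lemma lor_preserving_inj:
  assumes "linear A" "\<And>v w. lor (A v) (A w) = lor v w" shows "inj A"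
proof (rule linear_injective_0[THEN iffD2, OF assms(1)], intro allI impI)
  fix x assume "A x = 0"
  then show "x = 0" using assms(2)[of x] lor_nondegenerate[of x] by (metis lor.zero_left)
qed

lemma isoH_bij: "isoH A ==> bij A"
  unfolding bij_def using lor_preserving_inj[of A] linear_inj_imp_surj[of A] isoH_linear isoH_lor by metis

text \<open>Products of two points are negative on one sheet and positive across the sheets, so a
  linear map preserving the form keeps the upper sheet as soon as it keeps a single point
  there.\<close>

lemma lor_preserving_isoH:
  assumes A: "linear A" "\<And>v w. lor (A v) (A w) = lor v w" and y: "y \<in> Hyp" "A y \<in> Hyp"
  shows "isoH A"
proof -
  have "A z \<in> Hyp" if z: "z \<in> Hyp" for z
  proof -
    have l: "lor (A z) (A z) = -1" using z A by (simp add: Hyp_def)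
    have n: "lor (A z) (A y) < 0" using A(2)[of z y] Hyp_lor_le[OF z y(1)] by simp
    have s0: "tim (A z) \<noteq> 0"
    proof
      assume "tim (A z) = 0"
      then have "0 \<le> lor (A z) (A z)" by (simp add: lor_def)
      then show False using l by simp
    qed
    have "\<not> tim (A z) < 0"
    proof
      assume "tim (A z) < 0"
      then have "lor (- A z) (A y) < 0"
        using lor_causal_neg[of "- A z" "A y"] l HypD[OF y(2)] by (simp add: lor_simps)
      then show False using n by (simp add: lor_simps)
    qed
    then show ?thesis using l s0 by (simp add: Hyp_def)
  qed
  then show ?thesis using A by (auto simp: isoH_def)
qed

lemma isoH_id: "isoH (\<lambda>x. x)" "isoH id"
  by (simp_all add: isoH_def linear_id[unfolded id_def] linear_id)

lemma isoH_comp: "isoH A ==> isoH B ==> isoH (A \<circ> B)"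
  unfolding isoH_def using linear_compose[of B A] by (simp add: image_subset_iff)

abbreviation invf :: "('c => 'd) => 'd => 'c" where
  "invf f \<equiv> inv_into UNIV f"

lemma isoH_inv_apply: "isoH A ==> invf A (A y) = y" "isoH A ==> A (invf A y) = y"
  using isoH_bij[of A] by (simp_all add: bij_def surj_f_inv_f)

lemma isoH_inv: assumes A: "isoH A" shows "isoH (invf A)"
proof (rule lor_preserving_isoH[where y = "A hyp0"])
  show "linear (invf A)"
    using isoH_bij[OF A] inj_linear_imp_inv_linear[OF isoH_linear[OF A]] by (simp add: bij_def)
  show "lor (invf A v) (invf A w) = lor v w" for v w
    using isoH_lor[OF A, of "invf A v" "invf A w"] A by (simp add: isoH_inv_apply)
qed (use A in \<open>simp_all add: isoH_inv_apply\<close>)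

lemma isoH_lor_inv: "isoH A ==> lor (A v) w = lor v (invf A w)"
  by (metis isoH_inv_apply(2) isoH_lor)

lemma isoH_hdist_inv: "isoH A ==> hdist (A v) w = hdist v (invf A w)"
  by (simp add: hdist_def isoH_lor_inv)

definition reflH :: "'v::lorentz_space => 'v => 'v" where
  "reflH w z = z - (2 * lor z w) *\<^sub>R w"

lemma linear_reflH: "linear (reflH w)"
  by (rule linearI) (simp_all add: reflH_def lor_simps algebra_simps)

lemma lor_reflH: "lor w w = 1 ==> lor (reflH w v) (reflH w z) = lor v z"
  by (simp add: reflH_def lor_simps lor_commute[of w v] lor_commute[of w z] algebra_simps)

lemma lor_reflH_normal: "lor w w = 1 ==> lor (reflH w z) w = - lor z w"
  by (simp add: reflH_def lor_simps)

lemma reflH_reflH: "lor w w = 1 ==> reflH w (reflH w z) = z"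
  by (simp add: reflH_def lor_simps)

lemma reflH_fix: "lor z w = 0 ==> reflH w z = z"
  by (simp add: reflH_def)

lemma spacelike_perp_Hyp:
  fixes w :: "'v::lorentz_space"
  assumes w: "lor w w = 1" obtains y where "y \<in> Hyp" "lor y w = 0"
proof -
  have w1: "(norm (spa w))\<^sup>2 = 1 + (tim w)\<^sup>2"
    using w by (simp add: lor_def dot_square_norm power2_eq_square)
  define n where "n = norm (spa w)"
  have n0: "0 < n" using w1 unfolding n_def by (smt (verit) norm_ge_zero power2_less_0 zero_power2)
  define y where "y = (tim w / n) *\<^sub>R spa w + n *\<^sub>R tau"
  have ys: "spa y = (tim w / n) *\<^sub>R spa w" "tim y = n" by (simp_all add: y_def spa_linear inner_simps)
  have "lor y y = (tim w)\<^sup>2 - n\<^sup>2"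
    using n0 by (simp add: ys lor_def dot_square_norm n_def[symmetric] power2_eq_square field_simps)
  then have "y \<in> Hyp" using w1 n0 by (simp add: Hyp_def ys n_def)
  moreover have "lor y w = 0" using n0
    by (simp add: ys lor_def dot_square_norm n_def[symmetric] power2_eq_square field_simps)
  ultimately show ?thesis by (rule that)
qed

lemma isoH_reflH: assumes w: "lor w w = 1" shows "isoH (reflH w)"
proof -
  obtain y where "y \<in> Hyp" "lor y w = 0" using spacelike_perp_Hyp[OF w] .
  then show ?thesis
    using lor_preserving_isoH[OF linear_reflH[of w] lor_reflH[OF w], of y] by (simp add: reflH_fix)
qed

text \<open>The reflection in the perpendicular bisector does it; its normal has the direction of
  \<open>z - y\<close>, and \<open>q\<close> is the square of that vector.\<close>

lemma isoH_transitive: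
  assumes y: "y \<in> Hyp" and z: "z \<in> Hyp" obtains A where "isoH A" "A y = z"
proof (cases "y = z")
  case True then show ?thesis using that[of id] isoH_id(2) by simp
next
  case False
  define q where "q = - 2 - 2 * lor y z"
  have "lor y z < -1" using Hyp_lor_le[OF y z] Hyp_lor_eq[OF y z] False by linarith
  then have q: "0 < q" by (simp add: q_def)
  define w where "w = (1 / sqrt q) *\<^sub>R (z - y)"
  have l: "lor y y = -1" "lor z z = -1" using y z by (auto simp: Hyp_def)
  have "lor (z - y) (z - y) = q" by (simp add: lor_simps l lor_commute[of z y] q_def)
  then have "lor w w = 1" using q by (simp add: w_def)
  moreover have "reflH w y = z"
  proof -
    have "(2 * lor y w) *\<^sub>R w = (2 * (lor y z + 1) / q) *\<^sub>R (z - y)"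
      using q by (simp add: w_def lor_simps l)
    also have "\<dots> = (-1) *\<^sub>R (z - y)" using q by (intro arg_cong2[where f = scaleR]) (simp_all add: q_def field_simps)
    finally show ?thesis by (simp add: reflH_def)
  qed
  ultimately show ?thesis using that isoH_reflH by blast
qed

definition geo :: "'v::lorentz_space => 'v => real => 'v" where
  "geo y e t = cosh t *\<^sub>R y + sinh t *\<^sub>R e"

lemma lor_geo:
  assumes "y \<in> Hyp" "lor e y = 0" "lor e e = 1"
  shows "lor (geo y e s) (geo y e t) = - cosh (s - t)"
  using assms by (simp add: geo_def lor_simps lor_commute[of y e] Hyp_def cosh_diff)

lemma geo_Hyp:
  assumes y: "y \<in> Hyp" and e: "lor e y = 0" "lor e e = 1"
  shows "geo y e t \<in> Hyp"
proof -
  have l: "lor (geo y e t) (geo y e t) = - 1" using lor_geo[OF assms, of t t] by simp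
  have "norm (spa e) * norm (spa e) = 1 + tim e * tim e"
    using e by (simp add: lor_def dot_square_norm power2_eq_square)
  have "\<bar>tim e\<bar> \<le> tim y"
  proof -
    have "\<bar>lor e hyp0\<bar>\<^sup>2 \<le> (tim y)\<^sup>2"
    proof -
      obtain f where f: "hyp0 = (- lor y hyp0) *\<^sub>R y + f" "lor f y = 0" "lor f f = (- lor y hyp0)\<^sup>2 - 1"
        using Hyp_decomp[OF y hyp0_Hyp] by metis
      have "lor e hyp0 = lor e f" using f(1) e by (metis lor.add_right lor_scale(2) mult_zero_right add_0)
      then have "(lor e hyp0)\<^sup>2 \<le> (tim y)\<^sup>2 - 1"
        using perp_Cauchy_Schwarz[OF y e(1) f(2)] f(3) e by (simp add: lor_hyp0)
      then show ?thesis by simp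
    qed
    then show ?thesis using HypD(2)[OF y] by (simp add: lor_hyp0 abs_le_square_iff[symmetric])
  qed
  then have "\<bar>sinh t * tim e\<bar> \<le> \<bar>sinh t\<bar> * tim y" by (simp add: abs_mult mult_left_mono)
  moreover have "\<bar>sinh t\<bar> * tim y < cosh t * tim y"
    using HypD(2)[OF y] cosh_real_pos[of t] by (simp add: abs_less_iff sinh_less_cosh_real) (metis cosh_minus sinh_less_cosh_real sinh_minus)
  ultimately have "0 < cosh t * tim y + sinh t * tim e" by linarith
  then have "0 < tim (geo y e t)" by (simp add: geo_def)
  then show ?thesis using l by (simp add: Hyp_def)
qed

lemma hdist_geo:
  assumes "y \<in> Hyp" "lor e y = 0" "lor e e = 1"
  shows "hdist (geo y e s) (geo y e t) = \<bar>s - t\<bar>"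
proof -
  have "arcosh (cosh (s - t)) = arcosh (cosh \<bar>s - t\<bar>)" by simp
  then show ?thesis unfolding hdist_def lor_geo[OF assms] by (simp only: arcosh_cosh_real abs_ge_zero minus_minus)
qed

lemma geo_0 [simp]: "geo y e 0 = y"
  by (simp add: geo_def)

lemma geo_exists:
  assumes y: "y \<in> Hyp" and z: "z \<in> Hyp" "y \<noteq> z"
  obtains e where "lor e y = 0" "lor e e = 1" "z = geo y e (hdist y z)"
proof -
  obtain f where f: "z = (- lor y z) *\<^sub>R y + f" "lor f y = 0" "lor f f = (- lor y z)\<^sup>2 - 1"
    using Hyp_decomp[OF y z(1)] by metis
  define d where "d = hdist y z"
  have d: "0 < d" using hdist_nonneg[OF y z(1)] hdist_eq_0[OF y z(1)] z(2) by (simp add: d_def)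
  have c: "- lor y z = cosh d" by (simp add: d_def cosh_hdist y z)
  have ff: "lor f f = (sinh d)\<^sup>2" using f(3) by (simp add: c cosh_square_eq)
  have s: "0 < sinh d" using d by simp
  define e where "e = (1 / sinh d) *\<^sub>R f"
  have "lor e y = 0" "lor e e = 1" using f(2) ff s by (simp_all add: e_def power2_eq_square)
  moreover have "z = geo y e d" using f(1) s c by (simp add: geo_def e_def)
  ultimately show ?thesis using that by (simp add: d_def)
qed

text \<open>Besides \<open>y\<close> itself, each tangent direction at \<open>y\<close> is reached
  by one point of a short geodesic in that direction; subtracting the multiple of \<open>y\<close>
  recovers the value on the direction, and together these vectors span.\<close>

lemma linear_eq_on_ball:
  fixes A B :: "'v::lorentz_space => 'c::real_vector"
  assumes lin: "linear A" "linear B" and y: "y \<in> Hyp" and e: "0 < e"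
    and eq: "\<And>z. z \<in> Hyp ==> hdist y z < e ==> A z = B z"
  shows "A = B"
proof
  fix v
  have y0: "A y = B y" using eq[of y] y e by simp
  have f: "A f = B f" if f: "lor f y = 0" for f
  proof (cases "f = 0")
    case True then show ?thesis using lin by (simp add: linear_0)
  next
    case False
    define q where "q = sqrt (lor f f)"
    have q: "0 < q" using perp_pos[OF _ _ f False] y by (simp add: q_def Hyp_def)
    define g where "g = (1 / q) *\<^sub>R f"
    have g: "lor g y = 0" "lor g g = 1" using f q by (simp_all add: g_def) (simp add: q_def field_simps)
    define t where "t = e / 2"
    have "hdist y (geo y g t) < e" using hdist_geo[OF y g, of 0 t] e by (simp add: t_def)
    then have "A (geo y g t) = B (geo y g t)" by (intro eq geo_Hyp y g)
    then have "cosh t *\<^sub>R A y + (sinh t / q) *\<^sub>R A f = cosh t *\<^sub>R B y + (sinh t / q) *\<^sub>R B f"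
      using lin by (simp add: geo_def g_def linear_add linear_scale)
    moreover have "sinh t / q \<noteq> 0" using q e by (simp add: t_def)
    ultimately show ?thesis using y0 by simp
  qed
  have "v = (- lor v y) *\<^sub>R y + (v + lor v y *\<^sub>R y)" by simp
  moreover have "lor (v + lor v y *\<^sub>R y) y = 0" using y by (simp add: lor_simps Hyp_def)
  ultimately show "A v = B v" using f y0 lin
    by (metis (no_types, lifting) linear_add linear_scale)
qed

lemma Hyp_ball_span:
  assumes y: "y \<in> Hyp" "0 < e" and S: "\<And>z. z \<in> Hyp ==> hdist y z < e ==> z \<in> S"
  shows "span S = UNIV"
proof (rule ccontr)
  assume "span S \<noteq> UNIV"
  then obtain a where a: "a \<noteq> 0" "span S \<subseteq> {x. a \<bullet> x = 0}"
    using span_not_univ_subset_hyperplane[of S] by blast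
  have "(\<lambda>z. a \<bullet> z) = (\<lambda>z. 0)"
  proof (rule linear_eq_on_ball[OF _ _ y])
    show "linear ((\<bullet>) a)" by (rule bounded_linear.linear) (rule bounded_linear_inner_right)
    show "linear (\<lambda>z. 0 :: real)" by (simp add: linear_iff)
    show "a \<bullet> z = 0" if "z \<in> Hyp" "hdist y z < e" for z
      using a(2) S[OF that] span_base by blast
  qed
  then have "a \<bullet> a = 0" by metis
  then show False using a(1) by simp
qed

text \<open>A basis is chosen among the points of \<open>S\<close>. On the other points the linear
  extension is forced to agree with \<open>f\<close>, because the difference is orthogonal to the
  range of the extension, which is everything. Thus an isometry of a set containing a ball is the
  restriction of a global one.\<close>

lemma lor_preserving_extends:
  fixes f :: "'v::lorentz_space => 'v"
  assumes y: "y \<in> Hyp" "0 < e" and S: "\<And>z. z \<in> Hyp ==> hdist y z < e ==> z \<in> S"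
    and f: "\<And>z z'. z \<in> S ==> z' \<in> S ==> lor (f z) (f z') = lor z z'" and fH: "f y \<in> Hyp"
  obtains A where "isoH A" "\<And>z. z \<in> S ==> f z = A z"
proof -
  have sp: "span S = UNIV" by (rule Hyp_ball_span[OF y S])
  obtain B where B: "B \<subseteq> S" "independent B" "S \<subseteq> span B" using maximal_independent_subset by blast
  have spB: "span B = UNIV" using B sp by (metis span_minimal subspace_span top.extremum_unique)
  obtain A where A: "linear A" "\<And>b. b \<in> B ==> A b = f b"
    using linear_independent_extend[OF B(2), of f] by blast
  have bl: "bilinear lor"
    using bounded_bilinear_lor bilinear_conv_bounded_bilinear by blast
  have AA: "lor (A v) (A w) = lor v w" for v w
  proof (rule bilinear_eq[where f = "\<lambda>v w. lor (A v) (A w)" and S = UNIV and T = UNIV and B = B and C = B])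
    show "bilinear (\<lambda>v w. lor (A v) (A w))"
      using A(1) unfolding bilinear_def linear_iff by (simp add: lor_simps)
    show "lor (A x) (A y) = lor x y" if "x \<in> B" "y \<in> B" for x y
      using that B(1) A(2) f by (metis subsetD)
  qed (auto simp: bl spB)
  have surj: "surj A" using linear_inj_imp_surj[OF A(1) lor_preserving_inj[OF A(1) AA]] .
  have fA: "f s = A s" if s: "s \<in> S" for s
  proof -
    have "lor (f s - A s) (A v) = 0" for v
    proof -
      have "linear (\<lambda>v. lor (f s - A s) (A v))" "linear (\<lambda>v::'v. 0::real)"
        using A(1) by (simp_all add: linear_iff lor_simps algebra_simps)
      moreover have "lor (f s - A s) (A b) = 0" if "b \<in> B" for b
        using f[OF s subsetD[OF B(1) that]] A(2)[OF that] AA[of s b] by (simp add: lor_simps)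
      ultimately show ?thesis using linear_eq_on_span[of "\<lambda>v. lor (f s - A s) (A v)" "\<lambda>v. 0" B v] spB by simp
    qed
    then have "lor (f s - A s) w = 0" for w using surjD[OF surj, of w] by metis
    then have "f s - A s = 0" by (rule lor_nondegenerate)
    then show ?thesis by simp
  qed
  have "y \<in> S" using S[of y] y by simp
  then have "isoH A" using lor_preserving_isoH[OF A(1) AA y(1)] fA fH by simp
  then show ?thesis using that fA by blast
qed

section \<open>Balls and convexity in the hyperboloid\<close>

definition hball :: "'v::lorentz_space => real => ('v) set" where
  "hball y r = {z \<in> Hyp. hdist y z < r}"

lemma hball_Hyp: "hball y r \<subseteq> Hyp"
  and mem_hball: "z \<in> hball y r \<longleftrightarrow> z \<in> Hyp \<and> hdist y z < r"
  by (auto simp: hball_def)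

lemma center_hball [simp]: "y \<in> Hyp ==> y \<in> hball y r \<longleftrightarrow> 0 < r"
  by (simp add: hball_def)

lemma hball_eq: "y \<in> Hyp ==> 0 \<le> r ==> hball y r = {z \<in> Hyp. - lor z y < cosh r}"
  by (auto simp: hball_def hdist_less_iff lor_commute[of _ y])

lemma hball_mono: "r \<le> s ==> hball y r \<subseteq> hball y s"
  by (auto simp: hball_def)

lemma hball_sub: "y \<in> Hyp ==> z \<in> Hyp ==> hdist y z + r \<le> s ==> hball z r \<subseteq> hball y s"
  using hdist_triangle[of y z] by (force simp: hball_def)

lemma hball_image: assumes A: "isoH A" shows "A ` hball y r = hball (A y) r"
proof
  show "A ` hball y r \<subseteq> hball (A y) r" using A by (auto simp: hball_def)
  show "hball (A y) r \<subseteq> A ` hball y r"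
  proof
    fix z assume "z \<in> hball (A y) r"
    then have "invf A z \<in> hball y r" using A isoH_inv[OF A]
      by (simp add: hball_def hdist_commute[of _ z] hdist_commute[of _ "invf A z"]) (metis hdist_commute isoH_hdist isoH_inv_apply(2))
    then show "z \<in> A ` hball y r" using isoH_inv_apply(2)[OF A] by (metis imageI)
  qed
qed

lemma continuous_on_hdist: assumes "y \<in> Hyp" shows "continuous_on Hyp (hdist y)"
proof -
  have "continuous_on Hyp (\<lambda>z. arcosh (- lor y z))"
    using Hyp_lor_le[OF assms]
    by (intro continuous_on_compose2[OF continuous_on_arcosh[of "{1..}"]] continuous_intros lor.continuous_on)
       (auto simp: continuous_on_id)
  then show ?thesis by (simp add: hdist_def[abs_def])
qed

text \<open>The point \<open>y\<close> is moved to the base point, where the Euclidean distance is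
  computed exactly; \<open>K\<close> bounds the norm of the linear map back. This compares the
  Euclidean topology of the hyperboloid with \<open>hdist\<close>.\<close>

lemma norm_diff_Hyp_bound:
  fixes y :: "'v::lorentz_space"
  assumes y: "y \<in> Hyp"
  obtains K where "0 < K" "\<And>z. z \<in> Hyp ==> norm (z - y) \<le> K * sqrt (2 * (- lor y z) * (- lor y z - 1))"
proof -
  obtain A where A: "isoH A" "A hyp0 = y" using isoH_transitive[OF hyp0_Hyp y] .
  obtain K where K: "0 < K" "\<And>u. norm (A u) \<le> norm u * K"
    using bounded_linear.pos_bounded linear_conv_bounded_linear isoH_linear[OF A(1)] by metis
  have "norm (z - y) \<le> K * sqrt (2 * (- lor y z) * (- lor y z - 1))" if z: "z \<in> Hyp" for z
  proof -
    define u where "u = invf A z"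
    have u: "u \<in> Hyp" "A u = z" using z A isoH_inv[OF A(1)] by (simp_all add: u_def isoH_inv_apply)
    have c: "- lor y z = tim u" using isoH_lor[OF A(1), of hyp0 u] A u by (simp add: lor_hyp0)
    have "(norm (u - hyp0))\<^sup>2 = (norm (spa u))\<^sup>2 + (tim u - 1)\<^sup>2" using norm_spa[of "u - hyp0"] by (simp add: inner_simps spa_def[of tau] spa_def algebra_simps)
    also have "(norm (spa u))\<^sup>2 = (tim u)\<^sup>2 - 1"
      using HypD(1)[OF u(1)] by (simp add: lor_def dot_square_norm power2_eq_square)
    finally have "(norm (u - hyp0))\<^sup>2 = 2 * tim u * (tim u - 1)" by (simp add: power2_eq_square algebra_simps)
    then have "norm (u - hyp0) = sqrt (2 * tim u * (tim u - 1))" by (metis norm_ge_zero real_sqrt_abs abs_of_nonneg)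
    moreover have "z - y = A (u - hyp0)" using u(2) A(2) linear_diff[OF isoH_linear[OF A(1)]] by simp
    ultimately show ?thesis using K(2)[of "u - hyp0"] by (simp add: c mult.commute)
  qed
  then show ?thesis using that K(1) by blast
qed

lemma hball_nbhd:
  assumes y: "y \<in> Hyp" and e: "0 < e"
  obtains r where "0 < r" "\<And>z. z \<in> hball y r ==> norm (z - y) < e"
proof -
  obtain K where K: "0 < K" "\<And>z. z \<in> Hyp ==> norm (z - y) \<le> K * sqrt (2 * (- lor y z) * (- lor y z - 1))"
    using norm_diff_Hyp_bound[OF y] by blast
  have "isCont (\<lambda>d. K * sqrt (2 * cosh d * (cosh d - 1))) (0::real)" by (intro continuous_intros)
  then have "(\<lambda>d. K * sqrt (2 * cosh d * (cosh d - 1))) \<midarrow>0\<rightarrow> (0::real)" by (simp add: isCont_def)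
  then obtain r where r: "0 < r" "\<And>d::real. d \<noteq> 0 ==> \<bar>d\<bar> < r ==> \<bar>K * sqrt (2 * cosh d * (cosh d - 1))\<bar> < e"
    using LIM_D[OF _ e, of "\<lambda>d. K * sqrt (2 * cosh d * (cosh d - 1))" 0 0] by auto
  have "norm (z - y) < e" if z: "z \<in> hball y r" for z
  proof (cases "z = y")
    case False
    define d where "d = hdist y z"
    have z': "z \<in> Hyp" "d < r" using z by (auto simp: hball_def d_def)
    have "0 < d" using hdist_nonneg[OF y z'(1)] hdist_eq_0[OF y z'(1)] False by (simp add: d_def)
    then have "\<bar>K * sqrt (2 * cosh d * (cosh d - 1))\<bar> < e" using r(2)[of d] z' by simp
    moreover have "- lor y z = cosh d" using cosh_hdist[OF y z'(1)] by (simp add: d_def)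
    ultimately show ?thesis using K(2)[OF z'(1)] by simp
  qed (use e in simp)
  then show ?thesis using that r(1) by blast
qed

lemma openin_hball: "y \<in> Hyp ==> openin (top_of_set Hyp) (hball y r)"
  using continuous_openin_preimage_gen[OF continuous_on_hdist[of y], of "{..<r}"]
  by (simp add: hball_def vimage_def Int_def)

lemma openin_Hyp_iff:
  "openin (top_of_set Hyp) U \<longleftrightarrow> U \<subseteq> Hyp \<and> (\<forall>y\<in>U. \<exists>e>0. hball y e \<subseteq> U)"
proof
  assume U: "openin (top_of_set Hyp) U"
  have "\<exists>e>0. hball y e \<subseteq> U" if yU: "y \<in> U" for y
  proof -
    have y: "y \<in> Hyp" using U yU openin_imp_subset by blast
    obtain e where e: "e > 0" "ball y e \<inter> Hyp \<subseteq> U" using openin_contains_ball[THEN iffD1, OF U] yU by metis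
    obtain r where r: "0 < r" "\<And>z. z \<in> hball y r ==> norm (z - y) < e" using hball_nbhd[OF y e(1)] by blast
    have "hball y r \<subseteq> U"
    proof
      fix z assume z: "z \<in> hball y r"
      then have "dist y z < e" using r(2)[OF z] by (simp add: dist_norm norm_minus_commute)
      then show "z \<in> U" using e(2) subsetD[OF hball_Hyp z] by (simp add: subset_iff)
    qed
    then show ?thesis using r(1) by blast
  qed
  then show "U \<subseteq> Hyp \<and> (\<forall>y\<in>U. \<exists>e>0. hball y e \<subseteq> U)" using U openin_imp_subset by blast
next
  assume U: "U \<subseteq> Hyp \<and> (\<forall>y\<in>U. \<exists>e>0. hball y e \<subseteq> U)"
  have "\<exists>T. openin (top_of_set Hyp) T \<and> y \<in> T \<and> T \<subseteq> U" if "y \<in> U" for y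
    using that U openin_hball[of y] by (metis center_hball subsetD)
  then show "openin (top_of_set Hyp) U" by (subst openin_subopen) blast
qed

lemma compact_hcball: assumes y: "y \<in> Hyp" shows "compact {z \<in> Hyp. hdist y z \<le> r}"
proof -
  obtain K where K: "0 < K" "\<And>z. z \<in> Hyp ==> norm (z - y) \<le> K * sqrt (2 * (- lor y z) * (- lor y z - 1))"
    using norm_diff_Hyp_bound[OF y] by blast
  have "bounded {z \<in> Hyp. hdist y z \<le> r}"
  proof (rule boundedI)
    fix z assume z: "z \<in> {z \<in> Hyp. hdist y z \<le> r}"
    define c where "c = - lor y z"
    have c: "1 \<le> c" "c \<le> cosh \<bar>r\<bar>"
      using Hyp_lor_le[OF y, of z] hdist_le_iff[OF y, of z "\<bar>r\<bar>"] z by (auto simp: c_def)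
    have "2 * c * (c - 1) \<le> 2 * cosh \<bar>r\<bar> * cosh \<bar>r\<bar>" using c by (intro mult_mono) auto
    then have "K * sqrt (2 * c * (c - 1)) \<le> K * sqrt (2 * cosh \<bar>r\<bar> * cosh \<bar>r\<bar>)" using K(1) by simp
    moreover have "norm z \<le> norm y + norm (z - y)" by (metis add.commute diff_add_cancel norm_triangle_ineq)
    ultimately show "norm z \<le> norm y + K * sqrt (2 * cosh \<bar>r\<bar> * cosh \<bar>r\<bar>)" using K(2)[of z] z c_def by auto
  qed
  moreover have "closed {z \<in> Hyp. hdist y z \<le> r}"
    using continuous_closed_preimage[OF continuous_on_hdist[OF y] closed_Hyp, of "{..r}"]
    by (simp add: vimage_def Int_def)
  ultimately show ?thesis by (simp add: compact_eq_bounded_closed)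
qed

definition nrm :: "'v::lorentz_space => 'v" where
  "nrm w = (1 / sqrt (- lor w w)) *\<^sub>R w"

lemma nrm_Hyp: "lor w w < 0 ==> 0 < tim w ==> nrm w \<in> Hyp"
  by (simp add: nrm_def Hyp_def field_simps)

lemma nrm_id [simp]: "y \<in> Hyp ==> nrm y = y"
  by (simp add: nrm_def Hyp_def)

lemma nrm_scale: "0 < c ==> nrm (c *\<^sub>R w) = nrm w"
  using real_sqrt_mult[of "c\<^sup>2" "- lor w w"] by (simp add: nrm_def power2_eq_square mult.assoc)

text \<open>The chord pushed radially back to the hyperboloid. It traces the geodesic segment at
  varying speed; the advantage over unit speed is that linear inequalities hold along it up to a
  positive factor.\<close>

definition nseg :: "'v::lorentz_space => 'v => real => 'v" where
  "nseg y z t = nrm ((1 - t) *\<^sub>R y + t *\<^sub>R z)"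

lemma nseg_aux:
  assumes y: "y \<in> Hyp" and z: "z \<in> Hyp" and t: "0 \<le> t" "t \<le> (1::real)"
  defines "w \<equiv> (1 - t) *\<^sub>R y + t *\<^sub>R z"
  shows "lor w w \<le> - 1" "0 < tim w"
proof -
  have "lor w w = - (1 - t)\<^sup>2 - t\<^sup>2 + 2 * ((1 - t) * t) * lor y z"
    using HypD(1)[OF y] HypD(1)[OF z] lor_commute[of z y] by (simp add: w_def lor_simps power2_eq_square algebra_simps)
  also have "\<dots> \<le> - (1 - t)\<^sup>2 - t\<^sup>2 + 2 * ((1 - t) * t) * (- 1)"
    using Hyp_lor_le[OF y z] t by (intro add_left_mono mult_left_mono) auto
  also have "\<dots> = - 1" by (simp add: power2_eq_square algebra_simps)
  finally show "lor w w \<le> - 1" .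
  have "0 < (1 - t) * tim y + t * tim z"
    using HypD(2)[OF y] HypD(2)[OF z] t by (cases "t = 0") (auto intro: add_nonneg_pos)
  then show "0 < tim w" by (simp add: w_def)
qed

lemma nseg_Hyp: "y \<in> Hyp ==> z \<in> Hyp ==> 0 \<le> t ==> t \<le> 1 ==> nseg y z t \<in> Hyp"
  unfolding nseg_def using nseg_aux[of y z t] by (intro nrm_Hyp) auto

lemma nseg_lor:
  assumes y: "y \<in> Hyp" and z: "z \<in> Hyp" and t: "0 \<le> t" "t \<le> 1"
  obtains q where "0 < q" "q \<le> 1" "\<And>v. lor (nseg y z t) v = q * ((1 - t) * lor y v + t * lor z v)"
proof -
  define w where "w = (1 - t) *\<^sub>R y + t *\<^sub>R z"
  have w: "1 \<le> - lor w w" using nseg_aux[OF assms] by (simp add: w_def)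
  show ?thesis
  proof
    show "0 < 1 / sqrt (- lor w w)" "1 / sqrt (- lor w w) \<le> 1" using w by auto
    show "lor (nseg y z t) v = 1 / sqrt (- lor w w) * ((1 - t) * lor y v + t * lor z v)" for v
      by (simp add: nseg_def nrm_def w_def[symmetric]) (simp add: w_def lor_simps)
  qed
qed

lemma nseg_ends [simp]: "y \<in> Hyp ==> nseg y z 0 = y" "z \<in> Hyp ==> nseg y z 1 = z" "y \<in> Hyp ==> nseg y y t = y"
  by (simp_all add: nseg_def flip: scaleR_left.add)

lemma continuous_on_nseg:
  fixes f g :: "'c::topological_space => 'v::lorentz_space"
  assumes "continuous_on S f" "continuous_on S g" "continuous_on S h"
    and S: "\<And>x. x \<in> S ==> f x \<in> Hyp" "\<And>x. x \<in> S ==> g x \<in> Hyp" "\<And>x. x \<in> S ==> 0 \<le> h x \<and> h x \<le> 1"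
  shows "continuous_on S (\<lambda>x. nseg (f x) (g x) (h x))"
  unfolding nseg_def nrm_def
proof (intro continuous_intros lor.continuous_on assms(1-3) ballI)
  fix x assume "x \<in> S"
  then show "sqrt (- lor ((1 - h x) *\<^sub>R f x + h x *\<^sub>R g x) ((1 - h x) *\<^sub>R f x + h x *\<^sub>R g x)) \<noteq> 0"
    using nseg_aux(1)[OF S(1) S(2), of x x "h x"] S(3)[of x] by simp
qed

definition nconvex :: "('v::lorentz_space) set => bool" where
  "nconvex S \<longleftrightarrow> S \<subseteq> Hyp \<and> (\<forall>y\<in>S. \<forall>z\<in>S. \<forall>t\<in>{0..1}. nseg y z t \<in> S)"

lemma nconvexD: "nconvex S ==> y \<in> S ==> z \<in> S ==> 0 \<le> t ==> t \<le> 1 ==> nseg y z t \<in> S"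
  and nconvex_Hyp_sub: "nconvex S ==> S \<subseteq> Hyp"
  by (simp_all add: nconvex_def)

lemma nconvex_Hyp: "nconvex Hyp"
  by (simp add: nconvex_def nseg_Hyp)

lemma nconvex_Int: "nconvex S ==> nconvex T ==> nconvex (S \<inter> T)"
  by (auto simp: nconvex_def)

text \<open>Normalising multiplies the convex combination by a factor at most one, which preserves
  an upper bound by the positive number \<open>c\<close>. For \<open>v\<close> in \<open>Hyp\<close>
  the set is a ball, for a null vector it is a horoball.\<close>

lemma nconvex_horoball: assumes c: "0 < c" shows "nconvex {y \<in> Hyp. - lor y v < c}"
  unfolding nconvex_def
proof (intro conjI ballI)
  fix y z t assume "y \<in> {y \<in> Hyp. - lor y v < c}" "z \<in> {y \<in> Hyp. - lor y v < c}" "t \<in> {0..1::real}"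
  then have y: "y \<in> Hyp" "- lor y v < c" and z: "z \<in> Hyp" "- lor z v < c" and t: "0 \<le> t" "t \<le> 1" by auto
  obtain q where q: "0 < q" "q \<le> 1" "\<And>v. lor (nseg y z t) v = q * ((1 - t) * lor y v + t * lor z v)"
    using nseg_lor[OF y(1) z(1) t] by blast
  have m: "(1 - t) * (- lor y v) + t * (- lor z v) < c"
    by (rule convex_bound_lt) (use y z t in auto)
  have "q * ((1 - t) * (- lor y v) + t * (- lor z v)) < c"
  proof (cases "0 \<le> (1 - t) * (- lor y v) + t * (- lor z v)")
    case True
    then show ?thesis using mult_right_mono[OF q(2) True] m by simp
  next
    case False
    then have "q * ((1 - t) * (- lor y v) + t * (- lor z v)) < 0" using q(1) by (simp add: mult_less_0_iff)
    then show ?thesis using c by simp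
  qed
  then have "- lor (nseg y z t) v < c" by (simp add: q(3) algebra_simps)
  then show "nseg y z t \<in> {y \<in> Hyp. - lor y v < c}" using nseg_Hyp[OF y(1) z(1) t] by simp
qed auto

lemma nconvex_hball: "y \<in> Hyp ==> nconvex (hball y r)"
proof (cases "0 \<le> r")
  case True then show "y \<in> Hyp ==> nconvex (hball y r)" by (simp add: hball_eq nconvex_horoball)
next
  case False
  assume "y \<in> Hyp"
  then have "hball y r = {}" using False hdist_nonneg[of y] by (force simp: hball_def)
  then show ?thesis by (simp add: nconvex_def)
qed

lemma nconvex_halfspace: "nconvex {y \<in> Hyp. 0 \<le> lor y w}"
  unfolding nconvex_def
proof (intro conjI ballI)
  fix y z t assume a: "y \<in> {y \<in> Hyp. 0 \<le> lor y w}" "z \<in> {y \<in> Hyp. 0 \<le> lor y w}" "t \<in> {0..1::real}"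
  then have "y \<in> Hyp" "z \<in> Hyp" "0 \<le> t" "t \<le> 1" by auto
  then obtain q where q: "0 < q" "\<And>v. lor (nseg y z t) v = q * ((1 - t) * lor y v + t * lor z v)"
    using nseg_lor by metis
  then show "nseg y z t \<in> {y \<in> Hyp. 0 \<le> lor y w}" using a nseg_Hyp[of y z t] by simp
qed auto

lemma nconvex_hyperplane: "nconvex {y \<in> Hyp. lor y w = 0}"
proof -
  have "{y \<in> Hyp. lor y w = 0} = {y \<in> Hyp. 0 \<le> lor y w} \<inter> {y \<in> Hyp. 0 \<le> lor y (- w)}"
    by (auto simp: lor_simps)
  then show ?thesis using nconvex_Int[OF nconvex_halfspace[of w] nconvex_halfspace[of "- w"]] by simp
qed

lemma path_nseg: "y \<in> Hyp ==> z \<in> Hyp ==> path (nseg y z)"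
  unfolding path_def by (rule continuous_on_nseg) (auto intro: continuous_intros)

lemma nseg_path_ends [simp]: "y \<in> Hyp ==> pathstart (nseg y z) = y" "z \<in> Hyp ==> pathfinish (nseg y z) = z"
  by (simp_all add: pathstart_def pathfinish_def)

lemma path_image_nseg: "nconvex S ==> y \<in> S ==> z \<in> S ==> path_image (nseg y z) \<subseteq> S"
  by (auto simp: path_image_def nconvexD)

lemma nconvex_connected: assumes S: "nconvex S" shows "connected S"
proof (rule path_connected_imp_connected, unfold path_connected_def, intro ballI)
  fix y z assume y: "y \<in> S" and z: "z \<in> S"
  then have "y \<in> Hyp" "z \<in> Hyp" using nconvex_Hyp_sub[OF S] by blast+
  then show "\<exists>g. path g \<and> path_image g \<subseteq> S \<and> pathstart g = y \<and> pathfinish g = z"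
    by (intro exI[of _ "nseg y z"] conjI path_nseg path_image_nseg[OF S y z] nseg_path_ends)
qed

lemma nconvex_homotopic_paths:
  assumes S: "nconvex S" and p: "path p" "path_image p \<subseteq> S" and q: "path q" "path_image q \<subseteq> S"
    and eq: "pathstart p = pathstart q" "pathfinish p = pathfinish q"
  shows "homotopic_paths S p q"
proof -
  have pS: "p t \<in> S" "q t \<in> S" if "t \<in> {0..1}" for t using p q that by (auto simp: path_image_def)
  have H: "x \<in> S ==> x \<in> Hyp" for x using nconvex_Hyp_sub[OF S] by blast
  have c: "continuous_on ({0..1} \<times> {0..1}) (\<lambda>x. nseg (p (snd x)) (q (snd x)) (fst x))"
  proof (rule continuous_on_nseg)
    show "continuous_on ({0..1} \<times> {0..1}) (\<lambda>x. p (snd x))" "continuous_on ({0..1} \<times> {0..1}) (\<lambda>x. q (snd x))"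
      using p(1) q(1) unfolding path_def
      by (auto intro!: continuous_on_compose2[of "{0..1}" p] continuous_on_compose2[of "{0..1}" q] continuous_intros)
  qed (use pS H in \<open>auto intro!: continuous_intros\<close>)
  show ?thesis unfolding homotopic_paths
    by (rule exI[of _ "\<lambda>x. nseg (p (snd x)) (q (snd x)) (fst x)"])
       (use c pS H nconvexD[OF S] eq in \<open>auto simp: pathstart_def pathfinish_def\<close>)
qed

text \<open>Convexity is phrased with chords, so the point at time \<open>t\<close> is written as a
  combination of the two ends with the nonnegative weights \<open>sinh (d - t) / sinh d\<close> and
  \<open>sinh t / sinh d\<close>.\<close>

lemma geo_in_nconvex:
  assumes S: "nconvex S" and y: "y \<in> S" and e: "lor e y = 0" "lor e e = 1"
    and d: "geo y e d \<in> S" "0 \<le> t" "t \<le> d"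
  shows "geo y e t \<in> S"
proof (cases "d = 0")
  case True then show ?thesis using d by simp
next
  case False
  then have d0: "0 < d" using d by simp
  have yH: "y \<in> Hyp" using y nconvex_Hyp_sub[OF S] by blast
  define a b where "a = sinh (d - t) / sinh d" and "b = sinh t / sinh d"
  have ab: "0 \<le> a" "0 \<le> b" using d d0 by (simp_all add: a_def b_def)
  have comb: "geo y e t = a *\<^sub>R y + b *\<^sub>R geo y e d"
  proof -
    have "a + b * cosh d = cosh t" "b * sinh d = sinh t"
      using d0 by (simp_all add: a_def b_def sinh_diff field_simps)
    moreover have "a *\<^sub>R y + b *\<^sub>R geo y e d = (a + b * cosh d) *\<^sub>R y + (b * sinh d) *\<^sub>R e"
      by (simp add: geo_def algebra_simps)
    ultimately show ?thesis by (simp add: geo_def)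
  qed
  have s: "0 < a + b"
  proof (rule ccontr)
    assume "\<not> 0 < a + b"
    then have "a = 0" "b = 0" using ab by auto
    then have "geo y e t = 0" using comb by simp
    then show False using geo_Hyp[OF yH e, of t] by (simp add: Hyp_def)
  qed
  have g: "geo y e t = (a + b) *\<^sub>R ((1 - b / (a + b)) *\<^sub>R y + (b / (a + b)) *\<^sub>R geo y e d)"
    using s by (simp add: comb scaleR_add_right right_diff_distrib)
  have "geo y e t = nrm (geo y e t)" using geo_Hyp[OF yH e] by simp
  also have "\<dots> = nseg y (geo y e d) (b / (a + b))" using s by (subst g) (simp only: nrm_scale nseg_def)
  finally show ?thesis using nconvexD[OF S y d(1), of "b / (a + b)"] ab s by simp
qed

section \<open>Folding maps\<close>

lemma off_hyperplane:
  assumes y: "y \<in> Hyp" "0 < e" and w: "w \<noteq> 0"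
  obtains z where "z \<in> hball y e" "lor z w \<noteq> 0"
proof (rule ccontr)
  assume "\<not> thesis"
  then have n: "lor z w = 0" if "z \<in> hball y e" for z using that \<open>z \<in> hball y e ==> lor z w \<noteq> 0 ==> thesis\<close> by blast
  have "(\<lambda>z. lor z w) = (\<lambda>z. 0)"
  proof (rule linear_eq_on_ball[OF _ _ y])
    show "linear (\<lambda>z. lor z w)" "linear (\<lambda>z. 0 :: real)" by (simp_all add: linear_iff lor_simps)
  qed (use n in \<open>simp add: hball_def\<close>)
  then have "lor w z = 0" for z by (metis lor_commute)
  then show False using lor_nondegenerate w by blast
qed

lemma hball_sign:
  assumes z: "z \<in> Hyp" "0 < lor z w" obtains e where "0 < e" "\<And>x. x \<in> hball z e ==> 0 < lor x w"
proof -
  have "openin (top_of_set Hyp) {x \<in> Hyp. 0 < lor x w}"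
    using continuous_openin_preimage_gen[of Hyp "\<lambda>x. lor x w" "{0<..}"]
    by (simp add: vimage_def Int_def lor.continuous_on continuous_on_id)
  then obtain e where "0 < e" "hball z e \<subseteq> {x \<in> Hyp. 0 < lor x w}"
    using z unfolding openin_Hyp_iff by auto
  then show ?thesis using that by blast
qed

lemma hball_sub_ex:
  assumes "z \<in> hball y e" "y \<in> Hyp" obtains d where "0 < d" "hball z d \<subseteq> hball y e"
  using hball_sub[of y z "e - hdist y z" e] assms that[of "e - hdist y z"] by (simp add: mem_hball)

lemma openin_hball_Int:
  assumes "D \<subseteq> Hyp" "y \<in> D" "0 < e"
  shows "openin (top_of_set D) (D \<inter> hball y e)" "y \<in> D \<inter> hball y e"
proof -
  have yH: "y \<in> Hyp" using assms by blast
  obtain T where T: "open T" "hball y e = Hyp \<inter> T" using openin_hball[OF yH, of e] by (auto simp: openin_open)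
  have "D \<inter> hball y e = D \<inter> T" using T(2) assms(1) by blast
  then show "openin (top_of_set D) (D \<inter> hball y e)" using T(1) openin_open_Int by metis
  show "y \<in> D \<inter> hball y e" using assms yH by simp
qed

lemma hball_continuation:
  assumes D: "connected D" "D \<subseteq> Hyp" "c \<in> D" "y \<in> D" and c: "P c"
    and op: "\<And>x. x \<in> D ==> P x ==> \<exists>e>0. \<forall>z\<in>D \<inter> hball x e. P z"
    and cl: "\<And>x. x \<in> D ==> (\<And>e. 0 < e ==> \<exists>z\<in>D \<inter> hball x e. P z) ==> P x"
  shows "P y"
proof (rule connected_induction_simple[OF D(1,3,4), of P])
  fix x assume x: "x \<in> D"
  then obtain e where "0 < e" "(\<forall>z\<in>D \<inter> hball x e. P z) \<or> (\<forall>z\<in>D \<inter> hball x e. \<not> P z)" using op cl by meson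
  then show "\<exists>T. openin (top_of_set D) T \<and> x \<in> T \<and> (\<forall>y\<in>T. \<forall>z\<in>T. P y --> P z)"
    using openin_hball_Int[OF D(2) x] by blast
qed (rule c)

locale wall =
  fixes wn :: "'v::lorentz_space"
  assumes wn: "lor wn wn = 1"
begin

definition Hhalf :: "'v set" where "Hhalf = {y \<in> Hyp. 0 \<le> lor y wn}"

definition fold :: "'v => 'v" where "fold y = (if 0 \<le> lor y wn then y else reflH wn y)"

lemma wn0: "wn \<noteq> 0"
  using wn by (auto simp: lor.zero_left)

lemma isoH_wn: "isoH (reflH wn)" by (rule isoH_reflH[OF wn])

lemma fold_cases: obtains "fold y = y" "0 \<le> lor y wn" | "fold y = reflH wn y" "lor y wn < 0"
  unfolding fold_def by (cases "0 \<le> lor y wn") auto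

lemma fold_Hhalf: "y \<in> Hyp ==> fold y \<in> Hhalf"
  using isoH_Hyp[OF isoH_wn, of y] lor_reflH_normal[OF wn, of y] by (simp add: fold_def Hhalf_def)

lemma fold_Hyp: "y \<in> Hyp ==> fold y \<in> Hyp"
  using fold_Hhalf by (simp add: Hhalf_def)

lemma fold_id: "y \<in> Hhalf ==> fold y = y"
  by (simp add: fold_def Hhalf_def)

lemma fold_reflH: "fold (reflH wn y) = fold y"
  using reflH_reflH[OF wn, of y] lor_reflH_normal[OF wn, of y] reflH_fix[of y wn] by (auto simp: fold_def)

lemma lor_fold_wn: "lor (fold y) wn = \<bar>lor y wn\<bar>"
  by (simp add: fold_def lor_reflH_normal[OF wn])

lemma fold_fixes: "isoH T ==> T wn = wn ==> T (fold y) = fold (T y)"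
proof -
  assume T: "isoH T" "T wn = wn"
  have "lor (T y) wn = lor y wn" using isoH_lor[OF T(1), of y wn] T(2) by simp
  then show ?thesis using T linear_diff[OF isoH_linear[OF T(1)]] linear_scale[OF isoH_linear[OF T(1)]]
    by (simp add: fold_def reflH_def)
qed

text \<open>Only points on different sides matter: replacing one of them by its mirror image
  subtracts twice a product of two numbers of opposite sign. In terms of distances, folding does not
  increase them.\<close>

lemma fold_lor_le: "lor y z \<le> lor (fold y) (fold z)"
proof -
  have r: "lor y (reflH wn z) = lor y z - 2 * lor y wn * lor z wn" for y z
    by (simp add: reflH_def lor_simps)
  have m: "a * b \<le> 0" if "a \<ge> 0" "b < 0" for a b :: real using that by (simp add: mult_nonneg_nonpos)
  show ?thesis
  proof (cases rule: fold_cases[of y]; cases rule: fold_cases[of z])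
    assume "fold y = y" "0 \<le> lor y wn" "fold z = reflH wn z" "lor z wn < 0"
    then show ?thesis using m[of "lor y wn" "lor z wn"] by (simp add: r)
  next
    assume "fold y = reflH wn y" "lor y wn < 0" "fold z = z" "0 \<le> lor z wn"
    then show ?thesis using m[of "lor z wn" "lor y wn"] by (simp add: r lor_commute[of _ z] mult.commute)
  qed (simp_all add: lor_reflH[OF wn])
qed

lemma fold_hdist: "y \<in> Hyp ==> z \<in> Hyp ==> hdist (fold y) (fold z) \<le> hdist y z"
  using fold_lor_le[of y z] by (subst hdist_le_iff) (simp_all add: fold_Hyp hdist_nonneg cosh_hdist)

lemma fold_local:
  assumes "z \<in> Hyp" "lor z wn \<noteq> 0"
  obtains C e where "isoH C" "0 < e" "\<And>x. x \<in> hball z e ==> fold x = C x" "\<And>x. fold (C x) = fold x"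
    "C = id \<or> C = reflH wn"
proof (cases "0 < lor z wn")
  case True
  then obtain e where "0 < e" "\<And>x. x \<in> hball z e ==> 0 < lor x wn" using hball_sign assms by blast
  then show ?thesis using that[of id e] isoH_id by (force simp: fold_def)
next
  case False
  then have "0 < lor z (- wn)" using assms by (simp add: lor_simps)
  then obtain e where e: "0 < e" "\<And>x. x \<in> hball z e ==> 0 < lor x (- wn)" using hball_sign assms by blast
  have "fold x = reflH wn x" if "x \<in> hball z e" for x using e(2)[OF that] by (simp add: fold_def lor_simps)
  then show ?thesis using that[of "reflH wn" e] isoH_wn e(1) fold_reflH by blast
qed

lemma isoH_local_sign:
  assumes B: "isoH B" and z: "z \<in> Hyp" and "0 < e"
  obtains z' e' C where "z' \<in> Hyp" "0 < e'" "hball z' e' \<subseteq> hball z e" "isoH C" "\<And>x. x \<in> hball z' e' ==> fold (B x) = C (B x)"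
    "\<And>x. fold (C x) = fold x" "C = id \<or> C = reflH wn"
proof -
  have w: "invf B wn \<noteq> 0" using isoH_inv_apply(2)[OF B, of wn] linear_0[OF isoH_linear[OF B]] wn0 by metis
  obtain z' where z': "z' \<in> hball z e" "lor z' (invf B wn) \<noteq> 0"
    by (rule off_hyperplane[OF z \<open>0 < e\<close> w])
  have zH: "z' \<in> Hyp" using z'(1) by (simp add: mem_hball)
  have "lor (B z') wn \<noteq> 0" using z' by (simp add: isoH_lor_inv[OF B])
  then obtain C d where C: "isoH C" "0 < d" "\<And>x. x \<in> hball (B z') d ==> fold x = C x" "\<And>x. fold (C x) = fold x"
    "C = id \<or> C = reflH wn"
    using fold_local[OF isoH_Hyp[OF B zH]] by blast
  obtain d' where d': "0 < d'" "hball z' d' \<subseteq> hball z e" by (rule hball_sub_ex[OF z'(1) z])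
  show ?thesis
  proof
    show "0 < min d d'" "hball z' (min d d') \<subseteq> hball z e"
      using C(2) d' hball_mono[of "min d d'" d' z'] by auto
    show "fold (B x) = C (B x)" if "x \<in> hball z' (min d d')" for x
      using that C(3)[of "B x"] B by (simp add: mem_hball)
  qed (use C zH in auto)
qed

text \<open>Near a suitable point of the ball both images avoid the wall, so there each fold is the
  identity or the reflection, and two linear maps agreeing on a ball agree everywhere. Hence
  \<open>fold \<circ> B\<close> determines \<open>B\<close> up to the reflection.\<close>

lemma fold_eq_cases:
  assumes B: "isoH B" and B': "isoH B'" and z: "z \<in> Hyp" "0 < e"
    and eq: "\<And>x. x \<in> hball z e ==> fold (B x) = fold (B' x)"
  shows "B = B' \<or> B = reflH wn \<circ> B'" "fold (B x) = fold (B' x)"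
proof -
  obtain z1 e1 C where 1: "z1 \<in> Hyp" "0 < e1" "hball z1 e1 \<subseteq> hball z e" "isoH C" "\<And>x. x \<in> hball z1 e1 ==> fold (B x) = C (B x)"
    "\<And>x. fold (C x) = fold x" "C = id \<or> C = reflH wn"
    using isoH_local_sign[OF B z] by blast
  obtain z2 e2 C' where 2: "z2 \<in> Hyp" "0 < e2" "hball z2 e2 \<subseteq> hball z1 e1" "isoH C'" "\<And>x. x \<in> hball z2 e2 ==> fold (B' x) = C' (B' x)"
    "\<And>x. fold (C' x) = fold x" "C' = id \<or> C' = reflH wn"
    using isoH_local_sign[OF B' 1(1,2)] by blast
  have CC: "C \<circ> B = C' \<circ> B'"
  proof (rule linear_eq_on_ball[OF _ _ 2(1,2)])
    show "linear (C \<circ> B)" "linear (C' \<circ> B')" using isoH_comp 1(4) 2(4) B B' isoH_linear by blast+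
    show "(C \<circ> B) x = (C' \<circ> B') x" if "x \<in> Hyp" "hdist z2 x < e2" for x
    proof -
      have "x \<in> hball z2 e2" using that by (simp add: mem_hball)
      moreover from this have "x \<in> hball z1 e1" "x \<in> hball z e" using 1(3) 2(3) by blast+
      ultimately show ?thesis using 1(5)[of x] 2(5)[of x] eq[of x] by simp
    qed
  qed
  have rr: "reflH wn (reflH wn x) = x" for x by (rule reflH_reflH[OF wn])
  show "fold (B x) = fold (B' x)" using fun_cong[OF CC, of x] 1(6)[of "B x"] 2(6)[of "B' x"] by simp
  show "B = B' \<or> B = reflH wn \<circ> B'"
  proof -
    have inv: "C (C v) = v" for v using 1(7) rr by (elim disjE) simp_all
    have h: "B x = C (C' (B' x))" for x using fun_cong[OF CC, of x] inv[of "B x"] by simp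
    show ?thesis
    proof (cases "C = C'")
      case True
      then have "B = B'" using h inv by (intro ext) metis
      then show ?thesis by simp
    next
      case False
      then have "C (C' v) = reflH wn v" for v using 1(7) 2(7) by (elim disjE) simp_all
      then have "B = reflH wn \<circ> B'" using h by (intro ext) simp
      then show ?thesis by simp
    qed
  qed
qed

end

section \<open>Charts into the hyperbolic half-space and germs of folding maps\<close>

locale charted = wall wn for wn :: "'v::lorentz_space" +
  fixes M :: "'m::metric_space set"
begin

text \<open>Charts are isometric for the distance of \<open>M\<close> itself, not merely for lengths
  of curves. The condition on balls says that the image is open relative to
  \<open>Hhalf\<close>.\<close>

definition lchart :: "'m set => ('m => 'v) => bool" where
  "lchart U \<psi> \<longleftrightarrow> openin (top_of_set M) U \<and> \<psi> ` U \<subseteq> Hhalf \<and>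
     (\<forall>y\<in>\<psi> ` U. \<exists>r>0. hball y r \<inter> Hhalf \<subseteq> \<psi> ` U) \<and> (\<forall>p\<in>U. \<forall>q\<in>U. hdist (\<psi> p) (\<psi> q) = dist p q)"

lemma lchart_sub: "lchart U \<psi> ==> U \<subseteq> M"
  unfolding lchart_def using openin_imp_subset by blast

lemma lchart_Hhalf: "lchart U \<psi> ==> p \<in> U ==> \<psi> p \<in> Hhalf"
  and lchart_Hyp: "lchart U \<psi> ==> p \<in> U ==> \<psi> p \<in> Hyp"
  and lchart_dist: "lchart U \<psi> ==> p \<in> U ==> q \<in> U ==> hdist (\<psi> p) (\<psi> q) = dist p q"
  by (auto simp: lchart_def Hhalf_def)

lemma lchart_lor: "lchart U \<psi> ==> p \<in> U ==> q \<in> U ==> lor (\<psi> p) (\<psi> q) = - cosh (dist p q)"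
  using cosh_hdist[of "\<psi> p" "\<psi> q"] lchart_Hyp lchart_dist by fastforce

lemma lchart_inj: "lchart U \<psi> ==> p \<in> U ==> q \<in> U ==> \<psi> p = \<psi> q ==> p = q"
  using lchart_dist[of U \<psi> p q] lchart_Hyp[of U \<psi> p] by simp

lemma openin_M_ball: "openin (top_of_set M) U ==> p \<in> U ==> \<exists>r>0. \<forall>q\<in>M. dist p q < r --> q \<in> U"
  unfolding openin_contains_ball by (metis IntI mem_ball subsetD)

lemma lchart_ball:
  assumes "lchart U \<psi>" "p \<in> U"
  obtains r where "0 < r" "hball (\<psi> p) r \<inter> Hhalf \<subseteq> \<psi> ` U" "\<And>q. q \<in> M ==> dist p q < r ==> q \<in> U"
proof -
  obtain r1 where r1: "0 < r1" "hball (\<psi> p) r1 \<inter> Hhalf \<subseteq> \<psi> ` U"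
    using assms unfolding lchart_def by (metis imageI)
  obtain r2 where r2: "0 < r2" "\<forall>q\<in>M. dist p q < r2 --> q \<in> U"
    using assms(1) openin_M_ball[OF _ assms(2)] unfolding lchart_def by metis
  show ?thesis using that[of "min r1 r2"] r1 r2 hball_mono[of "min r1 r2" r1 "\<psi> p"] by auto
qed

lemma lchart_restrict:
  assumes U: "lchart U \<psi>" and V: "openin (top_of_set M) V" "V \<subseteq> U"
  shows "lchart V \<psi>"
  unfolding lchart_def
proof (intro conjI ballI)
  fix y assume "y \<in> \<psi> ` V"
  then obtain p where p: "p \<in> V" "y = \<psi> p" by blast
  obtain r1 where r1: "0 < r1" "hball (\<psi> p) r1 \<inter> Hhalf \<subseteq> \<psi> ` U"
    using lchart_ball[OF U subsetD[OF V(2) p(1)]] by metis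
  obtain r2 where r2: "0 < r2" "\<forall>q\<in>M. dist p q < r2 --> q \<in> V"
    using openin_M_ball[OF V(1) p(1)] by blast
  have "hball y (min r1 r2) \<inter> Hhalf \<subseteq> \<psi> ` V"
  proof
    fix z assume z: "z \<in> hball y (min r1 r2) \<inter> Hhalf"
    then obtain q where q: "q \<in> U" "z = \<psi> q" using r1(2) p(2) hball_mono[of "min r1 r2" r1 y] by auto
    then have "dist p q < r2" using z p(2) lchart_dist[OF U subsetD[OF V(2) p(1)] q(1)] by (simp add: mem_hball)
    then show "z \<in> \<psi> ` V" using r2(2) q lchart_sub[OF U] by blast
  qed
  then show "\<exists>r>0. hball y r \<inter> Hhalf \<subseteq> \<psi> ` V" using r1(1) r2(1) by (metis min_less_iff_conj)
qed (use U V lchart_Hhalf lchart_dist in blast)+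

lemma lchart_interior_ball:
  assumes U: "lchart U \<psi>" and p: "p \<in> U"
  obtains y e where "y \<in> Hyp" "0 < e" "hball y e \<subseteq> \<psi> ` U"
proof -
  obtain r where r: "0 < r" "hball (\<psi> p) r \<inter> Hhalf \<subseteq> \<psi> ` U" using lchart_ball[OF U p] by metis
  have pH: "\<psi> p \<in> Hyp" "0 \<le> lor (\<psi> p) wn" using lchart_Hhalf[OF U p] by (simp_all add: Hhalf_def)
  obtain z where z: "z \<in> hball (\<psi> p) r" "lor z wn \<noteq> 0" by (rule off_hyperplane[OF pH(1) r(1) wn0])
  define y where "y = fold z"
  have zH: "z \<in> Hyp" using z(1) by (simp add: mem_hball)
  have y: "y \<in> Hyp" "0 < lor y wn" using z(2) zH by (simp_all add: y_def fold_Hyp lor_fold_wn)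
  have "hdist (\<psi> p) y < r" using fold_hdist[OF pH(1) zH] fold_id[OF lchart_Hhalf[OF U p]] z(1) by (simp add: y_def mem_hball)
  then obtain d where d: "0 < d" "hball y d \<subseteq> hball (\<psi> p) r" using hball_sub_ex[of y "\<psi> p" r] y pH by (auto simp: mem_hball)
  obtain e where e: "0 < e" "\<And>x. x \<in> hball y e ==> 0 < lor x wn" using hball_sign[OF y] by blast
  have "hball y (min d e) \<subseteq> \<psi> ` U"
  proof
    fix x assume x: "x \<in> hball y (min d e)"
    then have "x \<in> hball y e" "x \<in> hball y d" by (auto simp: mem_hball)
    then have "x \<in> hball (\<psi> p) r \<inter> Hhalf" using subsetD[OF d(2), of x] e(2)[of x] by (simp add: Hhalf_def mem_hball)
    then show "x \<in> \<psi> ` U" using r(2) by blast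
  qed
  then show ?thesis using that[OF y(1), of "min d e"] d e by simp
qed

text \<open>The open set \<open>V\<close> makes the chart image of \<open>S\<close> contain a full
  ball, so that \<open>lor_preserving_extends\<close> applies to \<open>g\<close> read in the chart.
  It serves both for changes of charts and for the coordinates of a cusp, where \<open>S\<close>
  need not be open.\<close>

lemma lchart_extends:
  assumes U: "lchart U \<psi>" and V: "openin (top_of_set M) V" "V \<noteq> {}" "V \<subseteq> S" "S \<subseteq> U"
    and g: "\<And>q. q \<in> S ==> g q \<in> Hyp" "\<And>q q'. q \<in> S ==> q' \<in> S ==> hdist (g q) (g q') = dist q q'"
  obtains T where "isoH T" "\<And>q. q \<in> S ==> g q = T (\<psi> q)"
proof -
  have "lchart V \<psi>" using lchart_restrict[OF U V(1)] V(3,4) by blast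
  then obtain y e where y: "y \<in> Hyp" "0 < e" "hball y e \<subseteq> \<psi> ` V" using lchart_interior_ball V(2) by blast
  define k where "k = inv_into S \<psi>"
  have k: "k (\<psi> q) = q" if "q \<in> S" for q
    unfolding k_def by (rule inv_into_f_f[OF _ that]) (use lchart_inj[OF U] V(4) in \<open>auto simp: inj_on_def\<close>)
  have yS: "hball y e \<subseteq> \<psi> ` S" using y(3) V(3) by blast
  obtain T where "isoH T" "\<And>z. z \<in> \<psi> ` S ==> g (k z) = T z"
  proof (rule lor_preserving_extends[OF y(1,2), where S = "\<psi> ` S" and f = "\<lambda>z. g (k z)"])
    show "z \<in> \<psi> ` S" if "z \<in> Hyp" "hdist y z < e" for z using yS that by (auto simp: mem_hball)
    show "lor (g (k z)) (g (k z')) = lor z z'" if z: "z \<in> \<psi> ` S" "z' \<in> \<psi> ` S" for z z'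
    proof -
      obtain q q' where q: "q \<in> S" "z = \<psi> q" "q' \<in> S" "z' = \<psi> q'" using z by blast
      then show ?thesis using lchart_lor[OF U, of q q'] subsetD[OF V(4)] g(2)[of q q'] cosh_hdist[OF g(1)[OF q(1)] g(1)[OF q(3)]] by (simp add: k)
    qed
    show "g (k y) \<in> Hyp" using yS y(1,2) center_hball g(1) k by (metis imageE subsetD)
  qed blast
  then show ?thesis using that k by (metis imageI)
qed

lemma lchart_transition:
  assumes U: "lchart U \<psi>" and U': "lchart U' \<psi>'" and p: "p \<in> U" "p \<in> U'"
  obtains T where "isoH T" "\<And>q. q \<in> U ==> q \<in> U' ==> \<psi>' q = T (\<psi> q)"
proof -
  have "openin (top_of_set M) (U \<inter> U')" using U U' unfolding lchart_def by blast
  then show ?thesis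
    using lchart_extends[OF U, of "U \<inter> U'" "U \<inter> U'" \<psi>'] p lchart_Hyp[OF U'] lchart_dist[OF U'] that by (metis IntD1 IntD2 IntI emptyE order_refl inf_le1)
qed

text \<open>Were the image of \<open>p\<close> interior, a geodesic from \<open>p\<close> across the
  wall would be mapped into the half-space and hence come from the domain, which lies on one side.
  If then \<open>T wn\<close> differed from \<open>wn\<close>, moving from the wall point along
  \<open>wn - w1\<close> would give a point inside the half-space that \<open>T\<close> sends
  outside.\<close>

lemma transition_wall:
  assumes U: "lchart U \<psi>" and U': "lchart U' \<psi>'" and p: "p \<in> U" "p \<in> U'"
    and T: "isoH T" "\<And>q. q \<in> U ==> q \<in> U' ==> \<psi>' q = T (\<psi> q)" and 0: "lor (\<psi> p) wn = 0"
  shows "lor (\<psi>' p) wn = 0" "T wn = wn"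
proof -
  have o: "openin (top_of_set M) (U \<inter> U')" using U U' unfolding lchart_def by blast
  have V: "lchart (U \<inter> U') \<psi>" "lchart (U \<inter> U') \<psi>'" using lchart_restrict[OF U o] lchart_restrict[OF U' o] by blast+
  define y0 where "y0 = \<psi> p"
  have y0: "y0 \<in> Hyp" "lor y0 wn = 0" "lor wn y0 = 0" using lchart_Hyp[OF U p(1)] 0 by (simp_all add: y0_def lor_commute)
  have Ty0: "\<psi>' p = T y0" using T(2) p by (simp add: y0_def)
  obtain r where r: "0 < r" "hball y0 r \<inter> Hhalf \<subseteq> \<psi> ` (U \<inter> U')"
    using lchart_ball[OF V(1)] p by (metis IntI y0_def)
  show c: "lor (\<psi>' p) wn = 0"
  proof (rule ccontr)
    assume "lor (\<psi>' p) wn \<noteq> 0"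
    then have pos: "0 < lor (\<psi>' p) wn" using lchart_Hhalf[OF U' p(2)] by (simp add: Hhalf_def)
    have pH: "\<psi>' p \<in> Hyp" by (rule lchart_Hyp[OF U' p(2)])
    obtain e where e: "0 < e" "\<And>x. x \<in> hball (\<psi>' p) e ==> 0 < lor x wn" using hball_sign[OF pH pos] by blast
    obtain r' where r': "0 < r'" "hball (\<psi>' p) r' \<inter> Hhalf \<subseteq> \<psi>' ` (U \<inter> U')"
      using lchart_ball[OF V(2)] p by (metis IntI)
    define t where "t = min e r' / 2"
    have t: "0 < t" "t < e" "t < r'" using e(1) r'(1) by (auto simp: t_def)
    define y where "y = geo y0 wn (- t)"
    have y: "y \<in> Hyp" "hdist y0 y = t" using geo_Hyp[OF y0(1,3) wn] hdist_geo[OF y0(1,3) wn, of 0 "- t"] t by (simp_all add: y_def)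
    then have "T y \<in> hball (\<psi>' p) e" "T y \<in> hball (\<psi>' p) r'" using T(1) t by (simp_all add: Ty0 mem_hball)
    moreover from this(1) have "T y \<in> Hhalf" using e(2)[of "T y"] y T(1) by (simp add: Hhalf_def)
    ultimately obtain q where q: "q \<in> U \<inter> U'" "T y = \<psi>' q" using r'(2) by blast
    then have "T y = T (\<psi> q)" using T(2) by simp
    then have "y = \<psi> q" using isoH_bij[OF T(1)] by (simp add: bij_def inj_eq)
    then have "0 \<le> lor y wn" using lchart_Hhalf[OF U] q(1) by (auto simp: Hhalf_def)
    then show False using t wn y0 by (simp add: y_def geo_def lor_simps)
  qed
  define w1 where "w1 = invf T wn"
  have w1: "lor (T z) wn = lor z w1" for z by (simp add: w1_def isoH_lor_inv[OF T(1)])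
  have y0w1: "lor y0 w1 = 0" using c w1[of y0] Ty0 by simp
  have half: "0 \<le> lor z w1" if "z \<in> Hhalf" "hdist y0 z < r" for z
  proof -
    have "z \<in> hball y0 r \<inter> Hhalf" using that by (simp add: mem_hball Hhalf_def)
    then obtain q where "q \<in> U \<inter> U'" "z = \<psi> q" using r(2) by blast
    then show ?thesis using T(2)[of q] lchart_Hhalf[OF U', of q] w1[of z] by (simp add: Hhalf_def)
  qed
  show "T wn = wn"
  proof (rule ccontr)
    assume n: "T wn \<noteq> wn"
    define d where "d = wn - w1"
    define k where "k = sqrt (lor d d)"
    define e where "e = (1 / k) *\<^sub>R d"
    define z where "z = geo y0 e (r / 2)"
    have d: "d \<noteq> 0" "lor d y0 = 0"
      using n isoH_inv_apply(2)[OF T(1), of wn] y0 y0w1 by (auto simp: d_def w1_def lor_simps lor_commute)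
    have w1w1: "lor w1 w1 = 1" using isoH_lor[OF isoH_inv[OF T(1)], of wn wn] wn by (simp add: w1_def)
    have pos: "0 < lor d d" using perp_pos[OF _ _ d(2,1)] y0(1) by (simp add: Hyp_def)
    then have k: "0 < k" "lor d d = k * k" by (simp_all add: k_def)
    have e: "lor e y0 = 0" "lor e e = 1" using d(2) k by (simp_all add: e_def)
    have z: "z \<in> Hyp" "hdist y0 z < r" using geo_Hyp[OF y0(1) e] hdist_geo[OF y0(1) e, of 0 "r/2"] r(1) by (simp_all add: z_def)
    have dw: "lor d wn = lor d d / 2" "lor d w1 = - (lor d d / 2)" using w1w1 wn by (simp_all add: d_def lor_simps lor_commute[of wn w1] field_simps)
    have "lor z wn = sinh (r/2) / k * (lor d d / 2)" "lor z w1 = - (sinh (r/2) / k * (lor d d / 2))"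
      using y0 y0w1 by (simp_all add: z_def geo_def e_def lor_simps dw)
    moreover have "0 < sinh (r/2) / k * (lor d d / 2)" using pos k(1) r(1) by simp
    ultimately show False using half[of z] z by (simp add: Hhalf_def)
  qed
qed

definition bd :: "'m set" where
  "bd = {p \<in> M. \<exists>U \<psi>. lchart U \<psi> \<and> p \<in> U \<and> lor (\<psi> p) wn = 0}"

lemma bd_iff: assumes "lchart U \<psi>" "p \<in> U" shows "p \<in> bd \<longleftrightarrow> lor (\<psi> p) wn = 0"
proof
  assume "p \<in> bd"
  then obtain U' \<psi>' where U': "lchart U' \<psi>'" "p \<in> U'" "lor (\<psi>' p) wn = 0" by (auto simp: bd_def)
  obtain T where "isoH T" "\<And>q. q \<in> U' ==> q \<in> U ==> \<psi> q = T (\<psi>' q)"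
    using lchart_transition[OF U'(1) assms(1) U'(2) assms(2)] by blast
  then show "lor (\<psi> p) wn = 0" using transition_wall(1)[OF U'(1) assms(1) U'(2) assms(2) _ _ U'(3)] by blast
next
  assume "lor (\<psi> p) wn = 0"
  then show "p \<in> bd" using assms lchart_sub[OF assms(1)] unfolding bd_def by blast
qed

text \<open>A germ of a folding map: in some chart at the image, \<open>F\<close> is an isometry
  followed by \<open>fold\<close>. Over the boundary such a map identifies mirror images, which lets
  it be continued past the boundary as if there were none.\<close>

definition foldat :: "('v => 'm) => 'v => bool" where
  "foldat F y \<longleftrightarrow> (\<exists>U \<psi> B e. lchart U \<psi> \<and> isoH B \<and> 0 < e \<and> (\<forall>z\<in>hball y e. F z \<in> U \<and> \<psi> (F z) = fold (B z)))"

lemma foldat_M: "y \<in> Hyp ==> foldat F y ==> F y \<in> M"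
  unfolding foldat_def using lchart_sub center_hball by blast

lemma foldat_lipschitz:
  assumes "foldat F y" "y \<in> Hyp"
  obtains e where "0 < e" "\<And>z z'. z \<in> hball y e ==> z' \<in> hball y e ==> dist (F z) (F z') \<le> hdist z z'"
proof -
  obtain U \<psi> B e where F: "lchart U \<psi>" "isoH B" "0 < e" "\<And>z. z \<in> hball y e ==> F z \<in> U \<and> \<psi> (F z) = fold (B z)"
    using assms unfolding foldat_def by blast
  have "dist (F z) (F z') \<le> hdist z z'" if z: "z \<in> hball y e" "z' \<in> hball y e" for z z'
  proof -
    have "dist (F z) (F z') = hdist (fold (B z)) (fold (B z'))" using F(4)[OF z(1)] F(4)[OF z(2)] lchart_dist[OF F(1)] by metis
    also have "\<dots> \<le> hdist z z'" using fold_hdist[of "B z" "B z'"] F(2) z by (simp add: mem_hball)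
    finally show ?thesis .
  qed
  then show ?thesis using that F(3) by blast
qed

text \<open>If the point lies over the boundary, the change of charts fixes the wall normal and
  commutes with folding. Otherwise \<open>fold\<close> is one isometry nearby and is absorbed into
  \<open>B\<close>; the result already lies in the half-space, so folding it again changes
  nothing.\<close>

lemma foldat_change:
  assumes F: "foldat F y" "y \<in> Hyp" and U': "lchart U' \<psi>'" "F y \<in> U'"
  obtains B e where "isoH B" "0 < e" "\<And>z. z \<in> hball y e ==> F z \<in> U' \<and> \<psi>' (F z) = fold (B z)"
proof -
  obtain U \<psi> B e where U: "lchart U \<psi>" "isoH B" "0 < e" "\<And>z. z \<in> hball y e ==> F z \<in> U \<and> \<psi> (F z) = fold (B z)"
    using F(1) unfolding foldat_def by blast
  have yU: "F y \<in> U" "\<psi> (F y) = fold (B y)" using U(4)[of y] F(2) U(3) by simp_all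
  obtain T where T: "isoH T" "\<And>q. q \<in> U ==> q \<in> U' ==> \<psi>' q = T (\<psi> q)"
    using lchart_transition[OF U(1) U'(1) yU(1) U'(2)] by blast
  obtain r where r: "0 < r" "\<And>q. q \<in> M ==> dist (F y) q < r ==> q \<in> U'" using lchart_ball[OF U'] by metis
  obtain e1 where e1: "0 < e1" "\<And>z z'. z \<in> hball y e1 ==> z' \<in> hball y e1 ==> dist (F z) (F z') \<le> hdist z z'"
    using foldat_lipschitz[OF F] by blast
  have BH: "B y \<in> Hyp" using U(2) F(2) by simp
  obtain B' d where B': "isoH B'" "0 < d" "\<And>z. z \<in> Hyp ==> hdist y z < d ==> z \<in> hball y e ==> F z \<in> U' ==> \<psi>' (F z) = fold (B' z)"
  proof (cases "lor (B y) wn = 0")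
    case True
    then have w: "T wn = wn" using transition_wall(2)[OF U(1) U'(1) yU(1) U'(2) T] yU(2) by (simp add: lor_fold_wn)
    show ?thesis
      by (rule that[of "T \<circ> B" e]) (use T U w isoH_comp in \<open>simp_all add: fold_fixes\<close>)
  next
    case False
    obtain C d where C: "isoH C" "0 < d" "\<And>x. x \<in> hball (B y) d ==> fold x = C x"
      "\<And>x. fold (C x) = fold x" "C = id \<or> C = reflH wn" using fold_local[OF BH False] by blast
    show ?thesis
    proof (rule that[of "T \<circ> C \<circ> B" d])
      show "isoH (T \<circ> C \<circ> B)" by (rule isoH_comp[OF isoH_comp[OF T(1) C(1)] U(2)])
      show "0 < d" by (rule C(2))
      fix z assume z: "z \<in> Hyp" "hdist y z < d" "z \<in> hball y e" "F z \<in> U'"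
      have "fold (B z) = C (B z)" using C(3)[of "B z"] z U(2) by (simp add: mem_hball)
      then have "\<psi>' (F z) = T (C (B z))" using T(2) U(4)[OF z(3)] z(4) by simp
      moreover have "\<psi>' (F z) \<in> Hhalf" by (rule lchart_Hhalf[OF U'(1) z(4)])
      ultimately show "\<psi>' (F z) = fold ((T \<circ> C \<circ> B) z)" using fold_id by simp
    qed
  qed
  show ?thesis
  proof (rule that[OF B'(1), of "Min {d, e, e1, r}"])
    show "0 < Min {d, e, e1, r}" using B'(2) U(3) e1(1) r(1) by simp
    fix z assume z: "z \<in> hball y (Min {d, e, e1, r})"
    then have z': "z \<in> Hyp" "hdist y z < d" "z \<in> hball y e" "z \<in> hball y e1" "hdist y z < r" by (simp_all add: mem_hball)
    have "dist (F y) (F z) < r" using e1(2)[of y z] e1(1) z' F(2) by simp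
    moreover have "F z \<in> M" using U(4)[OF z'(3)] lchart_sub[OF U(1)] by blast
    ultimately have "F z \<in> U'" using r(2) by blast
    then show "F z \<in> U' \<and> \<psi>' (F z) = fold (B' z)" using B'(3) z' by simp
  qed
qed

lemma foldat_cong:
  assumes F: "foldat F y" "y \<in> Hyp" and e: "0 < e" "\<And>z. z \<in> hball y e ==> G z = F z" shows "foldat G y"
proof -
  obtain U \<psi> B d where U: "lchart U \<psi>" "isoH B" "0 < d" "\<And>z. z \<in> hball y d ==> F z \<in> U \<and> \<psi> (F z) = fold (B z)"
    using F(1) unfolding foldat_def by blast
  show ?thesis unfolding foldat_def
    by (rule exI[of _ U], rule exI[of _ \<psi>], rule exI[of _ B], rule exI[of _ "min d e"])
       (use U e in \<open>auto simp: mem_hball\<close>)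
qed

lemma foldat_comp:
  assumes F: "foldat F (A y)" "y \<in> Hyp" and A: "isoH A" shows "foldat (F \<circ> A) y"
proof -
  obtain U \<psi> B d where U: "lchart U \<psi>" "isoH B" "0 < d" "\<And>z. z \<in> hball (A y) d ==> F z \<in> U \<and> \<psi> (F z) = fold (B z)"
    using F(1) unfolding foldat_def by blast
  have "(F \<circ> A) z \<in> U \<and> \<psi> ((F \<circ> A) z) = fold ((B \<circ> A) z)" if "z \<in> hball y d" for z
    using U(4)[of "A z"] that A by (simp add: mem_hball)
  then show ?thesis unfolding foldat_def using U isoH_comp[OF U(2) A] by blast
qed

text \<open>Both germs are read in one chart at the common value; there they are
  \<open>fold \<circ> B\<close> and \<open>fold \<circ> B'\<close>, and these agree everywhere once
  they agree on some ball.\<close>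

lemma foldat_unique:
  assumes F: "foldat F y" "foldat F' y" and y: "y \<in> Hyp" and eq: "F y = F' y"
    and O: "\<And>e. 0 < e ==> \<exists>z d. z \<in> hball y e \<and> 0 < d \<and> (\<forall>x\<in>hball z d. F x = F' x)"
  shows "\<exists>e>0. \<forall>z\<in>hball y e. F z = F' z"
proof -
  obtain U \<psi> where U: "lchart U \<psi>" "F y \<in> U" using F(1) y unfolding foldat_def by (metis center_hball)
  obtain B e where B: "isoH B" "0 < e" "\<And>z. z \<in> hball y e ==> F z \<in> U \<and> \<psi> (F z) = fold (B z)"
    using foldat_change[OF F(1) y U] by blast
  obtain B' e' where B': "isoH B'" "0 < e'" "\<And>z. z \<in> hball y e' ==> F' z \<in> U \<and> \<psi> (F' z) = fold (B' z)"
    using foldat_change[OF F(2) y U(1)] U(2) eq by metis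
  define r where "r = min e e'"
  have r: "0 < r" "hball y r \<subseteq> hball y e" "hball y r \<subseteq> hball y e'" using B(2) B'(2) by (simp_all add: r_def hball_mono)
  obtain z d where z: "z \<in> hball y r" "0 < d" "\<forall>x\<in>hball z d. F x = F' x" using O[OF r(1)] by blast
  obtain d' where d': "0 < d'" "hball z d' \<subseteq> hball y r" by (rule hball_sub_ex[OF z(1) y])
  have zH: "z \<in> Hyp" using z(1) by (simp add: mem_hball)
  have "fold (B x) = fold (B' x)" if "x \<in> hball z (min d d')" for x
  proof -
    have "x \<in> hball z d" "x \<in> hball y r" using that d' hball_mono[of "min d d'" d z] hball_mono[of "min d d'" d' z] by auto
    then have "F x = F' x" "\<psi> (F x) = fold (B x)" "\<psi> (F' x) = fold (B' x)"
      using z(3) B(3)[of x] B'(3)[of x] r by blast+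
    then show ?thesis by simp
  qed
  then have "fold (B x) = fold (B' x)" for x
    using fold_eq_cases(2)[OF B(1) B'(1) zH, of "min d d'"] z(2) d'(1) by simp
  then have "F x = F' x" if "x \<in> hball y r" for x
    using B(3)[of x] B'(3)[of x] subsetD[OF r(2) that] subsetD[OF r(3) that] lchart_inj[OF U(1), of "F x" "F' x"] by simp
  then show ?thesis using r(1) by blast
qed

text \<open>The identity theorem for folding maps. For the closedness step, the values at a limit
  point agree since both maps are locally Lipschitz, and then \<open>foldat_unique\<close>
  applies.\<close>

lemma foldat_global_unique:
  assumes D: "connected D" "D \<subseteq> Hyp" and F: "\<And>y. y \<in> D ==> foldat F y" "\<And>y. y \<in> D ==> foldat F' y"
    and z0: "z0 \<in> D" "0 < e0" "\<And>z. z \<in> hball z0 e0 ==> F z = F' z" and y: "y \<in> D"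
  shows "\<exists>e>0. \<forall>z\<in>hball y e. F z = F' z"
proof (rule hball_continuation[OF D z0(1) y])
  show "\<exists>e>0. \<forall>z\<in>hball z0 e. F z = F' z" using z0 by blast
next
  fix x assume x: "x \<in> D" and "\<exists>e>0. \<forall>z\<in>hball x e. F z = F' z"
  then obtain e where e: "0 < e" "\<forall>z\<in>hball x e. F z = F' z" by blast
  then have "\<exists>d>0. \<forall>w\<in>hball z d. F w = F' w" if "z \<in> hball x e" for z
    using hball_sub_ex[OF that] D(2) x by (metis subsetD)
  then show "\<exists>e>0. \<forall>z\<in>D \<inter> hball x e. \<exists>e>0. \<forall>z\<in>hball z e. F z = F' z" using e(1) by blast
next
  fix y assume y: "y \<in> D" and near: "\<And>e. 0 < e ==> \<exists>z\<in>D \<inter> hball y e. \<exists>e>0. \<forall>z\<in>hball z e. F z = F' z"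
  have yH: "y \<in> Hyp" using y D by blast
  obtain e1 where e1: "0 < e1" "\<And>z z'. z \<in> hball y e1 ==> z' \<in> hball y e1 ==> dist (F z) (F z') \<le> hdist z z'"
    using foldat_lipschitz[OF F(1) yH] y by blast
  obtain e2 where e2: "0 < e2" "\<And>z z'. z \<in> hball y e2 ==> z' \<in> hball y e2 ==> dist (F' z) (F' z') \<le> hdist z z'"
    using foldat_lipschitz[OF F(2) yH] y by blast
  have "F y = F' y"
  proof (rule ccontr)
    assume "F y \<noteq> F' y"
    define e where "e = Min {e1, e2, dist (F y) (F' y) / 2}"
    have e: "0 < e" "e \<le> e1" "e \<le> e2" "e \<le> dist (F y) (F' y) / 2" using \<open>F y \<noteq> F' y\<close> e1(1) e2(1) by (auto simp: e_def)
    obtain z where z: "z \<in> hball y e" "F z = F' z" using near[OF e(1)] by (force simp: mem_hball)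
    then have "z \<in> hball y e1" "z \<in> hball y e2" using e by (auto simp: mem_hball)
    then have "dist (F y) (F z) \<le> hdist y z" "dist (F' y) (F' z) \<le> hdist y z"
      using e1(2)[of y z] e2(2)[of y z] e1(1) e2(1) yH by simp_all
    then show False using dist_triangle2[of "F y" "F' y" "F z"] z e(4) by (simp add: mem_hball)
  qed
  then show "\<exists>e>0. \<forall>z\<in>hball y e. F z = F' z"
    using foldat_unique[OF F(1) F(2) yH] y near by blast
qed

end

section \<open>Continuing a folding map over all of hyperbolic space\<close>

context charted
begin

definition chart_inv :: "'m set => ('m => 'v) => 'v => 'm" where
  "chart_inv U \<psi> w = (SOME q. q \<in> U \<and> \<psi> q = w)"

lemma chart_inv: "w \<in> \<psi> ` U ==> chart_inv U \<psi> w \<in> U \<and> \<psi> (chart_inv U \<psi> w) = w"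
  unfolding chart_inv_def by (rule someI_ex) blast

lemma chart_fold:
  assumes U: "lchart U \<psi>" and B: "isoH B" and w: "w \<in> Hyp" "hball w r \<inter> Hhalf \<subseteq> \<psi> ` U"
    and z: "z \<in> Hyp" "hdist w (fold (B z)) < r"
  shows "chart_inv U \<psi> (fold (B z)) \<in> U" "\<psi> (chart_inv U \<psi> (fold (B z))) = fold (B z)"
    "foldat (\<lambda>z. chart_inv U \<psi> (fold (B z))) z"
proof -
  have *: "chart_inv U \<psi> (fold (B x)) \<in> U \<and> \<psi> (chart_inv U \<psi> (fold (B x))) = fold (B x)"
    if "x \<in> Hyp" "hdist w (fold (B x)) < r" for x
  proof (rule chart_inv)
    have "fold (B x) \<in> hball w r \<inter> Hhalf" using that B fold_Hhalf[of "B x"] by (simp add: mem_hball fold_Hyp)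
    then show "fold (B x) \<in> \<psi> ` U" using w(2) by blast
  qed
  show "chart_inv U \<psi> (fold (B z)) \<in> U" "\<psi> (chart_inv U \<psi> (fold (B z))) = fold (B z)"
    using *[OF z] by auto
  define e where "e = r - hdist w (fold (B z))"
  have "hdist w (fold (B x)) < r" if x: "x \<in> hball z e" for x
  proof -
    have xH: "x \<in> Hyp" using x by (simp add: mem_hball)
    have "hdist w (fold (B x)) \<le> hdist w (fold (B z)) + hdist (fold (B z)) (fold (B x))"
      using B w z(1) xH by (intro hdist_triangle fold_Hyp) auto
    also have "\<dots> \<le> hdist w (fold (B z)) + hdist z x"
      using fold_hdist[of "B z" "B x"] B z(1) xH by simp
    finally show ?thesis using x by (simp add: e_def mem_hball)
  qed
  then have "\<forall>x\<in>hball z e. chart_inv U \<psi> (fold (B x)) \<in> U \<and> \<psi> (chart_inv U \<psi> (fold (B x))) = fold (B x)"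
    using * by (simp add: mem_hball)
  then show "foldat (\<lambda>z. chart_inv U \<psi> (fold (B z))) z"
    unfolding foldat_def using U B z(2) e_def by (metis diff_gt_0_iff_gt)
qed

text \<open>Folding maps do not increase distances locally; bisecting a geodesic segment, which
  stays in the convex set, adds these estimates up.\<close>

lemma foldat_nconvex_lipschitz:
  assumes D: "nconvex D" and F: "\<And>z. z \<in> D ==> foldat F z" and z: "z \<in> D" "z' \<in> D"
  shows "dist (F z) (F z') \<le> hdist z z'"
proof (cases "z = z'")
  case True
  then show ?thesis using z nconvex_Hyp_sub[OF D] by auto
next
  case False
  have zH: "z \<in> Hyp" "z' \<in> Hyp" using z nconvex_Hyp_sub[OF D] by auto
  obtain e where e: "lor e z = 0" "lor e e = 1" "z' = geo z e (hdist z z')"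
    using geo_exists[OF zH False] by blast
  define d where "d = hdist z z'"
  have d: "0 \<le> d" using hdist_nonneg[OF zH] by (simp add: d_def)
  have D': "geo z e t \<in> D" if "0 \<le> t" "t \<le> d" for t
    using geo_in_nconvex[OF D z(1) e(1,2), of d t] that z(2) e(3) by (simp add: d_def)
  define Q where "Q a b \<longleftrightarrow> (0 \<le> a \<and> a \<le> b \<and> b \<le> d --> dist (F (geo z e a)) (F (geo z e b)) \<le> b - a)" for a b
  have "Q 0 d"
  proof (rule Bolzano[OF d])
    show "Q a c" if "Q a b" "Q b c" "a \<le> b" "b \<le> c" for a b c
      using that dist_triangle[of "F (geo z e a)" "F (geo z e c)" "F (geo z e b)"] unfolding Q_def by linarith
    fix x assume x: "0 \<le> x" "x \<le> d"
    have xH: "geo z e x \<in> Hyp" using geo_Hyp[OF zH(1) e(1,2)] .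
    obtain r where r: "0 < r" "\<And>u v. u \<in> hball (geo z e x) r ==> v \<in> hball (geo z e x) r ==> dist (F u) (F v) \<le> hdist u v"
      using foldat_lipschitz[OF F[OF D'[OF x]] xH] by blast
    show "\<exists>\<delta>>0. \<forall>a b. a \<le> x \<and> x \<le> b \<and> b - a < \<delta> --> Q a b"
    proof (intro exI conjI allI impI)
      fix a b assume ab: "a \<le> x \<and> x \<le> b \<and> b - a < r"
      have "geo z e a \<in> hball (geo z e x) r" "geo z e b \<in> hball (geo z e x) r"
        using hdist_geo[OF zH(1) e(1,2)] geo_Hyp[OF zH(1) e(1,2)] ab by (auto simp: mem_hball)
      then have "dist (F (geo z e a)) (F (geo z e b)) \<le> hdist (geo z e a) (geo z e b)" using r by blast
      then show "Q a b" using ab unfolding hdist_geo[OF zH(1) e(1,2)] Q_def by linarith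
    qed (use r in auto)
  qed
  then show ?thesis using d e(3) by (simp add: Q_def d_def)
qed

end

locale hypmfd = charted wn M for wn :: "'v::lorentz_space" and M :: "'m::metric_space set" +
  assumes nonempty: "M \<noteq> {}" and conn: "connected M" and compl: "complete M"
    and atlas: "\<And>p. p \<in> M ==> \<exists>U \<psi>. lchart U \<psi> \<and> p \<in> U"
begin

lemma local_fold_exists:
  assumes p: "p \<in> M" and y: "y \<in> Hyp"
  obtains G e where "0 < e" "G y = p" "\<And>z. z \<in> hball y e ==> foldat G z"
proof -
  obtain U \<psi> where U: "lchart U \<psi>" "p \<in> U" using atlas[OF p] by blast
  obtain r where r: "0 < r" "hball (\<psi> p) r \<inter> Hhalf \<subseteq> \<psi> ` U" by (rule lchart_ball[OF U])
  have pH: "\<psi> p \<in> Hyp" using lchart_Hyp[OF U] .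
  obtain B where B: "isoH B" "B y = \<psi> p" using isoH_transitive[OF y pH] by blast
  have f: "fold (\<psi> p) = \<psi> p" using fold_id lchart_Hhalf[OF U] by blast
  have near: "hdist (\<psi> p) (fold (B z)) < r" if z: "z \<in> hball y r" for z
    using fold_hdist[of "B y" "B z"] isoH_hdist[OF B(1), of y z] f B(2) pH isoH_Hyp[OF B(1), of z] z by (simp add: mem_hball)
  have "chart_inv U \<psi> (fold (B y)) = p"
    using chart_fold(1,2)[OF U(1) B(1) pH r(2) y near] r(1) y B(2) f U lchart_inj[OF U(1)] by simp
  moreover have "foldat (\<lambda>z. chart_inv U \<psi> (fold (B z))) z" if "z \<in> hball y r" for z
    using chart_fold(3)[OF U(1) B(1) pH r(2) _ near[OF that]] that by (simp add: mem_hball)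
  ultimately show ?thesis using that[of r "\<lambda>z. chart_inv U \<psi> (fold (B z))"] r(1) by blast
qed

text \<open>Along the radius to \<open>z\<close> the map is 1-Lipschitz, so by completeness its
  values converge to some \<open>q\<close>. A chart at \<open>q\<close> has a definite size, and
  continuing within it from a point \<open>z1\<close> of the radius close to \<open>z\<close>
  reaches beyond \<open>z\<close>.\<close>

lemma fold_extend_boundary:
  assumes y: "y \<in> Hyp" and F: "\<And>z. z \<in> hball y R ==> foldat F z" and R: "0 < R"
    and z: "z \<in> Hyp" "hdist y z \<le> R"
  obtains e G where "0 < e" "\<And>x. x \<in> hball z e ==> foldat G x" "\<And>x. x \<in> hball z e ==> x \<in> hball y R ==> G x = F x"
proof (cases "hdist y z < R")
  case True
  then obtain d where "0 < d" "hball z d \<subseteq> hball y R" using hball_sub_ex[of z y R] z y by (auto simp: mem_hball)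
  then show ?thesis using that[of d F] F by blast
next
  case False
  then have zR: "hdist y z = R" using z by simp
  then have "y \<noteq> z" using R y by auto
  then obtain u where u: "lor u y = 0" "lor u u = 1" "z = geo y u R"
    using geo_exists[OF y z(1)] zR by metis
  have c: "geo y u t \<in> Hyp" "hdist (geo y u s) (geo y u t) = \<bar>s - t\<bar>" for s t
    using geo_Hyp[OF y u(1,2)] hdist_geo[OF y u(1,2)] by auto
  have cR: "geo y u t \<in> hball y R" if "0 \<le> t" "t < R" for t
    using c(1)[of t] c(2)[of 0 t] that by (simp add: mem_hball)
  define g where "g n = F (geo y u (R - R / real (n + 1)))" for n
  have tn: "0 \<le> R - R / real (n + 1)" "R - R / real (n + 1) < R" for n
    using R by (auto simp: field_simps)
  have lip: "dist (F a) (F b) \<le> hdist a b" if "a \<in> hball y R" "b \<in> hball y R" for a b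
    using foldat_nconvex_lipschitz[OF nconvex_hball[OF y] F that] by blast
  have gd: "dist (g m) (g n) \<le> R / real (m + 1)" if "m \<le> n" for m n
  proof -
    have "dist (g m) (g n) \<le> \<bar>R / real (n + 1) - R / real (m + 1)\<bar>"
      using lip[OF cR[OF tn[of m]] cR[OF tn[of n]]] unfolding g_def c(2) by simp
    moreover have "R / real (n + 1) \<le> R / real (m + 1)" "0 \<le> R / real (n + 1)" using R that by (auto intro: divide_left_mono)
    ultimately show ?thesis by linarith
  qed
  have lim0: "(\<lambda>n. R / real (n + 1)) \<longlonglongrightarrow> 0"
    using LIMSEQ_Suc[OF lim_const_over_n[of R]] by simp
  have small: "\<exists>n. R / real (n + 1) < e" if "0 < e" for e
    using order_tendstoD(2)[OF lim0 that] by (auto simp: eventually_sequentially)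
  have "Cauchy g"
  proof (rule CauchyI')
    fix e :: real assume "0 < e"
    then obtain N where N: "R / real (N + 1) < e / 2" using small[of "e / 2"] by auto
    have "dist (g m) (g n) < e" if "N \<le> m" "m < n" for m n
      using gd[of N m] gd[of N n] that N dist_triangle3[of "g m" "g n" "g N"] by linarith
    then show "\<exists>M. \<forall>m\<ge>M. \<forall>n>m. dist (g m) (g n) < e" by blast
  qed
  moreover have "g n \<in> M" for n
    using foldat_M[OF c(1) F[OF cR[OF tn[of n]]]] by (simp add: g_def)
  ultimately obtain q where q: "q \<in> M" "g \<longlonglongrightarrow> q" using compl by (metis completeE)
  have gq: "dist (g n) q \<le> R / real (n + 1)" for n
    by (rule LIMSEQ_le_const2[OF tendsto_dist[OF tendsto_const q(2)]]) (use gd[of n] in blast)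
  obtain U \<psi> where U: "lchart U \<psi>" "q \<in> U" using atlas[OF q(1)] by blast
  obtain r where r: "0 < r" "hball (\<psi> q) r \<inter> Hhalf \<subseteq> \<psi> ` U" "\<And>x. x \<in> M ==> dist q x < r ==> x \<in> U"
    using lchart_ball[OF U] by blast
  \<comment> \<open>The quarter leaves room twice: \<open>F z1\<close> is within
    \<open>r / 4\<close> of \<open>q\<close>, so the ball of radius \<open>r / 2\<close> about
    \<open>z1\<close> still folds into the chart, and this ball contains the ball of radius
    \<open>r / 4\<close> about \<open>z\<close>.\<close>
  obtain n where n: "R / real (n + 1) < r / 4" using small[of "r / 4"] r(1) by auto
  define z1 where "z1 = geo y u (R - R / real (n + 1))"
  have z1: "z1 \<in> hball y R" "z1 \<in> Hyp" "F z1 = g n" "hdist z1 z \<le> R / real (n + 1)"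
    using cR[OF tn] c R by (auto simp: z1_def g_def u(3))
  have F1: "F z1 \<in> M" "dist (F z1) q < r / 4" using foldat_M[OF z1(2) F[OF z1(1)]] order_le_less_trans[OF gq n] z1(3) by simp_all
  then have F1U: "F z1 \<in> U" using r(1) r(3)[of "F z1"] by (simp add: dist_commute)
  obtain B e1 where B: "isoH B" "0 < e1" "\<And>x. x \<in> hball z1 e1 ==> F x \<in> U \<and> \<psi> (F x) = fold (B x)"
    using foldat_change[OF F[OF z1(1)] z1(2) U(1) F1U] by blast
  define G where "G = (\<lambda>x. chart_inv U \<psi> (fold (B x)))"
  have qH: "\<psi> q \<in> Hyp" using lchart_Hyp[OF U] .
  have near: "hdist (\<psi> q) (fold (B x)) < r" if x: "x \<in> hball z1 (r / 2)" for x
  proof -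
    have xH: "x \<in> Hyp" using x by (simp add: mem_hball)
    have z1f: "\<psi> (F z1) = fold (B z1)" using B(3)[of z1] B(2) z1(2) by simp
    have "hdist (\<psi> q) (fold (B x)) \<le> hdist (\<psi> q) (fold (B z1)) + hdist (fold (B z1)) (fold (B x))"
      using qH B z1 xH by (intro hdist_triangle fold_Hyp) auto
    also have "hdist (\<psi> q) (fold (B z1)) = dist q (F z1)" using lchart_dist[OF U(1) U(2) F1U] z1f by simp
    also have "hdist (fold (B z1)) (fold (B x)) \<le> hdist z1 x"
      using fold_hdist[of "B z1" "B x"] B z1 xH by simp
    finally show ?thesis using F1(2) x r(1) by (simp add: mem_hball dist_commute)
  qed
  have G: "foldat G x" "G x \<in> U" "\<psi> (G x) = fold (B x)" if "x \<in> hball z1 (r / 2)" for x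
    using chart_fold[OF U(1) B(1) qH r(2) _ near[OF that]] that by (auto simp: G_def mem_hball)
  have GF: "G x = F x" if x: "x \<in> hball z1 (r / 2)" "x \<in> hball y R" for x
  proof -
    have xH: "x \<in> Hyp" using x by (simp add: mem_hball)
    let ?D = "hball z1 (r / 2) \<inter> hball y R"
    have "nconvex ?D" using nconvex_Int nconvex_hball y z1 by blast
    then have D: "connected ?D" "?D \<subseteq> Hyp" using nconvex_connected nconvex_Hyp_sub by blast+
    have near1: "G v = F v" if v: "v \<in> hball z1 (min (r / 2) e1)" for v
    proof -
      have "v \<in> hball z1 (r / 2)" "v \<in> hball z1 e1" using v by (simp_all add: mem_hball)
      then show ?thesis using G(2,3)[of v] B(3)[of v] lchart_inj[OF U(1), of "G v" "F v"] by simp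
    qed
    have "\<exists>e>0. \<forall>v\<in>hball x e. G v = F v"
      by (rule foldat_global_unique[OF D, where ?z0.0 = z1 and ?e0.0 = "min (r / 2) e1"])
         (use G(1) F x z1 r(1) B(2) near1 in auto)
    then show ?thesis using xH by auto
  qed
  have sub: "hball z (r / 4) \<subseteq> hball z1 (r / 2)"
    using hball_sub[OF z1(2) z(1), of "r / 4" "r / 2"] z1(4) n by simp
  show ?thesis using that[of "r / 4" G] r(1) G(1) GF sub by auto
qed

lemma hball_near:
  assumes y: "y \<in> Hyp" and x: "x \<in> Hyp" "hdist y x < R + \<delta>" and "0 < R" "0 < \<delta>"
  obtains c where "c \<in> hball y R" "hdist c x < \<delta>"
proof (cases "hdist y x < R")
  case True then show ?thesis using that[of x] x \<open>0 < \<delta>\<close> by (simp add: mem_hball)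
next
  case False
  then have "y \<noteq> x" using y \<open>0 < R\<close> by auto
  then obtain u where u: "lor u y = 0" "lor u u = 1" "x = geo y u (hdist y x)"
    using geo_exists[OF y x(1)] by metis
  define d where "d = hdist y x"
  define t where "t = (max (d - \<delta>) 0 + R) / 2"
  have t: "0 \<le> t" "t < R" "\<bar>t - d\<bar> < \<delta>"
    using assms False by (auto simp: t_def d_def max_def abs_if field_simps)
  have "geo y u t \<in> Hyp" "hdist y (geo y u t) = t" "hdist (geo y u t) x = \<bar>t - d\<bar>"
    using geo_Hyp[OF y u(1,2)] hdist_geo[OF y u(1,2), of 0 t] hdist_geo[OF y u(1,2), of t d] u(3) t(1) by (auto simp: d_def)
  then show ?thesis using that[of "geo y u t"] t by (simp add: mem_hball)
qed

lemma foldat_glue: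
  assumes D: "\<And>i. i \<in> I ==> x0 i \<in> Hyp"
    and G: "\<And>i x. i \<in> I ==> x \<in> hball (x0 i) (r i) ==> foldat (G i) x"
    and agree: "\<And>i j x. i \<in> I ==> j \<in> I ==> x \<in> hball (x0 i) (r i) ==> x \<in> hball (x0 j) (r j) ==> G i x = G j x"
  obtains F where "\<And>i x. i \<in> I ==> x \<in> hball (x0 i) (r i) ==> F x = G i x"
    "\<And>i x. i \<in> I ==> x \<in> hball (x0 i) (r i) ==> foldat F x"
proof -
  define F where "F x = G (SOME i. i \<in> I \<and> x \<in> hball (x0 i) (r i)) x" for x
  have F: "F x = G i x" if "i \<in> I" "x \<in> hball (x0 i) (r i)" for i x
    unfolding F_def using someI[of "\<lambda>i. i \<in> I \<and> x \<in> hball (x0 i) (r i)" i] that agree by blast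
  have "foldat F x" if i: "i \<in> I" "x \<in> hball (x0 i) (r i)" for i x
  proof -
    obtain d where d: "0 < d" "hball x d \<subseteq> hball (x0 i) (r i)" using hball_sub_ex[OF i(2) D[OF i(1)]] by blast
    show ?thesis by (rule foldat_cong[OF G[OF i] _ d(1)]) (use F[OF i(1)] d(2) i(2) in \<open>auto simp: mem_hball[of x]\<close>)
  qed
  then show ?thesis using that[of F] F by blast
qed

text \<open>Compactness of the closed ball turns the local extensions into one of uniform width.
  Each extension exists on a ball of radius \<open>3 * e\<close> and is kept only on the ball of
  radius \<open>e\<close>; the excess allows two of them to be compared.\<close>

lemma fold_extend_ball:
  assumes y: "y \<in> Hyp" and F: "\<And>z. z \<in> hball y R ==> foldat F z" and R: "0 < R"
  obtains \<delta> F' where "0 < \<delta>" "\<And>z. z \<in> hball y (R + \<delta>) ==> foldat F' z" "\<And>z. z \<in> hball y R ==> F' z = F z"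
proof -
  let ?C = "{z \<in> Hyp. hdist y z \<le> R}"
  define L where "L z e G \<longleftrightarrow> 0 < e \<and> (\<forall>x\<in>hball z (3 * e). foldat G x \<and> (x \<in> hball y R --> G x = F x))" for z e G
  have "\<exists>e G. L z e G" if z: "z \<in> ?C" for z
  proof -
    have "z \<in> Hyp" "hdist y z \<le> R" using z by auto
    then obtain e G where "0 < e" "\<And>x. x \<in> hball z e ==> foldat G x" "\<And>x. x \<in> hball z e ==> x \<in> hball y R ==> G x = F x"
      using fold_extend_boundary[OF y F R] by metis
    then have "L z (e / 3) G" by (simp add: L_def)
    then show ?thesis by blast
  qed
  then have "\<forall>z\<in>?C. \<exists>e. \<exists>G. L z e G" by blast
  then obtain e where "\<forall>z\<in>?C. \<exists>G. L z (e z) G" by (rule bchoice[THEN exE])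
  then obtain G where "\<forall>z\<in>?C. L z (e z) (G z)" by (rule bchoice[THEN exE])
  then have eG: "\<And>z. z \<in> ?C ==> 0 < e z" "\<And>z x. z \<in> ?C ==> x \<in> hball z (3 * e z) ==> foldat (G z) x"
    "\<And>z x. z \<in> ?C ==> x \<in> hball z (3 * e z) ==> x \<in> hball y R ==> G z x = F x"
    unfolding L_def by blast+
  have sub: "hball z (e z) \<subseteq> hball z (3 * e z)" if "z \<in> ?C" for z using eG(1)[OF that] by (intro hball_mono) simp
  \<comment> \<open>Two of the small balls which meet lie in a common large one, whose centre is in the closure of the ball of radius \<open>R\<close>.\<close>
  have agree': "G z x = G z' x" if z: "z \<in> ?C" "z' \<in> ?C" and le: "e z' \<le> e z"
    and x: "x \<in> hball z (e z)" "x \<in> hball z' (e z')" for x z z'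
  proof -
    have H: "z \<in> Hyp" "z' \<in> Hyp" "x \<in> Hyp" "hdist y z' < R + e z'" using x z eG(1)[OF z(2)] by (auto simp: mem_hball)
    obtain c where c: "c \<in> hball y R" "hdist c z' < e z'" using hball_near[OF y H(2,4) R eG(1)[OF z(2)]] by blast
    have cH: "c \<in> Hyp" using c by (simp add: mem_hball)
    have "hdist z c \<le> hdist z x + (hdist x z' + hdist z' c)"
      using hdist_triangle[OF H(1,3) cH] hdist_triangle[OF H(3,2) cH] by linarith
    then have cz: "c \<in> hball z (3 * e z)" "c \<in> hball z' (3 * e z')"
      using x c cH le eG(1)[OF z(2)] by (simp_all add: mem_hball hdist_commute[of z'])
    let ?D = "hball z (3 * e z) \<inter> hball z' (3 * e z')"
    have "nconvex ?D" using nconvex_Int nconvex_hball H by blast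
    then have D: "connected ?D" "?D \<subseteq> Hyp" using nconvex_connected nconvex_Hyp_sub by blast+
    obtain d1 where d1: "0 < d1" "hball c d1 \<subseteq> hball z (3 * e z)" using hball_sub_ex[OF cz(1) H(1)] .
    obtain d2 where d2: "0 < d2" "hball c d2 \<subseteq> hball z' (3 * e z')" using hball_sub_ex[OF cz(2) H(2)] .
    obtain d3 where d3: "0 < d3" "hball c d3 \<subseteq> hball y R" using hball_sub_ex[OF c(1) y] .
    have "G z v = G z' v" if v: "v \<in> hball c (min d1 (min d2 d3))" for v
      using eG(3)[OF z(1), of v] eG(3)[OF z(2), of v] v subsetD[OF d1(2), of v] subsetD[OF d2(2), of v] subsetD[OF d3(2), of v]
      by (simp add: mem_hball)
    then have "\<exists>\<epsilon>>0. \<forall>v\<in>hball x \<epsilon>. G z v = G z' v"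
      using eG(2)[OF z(1)] eG(2)[OF z(2)] cz sub[OF z(1)] sub[OF z(2)] x d1(1) d2(1) d3(1)
      by (intro foldat_global_unique[OF D, where ?z0.0 = c and ?e0.0 = "min d1 (min d2 d3)"]) auto
    then show ?thesis using H(3) by auto
  qed
  have "G z x = G z' x" if "z \<in> ?C" "z' \<in> ?C" "x \<in> hball z (e z)" "x \<in> hball z' (e z')" for z z' x
    using agree'[of z z' x] agree'[of z' z x] that by (metis linear)
  then obtain F' where F': "\<And>z x. z \<in> ?C ==> x \<in> hball z (e z) ==> F' x = G z x" "\<And>z x. z \<in> ?C ==> x \<in> hball z (e z) ==> foldat F' x"
    using foldat_glue[of ?C "\<lambda>z. z" e G] eG(2) sub by (smt (verit, best) mem_Collect_eq subsetD)
  have "openin (top_of_set Hyp) (\<Union>z\<in>?C. hball z (e z))" by (intro openin_Union ballI) (auto intro: openin_hball)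
  then obtain T where T: "open T" "(\<Union>z\<in>?C. hball z (e z)) = Hyp \<inter> T" by (auto simp: openin_open)
  have TC: "z \<in> T" if z: "z \<in> ?C" for z
  proof -
    have "z \<in> hball z (e z)" using z eG(1)[OF z] by simp
    then show ?thesis using T(2) z by blast
  qed
  have "\<exists>\<delta>>0. hball y (R + \<delta>) \<subseteq> T"
  proof (cases "{z \<in> Hyp. hdist y z \<le> R + 1} \<subseteq> T")
    case True
    then show ?thesis by (intro exI[of _ 1]) (auto simp: mem_hball)
  next
    case False
    \<comment> \<open>The point of the uncovered compact set \<open>?K\<close> nearest to
      \<open>y\<close> is farther away than \<open>R\<close>; the excess of its distance serves as
      \<open>\<delta>\<close>.\<close>
    let ?K = "{z \<in> Hyp. hdist y z \<le> R + 1} - T"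
    have "compact ?K" using compact_hcball[OF y] T(1) by (rule compact_diff)
    then obtain k where k: "k \<in> ?K" "\<And>z. z \<in> ?K ==> hdist y k \<le> hdist y z"
      using continuous_attains_inf[of ?K "hdist y"] False continuous_on_subset[OF continuous_on_hdist[OF y], of ?K] by auto
    have kR: "R < hdist y k" "hdist y k \<le> R + 1" using k(1) TC by force+
    then have "hball y (R + (hdist y k - R)) \<subseteq> T" using k(2) by (force simp: mem_hball)
    then show ?thesis using kR(1) by (intro exI[of _ "hdist y k - R"]) simp
  qed
  then obtain \<delta> where d: "0 < \<delta>" "hball y (R + \<delta>) \<subseteq> T" by blast
  have "foldat F' x" if x: "x \<in> hball y (R + \<delta>)" for x
  proof -
    have "x \<in> (\<Union>z\<in>?C. hball z (e z))" unfolding T(2) using x d(2) by (auto simp: mem_hball)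
    then show ?thesis using F'(2) by blast
  qed
  moreover have "F' x = F x" if x: "x \<in> hball y R" for x
  proof -
    have xC: "x \<in> ?C" using x by (simp add: mem_hball)
    have "x \<in> hball x (e x)" using xC eG(1)[OF xC] by simp
    then show ?thesis using F'(1)[OF xC] eG(3)[OF xC _ x] sub[OF xC] by (metis subsetD)
  qed
  ultimately show ?thesis using that d(1) by blast
qed

theorem fold_exists:
  assumes p: "p \<in> M" and y: "y \<in> Hyp"
  obtains F where "F y = p" "\<And>z. z \<in> Hyp ==> foldat F z"
proof -
  obtain G0 e0 where G0: "0 < e0" "G0 y = p" "\<And>z. z \<in> hball y e0 ==> foldat G0 z"
    using local_fold_exists[OF p y] by blast
  \<comment> \<open>Agreement with \<open>G0\<close> near \<open>y\<close> pins the extension down,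
    so the maps for different radii fit together.\<close>
  define P where "P R F \<longleftrightarrow> e0 \<le> R \<and> (\<forall>z\<in>hball y R. foldat F z) \<and> (\<forall>z\<in>hball y e0. F z = G0 z)" for R F
  define S where "S = {R. \<exists>F. P R F}"
  have "P e0 G0" using G0 by (simp add: P_def)
  then have S0: "e0 \<in> S" by (auto simp: S_def)
  define Fc where "Fc R = (SOME F. P R F)" for R
  have Fc: "P R (Fc R)" if "R \<in> S" for R using that unfolding S_def Fc_def by (simp add: someI_ex)
  have comp1: "Fc R z = Fc R' z" if R: "R \<in> S" "R' \<in> S" "R \<le> R'" and z: "z \<in> hball y R" for R R' z
  proof -
    have D: "connected (hball y R)" "hball y R \<subseteq> Hyp"
      using nconvex_connected[OF nconvex_hball[OF y]] hball_Hyp by blast+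
    have sub: "hball y R \<subseteq> hball y R'" using hball_mono R(3) .
    have P: "e0 \<le> R" "\<forall>z\<in>hball y R. foldat (Fc R) z" "\<forall>z\<in>hball y e0. Fc R z = G0 z"
      "\<forall>z\<in>hball y R'. foldat (Fc R') z" "\<forall>z\<in>hball y e0. Fc R' z = G0 z"
      using Fc[OF R(1)] Fc[OF R(2)] by (auto simp: P_def)
    have "\<exists>e>0. \<forall>v\<in>hball z e. Fc R v = Fc R' v"
      by (rule foldat_global_unique[OF D, where ?z0.0 = y and ?e0.0 = e0]) (use P sub z y G0(1) in auto)
    then show ?thesis using z by (auto simp: mem_hball)
  qed
  have comp2: "Fc R z = Fc R' z" if "R \<in> S" "R' \<in> S" "z \<in> hball y R" "z \<in> hball y R'" for R R' z
    using comp1[OF that(1,2) _ that(3)] comp1[OF that(2,1) _ that(4)] by (metis linear)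
  obtain F where F: "\<And>R z. R \<in> S ==> z \<in> hball y R ==> F z = Fc R z" and Ff: "\<And>R z. R \<in> S ==> z \<in> hball y R ==> foldat F z"
    using foldat_glue[of S "\<lambda>_. y" "\<lambda>R. R" Fc, OF y _ comp2] Fc unfolding P_def by blast
  have Fp: "F y = p" using F[OF S0, of y] Fc[OF S0] y G0 by (simp add: P_def)
  have FG: "F z = G0 z" if "z \<in> hball y e0" for z using F[OF S0 that] Fc[OF S0] that by (simp add: P_def)
  have unb: "\<exists>R\<in>S. r < R" for r
  proof (rule ccontr)
    assume n: "\<not> (\<exists>R\<in>S. r < R)"
    have bdd: "bdd_above S" by (rule bdd_aboveI[of _ r]) (use n in force)
    define R where "R = Sup S"
    have e0R: "e0 \<le> R" using cSup_upper[OF S0 bdd] by (simp add: R_def)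
    then have R0: "0 < R" using G0(1) by simp
    have "foldat F z" if "z \<in> hball y R" for z
    proof -
      have "S \<noteq> {}" "hdist y z < Sup S" using that S0 by (auto simp: mem_hball R_def)
      then obtain R' where "R' \<in> S" "hdist y z < R'" by (rule less_cSupD[THEN bexE])
      then show ?thesis using Ff that by (auto simp: mem_hball)
    qed
    then obtain \<delta> F' where F': "0 < \<delta>" "\<And>z. z \<in> hball y (R + \<delta>) ==> foldat F' z" "\<And>z. z \<in> hball y R ==> F' z = F z"
      using fold_extend_ball[OF y _ R0, of F] by metis
    have "P (R + \<delta>) F'" using F' e0R FG hball_mono[OF e0R, of y] by (auto simp: P_def)
    then have "R + \<delta> \<in> S" by (auto simp: S_def)
    then show False using cSup_upper[OF _ bdd] F'(1) by (fastforce simp: R_def)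
  qed
  have "foldat F z" if "z \<in> Hyp" for z
    using unb[of "hdist y z"] Ff that by (auto simp: mem_hball)
  then show ?thesis using that[of F] Fp by blast
qed

end

lemma reflH_conj: "isoH A ==> reflH (A w) (A z) = A (reflH w z)"
  using linear_diff[of A] linear_scale[of A] isoH_linear[of A] isoH_lor[of A z w] by (simp add: reflH_def)

lemma reflH_ne_id: assumes "lor w w = 1" shows "reflH w \<noteq> id"
proof
  assume "reflH w = id"
  then have "reflH w w = w" by simp
  then have "w = 0" using assms by (simp add: reflH_def)
  then show False using assms by (simp add: lor.zero_left)
qed

section \<open>The deck group of a folding map\<close>

locale folding = hypmfd wn M for wn :: "'v::lorentz_space" and M :: "'m::metric_space set" +
  fixes F :: "'v => 'm"
  assumes foldF: "\<And>z. z \<in> Hyp ==> foldat F z"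
begin

lemma F_M: "z \<in> Hyp ==> F z \<in> M"
  using foldat_M foldF by blast

lemma F_lipschitz: "z \<in> Hyp ==> z' \<in> Hyp ==> dist (F z) (F z') \<le> hdist z z'"
  using foldat_nconvex_lipschitz[OF nconvex_Hyp foldF] by blast

lemma continuous_on_F: "continuous_on Hyp F"
  unfolding continuous_on_iff
proof (intro ballI allI impI)
  fix x :: 'v and e :: real assume x: "x \<in> Hyp" and e: "0 < e"
  have "\<forall>\<^sub>F x' in at x within Hyp. dist (hdist x x') (hdist x x) < e"
    using continuous_on_hdist[OF x] x e unfolding continuous_on_def tendsto_iff by blast
  then obtain d where d: "0 < d" "\<And>x'. x' \<in> Hyp ==> x' \<noteq> x ==> dist x' x < d ==> \<bar>hdist x x'\<bar> < e"
    unfolding eventually_at using x by (auto simp: dist_real_def)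
  have "dist (F x') (F x) < e" if "x' \<in> Hyp" "dist x' x < d" for x'
    using d(2)[OF that(1) _ that(2)] F_lipschitz[OF x that(1)] e by (cases "x' = x") (auto simp: dist_commute)
  then show "\<exists>d>0. \<forall>x'\<in>Hyp. dist x' x < d --> dist (F x') (F x) < e" using d(1) by blast
qed

lemma unique_continuation:
  assumes "isoH A" "y \<in> Hyp" "0 < e" "\<And>z. z \<in> hball y e ==> F (A z) = F z" "z \<in> Hyp"
  shows "F (A z) = F z"
proof -
  have "\<exists>e>0. \<forall>v\<in>hball z e. (F \<circ> A) v = F v"
  proof (rule foldat_global_unique[OF nconvex_connected[OF nconvex_Hyp] order_refl, where ?z0.0 = y and ?e0.0 = e])
    show "foldat (F \<circ> A) v" if "v \<in> Hyp" for v
      using foldat_comp[OF foldF that assms(1)] that assms(1) by simp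
  qed (use assms foldF in auto)
  then show ?thesis using assms(5) by auto
qed

lemma foldat_normal:
  assumes y: "y \<in> Hyp" and U: "lchart U \<psi>" "F y \<in> U"
  obtains B e where "isoH B" "B y = \<psi> (F y)" "0 < e" "\<And>z. z \<in> hball y e ==> F z \<in> U \<and> \<psi> (F z) = fold (B z)"
proof -
  obtain B e where B: "isoH B" "0 < e" "\<And>z. z \<in> hball y e ==> F z \<in> U \<and> \<psi> (F z) = fold (B z)"
    using foldat_change[OF foldF[OF y] y U] by blast
  define B' where "B' = (if 0 \<le> lor (B y) wn then B else reflH wn \<circ> B)"
  have "isoH B'" "fold (B' x) = fold (B x)" for x using B(1) isoH_comp[OF isoH_wn B(1)] by (simp_all add: B'_def fold_reflH)
  moreover have "B' y = \<psi> (F y)" using B(2) B(3)[of y] y by (simp add: B'_def fold_def)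
  ultimately show ?thesis using that[of B' e] B(2,3) by simp
qed

text \<open>The chart at \<open>p\<close> is lifted near any \<open>z\<close> above it by means of
  the normal form at \<open>z\<close>. The radius depends on \<open>p\<close> only and not on
  \<open>z\<close>, which is what path lifting requires.\<close>

lemma chart_lift:
  assumes p: "p \<in> M"
  obtains r where "0 < r" "\<And>z q. z \<in> Hyp ==> dist p (F z) < r ==> q \<in> M ==> dist p q < r ==>
    \<exists>z'\<in>Hyp. F z' = q \<and> hdist z z' = dist (F z) q"
proof -
  obtain U \<psi> where U: "lchart U \<psi>" "p \<in> U" using atlas[OF p] by blast
  obtain r where r: "0 < r" "hball (\<psi> p) r \<inter> Hhalf \<subseteq> \<psi> ` U" "\<And>q. q \<in> M ==> dist p q < r ==> q \<in> U"
    using lchart_ball[OF U] by metis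
  have pH: "\<psi> p \<in> Hyp" "fold (\<psi> p) = \<psi> p" using lchart_Hyp[OF U] fold_id[OF lchart_Hhalf[OF U]] by auto
  have "\<exists>z'\<in>Hyp. F z' = q \<and> hdist z z' = dist (F z) q" if z: "z \<in> Hyp" "dist p (F z) < r" and q: "q \<in> M" "dist p q < r" for z q
  proof -
    have qU: "F z \<in> U" "q \<in> U" using r(3) F_M z q by blast+
    obtain B e where B: "isoH B" "B z = \<psi> (F z)" "0 < e" "\<And>x. x \<in> hball z e ==> F x \<in> U \<and> \<psi> (F x) = fold (B x)"
      using foldat_normal[OF z(1) U(1) qU(1)] by blast
    define c where "c = invf B (\<psi> p)"
    have c: "c \<in> Hyp" "hdist c x = hdist (\<psi> p) (B x)" for x
      using isoH_inv[OF B(1)] pH isoH_hdist[OF B(1), of c x] by (simp_all add: c_def isoH_inv_apply(2)[OF B(1)])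
    define G where "G = (\<lambda>x. chart_inv U \<psi> (fold (B x)))"
    have G: "G x \<in> U" "\<psi> (G x) = fold (B x)" "foldat G x" if x: "x \<in> hball c r" for x
    proof -
      have "hdist (\<psi> p) (fold (B x)) < r"
        using fold_hdist[of "\<psi> p" "B x"] pH x c isoH_Hyp[OF B(1), of x] by (simp add: mem_hball)
      then show "G x \<in> U" "\<psi> (G x) = fold (B x)" "foldat G x"
        using chart_fold[OF U(1) B(1) pH(1) r(2), of x] x by (auto simp: G_def mem_hball)
    qed
    have zc: "z \<in> hball c r" using z lchart_dist[OF U qU(1)] c B(2) by (simp add: mem_hball)
    obtain d where d: "0 < d" "hball z d \<subseteq> hball c r" using hball_sub_ex[OF zc c(1)] by blast
    have near: "G x = F x" if x: "x \<in> hball z (min d e)" for x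
    proof -
      have "x \<in> hball z d" "x \<in> hball z e" using x by (simp_all add: mem_hball)
      then show ?thesis using G(1,2)[OF subsetD[OF d(2)]] B(4)[of x] lchart_inj[OF U(1), of "G x" "F x"] by simp
    qed
    define z' where "z' = invf B (\<psi> q)"
    have z': "z' \<in> Hyp" "B z' = \<psi> q" using isoH_inv[OF B(1)] lchart_Hyp[OF U(1) qU(2)] by (simp_all add: z'_def isoH_inv_apply(2)[OF B(1)])
    have zc': "z' \<in> hball c r" using z' c(2) lchart_dist[OF U qU(2)] q by (simp add: mem_hball)
    have "\<exists>e>0. \<forall>v\<in>hball z' e. G v = F v"
      by (rule foldat_global_unique[OF nconvex_connected[OF nconvex_hball[OF c(1)]] hball_Hyp, where ?z0.0 = z and ?e0.0 = "min d e"])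
         (use G(3) foldF[OF subsetD[OF hball_Hyp]] zc d(1) B(3) near zc' in auto)
    then have "F z' = G z'" using z'(1) by force
    moreover have "G z' = q"
      using G(1,2)[OF zc'] z'(2) fold_id[OF lchart_Hhalf[OF U(1) qU(2)]] lchart_inj[OF U(1) _ qU(2)] by simp
    moreover have "hdist z z' = dist (F z) q" using isoH_hdist[OF B(1), of z z'] B(2) z'(2) lchart_dist[OF U(1) qU] by simp
    ultimately show ?thesis using z'(1) by auto
  qed
  then show ?thesis using that r(1) by blast
qed

lemma F_surj: "\<exists>z\<in>Hyp. F z = q" if q: "q \<in> M"
proof (rule connected_induction_simple[OF conn F_M[OF hyp0_Hyp] q, of "\<lambda>q. \<exists>z\<in>Hyp. F z = q"])
  fix p assume p: "p \<in> M"
  obtain r where r: "0 < r" "\<And>z q. z \<in> Hyp ==> dist p (F z) < r ==> q \<in> M ==> dist p q < r ==> \<exists>z'\<in>Hyp. F z' = q \<and> hdist z z' = dist (F z) q"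
    using chart_lift[OF p] by metis
  then have "\<forall>x\<in>M \<inter> ball p r. \<forall>y\<in>M \<inter> ball p r. (\<exists>z\<in>Hyp. F z = x) --> (\<exists>z\<in>Hyp. F z = y)" by (metis IntE mem_ball)
  then show "\<exists>T. openin (top_of_set M) T \<and> p \<in> T \<and> (\<forall>x\<in>T. \<forall>y\<in>T. (\<exists>z\<in>Hyp. F z = x) --> (\<exists>z\<in>Hyp. F z = y))"
    using p r(1) by (intro exI[of _ "M \<inter> ball p r"]) (simp add: openin_open_Int)
qed (use hyp0_Hyp in blast)

definition GT :: "('v => 'v) set" where
  "GT = {A. isoH A \<and> (\<forall>z\<in>Hyp. F (A z) = F z)}"

lemma GT_isoH: "A \<in> GT ==> isoH A" and GT_F: "A \<in> GT ==> z \<in> Hyp ==> F (A z) = F z"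
  unfolding GT_def by blast+

lemma GT_I: "isoH A ==> (\<And>z. z \<in> Hyp ==> F (A z) = F z) ==> A \<in> GT"
  unfolding GT_def by blast

lemma GT_Hyp: "A \<in> GT ==> z \<in> Hyp ==> A z \<in> Hyp"
  using GT_isoH isoH_Hyp by blast

lemma GT_id: "id \<in> GT"
  by (rule GT_I) (use isoH_id(2) in simp_all)

lemma GT_comp: "A \<in> GT ==> B \<in> GT ==> A \<circ> B \<in> GT"
  by (rule GT_I) (simp_all add: GT_isoH isoH_comp GT_F GT_Hyp del: isoH_Hyp)

lemma GT_inv: assumes A: "A \<in> GT" shows "invf A \<in> GT"
proof -
  have "F (invf A z) = F z" if "z \<in> Hyp" for z
    using GT_F[OF A, of "invf A z"] isoH_inv[OF GT_isoH[OF A]] that by (simp add: isoH_inv_apply(2)[OF GT_isoH[OF A]])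
  then show ?thesis using isoH_inv[OF GT_isoH[OF A]] by (intro GT_I)
qed

text \<open>Both points are put in normal form over the same chart, by \<open>B\<close> at
  \<open>y\<close> and by \<open>B'\<close> at \<open>y'\<close>; then
  \<open>invf B' \<circ> B\<close> preserves \<open>F\<close> near \<open>y\<close>, hence
  everywhere by continuation.\<close>

lemma GT_transitive:
  assumes y: "y \<in> Hyp" "y' \<in> Hyp" and eq: "F y = F y'"
  obtains A where "A \<in> GT" "A y = y'"
proof -
  obtain U \<psi> where U: "lchart U \<psi>" "F y \<in> U" using atlas[OF F_M[OF y(1)]] by blast
  obtain B e where B: "isoH B" "B y = \<psi> (F y)" "0 < e" "\<And>z. z \<in> hball y e ==> F z \<in> U \<and> \<psi> (F z) = fold (B z)"
    using foldat_normal[OF y(1) U] by blast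
  obtain B' e' where B': "isoH B'" "B' y' = \<psi> (F y)" "0 < e'" "\<And>z. z \<in> hball y' e' ==> F z \<in> U \<and> \<psi> (F z) = fold (B' z)"
    using foldat_normal[OF y(2) U(1)] U(2) eq by metis
  define A where "A = invf B' \<circ> B"
  have A: "isoH A" "A y = y'" and BA: "B' (A x) = B x" for x
    using isoH_comp[OF isoH_inv[OF B'(1)] B(1)] B(2) B'(2) isoH_inv_apply[OF B'(1), of y'] isoH_inv_apply(2)[OF B'(1)]
    by (simp_all add: A_def)
  have "F (A x) = F x" if x: "x \<in> hball y (min e e')" for x
  proof -
    have "A x \<in> hball y' e'" "x \<in> hball y e" using x isoH_hdist[OF A(1), of y x] A by (simp_all add: mem_hball)
    then show ?thesis using B(4) B'(4)[of "A x"] lchart_inj[OF U(1)] by (metis BA)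
  qed
  then have "A \<in> GT" using A unique_continuation[OF A(1) y(1), of "min e e'"] B(3) B'(3) by (intro GT_I) auto
  then show ?thesis using that A by blast
qed

definition walls :: "'v set" where "walls = {w. lor w w = 1 \<and> reflH w \<in> GT}"

lemma wallsD: "w \<in> walls ==> lor w w = 1" "w \<in> walls ==> reflH w \<in> GT"
  by (auto simp: walls_def)

lemma walls_chart:
  assumes B: "isoH B" and U: "lchart U \<psi>" and x: "x \<in> Hyp" "0 < e" "lor (B x) wn = 0"
    and e: "\<And>z. z \<in> hball x e ==> F z \<in> U \<and> \<psi> (F z) = fold (B z)"
  shows "invf B wn \<in> walls"
proof -
  define w where "w = invf B wn"
  have w: "lor x w = 0" using x(3) by (simp add: w_def isoH_lor_inv[OF B])
  have ww: "lor w w = 1" using isoH_lor[OF isoH_inv[OF B], of wn wn] wn by (simp add: w_def)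
  have iR: "isoH (reflH w)" by (rule isoH_reflH[OF ww])
  have BR: "B (reflH w z) = reflH wn (B z)" for z using reflH_conj[OF B, of w z] by (simp add: w_def isoH_inv_apply(2)[OF B])
  have "F (reflH w z) = F z" if z: "z \<in> hball x e" for z
  proof -
    have "reflH w z \<in> hball x e" using z iR isoH_hdist[OF iR, of x z] reflH_fix[OF w] by (simp add: mem_hball)
    then have "F (reflH w z) \<in> U" "\<psi> (F (reflH w z)) = fold (B z)" using e by (simp_all add: BR fold_reflH)
    then show ?thesis using e[OF z] lchart_inj[OF U] by metis
  qed
  then have "reflH w \<in> GT" using unique_continuation[OF iR x(1,2)] iR by (intro GT_I) auto
  then show ?thesis using ww by (simp add: walls_def w_def)
qed

text \<open>An element fixing \<open>y\<close> turns the normal form \<open>fold \<circ> B\<close>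
  near \<open>y\<close> into another one of the same map, so it is trivial or the reflection whose
  normal is \<open>wn\<close> pulled back by \<open>B\<close>. This normal \<open>w\<close> exists
  over interior points too, where its hyperplane misses \<open>y\<close>.\<close>

lemma GT_stabilizer:
  assumes y: "y \<in> Hyp"
  obtains w where "lor w w = 1" "F y \<in> bd \<longleftrightarrow> lor y w = 0" "F y \<in> bd ==> w \<in> walls"
    "\<And>A. A \<in> GT ==> A y = y ==> A = id \<or> A = reflH w"
proof -
  obtain U \<psi> B e where U: "lchart U \<psi>" and B: "isoH B" "0 < e" "\<And>x. x \<in> hball y e ==> F x \<in> U \<and> \<psi> (F x) = fold (B x)"
    using foldF[OF y] unfolding foldat_def by blast
  define w where "w = invf B wn"
  have w: "lor x w = lor (B x) wn" for x by (simp add: w_def isoH_lor_inv[OF B(1)])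
  have ww: "lor w w = 1" using isoH_lor[OF isoH_inv[OF B(1)], of wn wn] wn by (simp add: w_def)
  have bdw: "F y \<in> bd \<longleftrightarrow> lor y w = 0"
    using bd_iff[OF U] B(3)[of y] y B(2) by (simp add: lor_fold_wn w)
  moreover have "F y \<in> bd ==> w \<in> walls" unfolding w_def using walls_chart[OF B(1) U y B(2) _ B(3)] bdw w by simp
  moreover have "A = id \<or> A = reflH w" if A: "A \<in> GT" "A y = y" for A
  proof -
    have iA: "isoH A" using GT_isoH[OF A(1)] .
    have "fold ((B \<circ> A) x) = fold (B x)" if x: "x \<in> hball y e" for x
    proof -
      have "A x \<in> hball y e" using x iA isoH_hdist[OF iA, of y x] A(2) by (simp add: mem_hball)
      then show ?thesis using B(3)[of "A x"] B(3)[OF x] GT_F[OF A(1), of x] x by (simp add: mem_hball)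
    qed
    then have "B \<circ> A = B \<or> B \<circ> A = reflH wn \<circ> B"
      using fold_eq_cases(1)[OF isoH_comp[OF B(1) iA] B(1) y B(2)] by blast
    moreover have "reflH wn \<circ> B = B \<circ> reflH w"
      using reflH_conj[OF B(1), of w] by (simp add: fun_eq_iff w_def isoH_inv_apply(2)[OF B(1)])
    ultimately have "B \<circ> A = B \<circ> id \<or> B \<circ> A = B \<circ> reflH w" by simp
    moreover have "A = C" if "B \<circ> A = B \<circ> C" for C
    proof
      fix x show "A x = C x" using arg_cong[OF fun_cong[OF that, of x], of "invf B"] by (simp add: isoH_inv_apply(1)[OF B(1)])
    qed
    ultimately show ?thesis by blast
  qed
  ultimately show ?thesis using that ww by blast
qed

lemma GT_fixed_point:
  assumes A: "A \<in> GT" "A \<noteq> id" and y: "y \<in> Hyp" "A y = y"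
  obtains w where "w \<in> walls" "A = reflH w" "F y \<in> bd"
proof -
  obtain w where w: "lor w w = 1" "F y \<in> bd \<longleftrightarrow> lor y w = 0" "F y \<in> bd ==> w \<in> walls" "A = reflH w"
    using GT_stabilizer[OF y(1)] A y(2) by metis
  have "w \<noteq> 0" using w(1) by (auto simp: lor.zero_left)
  then have "lor y w = 0" using y(2) unfolding w(4) by (simp add: reflH_def)
  then show ?thesis using that w by blast
qed

lemma finite_stabilizer: assumes y: "y \<in> Hyp" shows "finite {A \<in> GT. A y = y}"
proof -
  obtain w where "\<And>A. A \<in> GT ==> A y = y ==> A = id \<or> A = reflH w" using GT_stabilizer[OF y] by metis
  then have "{A \<in> GT. A y = y} \<subseteq> {id, reflH w}" by blast
  then show ?thesis by (rule finite_subset) simp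
qed

text \<open>At an accumulation point of the fibre one value would be taken infinitely often nearby,
  but a folding germ takes each value at most twice.\<close>

lemma finite_fibre_ball:
  assumes y: "y \<in> Hyp" shows "finite {x \<in> Hyp. hdist y x \<le> c \<and> F x = p}"
proof (rule ccontr)
  assume "infinite {x \<in> Hyp. hdist y x \<le> c \<and> F x = p}"
  then obtain z where z: "z \<in> {x \<in> Hyp. hdist y x \<le> c}" "z islimpt {x \<in> Hyp. hdist y x \<le> c \<and> F x = p}"
    using Heine_Borel_imp_Bolzano_Weierstrass[OF compact_hcball[OF y, of c], of "{x \<in> Hyp. hdist y x \<le> c \<and> F x = p}"] by blast
  have zH: "z \<in> Hyp" using z by simp
  obtain U \<psi> B e where B: "lchart U \<psi>" "isoH B" "0 < e" "\<And>x. x \<in> hball z e ==> F x \<in> U \<and> \<psi> (F x) = fold (B x)"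
    using foldF[OF zH] unfolding foldat_def by blast
  obtain T where T: "open T" "hball z e = Hyp \<inter> T" using openin_hball[OF zH, of e] by (auto simp: openin_open)
  have "{x \<in> Hyp. hdist y x \<le> c \<and> F x = p} \<inter> T \<subseteq> {invf B (\<psi> p), invf B (reflH wn (\<psi> p))}"
  proof
    fix x assume x: "x \<in> {x \<in> Hyp. hdist y x \<le> c \<and> F x = p} \<inter> T"
    then have "\<psi> p = fold (B x)" using B(4)[of x] T(2) by auto
    then have "B x = \<psi> p \<or> B x = reflH wn (\<psi> p)" using reflH_reflH[OF wn, of "B x"] by (auto simp: fold_def split: if_splits)
    then show "x \<in> {invf B (\<psi> p), invf B (reflH wn (\<psi> p))}" using isoH_inv_apply(1)[OF B(2), of x] by auto
  qed
  then have "finite ({x \<in> Hyp. hdist y x \<le> c \<and> F x = p} \<inter> T)" by (rule finite_subset) simp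
  moreover have "z \<in> T" using T(2) zH B(3) by (metis IntE center_hball)
  ultimately show False using z(2) T(1) by (simp add: islimpt_eq_acc_point Int_commute)
qed

lemma GT_discrete: assumes y: "y \<in> Hyp" shows "finite {A \<in> GT. hdist y (A y) \<le> c}"
proof -
  let ?Y = "{x \<in> Hyp. hdist y x \<le> c \<and> F x = F y}"
  have "finite {A \<in> GT. A y = x}" for x
  proof (cases "\<exists>A0\<in>GT. A0 y = x")
    case True
    then obtain A0 where A0: "A0 \<in> GT" "A0 y = x" by blast
    have iA: "isoH A0" using GT_isoH[OF A0(1)] .
    have "{A \<in> GT. A y = x} \<subseteq> (\<lambda>A. A0 \<circ> A) ` {A \<in> GT. A y = y}"
    proof
      fix A assume A: "A \<in> {A \<in> GT. A y = x}"
      have "invf A0 \<circ> A \<in> {A \<in> GT. A y = y}" using A A0(2) GT_comp[OF GT_inv[OF A0(1)], of A] isoH_inv_apply(1)[OF iA, of y] by simp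
      moreover have "A = A0 \<circ> (invf A0 \<circ> A)" by (rule ext) (simp add: isoH_inv_apply(2)[OF iA])
      ultimately show "A \<in> (\<lambda>A. A0 \<circ> A) ` {A \<in> GT. A y = y}" by blast
    qed
    then show ?thesis using finite_stabilizer[OF y] by (meson finite_imageI finite_subset)
  next
    case False
    then have "{A \<in> GT. A y = x} = {}" by blast
    then show ?thesis by (metis finite.emptyI)
  qed
  then have "finite (\<Union>x\<in>?Y. {A \<in> GT. A y = x})" using finite_fibre_ball[OF y] by blast
  moreover have "{A \<in> GT. hdist y (A y) \<le> c} \<subseteq> (\<Union>x\<in>?Y. {A \<in> GT. A y = x})"
    using y GT_Hyp GT_F by auto
  ultimately show ?thesis by (rule rev_finite_subset)
qed

end

section \<open>Walls and chambers\<close>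

lemma reflH_eqD:
  assumes "lor w w = 1" "lor w' w' = 1" "reflH w = reflH w'" shows "w' = w \<or> w' = - w"
proof -
  define c where "c = lor w w'"
  have "- w = reflH w w" using assms(1) by (simp add: reflH_def scaleR_2)
  also have "\<dots> = w - (2 * c) *\<^sub>R w'" unfolding assms(3) by (simp add: reflH_def c_def)
  finally have "2 *\<^sub>R w = 2 *\<^sub>R (c *\<^sub>R w')" by (simp add: scaleR_2 algebra_simps)
  then have w: "w = c *\<^sub>R w'" by (simp only: scaleR_cancel_left) simp
  have "c * c = 1" using assms(1,2) unfolding w by simp
  then have "c = 1 \<or> c = - 1" by (metis square_eq_1_iff)
  then show ?thesis using w by auto
qed

lemma continuous_on_into_Hyp:
  fixes g :: "'c::metric_space => 'v::lorentz_space"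
  assumes g: "\<And>x. x \<in> S ==> g x \<in> Hyp" "\<And>x y. x \<in> S ==> y \<in> S ==> hdist (g x) (g y) \<le> dist x y"
  shows "continuous_on S g"
  unfolding continuous_on_iff
proof (intro ballI allI impI)
  fix x and e :: real assume x: "x \<in> S" and e: "0 < e"
  obtain r where r: "0 < r" "\<And>z. z \<in> hball (g x) r ==> norm (z - g x) < e" using hball_nbhd[OF g(1)[OF x] e] by blast
  have "dist (g y) (g x) < e" if "y \<in> S" "dist y x < r" for y
    using r(2)[of "g y"] g(1)[OF that(1)] g(2)[OF x that(1)] that(2) by (simp add: mem_hball dist_norm dist_commute)
  then show "\<exists>d>0. \<forall>y\<in>S. dist y x < d --> dist (g y) (g x) < e" using r(1) by blast
qed

lemma openin_M_I:
  fixes V :: "'m::metric_space set"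
  assumes "V \<subseteq> M" "\<And>p. p \<in> V ==> \<exists>r>0. \<forall>q\<in>M. dist p q < r --> q \<in> V"
  shows "openin (top_of_set M) V"
  unfolding openin_euclidean_subtopology_iff using assms by (simp add: dist_commute)

context folding
begin

lemma walls_bd: assumes w: "w \<in> walls" and y: "y \<in> Hyp" "lor y w = 0" shows "F y \<in> bd"
  using GT_fixed_point[OF wallsD(2)[OF w] reflH_ne_id[OF wallsD(1)[OF w]] y(1) reflH_fix[OF y(2)]] by blast

lemma bd_walls: assumes y: "y \<in> Hyp" "F y \<in> bd" obtains w where "w \<in> walls" "lor y w = 0"
  using GT_stabilizer[OF y(1)] y(2) by metis

text \<open>Distinct walls are disjoint, because the reflections in two walls through
  \<open>y\<close> both lie in the stabiliser of \<open>y\<close>, which has at most one nontrivial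
  element.\<close>

lemma walls_unique:
  assumes w: "w \<in> walls" "w' \<in> walls" and y: "y \<in> Hyp" "lor y w = 0" "lor y w' = 0" shows "w' = w \<or> w' = - w"
proof -
  have "reflH w = reflH w'"
    using GT_stabilizer[OF y(1)] wallsD w reflH_ne_id reflH_fix y(2,3) by metis
  then show ?thesis using reflH_eqD wallsD w by metis
qed

lemma walls_image: assumes A: "A \<in> GT" and w: "w \<in> walls" shows "A w \<in> walls"
proof -
  have iA: "isoH A" using GT_isoH[OF A] .
  have "reflH (A w) = A \<circ> reflH w \<circ> invf A"
    using reflH_conj[OF iA, of w] isoH_inv_apply(2)[OF iA] by (intro ext) (metis comp_apply)
  then have "reflH (A w) \<in> GT" using GT_comp[OF GT_comp[OF A wallsD(2)[OF w]] GT_inv[OF A]] by simp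
  then show ?thesis using wallsD(1)[OF w] isoH_lor[OF iA, of w w] by (simp add: walls_def)
qed

text \<open>Only the points of a fine partition are lifted, one after another; no continuous lift is
  formed. The bound on the sums is demanded for all \<open>n\<close> because the fineness comes from
  a Lebesgue number of the chart neighbourhoods.\<close>

lemma lift_partition:
  assumes g: "path g" "path_image g \<subseteq> M" and a: "a \<in> Hyp" "F a = g 0"
    and L: "\<And>n. (\<Sum>i<n. dist (g (real i / real n)) (g (real (Suc i) / real n))) \<le> L"
  obtains z where "z \<in> Hyp" "F z = g 1" "hdist a z \<le> L"
proof -
  define near where "near p r \<longleftrightarrow> (\<forall>q\<in>M. \<forall>q'\<in>M. dist p q < r --> dist p q' < r --> (\<forall>z\<in>Hyp. F z = q --> (\<exists>z'\<in>Hyp. F z' = q' \<and> hdist z z' = dist q q')))" for p r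
  have near: "\<exists>r>0. near p r" if "p \<in> M" for p
    using chart_lift[OF that] unfolding near_def by (metis (no_types, lifting))
  have gM: "g t \<in> M" if "t \<in> {0..1}" for t using g(2) that by (auto simp: path_image_def)
  define \<T> where "\<T> = {T. open T \<and> (\<exists>p r. near p r \<and> (\<forall>s\<in>T \<inter> {0..1}. dist p (g s) < r))}"
  have "{0..1} \<subseteq> \<Union> \<T>"
  proof
    fix t :: real assume t: "t \<in> {0..1}"
    obtain r where r: "0 < r" "near (g t) r" using near[OF gM[OF t]] by blast
    obtain d where d: "0 < d" "\<And>s. s \<in> {0..1} ==> dist s t < d ==> dist (g s) (g t) < r"
      using g(1) t r(1) unfolding path_def continuous_on_iff by blast
    have "\<forall>s\<in>ball t d \<inter> {0..1}. dist (g t) (g s) < r" using d(2) by (auto simp: dist_commute)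
    then show "t \<in> \<Union> \<T>" unfolding \<T>_def using r(2) d(1) by (intro UnionI[of "ball t d"]) auto
  qed
  then obtain e where e: "0 < e" "\<And>t. t \<in> {0..1} ==> \<exists>T\<in>\<T>. ball t e \<subseteq> T"
    by (rule Heine_Borel_lemma[OF compact_Icc]) (auto simp: \<T>_def)
  obtain n where n: "1 / e < real n" using reals_Archimedean2 by blast
  then have n0: "0 < real n" using e(1) by (meson order_less_trans zero_less_divide_1_iff)
  then have ne: "1 / real n < e" using n e(1) by (simp add: field_simps)
  have step: "\<exists>z'\<in>Hyp. F z' = g (real (Suc i) / real n) \<and> hdist z z' = dist (F z) (F z')"
    if i: "i < n" and z: "z \<in> Hyp" "F z = g (real i / real n)" for i z
  proof -
    have t: "real i / real n \<in> {0..1}" "real (Suc i) / real n \<in> {0..1}" using i n0 by (auto simp: field_simps)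
    obtain T p r where T: "ball (real i / real n) e \<subseteq> T" "near p r" "\<forall>s\<in>T \<inter> {0..1}. dist p (g s) < r" using e(2)[OF t(1)] by (auto simp: \<T>_def)
    have "dist (real i / real n) (real (Suc i) / real n) = 1 / real n" using n0 by (simp add: dist_real_def field_simps)
    then have "dist p (g (real (Suc i) / real n)) < r" "dist p (g (real i / real n)) < r" using T(1,3) t ne e(1) by (auto simp: subset_iff)
    then show ?thesis using z gM[OF t(1)] gM[OF t(2)] T(2) unfolding near_def by metis
  qed
  have "\<exists>z\<in>Hyp. F z = g (real k / real n) \<and> hdist a z \<le> (\<Sum>i<k. dist (g (real i / real n)) (g (real (Suc i) / real n)))" if "k \<le> n" for k
    using that
  proof (induction k)
    case 0
    then show ?case using a by (intro bexI[of _ a]) auto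
  next
    case (Suc k)
    then obtain z where z: "z \<in> Hyp" "F z = g (real k / real n)" "hdist a z \<le> (\<Sum>i<k. dist (g (real i / real n)) (g (real (Suc i) / real n)))"
      by auto
    obtain z' where z': "z' \<in> Hyp" "F z' = g (real (Suc k) / real n)" "hdist z z' = dist (F z) (F z')"
      using step[of k z] Suc z by auto
    have "hdist a z' \<le> hdist a z + hdist z z'" using hdist_triangle a z z' by blast
    then show ?case using z z' by (intro bexI[of _ z']) auto
  qed
  from this[of n] obtain z where "z \<in> Hyp" "F z = g (real n / real n)" "hdist a z \<le> L" using L[of n] by force
  then show ?thesis using that n0 by auto
qed

end

section \<open>The chamber as a convex covering space of the manifold\<close>

locale chamber = folding wn M F for wn :: "'v::lorentz_space" and M :: "'m::metric_space set" and F +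
  fixes b :: 'v
  assumes b: "b \<in> Hyp" "F b \<notin> bd"
begin

lemma b_walls: "w \<in> walls ==> lor b w \<noteq> 0"
  using walls_bd b by blast

text \<open>A wall has two normals \<open>w\<close> and \<open>- w\<close>; the product with
  \<open>lor b w\<close> makes the condition independent of the choice, and says that no wall
  separates \<open>y\<close> from \<open>b\<close>.\<close>

definition X :: "'v set" where
  "X = {y \<in> Hyp. \<forall>w\<in>walls. 0 \<le> lor b w * lor y w}"

lemma X_Hyp: "y \<in> X ==> y \<in> Hyp"
  by (simp add: X_def)

lemma X_walls: "y \<in> X ==> w \<in> walls ==> 0 \<le> lor b w * lor y w"
  by (simp add: X_def)

lemma b_X: "b \<in> X"
  using b by (simp add: X_def)

lemma nconvex_X: "nconvex X"
  unfolding nconvex_def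
proof (intro conjI ballI)
  fix y z t assume yz: "y \<in> X" "z \<in> X" "t \<in> {0..1::real}"
  then have "nseg y z t \<in> Hyp" using nseg_Hyp X_Hyp by auto
  moreover have "0 \<le> lor b w * lor (nseg y z t) w" if "w \<in> walls" for w
    using nconvexD[OF nconvex_halfspace[of "lor b w *\<^sub>R w"], of y z t] yz that by (simp add: X_def lor_simps)
  ultimately show "nseg y z t \<in> X" by (simp add: X_def)
qed (auto simp: X_def)

text \<open>A point of the fibre nearest to \<open>b\<close> lies in \<open>X\<close>, since
  reflecting it in a wall that separates it from \<open>b\<close> would bring it closer.\<close>

lemma F_X: "F ` X = M"
proof -
  have "q \<in> F ` X" if q: "q \<in> M" for q
  proof -
    obtain z where z: "z \<in> Hyp" "F z = q" using F_surj[OF q] by blast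
    define S where "S = {x \<in> Hyp. hdist b x \<le> hdist b z \<and> F x = q}"
    have S: "finite S" "z \<in> S" unfolding S_def using finite_fibre_ball[OF b(1)] z by simp_all
    then obtain x where x: "x \<in> S" "\<And>x'. x' \<in> S ==> hdist b x \<le> hdist b x'" using arg_min_if_finite[of S "hdist b"] by (metis empty_iff linorder_not_less)
    have xH: "x \<in> Hyp" using x(1) by (simp add: S_def)
    have "0 \<le> lor b w * lor x w" if w: "w \<in> walls" for w
    proof (rule ccontr)
      assume n: "\<not> ?thesis"
      have R: "reflH w x \<in> Hyp" "F (reflH w x) = q" using GT_Hyp[OF wallsD(2)[OF w]] GT_F[OF wallsD(2)[OF w]] x(1) by (auto simp: S_def)
      have "lor b x < lor b (reflH w x)" using n by (simp add: reflH_def lor_simps mult.commute)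
      then have "hdist b (reflH w x) < hdist b x" using hdist_less_iff[OF b(1) R(1), of "hdist b x"] cosh_hdist[OF b(1) xH] hdist_nonneg[OF b(1) xH] by simp
      then show False using x R by (force simp: S_def)
    qed
    then show ?thesis using x(1) by (auto simp: S_def X_def)
  qed
  then show ?thesis using F_M X_Hyp by blast
qed

definition GX :: "('v => 'v) set" where "GX = {A \<in> GT. A b \<in> X}"

lemma GX_GT: "A \<in> GX ==> A \<in> GT"
  by (simp add: GX_def)

lemma GX_isoH: "A \<in> GX ==> isoH A"
  using GX_GT GT_isoH by blast

lemma GX_id: "id \<in> GX"
  using GT_id b_X by (simp add: GX_def)

lemma GX_X: assumes A: "A \<in> GX" and y: "y \<in> X" shows "A y \<in> X"
proof -
  have iA: "isoH A" using GX_isoH[OF A] .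
  have "0 \<le> lor b w * lor (A y) w" if w: "w \<in> walls" for w
  proof -
    have w': "invf A w \<in> walls" using walls_image[OF GT_inv[OF GX_GT[OF A]] w] .
    have "0 \<le> lor b w * lor (A b) w" using A w by (simp add: GX_def X_walls)
    moreover have "0 \<le> lor (A b) w * lor (A y) w" "lor (A b) w \<noteq> 0"
      using X_walls[OF y w'] b_walls[OF w'] by (simp_all add: isoH_lor_inv[OF iA])
    ultimately show ?thesis by (auto simp: zero_le_mult_iff)
  qed
  then show ?thesis using X_Hyp[OF y] iA by (simp add: X_def)
qed

lemma GX_comp: "A \<in> GX ==> B \<in> GX ==> A \<circ> B \<in> GX"
  using GX_X GT_comp b_X unfolding GX_def by (metis (no_types, lifting) comp_apply mem_Collect_eq GX_def)

lemma GX_inv: assumes A: "A \<in> GX" shows "invf A \<in> GX"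
proof -
  have iA: "isoH A" using GX_isoH[OF A] .
  have "0 \<le> lor b w * lor (invf A b) w" if w: "w \<in> walls" for w
  proof -
    have "0 \<le> lor b (A w) * lor (A b) (A w)" using A walls_image[OF GX_GT[OF A] w] by (simp add: GX_def X_walls)
    then show ?thesis using isoH_lor[OF iA, of b w] isoH_lor_inv[OF iA, of w b] by (simp add: lor_commute mult.commute)
  qed
  then have "invf A b \<in> X" using b(1) isoH_inv[OF iA] by (simp add: X_def)
  then show ?thesis using GT_inv[OF GX_GT[OF A]] by (simp add: GX_def)
qed

lemma GX_F: "A \<in> GX ==> y \<in> X ==> F (A y) = F y"
  using GT_F GX_GT X_Hyp by blast

text \<open>A nontrivial element with a fixed point is the reflection in a wall, which moves
  \<open>b\<close> to the other side and so out of \<open>X\<close>.\<close>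

lemma GX_free: assumes A: "A \<in> GX" and z: "z \<in> X" "A z = z" shows "A = id"
proof (rule ccontr)
  assume "A \<noteq> id"
  then obtain w where w: "w \<in> walls" "A = reflH w" using GT_fixed_point[OF GX_GT[OF A] _ X_Hyp[OF z(1)] z(2)] by blast
  then have "0 \<le> lor b w * - lor b w" using X_walls[OF GX_X[OF A b_X] w(1)] lor_reflH_normal[OF wallsD(1)[OF w(1)]] by simp
  then show False using b_walls[OF w(1)] by (auto simp: mult_le_0_iff)
qed

text \<open>If an element of \<open>GT\<close> mapping \<open>z\<close> to \<open>z'\<close> does not preserve \<open>X\<close>, then the only wall separating
  the image of \<open>b\<close> from \<open>b\<close> passes through \<open>z'\<close>, and composing with the reflection in it helps.\<close>

lemma GX_simply_transitive:
  assumes z: "z \<in> X" "z' \<in> X" "F z = F z'" shows "\<exists>!A. A \<in> GX \<and> A z = z'"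
proof (rule ex_ex1I)
  have sep: "lor z' w = 0" if A: "A \<in> GT" "A z = z'" and w: "w \<in> walls" "lor b w * lor (A b) w < 0" for A w
  proof -
    have "0 \<le> lor (A b) w * lor z' w"
      using X_walls[OF z(1) walls_image[OF GT_inv[OF A(1)] w(1)]] A(2) isoH_lor_inv[OF GT_isoH[OF A(1)]] by metis
    then show ?thesis using X_walls[OF z(2) w(1)] w(2) by (auto simp: zero_le_mult_iff mult_less_0_iff)
  qed
  obtain A where A: "A \<in> GT" "A z = z'" using GT_transitive[OF X_Hyp[OF z(1)] X_Hyp[OF z(2)] z(3)] by blast
  show "\<exists>A. A \<in> GX \<and> A z = z'"
  proof (cases "A b \<in> X")
    case False
    then obtain w where w: "w \<in> walls" "lor b w * lor (A b) w < 0" using GT_Hyp[OF A(1) b(1)] by (force simp: X_def)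
    define B where "B = reflH w \<circ> A"
    have B: "B \<in> GT" "B z = z'" "lor (B b) w = - lor (A b) w"
      using GT_comp[OF wallsD(2)[OF w(1)] A(1)] A(2) reflH_fix[OF sep[OF A w]] lor_reflH_normal[OF wallsD(1)[OF w(1)]] by (simp_all add: B_def)
    have "0 \<le> lor b u * lor (B b) u" if u: "u \<in> walls" for u
    proof (rule ccontr)
      assume n: "\<not> ?thesis"
      then have "u = w \<or> u = - w" using walls_unique[OF w(1) u X_Hyp[OF z(2)] sep[OF A w]] sep[OF B(1,2) u] by simp
      then show False using n B(3) w(2) by (auto simp: lor_simps)
    qed
    then have "B \<in> GX" using B(1) GT_Hyp[OF B(1) b(1)] by (simp add: GX_def X_def)
    then show ?thesis using B(2) by blast
  qed (use A in \<open>auto simp: GX_def\<close>)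
  fix A B assume AB: "A \<in> GX \<and> A z = z'" "B \<in> GX \<and> B z = z'"
  then have iB: "isoH B" using GX_isoH by blast
  have "(invf B \<circ> A) z = z" using AB isoH_inv_apply(1)[OF iB, of z] by simp
  then have "invf B \<circ> A = id" using GX_free[OF GX_comp[OF GX_inv] z(1)] AB by blast
  then show "A = B" using isoH_inv_apply(2)[OF iB] by (intro ext) (metis comp_apply id_apply)
qed

text \<open>Near \<open>z\<close> the chamber is a full ball, or the half of it cut off by the one
  wall through \<open>z\<close>. In the latter case \<open>B\<close> is chosen, after a reflection
  if necessary, so that it takes \<open>b\<close> to the side of \<open>Hhalf\<close>; on
  \<open>X\<close> the fold then disappears.\<close>

lemma X_chart:
  assumes z: "z \<in> X"
  obtains U \<psi> B r where "lchart U \<psi>" "F z \<in> U" "isoH B" "B z = \<psi> (F z)" "0 < r" "\<And>q. q \<in> M ==> dist (F z) q < r ==> q \<in> U"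
    "\<And>q. q \<in> M ==> dist (F z) q < r ==> invf B (\<psi> q) \<in> X \<and> F (invf B (\<psi> q)) = q"
    "\<And>x. x \<in> X ==> hdist z x < r ==> F x \<in> U \<and> \<psi> (F x) = B x" "F z \<notin> bd ==> hball z r \<subseteq> X"
proof -
  have zH: "z \<in> Hyp" using X_Hyp z by blast
  obtain U \<psi> where U: "lchart U \<psi>" "F z \<in> U" using atlas[OF F_M[OF zH]] by blast
  obtain r0 where r0: "0 < r0" "\<And>q. q \<in> M ==> dist (F z) q < r0 ==> q \<in> U" using lchart_ball[OF U] by metis
  obtain B0 e where B0: "isoH B0" "B0 z = \<psi> (F z)" "0 < e" "\<And>x. x \<in> hball z e ==> F x \<in> U \<and> \<psi> (F x) = fold (B0 x)"
    using foldat_normal[OF zH U] by blast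
  obtain B where B: "isoH B" "B z = \<psi> (F z)" "\<And>x. x \<in> hball z e ==> F x \<in> U \<and> \<psi> (F x) = fold (B x)"
    and side: "lor (B z) wn = 0 ==> 0 \<le> lor (B b) wn"
  proof (cases "lor (B0 z) wn = 0 \<and> lor (B0 b) wn < 0")
    case True
    then show ?thesis using that[of "reflH wn \<circ> B0"] B0 isoH_comp[OF isoH_wn B0(1)] lor_reflH_normal[OF wn]
      by (simp add: reflH_fix fold_reflH)
  qed (use that[of B0] B0 in auto)
  define w where "w = invf B wn"
  have w: "lor x w = lor (B x) wn" for x by (simp add: w_def isoH_lor_inv[OF B(1)])
  have W: "w \<in> walls" if "lor z w = 0"
    unfolding w_def by (rule walls_chart[OF B(1) U(1) zH B0(3) _ B(3)]) (use that w in auto)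
  obtain r1 where r1: "0 < r1" "\<And>x. lor z w \<noteq> 0 ==> x \<in> hball z r1 ==> 0 < lor x w"
  proof (cases "lor z w = 0")
    case False
    then have "0 < lor z w" using w[of z] B(2) lchart_Hhalf[OF U] by (simp add: Hhalf_def)
    then show ?thesis using hball_sign[OF zH] that by metis
  qed (use that[of 1] in simp)
  define r where "r = Min {r0, r1, e}"
  have r: "0 < r" "r \<le> r0" "\<And>x. x \<in> hball z r ==> x \<in> hball z r1 \<and> x \<in> hball z e" using r0(1) r1(1) B0(3) by (auto simp: r_def mem_hball)
  have X_iff: "x \<in> X \<longleftrightarrow> 0 \<le> lor x w" if x: "x \<in> hball z r" for x
  proof
    assume xX: "x \<in> X"
    show "0 \<le> lor x w"
    proof (cases "lor z w = 0")
      case True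
      then have "0 < lor b w" using side w b_walls[OF W] by (metis order_le_less)
      then show ?thesis using X_walls[OF xX W[OF True]] by (simp add: zero_le_mult_iff)
    qed (use r1(2) r(3)[OF x] in force)
  next
    assume xw: "0 \<le> lor x w"
    have xH: "x \<in> Hyp" using x by (simp add: mem_hball)
    have "0 \<le> lor b u * lor x u" if u: "u \<in> walls" for u
    proof (rule ccontr)
      assume n: "\<not> ?thesis"
      define v where "v = lor b u *\<^sub>R u"
      have zv: "0 \<le> lor z v" "lor x v < 0" using X_walls[OF z u] n by (simp_all add: v_def)
      \<comment> \<open>The time at which the segment from \<open>z\<close> to \<open>x\<close>
        crosses the wall of \<open>u\<close>. The crossing point lies over the boundary, hence on
        the hyperplane of \<open>w\<close> as well, and walls that meet coincide.\<close>
      define t where "t = lor z v / (lor z v - lor x v)"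
      have t: "0 \<le> t" "t \<le> 1" "(1 - t) * lor z v + t * lor x v = 0" using zv by (auto simp: t_def field_simps)
      define y where "y = nseg z x t"
      have y: "y \<in> hball z r" using nconvexD[OF nconvex_hball[OF zH] _ x t(1,2)] r(1) zH by (simp add: y_def)
      then have yH: "y \<in> Hyp" by (simp add: mem_hball)
      have "lor y v = 0" using nseg_lor[OF zH xH t(1,2)] t(3) unfolding y_def by (metis mult_zero_right)
      then have y0: "lor y u = 0" using b_walls[OF u] by (simp add: v_def)
      then have "lor y w = 0" using walls_bd[OF u yH] bd_iff[OF U(1)] B(3)[of y] r(3)[OF y] w by (simp add: lor_fold_wn)
      then have "lor z w = 0" using r1(2)[of y] r(3)[OF y] by force
      then have "u = w \<or> u = - w" "0 \<le> lor b w" using walls_unique[OF W u yH \<open>lor y w = 0\<close> y0] side w by auto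
      then show False using n xw by (auto simp: lor_simps)
    qed
    then show "x \<in> X" using xH by (simp add: X_def)
  qed
  have FB: "F x \<in> U \<and> \<psi> (F x) = B x" if "x \<in> X" "hdist z x < r" for x
  proof -
    have "x \<in> hball z r" using that X_Hyp by (simp add: mem_hball)
    then show ?thesis using B(3)[of x] r(3) X_iff[of x] that(1) w by (simp add: fold_def)
  qed
  have "invf B (\<psi> q) \<in> X \<and> F (invf B (\<psi> q)) = q" if q: "q \<in> M" "dist (F z) q < r" for q
  proof -
    have qU: "q \<in> U" using r0(2)[OF q(1)] q(2) r(2) by simp
    define x where "x = invf B (\<psi> q)"
    have x: "x \<in> Hyp" "B x = \<psi> q" using isoH_inv[OF B(1)] lchart_Hyp[OF U(1) qU] by (simp_all add: x_def isoH_inv_apply(2)[OF B(1)])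
    have d: "hdist z x < r" using isoH_hdist[OF B(1), of z x] x(2) B(2) lchart_dist[OF U qU] q(2) by simp
    have xX: "x \<in> X" using X_iff[of x] x w lchart_Hhalf[OF U(1) qU] d by (simp add: Hhalf_def mem_hball)
    moreover have "F x = q" using FB[OF xX d] x(2) lchart_inj[OF U(1) _ qU] by simp
    ultimately show ?thesis using xX by (simp add: x_def)
  qed
  moreover have "hball z r \<subseteq> X" if "F z \<notin> bd"
    using that bd_iff[OF U] w[of z] B(2) X_iff r1(2) r(3) by (metis order_less_imp_le subsetI)
  ultimately show ?thesis using that[OF U B(1,2) r(1) _ _ FB] r0(2) r(2) by simp
qed

text \<open>The sheets over a small ball are the translates by \<open>GX\<close> of
  \<open>X \<inter> hball z r\<close>; at a boundary point they are half-balls.\<close>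

theorem covering_F: "covering_space X F M"
proof
  show cF: "continuous_on X F" using continuous_on_F continuous_on_subset X_Hyp by blast
  show "F ` X = M" by (rule F_X)
  fix p assume "p \<in> M"
  then obtain z where z: "z \<in> X" "F z = p" using F_X by blast
  obtain U \<psi> B r where U: "lchart U \<psi>" "F z \<in> U" and B: "isoH B" "B z = \<psi> (F z)" and r: "0 < r" "\<And>q. q \<in> M ==> dist (F z) q < r ==> q \<in> U"
    "\<And>q. q \<in> M ==> dist (F z) q < r ==> invf B (\<psi> q) \<in> X \<and> F (invf B (\<psi> q)) = q"
    "\<And>x. x \<in> X ==> hdist z x < r ==> F x \<in> U \<and> \<psi> (F x) = B x"
    using X_chart[OF z(1)] by metis
  have zH: "z \<in> Hyp" using X_Hyp z by blast
  define T where "T = {q \<in> M. dist (F z) q < r}"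
  define s where "s q = invf B (\<psi> q)" for q
  define S where "S A = A ` (X \<inter> hball z r)" for A :: "'v => 'v"
  have s: "s q \<in> X \<inter> hball z r" "F (s q) = q" if "q \<in> T" for q
  proof -
    have "hdist z (s q) = hdist (B z) (\<psi> q)" using isoH_hdist[OF B(1), of z "s q"] by (simp add: s_def isoH_inv_apply(2)[OF B(1)])
    then show "s q \<in> X \<inter> hball z r" "F (s q) = q"
      using r(2,3)[of q] that lchart_dist[OF U, of q] X_Hyp by (auto simp: B(2) T_def s_def mem_hball)
  qed
  have FS: "F x \<in> T" "s (F x) = x" if "x \<in> X \<inter> hball z r" for x
    using that r(4)[of x] F_M[of x] F_lipschitz[OF zH, of x] isoH_inv_apply(1)[OF B(1)] by (auto simp: T_def s_def mem_hball)
  have cs: "continuous_on T s"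
  proof (rule continuous_on_into_Hyp)
    fix x y assume x: "x \<in> T" and y: "y \<in> T"
    show "s x \<in> Hyp" using s(1)[OF x] X_Hyp by blast
    show "hdist (s x) (s y) \<le> dist x y"
      using lchart_dist[OF U(1), of x y] r(2) x y isoH_hdist[OF isoH_inv[OF B(1)], of "\<psi> x" "\<psi> y"] by (simp add: s_def T_def)
  qed
  have SX: "S A \<subseteq> X" if "A \<in> GX" for A using GX_X[OF that] by (auto simp: S_def)
  have "homeomorphism (S A) T F (A \<circ> s)" if A: "A \<in> GX" for A
  proof (rule homeomorphismI)
    show "continuous_on (S A) F" using cF SX[OF A] by (rule continuous_on_subset)
    show "continuous_on T (A \<circ> s)"
      using continuous_on_compose[OF cs linear_continuous_on[OF linear_conv_bounded_linear[THEN iffD1, OF isoH_linear[OF GX_isoH[OF A]]]]] .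
  qed (use s FS GX_F[OF A] in \<open>auto simp: S_def\<close>)
  moreover have "openin (top_of_set X) (S A)" if A: "A \<in> GX" for A
  proof -
    have "S A = X \<inter> hball (A z) r"
    proof
      show "S A \<subseteq> X \<inter> hball (A z) r" using SX[OF A] hball_image[OF GX_isoH[OF A], of z r] by (auto simp: S_def)
      show "X \<inter> hball (A z) r \<subseteq> S A"
        using hball_image[OF GX_isoH[OF A], of z r] GX_X[OF GX_inv[OF A]] isoH_inv_apply(1)[OF GX_isoH[OF A]] by (force simp: S_def)
    qed
    then show ?thesis using openin_hball_Int(1)[of X "A z" r] X_Hyp GX_X[OF A z(1)] r(1) by auto
  qed
  moreover have "\<Union> (S ` GX) = X \<inter> F -` T"
  proof
    show "\<Union> (S ` GX) \<subseteq> X \<inter> F -` T" using SX FS(1) GX_F by (auto simp: S_def)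
    show "X \<inter> F -` T \<subseteq> \<Union> (S ` GX)"
    proof
      fix x assume x: "x \<in> X \<inter> F -` T"
      then obtain A where "A \<in> GX" "A (s (F x)) = x" using GX_simply_transitive[of "s (F x)" x] s[of "F x"] by auto
      moreover have "s (F x) \<in> X \<inter> hball z r" using s(1)[of "F x"] x by simp
      ultimately show "x \<in> \<Union> (S ` GX)" unfolding S_def by (metis UN_I image_eqI)
    qed
  qed
  moreover have "pairwise disjnt (S ` GX)"
  proof -
    have "A = A'" if A: "A \<in> GX" "A' \<in> GX" and x: "y \<in> S A" "y \<in> S A'" for A A' y
    proof -
      obtain x x' where x: "y = A x" "x \<in> X \<inter> hball z r" "y = A' x'" "x' \<in> X \<inter> hball z r" using x unfolding S_def by blast
      then have "F x = F x'" using GX_F[OF A(1), of x] GX_F[OF A(2), of x'] by simp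
      then have "x = x'" using FS(2) x by metis
      then show ?thesis using GX_simply_transitive[of x y] GX_F[OF A(1)] GX_X[OF A(1)] A x by auto
    qed
    then show ?thesis unfolding pairwise_def disjnt_def by blast
  qed
  moreover have "p \<in> T" "openin (top_of_set M) T"
    using z(2) \<open>p \<in> M\<close> r(1) openin_open_Int[OF open_ball[of p r], of M] by (simp_all add: T_def Int_def ball_def)
  ultimately show "\<exists>T. p \<in> T \<and> openin (top_of_set M) T \<and>
      (\<exists>v. \<Union> v = X \<inter> F -` T \<and> (\<forall>u\<in>v. openin (top_of_set X) u) \<and> pairwise disjnt v \<and> (\<forall>u\<in>v. \<exists>q. homeomorphism u T F q))"
    by (intro exI[of _ T] conjI exI[of _ "S ` GX"]) blast+
qed

end

section \<open>Short isometries commute\<close>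

definition hs :: "('v::euclidean_space => 'v) => real" where
  "hs f = L2_set (\<lambda>b. norm (f b)) Basis"

definition tr :: "('v::euclidean_space => 'v) => real" where
  "tr f = (\<Sum>b\<in>Basis. f b \<bullet> b)"

lemma hs_nonneg: "0 \<le> hs f"
  by (simp add: hs_def L2_set_nonneg)

lemma hs_sq: "(hs f)\<^sup>2 = (\<Sum>b\<in>Basis. (norm (f b))\<^sup>2)"
  by (simp add: hs_def L2_set_def sum_nonneg)

lemma hs_triangle: "hs (\<lambda>x. f x + g x) \<le> hs f + hs g"
proof -
  have "hs (\<lambda>x. f x + g x) \<le> L2_set (\<lambda>b. norm (f b) + norm (g b)) Basis"
    unfolding hs_def by (intro L2_set_mono norm_triangle_ineq) auto
  also have "\<dots> \<le> hs f + hs g" unfolding hs_def by (rule L2_set_triangle_ineq)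
  finally show ?thesis .
qed

lemma hs_minus: "hs (\<lambda>x. - f x) = hs f"
  by (simp add: hs_def)

lemma hs_diff: "hs (\<lambda>x. f x - g x) \<le> hs f + hs g"
  using hs_triangle[of f "\<lambda>x. - g x"] by (simp add: hs_minus)

lemma linear_basis_sum:
  fixes v :: "'v::euclidean_space"
  assumes "linear f" shows "f v = (\<Sum>b\<in>Basis. (v \<bullet> b) *\<^sub>R f b)"
proof -
  have "f v = f (\<Sum>b\<in>Basis. (v \<bullet> b) *\<^sub>R b)" by (simp add: euclidean_representation)
  then show ?thesis using assms by (simp add: linear_sum linear_scale)
qed

lemma norm_le_hs: assumes "linear f" shows "norm (f v) \<le> hs f * norm v"
proof -
  have "norm (f v) = norm (\<Sum>b\<in>Basis. (v \<bullet> b) *\<^sub>R f b)" by (rule arg_cong[OF linear_basis_sum[OF assms]])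
  then have "norm (f v) \<le> (\<Sum>b\<in>Basis. \<bar>v \<bullet> b\<bar> * \<bar>norm (f b)\<bar>)"
    by (simp add: sum_norm_le)
  also have "\<dots> \<le> L2_set (\<lambda>b. v \<bullet> b) Basis * hs f" unfolding hs_def by (rule L2_set_mult_ineq)
  also have "L2_set (\<lambda>b. v \<bullet> b) Basis = norm v"
    by (simp add: L2_set_def norm_eq_sqrt_inner euclidean_inner[of v v] power2_eq_square)
  finally show ?thesis by (simp add: mult.commute)
qed

lemma hs_comp: assumes "linear f" shows "hs (f \<circ> g) \<le> hs f * hs g"
proof -
  have "hs (f \<circ> g) \<le> L2_set (\<lambda>b. hs f * norm (g b)) Basis"
    unfolding hs_def[of "f \<circ> g"] by (intro L2_set_mono) (auto intro: norm_le_hs[OF assms])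
  then show ?thesis by (simp add: hs_def[of g] L2_set_right_distrib hs_nonneg)
qed

lemma hs_0: assumes "linear f" "hs f = 0" shows "f v = 0"
  using norm_le_hs[OF assms(1), of v] assms(2) by simp

lemma tr_comm:
  fixes f g :: "'a::euclidean_space => 'a"
  assumes f: "linear f" and g: "linear g" shows "tr (f \<circ> g) = tr (g \<circ> f)"
proof -
  have e: "h (k b) \<bullet> b = (\<Sum>c\<in>Basis. (k b \<bullet> c) * (h c \<bullet> b))" if "linear h" for h k :: "'a => 'a" and b
    by (subst linear_basis_sum[OF that]) (simp add: inner_sum_left)
  have "tr (f \<circ> g) = (\<Sum>b\<in>Basis. \<Sum>c\<in>Basis. (g b \<bullet> c) * (f c \<bullet> b))" by (simp add: tr_def e[OF f])
  also have "\<dots> = (\<Sum>c\<in>Basis. \<Sum>b\<in>Basis. (f c \<bullet> b) * (g b \<bullet> c))" by (subst sum.swap) (simp add: mult.commute)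
  also have "\<dots> = tr (g \<circ> f)" by (simp add: tr_def e[OF g])
  finally show ?thesis .
qed

lemma tr_conj: assumes h: "isoH h" and A: "linear A" shows "tr (invf h \<circ> A \<circ> h) = tr A"
proof -
  have l: "linear (invf h \<circ> A)" using linear_compose[OF A isoH_linear[OF isoH_inv[OF h]]] .
  have "tr (invf h \<circ> A \<circ> h) = tr (h \<circ> (invf h \<circ> A))" by (rule tr_comm[OF l isoH_linear[OF h]])
  also have "h \<circ> (invf h \<circ> A) = A" by (rule ext) (simp add: isoH_inv_apply(2)[OF h])
  finally show ?thesis .
qed

definition lflip :: "'v::lorentz_space => 'v" where "lflip v = v - (2 * tim v) *\<^sub>R tau"

lemma lflip:
  fixes v w :: "'v::lorentz_space"
  shows "linear (lflip :: 'v => 'v)" "lor v w = v \<bullet> lflip w" "lor v (lflip w) = v \<bullet> w" "lflip (lflip v) = v" "norm (lflip v) = norm v"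
proof -
  show "linear (lflip :: 'v => 'v)" by (rule linearI) (simp_all add: lflip_def algebra_simps)
  have l: "lor v w = v \<bullet> lflip w" for v w :: 'v by (simp add: lor_inner lflip_def inner_diff_right inner_commute[of _ tau])
  have s: "lflip (lflip v) = v" for v :: 'v by (simp add: lflip_def scaleR_left_diff_distrib)
  show "lor v w = v \<bullet> lflip w" "lflip (lflip v) = v" by (rule l, rule s)
  show "lor v (lflip w) = v \<bullet> w" by (simp add: l s)
  have "lflip v \<bullet> lflip v = v \<bullet> v" by (simp add: lflip_def inner_simps inner_commute[of tau v])
  then show "norm (lflip v) = norm v" by (simp add: norm_eq_sqrt_inner)
qed

text \<open>The inverse of a Lorentz map is its transpose conjugated by \<open>lflip\<close>, and
  neither operation changes the trace.\<close>

lemma tr_inv: assumes A: "isoH A" shows "tr (invf A) = tr A"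
proof -
  have lA: "linear A" "linear (invf A)" using isoH_linear A isoH_inv by blast+
  have "invf A b \<bullet> b = (lflip \<circ> (A \<circ> lflip)) b \<bullet> b" for b
    using isoH_lor[OF A, of "invf A b" "lflip b"] isoH_inv_apply(2)[OF A, of b] lflip(2)[of "A (lflip b)" b]
    by (simp add: lflip(3)) (metis inner_commute lflip(2) lor_commute)
  then have "tr (invf A) = tr (lflip \<circ> (A \<circ> lflip))" by (simp add: tr_def)
  also have "\<dots> = tr ((A \<circ> lflip) \<circ> lflip)" by (rule tr_comm[OF lflip(1) linear_compose[OF lflip(1) lA(1)]])
  also have "(A \<circ> lflip) \<circ> lflip = A" by (rule ext) (simp add: lflip(4))
  finally show ?thesis .
qed

lemma tr_reflH: fixes w :: "'v::lorentz_space" assumes "lor w w = 1" shows "tr (reflH w) = real DIM('v) - 2"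
proof -
  have "tr (reflH w) = (\<Sum>b\<in>Basis. b \<bullet> b - 2 * ((w \<bullet> b) * lor b w))" by (simp add: tr_def reflH_def inner_diff_left ac_simps)
  also have "\<dots> = real DIM('v) - 2 * (\<Sum>b\<in>Basis. (w \<bullet> b) * lor b w)" by (simp add: sum_subtractf sum_distrib_left inner_same_Basis)
  also have "(\<Sum>b\<in>Basis. (w \<bullet> b) * lor b w) = lor (\<Sum>b\<in>Basis. (w \<bullet> b) *\<^sub>R b) w" by (simp add: lor.sum_left)
  also have "\<dots> = 1" using assms by (simp add: euclidean_representation)
  finally show ?thesis by simp
qed

definition disp :: "('v::lorentz_space => 'v) => 'v => real" where "disp A y = - lor y (A y)"

text \<open>A closed form of the squared Hilbert-Schmidt distance to the identity in a frame at
  \<open>y\<close>. Invariance under inversion and conjugation, and monotonicity in the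
  displacement, can be read off from it.\<close>

definition dnorm :: "('v::lorentz_space => 'v) => 'v => real" where
  "dnorm A y = 4 * ((disp A y)\<^sup>2 - 1) + 2 * (real DIM('v) - tr A)"

lemma disp_ge: "isoH A ==> y \<in> Hyp ==> 1 \<le> disp A y"
  using Hyp_lor_le[of y "A y"] by (simp add: disp_def)

lemma disp_eq_1: "isoH A ==> y \<in> Hyp ==> disp A y = 1 \<longleftrightarrow> A y = y"
  using Hyp_lor_eq[of y "A y"] by (auto simp: disp_def)

lemma disp_conj: "isoH h ==> disp (h \<circ> A \<circ> invf h) (h y) = disp A y"
  by (simp add: disp_def isoH_inv_apply)

text \<open>In a frame at \<open>y\<close>, i.e. after conjugation by an isometry \<open>h\<close> with \<open>h tau = y\<close>, the squared
  Hilbert-Schmidt norm of \<open>A - 1\<close> depends only on the displacement of \<open>y\<close> and the trace of \<open>A\<close>.\<close>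

lemma dnorm_tau:
  fixes A :: "'v::lorentz_space => 'v"
  assumes A: "isoH A" shows "(hs (\<lambda>x. A x - x))\<^sup>2 = dnorm A tau"
proof -
  have "(hs (\<lambda>x. A x - x))\<^sup>2 = (\<Sum>b\<in>Basis. A b \<bullet> A b + 1 - 2 * (A b \<bullet> b))"
    unfolding hs_sq by (rule sum.cong) (auto simp: power2_norm_eq_inner inner_simps inner_same_Basis inner_commute)
  also have "\<dots> = (\<Sum>b\<in>Basis. A b \<bullet> A b) + real DIM('v) - 2 * tr A"
    by (simp add: sum.distrib sum_subtractf sum_distrib_left tr_def)
  also have "(\<Sum>b\<in>Basis. A b \<bullet> A b) = (\<Sum>b\<in>Basis. lor b b + 2 * (tim (A b))\<^sup>2)"
  proof (rule sum.cong[OF refl])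
    fix b :: 'v
    show "A b \<bullet> A b = lor b b + 2 * (tim (A b))\<^sup>2"
      using isoH_lor[OF A, of b b] lor_inner[of "A b" "A b"] by (simp add: power2_eq_square)
  qed
  also have "\<dots> = (\<Sum>b::'v\<in>Basis. lor b b) + 2 * (\<Sum>b\<in>Basis. (tim (A b))\<^sup>2)"
    by (simp only: sum.distrib sum_distrib_left)
  also have "(\<Sum>b::'v\<in>Basis. lor b b) = real DIM('v) - 2 * (\<Sum>b::'v\<in>Basis. (tim b)\<^sup>2)"
    by (simp add: lor_inner sum_subtractf sum_distrib_left inner_same_Basis power2_eq_square mult.assoc)
  also have "(\<Sum>b::'v\<in>Basis. (tim b)\<^sup>2) = 1"
    using euclidean_inner[of "tau :: 'v" tau] by (simp add: power2_eq_square inner_commute)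
  also have "(\<Sum>b\<in>Basis. (tim (A b))\<^sup>2) = 2 * (disp A tau)\<^sup>2 - 1"
  proof -
    define u where "u = invf A tau"
    have u: "u \<in> Hyp" using isoH_inv[OF A] by (simp add: u_def)
    have "tim (A b) = - (lflip u \<bullet> b)" for b
      using isoH_lor_inv[OF A, of b tau] lflip(2)[of b u] by (simp add: lor_hyp0 u_def inner_commute[of "lflip _"])
    then have "(\<Sum>b\<in>Basis. (tim (A b))\<^sup>2) = lflip u \<bullet> lflip u"
      by (subst euclidean_inner) (simp add: power2_eq_square)
    also have "\<dots> = (norm u)\<^sup>2" by (simp add: lflip(5) flip: power2_norm_eq_inner)
    also have "\<dots> = 2 * (tim u)\<^sup>2 - 1" by (rule Hyp_norm[OF u])
    also have "tim u = disp A tau" using isoH_lor[OF A, of u tau] isoH_inv_apply(2)[OF A, of tau]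
      by (simp add: disp_def lor_hyp0 u_def)
    finally show ?thesis .
  qed
  finally show ?thesis by (simp add: dnorm_def)
qed

lemma dnorm_hs:
  assumes A: "isoH A" and h: "isoH h" "h tau = y"
  shows "(hs (\<lambda>x. (invf h \<circ> A \<circ> h) x - x))\<^sup>2 = dnorm A y"
proof -
  have i: "isoH (invf h \<circ> A \<circ> h)" by (intro isoH_comp isoH_inv A h)
  have "disp (invf h \<circ> A \<circ> h) tau = disp A y"
    using isoH_lor_inv[OF h(1), of tau "A (h tau)"] h(2) by (simp add: disp_def)
  then show ?thesis using dnorm_tau[OF i] tr_conj[OF h(1) isoH_linear[OF A]] by (simp add: dnorm_def)
qed

lemma dnorm_nonneg: assumes A: "isoH A" and y: "y \<in> Hyp" shows "0 \<le> dnorm A y"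
proof -
  obtain h where "isoH h" "h tau = y" using isoH_transitive[OF hyp0_Hyp y] by blast
  then show ?thesis using dnorm_hs[OF A] by (metis zero_le_power2)
qed

lemma dnorm_eq_0: assumes A: "isoH A" and y: "y \<in> Hyp" and 0: "dnorm A y = 0" shows "A = id"
proof -
  obtain h where h: "isoH h" "h tau = y" using isoH_transitive[OF hyp0_Hyp y] by blast
  have i: "isoH (invf h \<circ> A \<circ> h)" by (intro isoH_comp isoH_inv A h)
  have "linear (\<lambda>x. (invf h \<circ> A \<circ> h) x - x)" using isoH_linear[OF i] linear_compose_sub linear_id[unfolded id_def] by blast
  then have "(invf h \<circ> A \<circ> h) x - x = 0" for x using hs_0[of "\<lambda>x. (invf h \<circ> A \<circ> h) x - x" x] dnorm_hs[OF A h] 0 by simp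
  then have e: "invf h (A (h x)) = x" for x by simp
  show ?thesis
  proof
    fix x
    have "h (invf h (A (h (invf h x)))) = h (invf h x)" using e by simp
    then show "A x = id x" by (simp add: isoH_inv_apply(2)[OF h(1)])
  qed
qed

lemma dnorm_disp: assumes A: "isoH A" and y: "y \<in> Hyp" shows "disp A y \<le> 1 + sqrt (dnorm A y)"
proof -
  obtain h where h: "isoH h" "h tau = y" using isoH_transitive[OF hyp0_Hyp y] by blast
  define A' where "A' = invf h \<circ> A \<circ> h"
  have i: "isoH A'" unfolding A'_def by (intro isoH_comp isoH_inv A h)
  have l: "linear (\<lambda>x. A' x - x)" using isoH_linear[OF i] linear_compose_sub linear_id[unfolded id_def] by blast
  have "norm (A' tau - tau) \<le> hs (\<lambda>x. A' x - x)" using norm_le_hs[OF l, of tau] by simp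
  also have "hs (\<lambda>x. A' x - x) = sqrt (dnorm A y)"
    using dnorm_hs[OF A h] hs_nonneg by (metis A'_def real_sqrt_unique)
  finally have "norm (A' tau - tau) \<le> sqrt (dnorm A y)" .
  moreover have "tim (A' tau - tau) \<le> norm (A' tau - tau)"
    using norm_cauchy_schwarz[of "A' tau - tau" tau] by simp
  moreover have "tim (A' tau) = disp A y"
    using isoH_lor_inv[OF h(1), of tau "A (h tau)"] h(2) by (simp add: disp_def A'_def lor_hyp0)
  ultimately show ?thesis by simp
qed

lemma dnorm_inv: assumes A: "isoH A" shows "dnorm (invf A) y = dnorm A y"
proof -
  have "lor y (invf A y) = lor y (A y)" using isoH_lor_inv[OF A, of y y] by (simp add: lor_commute)
  then show ?thesis by (simp add: dnorm_def disp_def tr_inv[OF A])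
qed

lemma dnorm_conj: assumes h: "isoH h" and A: "isoH A" shows "dnorm (h \<circ> A \<circ> invf h) (h y) = dnorm A y"
proof -
  have "invf (invf h) = h" using isoH_bij[OF h] by (simp add: inv_inv_eq)
  then have "tr (h \<circ> A \<circ> invf h) = tr A" using tr_conj[OF isoH_inv[OF h] isoH_linear[OF A]] by simp
  then show ?thesis using disp_conj[OF h] by (simp add: dnorm_def)
qed

definition commutator :: "('v => 'v) => ('v => 'v) => 'v => 'v" where
  "commutator a b = a \<circ> b \<circ> invf a \<circ> invf b"

text \<open>The difference \<open>a b - b a\<close> equals the additive commutator of
  \<open>a - 1\<close> and \<open>b - 1\<close>, so its norm is at most twice the product of theirs,
  and multiplying by the two inverses costs factors at most 9/8. With norms at most 1/8, whose
  square is the 1/64 of the hypotheses, the total factor 2 * 1/8 * 81/64 is below 1/2.\<close>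

lemma commutator_contraction:
  assumes a: "isoH a" and b: "isoH b" and y: "y \<in> Hyp" and s: "dnorm a y \<le> 1 / 64" "dnorm b y \<le> 1 / 64"
  shows "dnorm (commutator a b) y \<le> dnorm a y / 4"
proof -
  obtain h where h: "isoH h" "h tau = y" using isoH_transitive[OF hyp0_Hyp y] by blast
  define cj where "cj A = invf h \<circ> A \<circ> h" for A
  have cj: "isoH (cj A)" if "isoH A" for A unfolding cj_def by (intro isoH_comp isoH_inv that h)
  define q where "q A = hs (\<lambda>x. cj A x - x)" for A
  have q: "(q A)\<^sup>2 = dnorm A y" "0 \<le> q A" if "isoH A" for A
    using dnorm_hs[OF that h] hs_nonneg by (simp_all add: q_def cj_def)
  have lin: "linear (\<lambda>x. cj A x - x)" if "isoH A" for A
    using isoH_linear[OF cj[OF that]] linear_compose_sub linear_id[unfolded id_def] by blast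
  have ai: "isoH (invf a)" "isoH (invf b)" using isoH_inv a b by auto
  have qinv: "q (invf a) = q a" "q (invf b) = q b"
    using q[OF ai(1)] q[OF ai(2)] q[OF a] q[OF b] dnorm_inv[OF a] dnorm_inv[OF b] by (metis power2_eq_imp_eq)+
  have small: "q a \<le> 1 / 8" "q b \<le> 1 / 8"
    using q[OF a] q[OF b] s power2_le_imp_le[of "q a" "1/8"] power2_le_imp_le[of "q b" "1/8"] by (simp_all add: power_divide)
  define K where "K x = cj a (cj b x) - cj b (cj a x)" for x
  have lK: "linear K" unfolding K_def
    using linear_compose_sub[OF linear_compose[OF isoH_linear[OF cj[OF b]] isoH_linear[OF cj[OF a]]] linear_compose[OF isoH_linear[OF cj[OF a]] isoH_linear[OF cj[OF b]]]]
    by (simp add: o_def)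
  have "hs K \<le> hs ((\<lambda>x. cj a x - x) \<circ> (\<lambda>x. cj b x - x)) + hs ((\<lambda>x. cj b x - x) \<circ> (\<lambda>x. cj a x - x))"
  proof -
    have "K = (\<lambda>x. ((\<lambda>x. cj a x - x) \<circ> (\<lambda>x. cj b x - x)) x - ((\<lambda>x. cj b x - x) \<circ> (\<lambda>x. cj a x - x)) x)"
      using linear_diff[OF isoH_linear[OF cj[OF a]]] linear_diff[OF isoH_linear[OF cj[OF b]]] by (intro ext) (simp add: K_def)
    then show ?thesis by (simp only: hs_diff)
  qed
  also have "\<dots> \<le> q a * q b + q b * q a" unfolding q_def by (intro add_mono hs_comp lin a b)
  finally have K: "hs K \<le> 2 * q a * q b" by simp
  have ext1: "hs (f \<circ> cj A) \<le> hs f * (1 + q A)" if "linear f" "isoH A" for f A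
  proof -
    have "f \<circ> cj A = (\<lambda>x. f x + (f \<circ> (\<lambda>x. cj A x - x)) x)" using linear_diff[OF that(1)] by (intro ext) simp
    then have "hs (f \<circ> cj A) \<le> hs f + hs (f \<circ> (\<lambda>x. cj A x - x))" using hs_triangle by metis
    also have "\<dots> \<le> hs f + hs f * q A" using hs_comp[OF that(1), of "\<lambda>x. cj A x - x"] by (simp add: q_def)
    finally show ?thesis by (simp add: algebra_simps)
  qed
  have c: "isoH (commutator a b)" unfolding commutator_def by (intro isoH_comp a b ai)
  have "(\<lambda>x. cj (commutator a b) x - x) = (K \<circ> cj (invf a)) \<circ> cj (invf b)"
    by (rule ext) (simp add: K_def cj_def commutator_def isoH_inv_apply[OF h(1)] isoH_inv_apply[OF a] isoH_inv_apply[OF b])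
  then have "q (commutator a b) \<le> hs (K \<circ> cj (invf a)) * (1 + q b)"
    using ext1[OF linear_compose[OF isoH_linear[OF cj[OF ai(1)]] lK] ai(2)] qinv by (simp add: q_def[of "commutator a b"])
  also have "\<dots> \<le> (hs K * (1 + q a)) * (1 + q b)"
    using ext1[OF lK ai(1)] qinv q(2)[OF b] by (intro mult_right_mono) auto
  also have "\<dots> \<le> (2 * q a * q b * (1 + q a)) * (1 + q b)"
    using K q(2)[OF a] q(2)[OF b] by (intro mult_right_mono) auto
  also have "\<dots> \<le> (2 * q a * (1/8) * (1 + 1/8)) * (1 + 1/8)"
    using small q(2)[OF a] q(2)[OF b] by (intro mult_mono) auto
  also have "\<dots> \<le> q a / 2" using q(2)[OF a] by simp
  finally have "(q (commutator a b))\<^sup>2 \<le> (q a / 2)\<^sup>2" using q(2)[OF c] by (intro power_mono)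
  then show ?thesis using q(1)[OF c] q(1)[OF a] by (simp add: power_divide)
qed

lemma commutator_id: assumes a: "isoH a" and b: "isoH b" and c: "commutator a b = id" shows "a \<circ> b = b \<circ> a"
proof
  fix x
  have "commutator a b (b (a x)) = b (a x)" using c by simp
  then show "(a \<circ> b) x = (b \<circ> a) x" by (simp add: commutator_def isoH_inv_apply[OF a] isoH_inv_apply[OF b])
qed

section \<open>Parabolic and loxodromic isometries\<close>

text \<open>Time coordinate one picks one vector on each future light ray, so an ideal point is a
  single vector and equal ideal points are equal vectors.\<close>

definition null :: "'v::lorentz_space => bool" where "null v \<longleftrightarrow> lor v v = 0 \<and> tim v = 1"

definition nofix :: "('v::lorentz_space => 'v) => bool" where "nofix A \<longleftrightarrow> (\<forall>y\<in>Hyp. A y \<noteq> y)"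

text \<open>The vector itself is fixed, not only its ray. Rotations may satisfy this too;
  \<open>par\<close> becomes the usual notion of a parabolic isometry only together with
  \<open>nofix\<close>.\<close>

definition par :: "('v::lorentz_space => 'v) => 'v => bool" where "par A v \<longleftrightarrow> null v \<and> A v = v"

definition lox :: "('v::lorentz_space => 'v) => 'v => 'v => bool" where
  "lox A v v' \<longleftrightarrow> null v \<and> null v' \<and> v \<noteq> v' \<and> (\<exists>l>0. l \<noteq> 1 \<and> A v = l *\<^sub>R v \<and> A v' = (1 / l) *\<^sub>R v')"

lemma null_lor_Hyp: "null v ==> y \<in> Hyp ==> lor y v < 0"
  using lor_causal_neg[of v y] by (simp add: null_def Hyp_def lor_commute)

lemma null_lor: assumes "null v" "null v'" "v \<noteq> v'" shows "lor v v' < 0"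
proof -
  have "lor (v - v') (v - v') = (norm (v - v'))\<^sup>2"
    using assms unfolding lor_inner power2_norm_eq_inner by (simp add: null_def)
  moreover have "0 < (norm (v - v'))\<^sup>2" using assms(3) by simp
  ultimately have "0 < lor (v - v') (v - v')" by linarith
  then show ?thesis using assms lor_commute[of v' v] by (simp add: lor_simps null_def)
qed

lemma null_ray: assumes "null v" "null v'" "v' = c *\<^sub>R v" shows "v' = v"
  using assms by (simp add: null_def)

lemma null_normalize:
  assumes v: "lor v v = 0" "v \<noteq> 0" shows "null ((1 / tim v) *\<^sub>R v)" "tim v \<noteq> 0"
proof -
  show t: "tim v \<noteq> 0"
  proof
    assume "tim v = 0"
    then have "v \<bullet> v = 0" using v(1) by (simp add: lor_inner)
    then show False using v(2) by simp
  qed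
  then show "null ((1 / tim v) *\<^sub>R v)" using v by (simp add: null_def)
qed

lemma null_sum_Hyp: assumes "null v" "null v'" "v \<noteq> v'" "0 < a" "0 < b" shows "nrm (a *\<^sub>R v + b *\<^sub>R v') \<in> Hyp"
proof (rule nrm_Hyp)
  have "lor (a *\<^sub>R v + b *\<^sub>R v') (a *\<^sub>R v + b *\<^sub>R v') = 2 * (a * b) * lor v v'"
    using assms by (simp add: lor_simps null_def lor_commute[of v' v])
  also have "\<dots> < 0" using null_lor[OF assms(1-3)] assms(4,5) by (simp add: mult_pos_neg)
  finally show "lor (a *\<^sub>R v + b *\<^sub>R v') (a *\<^sub>R v + b *\<^sub>R v') < 0" .
  show "0 < tim (a *\<^sub>R v + b *\<^sub>R v')" using assms by (simp add: null_def)
qed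

lemma isoH_nrm: "isoH A ==> A (nrm w) = nrm (A w)"
  using isoH_lor[of A w w] isoH_linear[of A] by (simp add: nrm_def linear_scale)

lemma fixed_two_null:
  assumes A: "isoH A" "nofix A" and v: "null v" "A v = v" and v': "null v'" "A v' = l *\<^sub>R v'"
  shows "v' = v"
proof (rule ccontr)
  assume n: "v' \<noteq> v"
  have "lor v v' = l * lor v v'" using isoH_lor[OF A(1), of v v'] v(2) v'(2) by simp
  then have "l = 1" using null_lor[OF v(1) v'(1)] n by simp
  then have "A (v + v') = v + v'" using v v' linear_add[OF isoH_linear[OF A(1)]] by simp
  then have "A (nrm (v + v')) = nrm (v + v')" using isoH_nrm[OF A(1)] by simp
  moreover have "nrm (v + v') \<in> Hyp" using null_sum_Hyp[OF v(1) v'(1), of 1 1] n by auto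
  ultimately show False using A(2) by (simp add: nofix_def)
qed

text \<open>Brouwer's theorem on the slice of the solid light cone at time one, a compact convex
  model of hyperbolic space with its ideal boundary. A fixed point inside the cone would give a
  fixed point in \<open>Hyp\<close>.\<close>

lemma null_eigenvector:
  fixes A :: "'v::lorentz_space => 'v"
  assumes A: "isoH A" "nofix A"
  obtains v l where "null v" "0 < l" "A v = l *\<^sub>R v"
proof -
  define S where "S = {v :: 'v. tim v = 1} \<inter> cball 0 (sqrt 2)"
  have S: "v \<in> S \<longleftrightarrow> tim v = 1 \<and> lor v v \<le> 0" for v :: 'v
  proof -
    have "norm v \<le> sqrt 2 \<longleftrightarrow> (norm v)\<^sup>2 \<le> 2" by (metis norm_ge_zero real_le_rsqrt real_sqrt_le_iff real_sqrt_abs abs_of_nonneg)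
    then show ?thesis by (auto simp: S_def lor_inner power2_norm_eq_inner)
  qed
  have "closed {v :: 'v. tim v = 1}" by (intro closed_Collect_eq continuous_intros)
  then have "compact S" unfolding S_def by (intro closed_Int_compact) auto
  moreover have "convex S" unfolding S_def by (intro convex_Int convex_cball) (auto simp: convex_def)
  moreover have "(tau :: 'v) \<in> S" by (simp add: S lor_def)
  moreover have pos: "0 < tim (A v)" if "v \<in> S" for v
  proof -
    have "lor v (invf A tau) < 0"
      using lor_causal_neg[of v "invf A tau"] isoH_Hyp[OF isoH_inv[OF A(1)] hyp0_Hyp] that by (simp add: S Hyp_def)
    then show ?thesis by (simp add: lor_hyp0 flip: isoH_lor_inv[OF A(1)])
  qed
  moreover have "continuous_on S (\<lambda>v. (1 / tim (A v)) *\<^sub>R A v)"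
    using pos linear_continuous_on[OF linear_conv_bounded_linear[THEN iffD1, OF isoH_linear[OF A(1)]], of S]
    by (intro continuous_intros) force+
  moreover have "(\<lambda>v. (1 / tim (A v)) *\<^sub>R A v) \<in> S \<rightarrow> S"
  proof
    fix v assume v: "v \<in> S"
    have "lor (A v) (A v) \<le> 0" using isoH_lor[OF A(1), of v v] v by (simp add: S)
    then show "(1 / tim (A v)) *\<^sub>R A v \<in> S" using pos[OF v] by (simp add: S divide_nonpos_pos)
  qed
  ultimately obtain v where v: "v \<in> S" "(1 / tim (A v)) *\<^sub>R A v = v" using brouwer[of S] by blast
  define l where "l = tim (A v)"
  have l: "0 < l" "A v = l *\<^sub>R v" using pos[OF v(1)] arg_cong[OF v(2), of "\<lambda>x. tim (A v) *\<^sub>R x"] by (auto simp: l_def)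
  have "lor v v = 0"
  proof (rule ccontr)
    assume "lor v v \<noteq> 0"
    then have neg: "lor v v < 0" "0 < tim v" using v(1) S by auto
    have "l * l * lor v v = lor v v" using isoH_lor[OF A(1), of v v] l(2) by simp
    then have "l = 1" using neg l(1) by (simp add: square_eq_1_iff)
    then have "A (nrm v) = nrm v" using isoH_nrm[OF A(1)] l(2) by simp
    then show False using nrm_Hyp[OF neg] A(2) by (simp add: nofix_def)
  qed
  then show ?thesis using that l v(1) S by (auto simp: null_def)
qed

text \<open>Since \<open>l\<close> is an eigenvalue, \<open>A - l\<close> is not surjective; a
  vector orthogonal to its range is, after \<open>lflip\<close>, an eigenvector of \<open>A\<close>
  with factor \<open>1 / l\<close>. It is null because \<open>A\<close> scales it and yet preserves
  its square.\<close>

lemma lox_other: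
  fixes A :: "'v::lorentz_space => 'v"
  assumes A: "isoH A" and v: "null v" "A v = l *\<^sub>R v" "0 < l" "l \<noteq> 1"
  obtains v' where "null v'" "A v' = (1 / l) *\<^sub>R v'" "v \<noteq> v'"
proof -
  define T where "T x = A x - l *\<^sub>R x" for x
  have T: "linear T" unfolding T_def using isoH_linear[OF A] linear_compose_sub linear_scale_self by blast
  have "T v = T 0" using v(2) linear_0[OF T] by (simp add: T_def)
  moreover have "v \<noteq> 0" using v(1) by (auto simp: null_def)
  ultimately have "\<not> inj T" by (metis injD)
  then have "\<not> surj T" using linear_surj_imp_inj[OF T] by blast
  moreover have "span (range T) = range T" using T by (simp add: span_eq_iff linear_subspace_image)
  ultimately have "\<exists>a. a \<noteq> 0 \<and> (\<forall>x\<in>range T. a \<bullet> x = 0)" using span_not_UNIV_orthogonal[of "range T"] by metis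
  then obtain u where u: "u \<noteq> 0" "\<And>x. u \<bullet> T x = 0" by blast
  define w where "w = lflip u"
  have w0: "w \<noteq> 0" using u(1) lflip(5)[of u] unfolding w_def by (metis norm_eq_zero)
  have "lor (invf A w - l *\<^sub>R w) x = 0" for x
  proof -
    have "lor (T x) w = 0" using u(2)[of x] lflip(3)[of "T x" u] by (simp add: w_def inner_commute)
    then have "lor x (invf A w) = l * lor x w" by (simp add: T_def lor_simps isoH_lor_inv[OF A])
    then show ?thesis by (simp add: lor_simps lor_commute[of _ x])
  qed
  then have e: "invf A w = l *\<^sub>R w" using lor_nondegenerate by (metis eq_iff_diff_eq_0)
  have Aw: "A w = (1 / l) *\<^sub>R w"
  proof -
    have "w = l *\<^sub>R A w" using arg_cong[OF e, of A] linear_scale[OF isoH_linear[OF A]] by (simp add: isoH_inv_apply(2)[OF A])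
    then have "(1 / l) *\<^sub>R w = (1 / l) *\<^sub>R (l *\<^sub>R A w)" by simp
    then show ?thesis using v(3) by simp
  qed
  have "lor w w = (1 / l * (1 / l)) * lor w w" using isoH_lor[OF A, of w w] Aw by simp
  moreover have "1 / l * (1 / l) \<noteq> 1" using v(3,4) by (auto simp: field_simps square_eq_1_iff)
  ultimately have "lor w w = 0" by (metis mult_cancel_right1)
  then have n: "null ((1 / tim w) *\<^sub>R w)" "tim w \<noteq> 0" using null_normalize w0 by auto
  define v' where "v' = (1 / tim w) *\<^sub>R w"
  have Av': "A v' = (1 / l) *\<^sub>R v'" using Aw linear_scale[OF isoH_linear[OF A]] by (simp add: v'_def)
  have "v \<noteq> v'"
  proof
    assume "v = v'"
    then have "l *\<^sub>R v = (1 / l) *\<^sub>R v" using Av' v(2) by metis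
    then have "l = 1 / l" using \<open>v \<noteq> 0\<close> scaleR_cancel_right[of l v "1 / l"] by blast
    then show False using v(3,4) by (auto simp: field_simps square_eq_1_iff)
  qed
  then show ?thesis using that n(1) Av' by (simp add: v'_def)
qed

lemma par_or_lox: assumes A: "isoH A" "nofix A" shows "(\<exists>v. par A v) \<or> (\<exists>v v'. lox A v v')"
proof -
  obtain v l where v: "null v" "0 < l" "A v = l *\<^sub>R v" using null_eigenvector[OF A] by blast
  show ?thesis
  proof (cases "l = 1")
    case True then show ?thesis using v by (auto simp: par_def)
  next
    case False
    obtain v' where "null v'" "A v' = (1 / l) *\<^sub>R v'" "v \<noteq> v'" using lox_other[OF A(1) v(1,3,2) False] by blast
    then show ?thesis using v False unfolding lox_def by blast
  qed
qed

lemma null_eigen_pos: assumes A: "isoH A" and v: "null v" "lor u u = 0" "0 < tim u"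
  shows "0 < tim (A u)"
proof -
  have "lor u (invf A tau) < 0"
    using lor_causal_neg[of u "invf A tau"] isoH_Hyp[OF isoH_inv[OF A] hyp0_Hyp] v by (simp add: Hyp_def)
  then show ?thesis by (simp add: lor_hyp0 flip: isoH_lor_inv[OF A])
qed

text \<open>Otherwise the products with \<open>v\<close> and \<open>v'\<close> are nonzero, and
  their preservation forces the factor \<open>m\<close> to equal both \<open>1 / k\<close> and
  \<open>k\<close>.\<close>

lemma lox_eigen:
  assumes A: "isoH A" and l: "lox A v v'" and u: "null u" "A u = m *\<^sub>R u"
  shows "u = v \<or> u = v'"
proof (rule ccontr)
  assume n: "\<not> ?thesis"
  obtain k where k: "0 < k" "k \<noteq> 1" "A v = k *\<^sub>R v" "A v' = (1 / k) *\<^sub>R v'" "null v" "null v'" using l by (auto simp: lox_def)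
  have "lor v u = k * m * lor v u" "lor v' u = (1 / k) * m * lor v' u"
    using isoH_lor[OF A, of v u] isoH_lor[OF A, of v' u] by (simp_all add: k(3,4) u(2) ac_simps)
  moreover have "lor v u \<noteq> 0" "lor v' u \<noteq> 0" using null_lor[OF k(5) u(1)] null_lor[OF k(6) u(1)] n by auto
  ultimately have "k * m = 1" "1 / k * m = 1" by (metis mult_cancel_right1)+
  then have "k * k = 1" using k(1) by (simp add: field_simps)
  then show False using k(1,2) by (simp add: square_eq_1_iff)
qed

lemma image_null: assumes A: "isoH A" and v: "null v" obtains l u where "0 < l" "null u" "A v = l *\<^sub>R u"
proof -
  have t: "0 < tim (A v)" using null_eigen_pos[OF A v, of v] v by (simp add: null_def)
  then have "lor (A v) (A v) = 0" "A v \<noteq> 0" using isoH_lor[OF A, of v v] v by (auto simp: null_def)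
  then have "null ((1 / tim (A v)) *\<^sub>R A v)" by (rule null_normalize)
  then show ?thesis using that[of "tim (A v)" "(1 / tim (A v)) *\<^sub>R A v"] t by simp
qed

text \<open>The map \<open>a\<close> permutes the invariant rays of \<open>b\<close>, and
  \<open>b\<close> has only the ray of \<open>v\<close>. If \<open>a\<close> scaled \<open>v\<close>
  it would be loxodromic, and \<open>b\<close> would have to preserve the second end of
  \<open>a\<close> too.\<close>

lemma commute_par:
  assumes a: "isoH a" "nofix a" and b: "isoH b" "nofix b" and c: "a \<circ> b = b \<circ> a" and p: "par b v"
  shows "par a v"
proof -
  have ab: "a (b x) = b (a x)" for x using fun_cong[OF c, of x] by simp
  have v: "null v" "b v = v" using p by (auto simp: par_def)
  obtain l u where u: "0 < l" "null u" "a v = l *\<^sub>R u" using image_null[OF a(1) v(1)] .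
  have "l *\<^sub>R b u = l *\<^sub>R u" using ab[of v] v(2) u(3) linear_scale[OF isoH_linear[OF b(1)], of l u] by metis
  then have "b u = 1 *\<^sub>R u" using u(1) by simp
  then have uv: "u = v" using fixed_two_null[OF b v u(2)] by blast
  have "l = 1"
  proof (rule ccontr)
    assume n: "l \<noteq> 1"
    have av: "a v = l *\<^sub>R v" using u(3) uv by simp
    obtain v' where v': "null v'" "a v' = (1 / l) *\<^sub>R v'" "v \<noteq> v'" using lox_other[OF a(1) v(1) av u(1) n] by blast
    have lx: "lox a v v'" unfolding lox_def using v(1) v' u(1) n av by blast
    obtain k w where w: "0 < k" "null w" "b v' = k *\<^sub>R w" using image_null[OF b(1) v'(1)] .
    have "k *\<^sub>R a w = (1 / l) *\<^sub>R (k *\<^sub>R w)"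
      using ab[of v'] w(3) v'(2) linear_scale[OF isoH_linear[OF b(1)]] linear_scale[OF isoH_linear[OF a(1)]] by simp
    then have "k *\<^sub>R a w = k *\<^sub>R ((1 / l) *\<^sub>R w)" by (simp add: mult.commute)
    then have aw: "a w = (1 / l) *\<^sub>R w" using w(1) by (simp only: scaleR_cancel_left) simp
    have "w \<noteq> v"
    proof
      assume "w = v"
      then have "l *\<^sub>R v = (1 / l) *\<^sub>R v" using aw av by simp
      moreover have "v \<noteq> 0" using v(1) by (auto simp: null_def)
      ultimately have "l = 1 / l" by (metis scaleR_cancel_right)
      then show False using u(1) n by (auto simp: field_simps square_eq_1_iff)
    qed
    then have "w = v'" using lox_eigen[OF a(1) lx w(2) aw] by blast
    then show False using fixed_two_null[OF b v v'(1)] w(3) v'(3) by blast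
  qed
  then show ?thesis using u uv v(1) by (simp add: par_def)
qed

text \<open>An eigenvector of \<open>b\<close> is mapped by \<open>a\<close> to one with the same
  factor, and the two factors differ, so the ends are not interchanged. The factors of
  \<open>a\<close> are reciprocal since the product of the ends is preserved, and not 1 since
  otherwise both ends, and so a point between them, would be fixed.\<close>

lemma commute_lox:
  assumes a: "isoH a" "nofix a" and b: "isoH b" "nofix b" and c: "a \<circ> b = b \<circ> a" and p: "lox b v v'"
  shows "lox a v v'"
proof -
  have ab: "a (b x) = b (a x)" for x using fun_cong[OF c, of x] by simp
  obtain k where k: "0 < k" "k \<noteq> 1" "b v = k *\<^sub>R v" "b v' = (1 / k) *\<^sub>R v'" "null v" "null v'" "v \<noteq> v'" using p by (auto simp: lox_def)
  have kk: "k \<noteq> 1 / k" using k(1,2) by (auto simp: field_simps square_eq_1_iff)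
  have nz: "v \<noteq> 0" "v' \<noteq> 0" using k(5,6) by (auto simp: null_def)
  have key: "\<exists>l>0. a x = l *\<^sub>R x" if x: "null x" "b x = m *\<^sub>R x" and o: "null x'" "b x' = m' *\<^sub>R x'" "m \<noteq> m'"
    and e: "\<And>u s. null u ==> b u = s *\<^sub>R u ==> u = x \<or> u = x'" for x x' m m'
  proof -
    obtain l u where u: "0 < l" "null u" "a x = l *\<^sub>R u" using image_null[OF a(1) x(1)] .
    have "l *\<^sub>R b u = m *\<^sub>R (l *\<^sub>R u)"
      using ab[of x] x(2) u(3) linear_scale[OF isoH_linear[OF b(1)]] linear_scale[OF isoH_linear[OF a(1)]] by simp
    then have "l *\<^sub>R b u = l *\<^sub>R (m *\<^sub>R u)" by (simp add: mult.commute)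
    then have bu: "b u = m *\<^sub>R u" using u(1) by (simp only: scaleR_cancel_left) simp
    have "u \<noteq> x'"
    proof
      assume "u = x'"
      then have "m *\<^sub>R x' = m' *\<^sub>R x'" using bu o(2) by metis
      moreover have "x' \<noteq> 0" using o(1) by (auto simp: null_def)
      ultimately show False using o(3) by simp
    qed
    then have "u = x" using e[OF u(2) bu] by blast
    then show ?thesis using u by blast
  qed
  obtain l where l: "0 < l" "a v = l *\<^sub>R v"
    using key[OF k(5,3,6,4) kk] lox_eigen[OF b(1) p] by blast
  obtain l' where l': "0 < l'" "a v' = l' *\<^sub>R v'"
    using key[OF k(6,4,5,3)] kk lox_eigen[OF b(1) p] by metis
  have "l * l' = 1" using isoH_lor[OF a(1), of v v'] l l' null_lor[OF k(5-7)] by (simp add: mult.commute)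
  then have ll: "l' = 1 / l" using l(1) by (simp add: field_simps)
  have "l \<noteq> 1"
  proof
    assume "l = 1"
    then have "v' = v" using fixed_two_null[OF a k(5) _ k(6) l'(2)] l(2) by simp
    then show False using k(7) by simp
  qed
  then show ?thesis unfolding lox_def using k l l' ll by blast
qed

section \<open>Pushing out of the cusps\<close>

text \<open>The unit speed geodesic through \<open>y\<close> leaving the ideal point of the null vector \<open>v\<close>.\<close>

definition flow :: "'v::lorentz_space => real => 'v => 'v" where
  "flow v s y = exp s *\<^sub>R y + (sinh s / lor y v) *\<^sub>R v"

lemma flow_0 [simp]: "flow v 0 y = y"
  by (simp add: flow_def)

lemma flow_lor_null: "null v ==> lor (flow v s y) v = exp s * lor y v"
  by (simp add: flow_def lor_simps null_def)

lemma flow_Hyp: assumes v: "null v" and y: "y \<in> Hyp" shows "flow v s y \<in> Hyp"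
proof -
  have n: "lor y v < 0" using null_lor_Hyp[OF v y] .
  have "lor (flow v s y) (flow v s y) = - (exp s * exp s) + 2 * (exp s * sinh s)"
    using n v y by (simp add: flow_def lor_simps null_def Hyp_def lor_commute[of v y] algebra_simps)
  also have "\<dots> = - 1" by (simp add: sinh_def exp_minus field_simps)
  finally have l: "lor (flow v s y) (flow v s y) = - 1" .
  have neg: "lor v (flow v s y) < 0" using flow_lor_null[OF v, of s y] n by (simp add: lor_commute mult_pos_neg)
  have "tim (flow v s y) \<noteq> 0"
  proof
    assume "tim (flow v s y) = 0"
    then have "0 \<le> lor (flow v s y) (flow v s y)" by (simp add: lor_inner)
    then show False using l by simp
  qed
  moreover have "\<not> tim (flow v s y) < 0"
  proof
    assume "tim (flow v s y) < 0"
    then have "lor v (- flow v s y) < 0" using lor_causal_neg[of v "- flow v s y"] v l by (simp add: null_def lor_simps inner_minus_left)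
    then show False using neg by (simp add: lor_simps)
  qed
  ultimately show ?thesis using l by (simp add: Hyp_def)
qed

text \<open>On a horosphere about \<open>v\<close> an isometry fixing \<open>v\<close> acts as a
  Euclidean one. Flowing by \<open>s\<close> scales the horosphere by \<open>exp s\<close>, and the
  displacement minus 1 is half the square of the Euclidean displacement.\<close>

lemma flow_disp:
  assumes A: "isoH A" "par A v" and y: "y \<in> Hyp"
  shows "disp A (flow v s y) - 1 = exp (2 * s) * (disp A y - 1)"
proof -
  have v: "null v" "A v = v" using A(2) by (auto simp: par_def)
  have n: "lor y v < 0" using null_lor_Hyp[OF v(1) y] .
  have e: "lor v (A y) = lor v y" using isoH_lor[OF A(1), of v y] v(2) by simp
  have "A (flow v s y) = exp s *\<^sub>R A y + (sinh s / lor y v) *\<^sub>R v"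
    using linear_add[OF isoH_linear[OF A(1)]] linear_scale[OF isoH_linear[OF A(1)]] v(2) by (simp add: flow_def)
  then have "disp A (flow v s y) = exp s * exp s * disp A y - 2 * (exp s * sinh s)"
    using n v(1) e by (simp add: disp_def flow_def lor_simps null_def lor_commute[of v y] algebra_simps)
  also have "\<dots> - 1 = exp s * exp s * (disp A y - 1)" by (simp add: sinh_def exp_minus field_simps)
  finally show ?thesis by (simp add: exp_add[symmetric])
qed

lemma continuous_on_flow:
  assumes v: "null v" and s: "continuous_on Hyp s" shows "continuous_on Hyp (\<lambda>y. flow v (s y) y)"
  unfolding flow_def
  by (intro continuous_intros s lor.continuous_on) (use null_lor_Hyp[OF v] in force)

lemma continuous_on_disp: assumes "isoH A" shows "continuous_on S (disp A)"
  unfolding disp_def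
  by (intro continuous_intros lor.continuous_on linear_continuous_on linear_conv_bounded_linear[THEN iffD1] isoH_linear assms)

lemma continuous_on_Min:
  fixes g :: "'i => 'x::topological_space => real"
  assumes "finite I" "I \<noteq> {}" "\<And>i. i \<in> I ==> continuous_on S (g i)"
  shows "continuous_on S (\<lambda>y. Min ((\<lambda>i. g i y) ` I))"
  using assms by (induction I rule: finite_ne_induct) (auto intro: continuous_on_min)

text \<open>The function may jump between finitely many branches near the point, as long as all
  branches have the same limit there. This is the situation of \<open>push\<close> at the edge of
  the cusps.\<close>

lemma tendsto_finite_choice:
  fixes h :: "'i => 'x => 'y::metric_space"
  assumes I: "finite I" "\<And>i. i \<in> I ==> (h i \<longlongrightarrow> l) F" and ev: "\<forall>\<^sub>F x in F. \<exists>i\<in>I. f x = h i x"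
  shows "(f \<longlongrightarrow> l) F"
proof (rule tendstoI)
  fix e :: real assume "0 < e"
  then have "\<forall>\<^sub>F x in F. \<forall>i\<in>I. dist (h i x) l < e"
    using I by (intro eventually_ball_finite) (auto simp: tendstoD)
  with ev show "\<forall>\<^sub>F x in F. dist (f x) l < e" by eventually_elim auto
qed

lemma eventually_hball:
  assumes "y \<in> Hyp" "0 < r" shows "\<forall>\<^sub>F x in at y within Hyp. x \<in> hball y r"
proof -
  obtain T where T: "open T" "hball y r = Hyp \<inter> T" using openin_hball[OF assms(1), of r] by (auto simp: openin_open)
  have "y \<in> T" using T(2) assms by (metis IntE center_hball)
  then show ?thesis using T unfolding eventually_at_topological by blast
qed

lemma par_unique: "isoH A ==> nofix A ==> par A v ==> par A v' ==> v' = v"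
  using fixed_two_null[of A v v' 1] by (simp add: par_def)

lemma par_conj:
  assumes h: "isoH h" and A0: "isoH A" and A: "par A v" obtains u where "par (h \<circ> A \<circ> invf h) u"
proof -
  have v: "null v" "A v = v" using A by (auto simp: par_def)
  obtain l u where u: "0 < l" "null u" "h v = l *\<^sub>R u" using image_null[OF h v(1)] .
  have a: "l *\<^sub>R f u = f (l *\<^sub>R u)" if "isoH f" for f u using linear_scale[OF isoH_linear[OF that]] by simp
  have "invf h (h v) = v" using isoH_inv_apply(1)[OF h] by simp
  then have "l *\<^sub>R invf h u = v" using a[OF isoH_inv[OF h]] u(3) by simp
  then have "l *\<^sub>R A (invf h u) = v" using a[OF A0, of "invf h u"] v(2) by simp
  then have "l *\<^sub>R h (A (invf h u)) = l *\<^sub>R u" using a[OF h, of "A (invf h u)"] u(3) by simp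
  then have "h (A (invf h u)) = u" using u(1) by simp
  then show ?thesis using that u(2) by (simp add: par_def)
qed

lemma isoH_hdist_triangle: "isoH A ==> x \<in> Hyp ==> y \<in> Hyp ==> z \<in> Hyp ==> hdist x (A y) \<le> hdist x (A z) + hdist y z"
  using hdist_triangle[of x "A z" "A y"] isoH_Hyp[of A] isoH_hdist[of A z y] hdist_commute[of y z] by simp

lemma isoH_displacement: "isoH A ==> y \<in> Hyp ==> z \<in> Hyp ==> hdist y (A y) \<le> hdist z (A z) + 2 * hdist y z"
  using isoH_hdist_triangle[of A y y z] hdist_triangle[of y z "A z"] isoH_Hyp[of A z] by simp

text \<open>What the thick-thin argument uses of the deck group: only reflections among its
  nontrivial elements have fixed points, and the points at which every nontrivial element has
  \<open>dnorm\<close> at least \<open>\<delta>\<close> lie within bounded distance of the orbit of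
  \<open>tau\<close>.\<close>

locale kleinian =
  fixes G :: "('v::lorentz_space => 'v) set"
  assumes id_in: "id \<in> G" and comp_in: "A \<in> G ==> B \<in> G ==> A \<circ> B \<in> G" and inv_in: "A \<in> G ==> invf A \<in> G"
    and iso: "A \<in> G ==> isoH A"
    and discrete: "y \<in> Hyp ==> finite {A \<in> G. hdist y (A y) \<le> c}"
    and fixed: "A \<in> G ==> A \<noteq> id ==> y \<in> Hyp ==> A y = y ==> \<exists>w. lor w w = 1 \<and> A = reflH w"
    and dim3: "3 \<le> DIM('v)"
    and thick: "0 < \<delta> ==> \<exists>R. \<forall>y\<in>Hyp. (\<forall>A\<in>G. A \<noteq> id --> \<delta> \<le> dnorm A y) --> (\<exists>A\<in>G. hdist tau (A y) \<le> R)"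
begin

lemma fixed_trace: assumes "A \<in> G" "A \<noteq> id" "\<not> nofix A" shows "real DIM('v) - tr A = 2"
proof -
  obtain y where "y \<in> Hyp" "A y = y" using assms(3) by (auto simp: nofix_def)
  then obtain w where "lor w w = 1" "A = reflH w" using fixed assms(1,2) by blast
  then show ?thesis using tr_reflH[of w] by simp
qed

text \<open>A reflection has trace defect 2, so its \<open>dnorm\<close> is at least 4 at every
  point.\<close>

lemma nofix_small: assumes A: "A \<in> G" "A \<noteq> id" and y: "y \<in> Hyp" "dnorm A y \<le> 1 / 64" shows "nofix A"
proof (rule ccontr)
  assume "\<not> nofix A"
  then have "real DIM('v) - tr A = 2" using fixed_trace A by blast
  moreover have "1 \<le> (disp A y)\<^sup>2" using disp_ge[OF iso[OF A(1)] y(1)] by (simp add: one_le_power)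
  ultimately show False using y(2) by (simp add: dnorm_def)
qed

lemma finite_small: assumes y: "y \<in> Hyp" shows "finite {A \<in> G. dnorm A y \<le> 1 / 64}"
proof -
  have "{A \<in> G. dnorm A y \<le> 1 / 64} \<subseteq> {A \<in> G. hdist y (A y) \<le> arcosh (9 / 8)}"
  proof safe
    fix A assume A: "A \<in> G" "dnorm A y \<le> 1 / 64"
    have "sqrt (dnorm A y) \<le> sqrt ((1 / 8)\<^sup>2)" using A(2) by (intro real_sqrt_le_mono) (simp add: power2_eq_square)
    then have "disp A y \<le> 9 / 8" using dnorm_disp[OF iso[OF A(1)] y] by simp
    then show "hdist y (A y) \<le> arcosh (9 / 8)"
      using hdist_le_iff[OF y isoH_Hyp[OF iso[OF A(1)] y], of "arcosh (9 / 8)"] by (simp add: disp_def)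
  qed
  then show ?thesis using discrete[OF y] finite_subset by blast
qed

definition minimal :: "('v => 'v) => 'v => bool" where
  "minimal a y \<longleftrightarrow> a \<in> G \<and> a \<noteq> id \<and> (\<forall>c\<in>G. c \<noteq> id --> dnorm a y \<le> dnorm c y)"

lemma minimal_exists:
  assumes b: "b \<in> G" "b \<noteq> id" and y: "y \<in> Hyp" "dnorm b y \<le> 1 / 64" obtains a where "minimal a y"
proof -
  let ?S = "{A \<in> G. A \<noteq> id \<and> dnorm A y \<le> 1 / 64}"
  have fin: "finite ?S" by (rule finite_subset[OF _ finite_small[OF y(1)]]) blast
  define a where "a = arg_min_on (\<lambda>A. dnorm A y) ?S"
  have ne: "?S \<noteq> {}" using b y by blast
  have a: "a \<in> ?S" using arg_min_if_finite(1)[OF fin ne] by (simp add: a_def)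
  have "dnorm a y \<le> dnorm c y" if c: "c \<in> G" "c \<noteq> id" for c
  proof (cases "c \<in> ?S")
    case True then show ?thesis using arg_min_least[OF fin ne] by (simp add: a_def)
  next
    case False then show ?thesis using a c by auto
  qed
  then show ?thesis using that a by (auto simp: minimal_def)
qed

text \<open>By the contraction the commutator with \<open>c\<close> has \<open>dnorm\<close> at most
  a quarter of that of \<open>a\<close>, so minimality makes it trivial.\<close>

lemma minimal_commutes:
  assumes a: "minimal a y" "dnorm a y \<le> 1 / 64" and y: "y \<in> Hyp" and c: "c \<in> G" "dnorm c y \<le> 1 / 64"
  shows "a \<circ> c = c \<circ> a"
proof (rule commutator_id)
  have aG: "a \<in> G" "a \<noteq> id" using a(1) by (auto simp: minimal_def)
  show "isoH a" "isoH c" using iso aG c by auto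
  show "commutator a c = id"
  proof (rule ccontr)
    assume n: "commutator a c \<noteq> id"
    have "commutator a c \<in> G" unfolding commutator_def by (intro comp_in inv_in aG c)
    then have "dnorm a y \<le> dnorm (commutator a c) y" using a(1) n by (simp add: minimal_def)
    also have "\<dots> \<le> dnorm a y / 4" using commutator_contraction[OF iso[OF aG(1)] iso[OF c(1)] y a(2) c(2)] .
    finally have "dnorm a y = 0" using dnorm_nonneg[OF iso[OF aG(1)] y] by simp
    then show False using dnorm_eq_0[OF iso[OF aG(1)] y] aG(2) by blast
  qed
qed

lemma minimal_small: "minimal a y ==> b \<in> G ==> b \<noteq> id ==> dnorm b y \<le> d ==> dnorm a y \<le> d"
  unfolding minimal_def by force

text \<open>The two elements need not commute with each other; a shortest element \<open>a\<close>
  at \<open>y\<close> commutes with both and transmits the ideal point.\<close>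

lemma same_par:
  assumes y: "y \<in> Hyp" and b: "b \<in> G" "b \<noteq> id" "dnorm b y \<le> 1 / 64" and c: "c \<in> G" "c \<noteq> id" "dnorm c y \<le> 1 / 64"
    and p: "par b v"
  shows "par c v"
proof -
  obtain a where a: "minimal a y" using minimal_exists[OF b(1,2) y b(3)] .
  have aG: "a \<in> G" "a \<noteq> id" "dnorm a y \<le> 1 / 64" using a minimal_small[OF a b] by (auto simp: minimal_def)
  have nf: "nofix a" "nofix b" "nofix c" using nofix_small y aG b c by blast+
  have "par a v" using commute_par[OF iso[OF aG(1)] nf(1) iso[OF b(1)] nf(2) minimal_commutes[OF a aG(3) y b(1,3)] p] .
  then show ?thesis using commute_par[OF iso[OF c(1)] nf(3) iso[OF aG(1)] nf(1) minimal_commutes[OF a aG(3) y c(1,3), symmetric]] by blast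
qed

lemma same_lox:
  assumes y: "y \<in> Hyp" and b: "b \<in> G" "b \<noteq> id" "dnorm b y \<le> 1 / 64" and c: "c \<in> G" "c \<noteq> id" "dnorm c y \<le> 1 / 64"
    and p: "lox b v v'"
  shows "lox c v v'"
proof -
  obtain a where a: "minimal a y" using minimal_exists[OF b(1,2) y b(3)] .
  have aG: "a \<in> G" "a \<noteq> id" "dnorm a y \<le> 1 / 64" using a minimal_small[OF a b] by (auto simp: minimal_def)
  have nf: "nofix a" "nofix b" "nofix c" using nofix_small y aG b c by blast+
  have "lox a v v'" using commute_lox[OF iso[OF aG(1)] nf(1) iso[OF b(1)] nf(2) minimal_commutes[OF a aG(3) y b(1,3)] p] .
  then show ?thesis using commute_lox[OF iso[OF c(1)] nf(3) iso[OF aG(1)] nf(1) minimal_commutes[OF a aG(3) y c(1,3), symmetric]] by blast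
qed

text \<open>Chosen so that, together with a trace defect of at most 1/256, it keeps
  \<open>dnorm\<close> below 1/64: a displacement of at most \<open>1 + c0\<close> contributes at
  most 4/1024, the trace at most 2/256.\<close>

definition c0 :: real where "c0 = 1 / 4096"

text \<open>The bound on the trace keeps the rotational part small. Without it, a small displacement
  of \<open>y\<close> would not make the element small at \<open>y\<close> in the sense of
  \<open>dnorm\<close>.\<close>

definition cusp_elts :: "('v => 'v) set" where
  "cusp_elts = {A \<in> G. A \<noteq> id \<and> (\<exists>v. par A v) \<and> real DIM('v) - tr A \<le> 1 / 256}"

lemma cusp_elts: "A \<in> cusp_elts ==> A \<in> G" "A \<in> cusp_elts ==> A \<noteq> id" "A \<in> cusp_elts ==> isoH A" "A \<in> cusp_elts ==> nofix A"
proof -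
  assume A: "A \<in> cusp_elts"
  show 1: "A \<in> G" "A \<noteq> id" using A by (auto simp: cusp_elts_def)
  show "isoH A" using iso 1 by blast
  show "nofix A" using fixed_trace[OF 1] A by (force simp: cusp_elts_def)
qed

lemma cusp_elts_small: assumes A: "A \<in> cusp_elts" and y: "y \<in> Hyp" "disp A y - 1 \<le> c0" shows "dnorm A y \<le> 1 / 64"
proof -
  have "1 \<le> disp A y" "disp A y \<le> 4097 / 4096" using disp_ge[OF cusp_elts(3)[OF A] y(1)] y(2) by (simp_all add: c0_def)
  then have "(disp A y)\<^sup>2 \<le> (4097 / 4096)\<^sup>2" using power_mono[of "disp A y" "4097 / 4096" 2] by simp
  also have "\<dots> \<le> 1 + (1 / 1024 :: real)" by (simp add: power2_eq_square)
  finally have "(disp A y)\<^sup>2 - 1 \<le> 1 / 1024" by simp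
  moreover have "real DIM('v) - tr A \<le> 1 / 256" using A by (simp add: cusp_elts_def)
  ultimately show ?thesis unfolding dnorm_def by simp
qed

text \<open>The identity stands for the constant \<open>c0\<close>, so that the minimum defining
  \<open>height\<close> is over a nonempty set and is capped there.\<close>

definition gap :: "('v => 'v) => 'v => real" where "gap A y = (if A = id then c0 else disp A y - 1)"

text \<open>A value of \<open>disp\<close> at most \<open>1 + c0\<close> is a distance at most
  \<open>arcosh (1 + c0)\<close>. The margin \<open>r\<close> allows for a change of the base point,
  which for points less than 1 apart costs at most 2.\<close>

definition near :: "'v => real => ('v => 'v) set" where "near y r = insert id {A \<in> cusp_elts. hdist y (A y) \<le> r + arcosh (1 + c0)}"

definition height :: "'v => real" where "height y = Min ((\<lambda>A. gap A y) ` near y 2)"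

lemma finite_near: assumes "y \<in> Hyp" shows "finite (near y r)"
proof -
  have "{A \<in> cusp_elts. hdist y (A y) \<le> r + arcosh (1 + c0)} \<subseteq> {A \<in> G. hdist y (A y) \<le> r + arcosh (1 + c0)}"
    using cusp_elts(1) by auto
  then have "finite {A \<in> cusp_elts. hdist y (A y) \<le> r + arcosh (1 + c0)}" using discrete[OF assms] by (rule finite_subset)
  then show ?thesis by (simp add: near_def)
qed

lemma near_mem:
  assumes A: "A \<in> cusp_elts" and y: "y0 \<in> Hyp" "y \<in> hball y0 1" and d: "disp A y - 1 \<le> c0" shows "A \<in> near y0 2"
proof -
  have iA: "isoH A" using cusp_elts(3)[OF A] .
  have yH: "y \<in> Hyp" "hdist y0 y < 1" using y(2) by (auto simp: mem_hball)
  have "hdist y (A y) \<le> arcosh (1 + c0)"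
    using hdist_le_iff[OF yH(1) isoH_Hyp[OF iA yH(1)], of "arcosh (1 + c0)"] d by (simp add: disp_def c0_def)
  moreover have "hdist y0 (A y0) \<le> hdist y (A y) + 2 * hdist y0 y" by (rule isoH_displacement[OF iA y(1) yH(1)])
  ultimately have "hdist y0 (A y0) \<le> 2 + arcosh (1 + c0)" using yH(2) by linarith
  then show ?thesis using A by (simp add: near_def)
qed

lemma gap_pos: "A \<in> insert id cusp_elts ==> y \<in> Hyp ==> 0 < gap A y"
  using disp_ge[of A y] disp_eq_1[of A y] cusp_elts[of A] by (force simp: gap_def c0_def nofix_def)

lemma near_sub: "near y r \<subseteq> insert id cusp_elts"
  by (auto simp: near_def)

lemma height_props:
  assumes y: "y \<in> Hyp"
  shows "\<exists>A\<in>insert id cusp_elts. height y = gap A y" "A \<in> insert id cusp_elts ==> height y \<le> gap A y"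
proof -
  have fin: "finite ((\<lambda>A. gap A y) ` near y 2)" using finite_near[OF y] by blast
  have ne: "(\<lambda>A. gap A y) ` near y 2 \<noteq> {}" by (auto simp: near_def)
  show "\<exists>A\<in>insert id cusp_elts. height y = gap A y"
    using Min_in[OF fin ne] near_sub unfolding height_def by blast
  have 0: "height y \<le> c0" unfolding height_def using fin by (intro Min_le) (auto simp: near_def gap_def)
  show "height y \<le> gap A y" if A: "A \<in> insert id cusp_elts"
  proof (cases "A \<in> near y 2")
    case True then show ?thesis unfolding height_def using fin by (intro Min_le) auto
  next
    case False
    then have "c0 < disp A y - 1" "A \<noteq> id" using near_mem[of A y y] A y by (force simp: near_def)+
    then show ?thesis using 0 by (simp add: gap_def)
  qed
qed

lemma height_pos: "y \<in> Hyp ==> 0 < height y"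
  using height_props(1) gap_pos by force

lemma height_le: "y \<in> Hyp ==> height y \<le> c0"
  using height_props(2)[of y id] by (simp add: gap_def)

lemma height_local:
  assumes y0: "y0 \<in> Hyp" and y: "y \<in> hball y0 1" shows "height y = Min ((\<lambda>A. gap A y) ` near y0 2)"
proof -
  have yH: "y \<in> Hyp" using y by (simp add: mem_hball)
  have fin: "finite ((\<lambda>A. gap A y) ` near y0 2)" using finite_near[OF y0] by blast
  obtain A where A: "A \<in> insert id cusp_elts" "height y = gap A y" using height_props(1)[OF yH] by blast
  have "A \<in> near y0 2"
  proof (cases "A = id")
    case False
    then show ?thesis using A height_le[OF yH] near_mem[OF _ y0 y] by (auto simp: gap_def)
  qed (simp add: near_def)
  then have "height y \<in> (\<lambda>A. gap A y) ` near y0 2" using A(2) by blast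
  moreover have "height y \<le> z" if "z \<in> (\<lambda>A. gap A y) ` near y0 2" for z
    using that near_sub height_props(2)[OF yH] by blast
  ultimately show ?thesis using Min_eqI[OF fin] by metis
qed

lemma continuous_on_height: "continuous_on Hyp height"
proof -
  have "(height \<longlongrightarrow> height y0) (at y0 within Hyp)" if y0: "y0 \<in> Hyp" for y0
  proof -
    have "continuous_on Hyp (\<lambda>y. Min ((\<lambda>A. gap A y) ` near y0 2))"
    proof (rule continuous_on_Min[OF finite_near[OF y0]])
      show "near y0 2 \<noteq> {}" by (simp add: near_def)
      fix A assume "A \<in> near y0 2"
      then have "A = id \<or> isoH A" using near_sub cusp_elts(3) by blast
      then show "continuous_on Hyp (gap A)"
        unfolding gap_def[abs_def] by (cases "A = id") (auto intro!: continuous_intros continuous_on_disp)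
    qed
    then have "((\<lambda>y. Min ((\<lambda>A. gap A y) ` near y0 2)) \<longlongrightarrow> height y0) (at y0 within Hyp)"
      using y0 height_local[OF y0, of y0] by (simp add: continuous_on_def)
    moreover have "\<forall>\<^sub>F y in at y0 within Hyp. Min ((\<lambda>A. gap A y) ` near y0 2) = height y"
      by (rule eventually_mono[OF eventually_hball[OF y0, of 1]]) (simp_all add: height_local[OF y0])
    ultimately show ?thesis using Lim_transform_eventually by blast
  qed
  then show ?thesis by (simp add: continuous_on_def)
qed

text \<open>The common ideal point of all cusp elements that move \<open>y\<close> little. It exists
  by \<open>same_par\<close>, and has a meaning only where there is such an element.\<close>

definition dir :: "'v => 'v" where "dir y = (SOME v. null v \<and> (\<forall>A\<in>cusp_elts. disp A y - 1 \<le> c0 --> par A v))"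

lemma dir: assumes y: "y \<in> Hyp" and A0: "A0 \<in> cusp_elts" "disp A0 y - 1 \<le> c0"
  shows "null (dir y)" "A \<in> cusp_elts ==> disp A y - 1 \<le> c0 ==> par A (dir y)"
proof -
  obtain v where v: "par A0 v" using A0 by (auto simp: cusp_elts_def)
  have "par A v" if "A \<in> cusp_elts" "disp A y - 1 \<le> c0" for A
    using same_par[OF y cusp_elts(1,2)[OF A0(1)] cusp_elts_small[OF A0(1) y A0(2)] cusp_elts(1,2)[OF that(1)] cusp_elts_small[OF that(1) y that(2)] v] .
  then have "null v \<and> (\<forall>A\<in>cusp_elts. disp A y - 1 \<le> c0 --> par A v)" using v by (auto simp: par_def)
  then have "null (dir y) \<and> (\<forall>A\<in>cusp_elts. disp A y - 1 \<le> c0 --> par A (dir y))" unfolding dir_def by (rule someI)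
  then show "null (dir y)" "A \<in> cusp_elts ==> disp A y - 1 \<le> c0 ==> par A (dir y)" by blast+
qed

text \<open>The least value of \<open>disp A y - 1\<close> grows by the factor
  \<open>exp (2 * s)\<close> under the flow; this is the time at which it reaches
  \<open>c0\<close>.\<close>

definition push_time :: "'v => real" where "push_time y = ln (c0 / height y) / 2"

definition push :: "'v => 'v" where "push y = (if height y < c0 then flow (dir y) (push_time y) y else y)"

definition outside :: "'v set" where "outside = {y \<in> Hyp. \<forall>A\<in>cusp_elts. c0 \<le> disp A y - 1}"

lemma height_outside: "y \<in> Hyp ==> y \<in> outside \<longleftrightarrow> height y = c0"
  using height_props[of y] height_le[of y] cusp_elts(2) unfolding outside_def gap_def by (fastforce split: if_splits)

lemma exp_push_time: "y \<in> Hyp ==> exp (2 * push_time y) = c0 / height y"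
  using height_pos[of y] by (simp add: push_time_def c0_def)

lemma continuous_on_push_time: "continuous_on Hyp push_time"
  unfolding push_time_def
  by (intro continuous_intros continuous_on_height) (use height_pos in \<open>force simp: c0_def\<close>)+

lemma height_attained:
  assumes y: "y \<in> Hyp" "height y < c0"
  obtains A where "A \<in> cusp_elts" "height y = disp A y - 1" "disp A y - 1 \<le> c0" "par A (dir y)" "null (dir y)"
proof -
  obtain A where A: "A \<in> insert id cusp_elts" "height y = gap A y" using height_props(1)[OF y(1)] by blast
  then have "A \<in> cusp_elts" "height y = disp A y - 1" using y(2) by (auto simp: gap_def split: if_splits)
  then show ?thesis using that dir[OF y(1)] y(2) by auto
qed

text \<open>An element that is short at the pushed point has the same ideal point as the element
  attaining the height at \<open>y\<close>, whose value there is exactly \<open>c0\<close>. So it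
  was scaled by the same factor, and would have been below the minimum at \<open>y\<close>.\<close>

lemma push_outside: assumes y: "y \<in> Hyp" shows "push y \<in> outside" "y \<in> outside ==> push y = y"
proof -
  show "y \<in> outside ==> push y = y" using height_outside[OF y] by (simp add: push_def)
  show "push y \<in> outside"
  proof (cases "height y < c0")
    case False
    then have "height y = c0" using height_le[OF y] by simp
    then show ?thesis using height_outside[OF y] by (simp add: push_def)
  next
    case True
    obtain A0 where A0: "A0 \<in> cusp_elts" "height y = disp A0 y - 1" "disp A0 y - 1 \<le> c0" "par A0 (dir y)" "null (dir y)"
      using height_attained[OF y True] .
    define z where "z = flow (dir y) (push_time y) y"
    have z: "z \<in> Hyp" "push y = z" using flow_Hyp[OF A0(5) y] True by (simp_all add: z_def push_def)
    have d: "disp A z - 1 = c0 / height y * (disp A y - 1)" if "A \<in> cusp_elts" "par A (dir y)" for A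
      using flow_disp[OF cusp_elts(3)[OF that(1)] that(2) y] exp_push_time[OF y] by (simp add: z_def)
    have d0: "disp A0 z - 1 \<le> c0" using d[OF A0(1,4)] A0(2) height_pos[OF y] by simp
    have "c0 \<le> disp A z - 1" if A: "A \<in> cusp_elts" for A
    proof (rule ccontr)
      assume n: "\<not> c0 \<le> disp A z - 1"
      then have Az: "disp A z - 1 \<le> c0" by simp
      have "par A (dir y)"
        using same_par[OF z(1) cusp_elts(1,2)[OF A0(1)] cusp_elts_small[OF A0(1) z(1) d0] cusp_elts(1,2)[OF A] cusp_elts_small[OF A z(1) Az] A0(4)] .
      then have "disp A z - 1 = c0 / height y * (disp A y - 1)" using d A by blast
      moreover have "height y \<le> disp A y - 1" using height_props(2)[OF y, of A] A cusp_elts(2)[OF A] by (simp add: gap_def)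
      moreover have "c0 = c0 / height y * height y" using height_pos[OF y] by simp
      moreover have "0 \<le> c0 / height y" using height_pos[OF y] by (simp add: c0_def)
      ultimately have "c0 \<le> disp A z - 1" using mult_left_mono by metis
      then show False using n by simp
    qed
    then show ?thesis using z by (simp add: outside_def)
  qed
qed

text \<open>Where the height is below \<open>c0\<close>, the direction is locally constant, because
  the element attaining the height remains short. Where it equals \<open>c0\<close>, the direction
  may vary, but only among finitely many ideal points, and the pushing time tends to 0.\<close>

lemma continuous_on_push: "continuous_on Hyp push"
proof -
  have "(push \<longlongrightarrow> push y0) (at y0 within Hyp)" if y0: "y0 \<in> Hyp" for y0
  proof (cases "height y0 < c0")
    case True
    obtain A0 where A0: "A0 \<in> cusp_elts" "height y0 = disp A0 y0 - 1" "disp A0 y0 - 1 \<le> c0" "par A0 (dir y0)" "null (dir y0)"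
      using height_attained[OF y0 True] .
    have "(disp A0 \<longlongrightarrow> disp A0 y0) (at y0 within Hyp)"
      using continuous_on_disp[OF cusp_elts(3)[OF A0(1)], of Hyp] y0 by (simp add: continuous_on_def)
    moreover have "disp A0 y0 < 1 + c0" using A0(2) True by simp
    ultimately have "\<forall>\<^sub>F y in at y0 within Hyp. disp A0 y < 1 + c0" by (rule order_tendstoD(2))
    moreover have "\<forall>\<^sub>F y in at y0 within Hyp. y \<in> Hyp" by (simp add: eventually_at_filter)
    ultimately have "\<forall>\<^sub>F y in at y0 within Hyp. flow (dir y0) (push_time y) y = push y"
    proof eventually_elim
      case (elim y)
      have "height y \<le> disp A0 y - 1" using height_props(2)[OF elim(2), of A0] A0(1) cusp_elts(2)[OF A0(1)] by (simp add: gap_def)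
      then have "height y < c0" using elim(1) by simp
      moreover have "par A0 (dir y)" using dir(2)[OF elim(2) A0(1) _ A0(1)] elim(1) by simp
      then have "dir y = dir y0" using par_unique[OF cusp_elts(3,4)[OF A0(1)] A0(4)] by blast
      ultimately show ?case by (simp add: push_def)
    qed
    moreover have "((\<lambda>y. flow (dir y0) (push_time y) y) \<longlongrightarrow> push y0) (at y0 within Hyp)"
      using continuous_on_flow[OF A0(5) continuous_on_push_time] y0 True by (simp add: continuous_on_def push_def)
    ultimately show ?thesis using Lim_transform_eventually by blast
  next
    case False
    then have h0: "height y0 = c0" using height_le[OF y0] by simp
    then have p0: "push y0 = y0" "push_time y0 = 0" by (simp_all add: push_def push_time_def c0_def)
    define V where "V = {v. null v \<and> (\<exists>A\<in>near y0 2. A \<in> cusp_elts \<and> par A v)}"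
    have "V \<subseteq> (\<lambda>A. SOME v. par A v) ` near y0 2"
    proof
      fix v assume "v \<in> V"
      then obtain A where A: "A \<in> near y0 2" "A \<in> cusp_elts" "par A v" by (auto simp: V_def)
      have "par A (SOME v. par A v)" using A(3) by (rule someI)
      then have "v = (SOME v. par A v)" using par_unique[OF cusp_elts(3,4)[OF A(2)]] A(3) by blast
      then show "v \<in> (\<lambda>A. SOME v. par A v) ` near y0 2" using A(1) by blast
    qed
    then have V: "finite V" using finite_near[OF y0] finite_surj by blast
    define h where "h i y = (case i of None => y | Some v => flow v (push_time y) y)" for i y
    show ?thesis
    proof (rule tendsto_finite_choice[where I = "insert None (Some ` V)" and h = h])
      show "finite (insert None (Some ` V))" using V by simp
      fix i assume "i \<in> insert None (Some ` V)"
      then show "(h i \<longlongrightarrow> push y0) (at y0 within Hyp)"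
      proof
        assume "i = None"
        moreover have "h None = (\<lambda>y. y)" by (rule ext) (simp add: h_def)
        ultimately show ?thesis by (simp add: p0(1) tendsto_ident_at)
      next
        assume "i \<in> Some ` V"
        then obtain v where v: "v \<in> V" "i = Some v" by blast
        have "((\<lambda>y. flow v (push_time y) y) \<longlongrightarrow> flow v (push_time y0) y0) (at y0 within Hyp)"
          using continuous_on_flow[OF _ continuous_on_push_time, of v] v y0 by (simp add: continuous_on_def V_def)
        moreover have "h (Some v) = (\<lambda>y. flow v (push_time y) y)" by (rule ext) (simp add: h_def)
        ultimately show ?thesis by (simp add: v(2) p0)
      qed
    next
      show "\<forall>\<^sub>F y in at y0 within Hyp. \<exists>i\<in>insert None (Some ` V). push y = h i y"
        using eventually_hball[OF y0, of 1]
      proof (rule eventually_mono)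
        fix y assume y: "y \<in> hball y0 1"
        then have yH: "y \<in> Hyp" by (simp add: mem_hball)
        show "\<exists>i\<in>insert None (Some ` V). push y = h i y"
        proof (cases "height y < c0")
          case True
          obtain A where A: "A \<in> cusp_elts" "height y = disp A y - 1" "disp A y - 1 \<le> c0" "par A (dir y)" "null (dir y)"
            using height_attained[OF yH True] .
          have "dir y \<in> V" unfolding V_def using A near_mem[OF A(1) y0 y A(3)] by blast
          then show ?thesis using True by (intro bexI[of _ "Some (dir y)"]) (auto simp: h_def push_def)
        qed (intro bexI[of _ None], auto simp: h_def push_def)
      qed simp
    qed
  qed
  then show ?thesis by (simp add: continuous_on_def)
qed

end

section \<open>Tubes and finite generation\<close>

text \<open>Flowing towards the ideal point makes the displacement tend to 1, while
  \<open>dnorm\<close> stays nonnegative.\<close>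

lemma par_trace_le:
  fixes A :: "'v::lorentz_space => 'v"
  assumes A: "isoH A" "par A v" shows "tr A \<le> real DIM('v)"
proof -
  define D where "D = 2 * (real DIM('v) - tr A)"
  define b where "b = disp A tau - 1"
  have v: "null v" using A(2) by (simp add: par_def)
  have "0 \<le> 4 * ((1 + x * b)\<^sup>2 - 1) + D" if x: "0 < x" for x
  proof -
    define s where "s = ln x / 2"
    have "disp A (flow v s tau) = 1 + x * b"
      using flow_disp[OF A hyp0_Hyp, of s] x by (simp add: s_def b_def)
    then show ?thesis using dnorm_nonneg[OF A(1) flow_Hyp[OF v hyp0_Hyp], of s] by (simp add: dnorm_def D_def)
  qed
  then have "\<forall>\<^sub>F x in at_right 0. 0 \<le> 4 * ((1 + x * b)\<^sup>2 - 1) + D" by (simp add: eventually_at_filter)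
  moreover have "((\<lambda>x. 4 * ((1 + x * b)\<^sup>2 - 1) + D) \<longlongrightarrow> 4 * ((1 + 0 * b)\<^sup>2 - 1) + D) (at_right 0)"
    by (intro tendsto_intros)
  ultimately have "0 \<le> 4 * ((1 + 0 * b)\<^sup>2 - 1) + D" by (intro tendsto_lowerbound) auto
  then show ?thesis by (simp add: D_def)
qed

lemma perp_plane_exists:
  fixes v v' :: "'v::lorentz_space"
  assumes "3 \<le> DIM('v)" obtains e where "e \<noteq> 0" "lor e v = 0" "lor e v' = 0"
proof -
  have "dim {lflip v, lflip v'} \<le> card {lflip v, lflip v'}" by (rule dim_le_card') simp
  also have "\<dots> \<le> 2" by (rule card_insert_le_m1) auto
  finally have "dim {lflip v, lflip v'} < DIM('v)" using assms by simp
  then obtain e where e: "e \<noteq> 0" "\<And>y. y \<in> span {lflip v, lflip v'} ==> orthogonal e y"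
    using orthogonal_to_subspace_exists by blast
  have "orthogonal e (lflip v)" "orthogonal e (lflip v')" by (rule e(2), simp add: span_base)+
  then show ?thesis using that e(1) by (simp add: lflip(2) orthogonal_def)
qed

text \<open>The point \<open>q\<close> is the foot of the perpendicular from \<open>y\<close> to the
  geodesic with ends \<open>v\<close> and \<open>v'\<close>, and \<open>r\<close> is the distance.
  If \<open>y\<close> is on that geodesic a normal direction has to be chosen, which is where
  dimension 3 enters.\<close>

lemma plane_coordinates:
  fixes v v' :: "'v::lorentz_space"
  assumes dim: "3 \<le> DIM('v)" and v: "null v" "null v'" "v \<noteq> v'" and y: "y \<in> Hyp"
  obtains a b q e r where "q = a *\<^sub>R v + b *\<^sub>R v'" "q \<in> Hyp" "lor e v = 0" "lor e v' = 0" "lor e e = 1" "0 \<le> r" "y = geo q e r"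
proof -
  define m where "m = lor v v'"
  have m: "m < 0" using null_lor[OF v] by (simp add: m_def)
  have n: "lor y v < 0" "lor y v' < 0" using null_lor_Hyp v y by blast+
  define a where "a = lor y v' / m" define b where "b = lor y v / m"
  have ab: "0 < a" "0 < b" using n m by (simp_all add: a_def b_def divide_neg_neg)
  define y0 where "y0 = a *\<^sub>R v + b *\<^sub>R v'"
  define e0 where "e0 = y - y0"
  have e0: "lor e0 v = 0" "lor e0 v' = 0"
    using m v by (simp_all add: e0_def y0_def lor_simps null_def m_def[symmetric] lor_commute[of v' v] a_def b_def)
  define q where "q = nrm y0"
  have q: "q \<in> Hyp" using null_sum_Hyp[OF v ab] by (simp add: q_def y0_def)
  define k where "k = sqrt (- lor y0 y0)"
  have "lor y0 y0 = 2 * (a * b * m)" using v by (simp add: y0_def lor_simps null_def m_def lor_commute[of v' v])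
  then have l0: "lor y0 y0 < 0" using ab m by (simp add: mult_pos_neg)
  then have k: "0 < k" "k\<^sup>2 = - lor y0 y0" by (simp_all add: k_def)
  have y0q: "y0 = k *\<^sub>R q" using k(1) by (simp add: q_def nrm_def k_def[symmetric])
  have qv: "q = (a / k) *\<^sub>R v + (b / k) *\<^sub>R v'" unfolding q_def nrm_def k_def[symmetric] by (simp add: y0_def scaleR_add_right)
  have perp_q: "lor f q = 0" if "lor f v = 0" "lor f v' = 0" for f using that by (simp add: qv lor_simps)
  have yy: "y = k *\<^sub>R q + e0" by (simp add: e0_def y0q)
  have "lor y y = - k\<^sup>2 + lor e0 e0"
    using perp_q[OF e0] HypD(1)[OF q] by (simp add: yy lor_simps lor_commute[of q e0] power2_eq_square)
  then have ks: "k\<^sup>2 = 1 + lor e0 e0" using HypD(1)[OF y] by simp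
  show ?thesis
  proof (cases "e0 = 0")
    case True
    then have "k\<^sup>2 = 1" using ks by (simp add: lor_inner)
    then have "k = 1" using k(1) by (simp add: power2_eq_1_iff)
    then have yq: "y = geo q e 0" for e using yy True by simp
    obtain e where e: "e \<noteq> 0" "lor e v = 0" "lor e v' = 0" using perp_plane_exists[OF dim] .
    have p: "0 < lor e e" using perp_pos[OF _ _ perp_q[OF e(2,3)] e(1)] HypD[OF q] by simp
    define f where "f = (1 / sqrt (lor e e)) *\<^sub>R e"
    have "lor f v = 0" "lor f v' = 0" "lor f f = 1" using e p by (simp_all add: f_def lor_simps)
    then show ?thesis using that[OF qv q _ _ _ _ yq, of f] by simp
  next
    case False
    then have p: "0 < lor e0 e0" using perp_pos[OF _ _ perp_q[OF e0]] HypD[OF q] by simp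
    define s where "s = sqrt (lor e0 e0)"
    have s: "0 < s" "s\<^sup>2 = lor e0 e0" using p by (simp_all add: s_def)
    define f where "f = (1 / s) *\<^sub>R e0"
    have "s * s = lor e0 e0" using s(2) by (simp add: power2_eq_square)
    then have f: "lor f v = 0" "lor f v' = 0" "lor f f = 1" using e0 s(1) p by (simp_all add: f_def)
    have "cosh (arsinh s) = sqrt (s\<^sup>2 + 1)" by (rule cosh_arsinh_real)
    also have "\<dots> = k" using ks s k(1) by (simp add: add.commute real_sqrt_unique)
    finally have "y = geo q f (arsinh s)" using s(1) by (simp add: geo_def f_def yy)
    moreover have "0 \<le> arsinh s" using s(1) by (metis less_imp_le sinh_arsinh_real sinh_real_nonneg_iff)
    ultimately show ?thesis using that[OF qv q f] by blast
  qed
qed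

section \<open>Loxodromic isometries in coordinates about their axis\<close>

context
  fixes B :: "'v::lorentz_space => 'v" and v v' q e :: 'v and a b :: real
  assumes B: "isoH B" "nofix B" and l: "lox B v v'"
    and q: "q = a *\<^sub>R v + b *\<^sub>R v'" "q \<in> Hyp" and e: "lor e v = 0" "lor e v' = 0" "lor e e = 1"
begin

text \<open>Away from the axis along a normal geodesic, \<open>disp\<close> grows with the square of
  \<open>sinh\<close>. The coefficient is positive because \<open>lor e (B e)\<close> is at most 1
  while \<open>B\<close> moves \<open>q\<close>.\<close>

lemma lox_radial:
  obtains k where "0 < k" "1 < disp B q" "\<And>t. disp B (geo q e t) = disp B q + k * (sinh t)\<^sup>2"
proof -
  obtain m where m: "0 < m" "B v = m *\<^sub>R v" "B v' = (1 / m) *\<^sub>R v'" using l by (auto simp: lox_def)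
  note lin = linear_add[OF isoH_linear[OF B(1)]] linear_scale[OF isoH_linear[OF B(1)]]
  have eq: "lor e q = 0" "lor q e = 0" "lor e (B q) = 0" using e by (simp_all add: q(1) lin m lor_simps lor_commute[of v] lor_commute[of v'])
  have "lor (B v) (B e) = 0" "lor (B v') (B e) = 0" using e isoH_lor[OF B(1)] by (simp_all add: lor_commute)
  then have "lor v (B e) = 0" "lor v' (B e) = 0" using m by simp_all
  then have qe: "lor q (B e) = 0" "lor (B e) q = 0" by (simp_all add: q(1) lor_simps lor_commute[of "B e"])
  define k where "k = disp B q - lor e (B e)"
  have 1: "1 < disp B q" using disp_ge[OF B(1) q(2)] disp_eq_1[OF B(1) q(2)] B(2)[unfolded nofix_def, rule_format, OF q(2)] by linarith
  have "(lor e (B e))\<^sup>2 \<le> lor e e * lor (B e) (B e)" using perp_Cauchy_Schwarz[OF q(2) eq(1) qe(2)] .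
  then have "(lor e (B e))\<^sup>2 \<le> 1\<^sup>2" using e(3) isoH_lor[OF B(1)] by simp
  then have "lor e (B e) \<le> 1" by (rule power2_le_imp_le) simp
  then have k: "0 < k" using 1 by (simp add: k_def)
  have "disp B (geo q e t) = disp B q + k * (sinh t)\<^sup>2" for t
  proof -
    have "disp B (geo q e t) = (cosh t)\<^sup>2 * disp B q - (sinh t)\<^sup>2 * lor e (B e)"
      by (simp add: disp_def geo_def lin lor_simps eq qe power2_eq_square)
    also have "\<dots> = disp B q + k * (sinh t)\<^sup>2" by (simp add: k_def cosh_square_eq algebra_simps)
    finally show ?thesis .
  qed
  then show ?thesis using that k 1 by blast
qed

lemma lox_dnorm_mono: assumes "0 \<le> r" "r \<le> t" shows "dnorm B (geo q e r) \<le> dnorm B (geo q e t)"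
proof -
  obtain k where k: "0 < k" "1 < disp B q" "\<And>t. disp B (geo q e t) = disp B q + k * (sinh t)\<^sup>2" using lox_radial by blast
  have "(sinh r)\<^sup>2 \<le> (sinh t)\<^sup>2" using assms by (intro power_mono) auto
  then have "disp B (geo q e r) \<le> disp B (geo q e t)" "0 \<le> disp B (geo q e r)" using k by simp_all
  then have "(disp B (geo q e r))\<^sup>2 \<le> (disp B (geo q e t))\<^sup>2" by (intro power_mono)
  then show ?thesis by (simp add: dnorm_def)
qed

text \<open>The displacement at which \<open>dnorm\<close> equals \<open>d\<close> is
  \<open>D\<close>; the formula of \<open>lox_radial\<close> is then solved for
  \<open>t\<close>.\<close>

lemma lox_dnorm_reach:
  assumes r: "0 \<le> r" "dnorm B (geo q e r) < d" obtains t where "r \<le> t" "dnorm B (geo q e t) = d"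
proof -
  obtain k where k: "0 < k" "1 < disp B q" "\<And>t. disp B (geo q e t) = disp B q + k * (sinh t)\<^sup>2" using lox_radial by blast
  define c where "c = 2 * (real DIM('v) - tr B)"
  define D where "D = sqrt (1 + (d - c) / 4)"
  have ge: "disp B q \<le> disp B (geo q e r)" using k by simp
  have dr: "4 * ((disp B (geo q e r))\<^sup>2 - 1) + c < d" using r(2) by (simp add: dnorm_def c_def)
  then have dr': "(disp B (geo q e r))\<^sup>2 < 1 + (d - c) / 4" by (simp add: field_simps)
  then have "0 < 1 + (d - c) / 4" using zero_le_power2[of "disp B (geo q e r)"] by linarith
  then have D: "D\<^sup>2 = 1 + (d - c) / 4" by (simp add: D_def)
  have "disp B (geo q e r) < D" unfolding D_def using dr' by (rule real_less_rsqrt)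
  then have Dq: "disp B q < D" using ge by simp
  define t where "t = arsinh (sqrt ((D - disp B q) / k))"
  have "(sinh t)\<^sup>2 = (D - disp B q) / k" using Dq k(1) by (simp add: t_def)
  then have "disp B (geo q e t) = D" using k(1,3) by simp
  then have "dnorm B (geo q e t) = 4 * (D\<^sup>2 - 1) + c" by (simp add: dnorm_def c_def)
  also have "\<dots> = d" unfolding D by (simp add: field_simps)
  finally have dt: "dnorm B (geo q e t) = d" .
  have "0 \<le> sinh t" using Dq k(1) by (simp add: t_def)
  then have "0 \<le> t" by simp
  then have "r \<le> t" using lox_dnorm_mono[of t r] dt r(2) by force
  then show ?thesis using that dt by blast
qed

text \<open>As \<open>e\<close> is orthogonal to the plane of the axis, \<open>cosh t\<close> splits
  off the product of the two points, and the remaining factor is at least 1.\<close>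

lemma lox_axis_distance:
  assumes p: "p = c *\<^sub>R v + d *\<^sub>R v'" "p \<in> Hyp" and t: "0 \<le> t" shows "t \<le> hdist (geo q e t) p"
proof -
  have eq: "lor e q = 0" "lor e p = 0" using e by (simp_all add: q(1) p(1) lor_simps)
  have gH: "geo q e t \<in> Hyp" using geo_Hyp q(2) eq(1) e(3) by blast
  have "cosh t * 1 \<le> cosh t * (- lor q p)" using Hyp_lor_le[OF q(2) p(2)] by (intro mult_left_mono) auto
  also have "\<dots> = - lor (geo q e t) p" by (simp add: geo_def lor_simps eq)
  also have "\<dots> = cosh (hdist (geo q e t) p)" using cosh_hdist[OF gH p(2)] by simp
  finally show ?thesis using t hdist_nonneg[OF gH p(2)] by (simp add: cosh_real_nonneg_le_iff)
qed

end

lemma lox_conj: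
  assumes h: "isoH h" and A0: "isoH A" and l: "lox A v v'"
  obtains u u' c c' where "lox (h \<circ> A \<circ> invf h) u u'" "0 < c" "0 < c'" "h v = c *\<^sub>R u" "h v' = c' *\<^sub>R u'"
proof -
  obtain m where m: "0 < m" "m \<noteq> 1" "A v = m *\<^sub>R v" "A v' = (1 / m) *\<^sub>R v'" and n: "null v" "null v'" "v \<noteq> v'"
    using l by (auto simp: lox_def)
  obtain c u where u: "0 < c" "null u" "h v = c *\<^sub>R u" using image_null[OF h n(1)] .
  obtain c' u' where u': "0 < c'" "null u'" "h v' = c' *\<^sub>R u'" using image_null[OF h n(2)] .
  have key: "(h \<circ> A \<circ> invf h) z = m *\<^sub>R z" if "0 < c" "h w = c *\<^sub>R z" "A w = m *\<^sub>R w" for c z w and m :: real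
  proof -
    have z: "z = h ((1 / c) *\<^sub>R w)" using that linear_scale[OF isoH_linear[OF h]] by simp
    have "invf h z = (1 / c) *\<^sub>R w" using isoH_inv_apply(1)[OF h, of "(1 / c) *\<^sub>R w"] z by simp
    then have "(h \<circ> A \<circ> invf h) z = h (m *\<^sub>R ((1 / c) *\<^sub>R w))"
      using that(3) linear_scale[OF isoH_linear[OF A0], of "1 / c" w] by simp
    also have "\<dots> = m *\<^sub>R z" unfolding z by (rule linear_scale[OF isoH_linear[OF h]])
    finally show ?thesis .
  qed
  have "u \<noteq> u'"
  proof
    assume "u = u'"
    then have "h v' = h ((c' / c) *\<^sub>R v)" using u u' linear_scale[OF isoH_linear[OF h]] by simp
    then have "v' = (c' / c) *\<^sub>R v" using isoH_inv_apply(1)[OF h] by metis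
    then show False using null_ray[OF n(1,2)] n(3) by metis
  qed
  then have "lox (h \<circ> A \<circ> invf h) u u'"
    using key[OF u(1,3) m(3)] key[OF u'(1,3) m(4)] u u' m(1,2) unfolding lox_def by blast
  then show ?thesis using that u u' by blast
qed

lemma lox_unique: "isoH A ==> lox A v v' ==> lox A u u' ==> (u = v \<and> u' = v') \<or> (u = v' \<and> u' = v)"
proof -
  assume A: "isoH A" "lox A v v'" "lox A u u'"
  obtain m where m: "null u" "null u'" "u \<noteq> u'" "A u = m *\<^sub>R u" "A u' = (1 / m) *\<^sub>R u'" using A(3) by (auto simp: lox_def)
  show ?thesis using lox_eigen[OF A(1,2) m(1,4)] lox_eigen[OF A(1,2) m(2,5)] m(3) by blast
qed

lemma hdist_disp_le: assumes "isoH A" "y \<in> Hyp" "dnorm A y \<le> 1 / 64" shows "hdist y (A y) \<le> arcosh (9 / 8)"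
proof -
  have "sqrt (dnorm A y) \<le> sqrt ((1 / 8)\<^sup>2)" using assms(3) by (intro real_sqrt_le_mono) (simp add: power2_eq_square)
  then have "disp A y \<le> 9 / 8" using dnorm_disp[OF assms(1,2)] by simp
  then show ?thesis using hdist_le_iff[OF assms(2) isoH_Hyp[OF assms(1,2)], of "arcosh (9 / 8)"] by (simp add: disp_def)
qed

section \<open>Leaving the tubes, and generators from the connected complement of the cusps\<close>

context kleinian begin

text \<open>The point moves straight away from the axis until the last of the finitely many elements
  that are short at \<open>y\<close> has reached \<open>c0\<close>. No other element can be short
  there: it would have the same axis, and by monotonicity it would already be short at
  \<open>y\<close>.\<close>

lemma tube_exit:
  assumes y: "y \<in> Hyp" and B0: "B0 \<in> G" "B0 \<noteq> id" "dnorm B0 y < c0" "lox B0 v v'"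
  obtains y' t B where "y' \<in> Hyp" "hdist y y' \<le> t" "B \<in> G" "B \<noteq> id" "dnorm B y' = c0" "lox B v v'"
    "\<And>A. A \<in> G ==> A \<noteq> id ==> c0 \<le> dnorm A y'"
    "\<And>p c d. p \<in> Hyp ==> p = c *\<^sub>R v + d *\<^sub>R v' ==> t \<le> hdist y' p"
proof -
  have small: "x < c0 ==> x \<le> 1 / 64" "c0 \<le> 1 / 64" for x :: real by (simp_all add: c0_def)
  have v: "null v" "null v'" "v \<noteq> v'" using B0(4) by (auto simp: lox_def)
  obtain a b q e r where q: "q = a *\<^sub>R v + b *\<^sub>R v'" "q \<in> Hyp" and e: "lor e v = 0" "lor e v' = 0" "lor e e = 1"
    and r: "0 \<le> r" "y = geo q e r" by (rule plane_coordinates[OF dim3 v y])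
  have eq: "lor e q = 0" using e by (simp add: q(1) lor_simps)
  define S where "S = {B \<in> G. B \<noteq> id \<and> dnorm B y < c0}"
  have fin: "finite S" by (rule finite_subset[OF _ finite_small[OF y]]) (use small in \<open>auto simp: S_def\<close>)
  have lS: "lox B v v'" "isoH B" "nofix B" if "B \<in> S" for B
    using same_lox[OF y B0(1,2) small(1)[OF B0(3)] _ _ small(1) B0(4)] nofix_small[OF _ _ y small(1)] iso that
    by (auto simp: S_def)
  have "\<exists>t. \<forall>B\<in>S. r \<le> t B \<and> dnorm B (geo q e (t B)) = c0"
  proof (rule bchoice, rule ballI)
    fix B assume B: "B \<in> S"
    have "dnorm B (geo q e r) < c0" using B r by (simp add: S_def)
    then show "\<exists>t. r \<le> t \<and> dnorm B (geo q e t) = c0" using lox_dnorm_reach[OF lS(2,3,1)[OF B] q e r(1)] by blast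
  qed
  then obtain t where t: "\<And>B. B \<in> S ==> r \<le> t B" "\<And>B. B \<in> S ==> dnorm B (geo q e (t B)) = c0" by blast
  have ne: "S \<noteq> {}" using B0 by (auto simp: S_def)
  have "Max (t ` S) \<in> t ` S" using fin ne by (intro Max_in) auto
  then obtain B where B: "B \<in> S" "Max (t ` S) = t B" by blast
  define T where "T = t B"
  have mx: "t C \<le> T" if "C \<in> S" for C using that fin Max_ge[of "t ` S" "t C"] B(2) by (simp add: T_def)
  have T: "0 \<le> T" "r \<le> T" using t(1)[OF B(1)] r(1) by (simp_all add: T_def)
  define y' where "y' = geo q e T"
  have y': "y' \<in> Hyp" unfolding y'_def by (rule geo_Hyp[OF q(2) eq e(3)])
  have By: "dnorm B y' = c0" using t(2)[OF B(1)] by (simp add: y'_def T_def)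
  have BG: "B \<in> G" "B \<noteq> id" using B(1) by (auto simp: S_def)
  have thick: "c0 \<le> dnorm A y'" if A: "A \<in> G" "A \<noteq> id" for A
  proof (rule ccontr)
    assume n: "\<not> c0 \<le> dnorm A y'"
    have s: "dnorm B y' \<le> 1 / 64" "dnorm A y' \<le> 1 / 64" using By n small by auto
    have l: "lox A v v'" by (rule same_lox[OF y' BG s(1) A s(2) lS(1)[OF B(1)]])
    note c = iso[OF A(1)] nofix_small[OF A y' s(2)] l q e
    have "dnorm A y \<le> dnorm A y'" using lox_dnorm_mono[OF c r(1) T(2)] by (simp add: r(2) y'_def)
    then have AS: "A \<in> S" using n A by (simp add: S_def)
    have "0 \<le> t A" using t(1)[OF AS] r(1) by simp
    then have "c0 \<le> dnorm A y'" using lox_dnorm_mono[OF c _ mx[OF AS]] t(2)[OF AS] by (simp add: y'_def)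
    then show False using n by simp
  qed
  have ax: "T \<le> hdist y' p" if "p \<in> Hyp" "p = c *\<^sub>R v + d *\<^sub>R v'" for p c d
    using lox_axis_distance[OF lS(2,3,1)[OF B(1)] q e that(2,1) T(1)] by (simp add: y'_def)
  have "hdist y y' \<le> T" using hdist_geo[OF q(2) eq e(3), of r T] r T by (simp add: y'_def)
  then show ?thesis by (rule that[OF y' _ BG By lS(1)[OF B(1)] thick ax])
qed

text \<open>A parabolic element this short would have a trace defect below 1/256 and hence be one of
  the \<open>cusp_elts\<close>, which move the points of \<open>outside\<close> by a definite
  amount.\<close>

lemma outside_lox:
  assumes y: "y \<in> outside" and A: "A \<in> G" "A \<noteq> id" "dnorm A y < c0" obtains v v' where "lox A v v'"
proof -
  have yH: "y \<in> Hyp" using y by (simp add: outside_def)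
  have iA: "isoH A" using iso[OF A(1)] .
  have nf: "nofix A" using nofix_small[OF A(1,2) yH] A(3) by (simp add: c0_def)
  have d1: "1 \<le> disp A y" using disp_ge[OF iA yH] .
  have "\<not> par A v" for v
  proof
    assume p: "par A v"
    have "(disp A y)\<^sup>2 - 1 = (disp A y - 1) * (disp A y + 1)" by (simp add: power2_eq_square algebra_simps)
    moreover have "(disp A y - 1) * 2 \<le> (disp A y - 1) * (disp A y + 1)" using d1 by (intro mult_left_mono) auto
    ultimately have d2: "2 * (disp A y - 1) \<le> (disp A y)\<^sup>2 - 1" by simp
    have t: "tr A \<le> real DIM('v)" using par_trace_le[OF iA p] .
    have dn: "4 * ((disp A y)\<^sup>2 - 1) + 2 * (real DIM('v) - tr A) < c0" using A(3) by (simp add: dnorm_def)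
    then have "real DIM('v) - tr A \<le> 1 / 256" using d1 d2 by (simp add: c0_def)
    then have "A \<in> cusp_elts" using A p by (auto simp: cusp_elts_def)
    then have "c0 \<le> disp A y - 1" using y by (simp add: outside_def)
    then show False using d1 d2 t dn by simp
  qed
  then show ?thesis using par_or_lox[OF iA nf] that by blast
qed

text \<open>From a thin point the tube is left within distance \<open>t\<close>, at a point
  \<open>y'\<close> that some \<open>g\<close> brings near \<open>tau\<close>. The conjugate of
  \<open>B\<close> by \<open>g\<close> is then one of finitely many elements, so its axis passes at
  bounded distance from \<open>tau\<close>; as \<open>y'\<close> is at least \<open>t\<close> away
  from the axis, \<open>t\<close> is bounded.\<close>

lemma outside_cobounded: "\<exists>R. \<forall>y\<in>outside. \<exists>A\<in>G. hdist tau (A y) \<le> R"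
proof -
  have "0 < c0" by (simp add: c0_def)
  then obtain R where R: "\<And>y. y \<in> Hyp ==> (\<And>A. A \<in> G ==> A \<noteq> id ==> c0 \<le> dnorm A y) ==> \<exists>A\<in>G. hdist tau (A y) \<le> R"
    using thick[of c0] by metis
  \<comment> \<open>A displacement of at most \<open>arcosh (9 / 8)\<close> at a point within
    \<open>R\<close> of \<open>tau\<close> amounts to at most this displacement at
    \<open>tau\<close>.\<close>
  define S where "S = {C \<in> G. hdist tau (C tau) \<le> 2 * R + arcosh (9 / 8)}"
  have finS: "finite S" unfolding S_def by (rule discrete) simp
  define axis where "axis C = {p \<in> Hyp. \<exists>v v' c d. lox C v v' \<and> p = c *\<^sub>R v + d *\<^sub>R v'}" for C :: "'v => 'v"
  define P where "P C = (SOME p. p \<in> axis C)" for C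
  have P: "P C \<in> axis C" if "lox C v v'" for C v v'
  proof -
    have n: "null v" "null v'" "v \<noteq> v'" using that by (auto simp: lox_def)
    have "nrm (1 *\<^sub>R v + 1 *\<^sub>R v') \<in> Hyp" using null_sum_Hyp[OF n, of 1 1] by simp
    then have "nrm (1 *\<^sub>R v + 1 *\<^sub>R v') \<in> axis C" using that by (auto simp: axis_def nrm_def scaleR_add_right)
    then show ?thesis unfolding P_def by (rule someI)
  qed
  define D where "D = Max (insert 0 ((\<lambda>C. hdist tau (P C)) ` S))"
  have D: "0 \<le> D" "C \<in> S ==> hdist tau (P C) \<le> D" for C unfolding D_def using finS by (auto intro!: Max_ge)
  have "\<exists>A\<in>G. hdist tau (A y) \<le> R + (R + D)" if y: "y \<in> outside" for y
  proof (cases "\<forall>A\<in>G. A \<noteq> id --> c0 \<le> dnorm A y")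
    case True
    have yH: "y \<in> Hyp" using y by (simp add: outside_def)
    obtain A where A: "A \<in> G" "hdist tau (A y) \<le> R" using R[OF yH] True by blast
    then have "0 \<le> R" using hdist_nonneg[OF hyp0_Hyp isoH_Hyp[OF iso[OF A(1)] yH]] by simp
    then show ?thesis using A D(1) by (intro bexI[of _ A]) auto
  next
    case False
    have yH: "y \<in> Hyp" using y by (simp add: outside_def)
    obtain B0 where B0: "B0 \<in> G" "B0 \<noteq> id" "dnorm B0 y < c0" using False by force
    obtain v v' where l: "lox B0 v v'" using outside_lox[OF y B0] .
    obtain y' t B where y': "y' \<in> Hyp" "hdist y y' \<le> t" and B: "B \<in> G" "B \<noteq> id" "dnorm B y' = c0" "lox B v v'"
      and tk: "\<And>A. A \<in> G ==> A \<noteq> id ==> c0 \<le> dnorm A y'"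
      and ax: "\<And>p c d. p \<in> Hyp ==> p = c *\<^sub>R v + d *\<^sub>R v' ==> t \<le> hdist y' p"
      using tube_exit[OF yH B0 l] by (metis (no_types, lifting))
    obtain g where g: "g \<in> G" "hdist tau (g y') \<le> R" using R[OF y'(1) tk] by blast
    have ig: "isoH g" "isoH B" using iso g B by auto
    define C where "C = g \<circ> B \<circ> invf g"
    have CG: "C \<in> G" unfolding C_def by (intro comp_in inv_in g B)
    have iC: "isoH C" using iso[OF CG] .
    have gy: "g y' \<in> Hyp" "C (g y') = g (B y')" using isoH_Hyp[OF ig(1) y'(1)] isoH_inv_apply(1)[OF ig(1)] by (simp_all add: C_def)
    have "hdist tau (C tau) \<le> hdist (g y') (C (g y')) + 2 * hdist tau (g y')" by (rule isoH_displacement[OF iC hyp0_Hyp gy(1)])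
    also have "hdist (g y') (C (g y')) = hdist y' (B y')" using isoH_hdist[OF ig(1)] gy(2) by simp
    also have "hdist y' (B y') \<le> arcosh (9 / 8)" using hdist_disp_le[OF ig(2) y'(1)] B(3) by (simp add: c0_def)
    finally have CS: "C \<in> S" using g CG by (simp add: S_def)
    obtain u u' m m' where u: "lox C u u'" "0 < m" "0 < m'" "g v = m *\<^sub>R u" "g v' = m' *\<^sub>R u'"
      using lox_conj[OF ig(1,2) B(4)] unfolding C_def by blast
    have "P C \<in> axis C" using P[OF u(1)] .
    then obtain w w' c d where p: "P C \<in> Hyp" "lox C w w'" "P C = c *\<^sub>R w + d *\<^sub>R w'" by (auto simp: axis_def)
    have "\<exists>c d. P C = c *\<^sub>R u + d *\<^sub>R u'" using lox_unique[OF iC u(1) p(2)] p(3) by (metis add.commute)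
    then obtain c d where cd: "P C = c *\<^sub>R u + d *\<^sub>R u'" by blast
    define p0 where "p0 = (c / m) *\<^sub>R v + (d / m') *\<^sub>R v'"
    have gp: "g p0 = P C"
      using u(2-5) linear_add[OF isoH_linear[OF ig(1)]] linear_scale[OF isoH_linear[OF ig(1)]] by (simp add: p0_def cd)
    have p0: "p0 \<in> Hyp" using isoH_Hyp[OF isoH_inv[OF ig(1)] p(1)] isoH_inv_apply(1)[OF ig(1), of p0] gp by simp
    have "t \<le> hdist y' p0" using ax[OF p0 p0_def] .
    also have "\<dots> = hdist (g y') (P C)" using isoH_hdist[OF ig(1), of y' p0] gp by simp
    also have "\<dots> \<le> hdist (g y') tau + hdist tau (P C)" by (rule hdist_triangle[OF gy(1) hyp0_Hyp p(1)])
    also have "\<dots> \<le> R + D" using g(2) D(2)[OF CS] by (simp add: hdist_commute)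
    finally have t: "t \<le> R + D" .
    have "hdist tau (g y) \<le> hdist tau (g y') + hdist y y'" by (rule isoH_hdist_triangle[OF ig(1) hyp0_Hyp yH y'(1)])
    then have "hdist tau (g y) \<le> R + (R + D)" using g(2) y'(2) t by simp
    then show ?thesis using g(1) by blast
  qed
  then show ?thesis by blast
qed

lemma outside_invariant: assumes h: "h \<in> G" and y: "y \<in> outside" shows "h y \<in> outside"
proof -
  have yH: "y \<in> Hyp" using y by (simp add: outside_def)
  have ih: "isoH h" "isoH (invf h)" "invf h \<in> G" using iso h isoH_inv inv_in by blast+
  have ii: "invf (invf h) = h" using isoH_bij[OF ih(1)] by (simp add: inv_inv_eq)
  have "c0 \<le> disp A (h y) - 1" if A: "A \<in> cusp_elts" for A
  proof -
    have AG: "A \<in> G" "A \<noteq> id" "isoH A" using cusp_elts[OF A] by auto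
    obtain v where v: "par A v" "real DIM('v) - tr A \<le> 1 / 256" using A by (auto simp: cusp_elts_def)
    define C where "C = invf h \<circ> A \<circ> h"
    have CG: "C \<in> G" unfolding C_def by (intro comp_in AG h ih)
    obtain u where u: "par C u" using par_conj[OF ih(2) AG(3) v(1)] unfolding C_def ii by blast
    have A_eq: "A = h \<circ> C \<circ> invf h" unfolding C_def by (rule ext) (simp add: isoH_inv_apply[OF ih(1)])
    have "C \<noteq> id"
    proof
      assume "C = id"
      then have "A = id" unfolding A_eq by (intro ext) (simp add: isoH_inv_apply[OF ih(1)])
      then show False using AG(2) by blast
    qed
    moreover have "tr C = tr A" unfolding C_def by (rule tr_conj[OF ih(1) isoH_linear[OF AG(3)]])
    ultimately have "C \<in> cusp_elts" using CG u v by (auto simp: cusp_elts_def)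
    then have "c0 \<le> disp C y - 1" using y by (simp add: outside_def)
    then show ?thesis using disp_conj[OF ih(1), of C y] A_eq by simp
  qed
  then show ?thesis using isoH_Hyp[OF ih(1) yH] by (simp add: outside_def)
qed

text \<open>The translates of a ball about \<open>tau\<close> cover the connected set
  \<open>outside\<close>; passing from one translate to an overlapping one changes the group element
  by a factor in \<open>S\<close>. Generation is stated as containment in every set that contains
  \<open>S\<close> and is closed under composition, the form in which properties of matrix entries
  are transferred.\<close>

theorem finitely_generated:
  "\<exists>S. finite S \<and> S \<subseteq> G \<and> (\<forall>E. S \<subseteq> E \<and> (\<forall>A\<in>E. \<forall>B\<in>E. A \<circ> B \<in> E) --> G \<subseteq> E)"
proof -
  obtain R0 where R0: "\<And>y. y \<in> outside ==> \<exists>A\<in>G. hdist tau (A y) \<le> R0" using outside_cobounded by blast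
  \<comment> \<open>The extra 1 makes the bound strict, hence an open condition.\<close>
  define R where "R = R0 + 1"
  have R: "\<exists>A\<in>G. hdist tau (A y) < R" if "y \<in> outside" for y using R0[OF that] by (force simp: R_def)
  define S where "S = {A \<in> G. hdist tau (A tau) \<le> R + R}"
  have finS: "finite S" unfolding S_def by (rule discrete) simp
  have chain: "h' \<circ> invf h \<in> S" if h: "h \<in> G" "h' \<in> G" "y \<in> Hyp" "hdist tau (h y) < R" "hdist tau (h' y) < R" for h h' y
  proof -
    have C: "h' \<circ> invf h \<in> G" using comp_in inv_in h by blast
    have i: "isoH h" "isoH h'" "isoH (h' \<circ> invf h)" using iso h C by auto
    have "hdist tau ((h' \<circ> invf h) tau) \<le> hdist tau (h' y) + hdist (h' y) ((h' \<circ> invf h) tau)"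
      by (intro hdist_triangle isoH_Hyp[OF i(2)] isoH_Hyp[OF i(3)] hyp0_Hyp h(3))
    also have "hdist (h' y) ((h' \<circ> invf h) tau) = hdist (h y) tau"
      using isoH_hdist[OF i(3), of "h y" tau] by (simp add: isoH_inv_apply(1)[OF i(1)])
    finally show ?thesis using C h(4,5) by (simp add: S_def hdist_commute)
  qed
  have "y \<in> push ` Hyp" if "y \<in> outside" for y using push_outside(2)[of y] that by (metis (no_types, lifting) image_eqI mem_Collect_eq outside_def)
  then have "outside = push ` Hyp" using push_outside(1) by blast
  then have conn: "connected outside"
    using connected_continuous_image[OF continuous_on_push nconvex_connected[OF nconvex_Hyp]] by simp
  have oH: "outside \<subseteq> Hyp" by (auto simp: outside_def)
  have y0: "push tau \<in> outside" "push tau \<in> Hyp" using push_outside(1)[OF hyp0_Hyp] oH by auto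
  obtain a where a: "a \<in> G" "hdist tau (a (push tau)) < R" using R[OF y0(1)] by blast
  have ia: "isoH a" using iso[OF a(1)] .
  have "g \<in> E" if E: "S \<subseteq> E" "\<And>A B. A \<in> E ==> B \<in> E ==> A \<circ> B \<in> E" and g: "g \<in> G" for E g
  proof -
    define P where "P y \<longleftrightarrow> (\<exists>h\<in>G. h \<circ> invf a \<in> E \<and> hdist tau (h y) < R)" for y
    have P: "P y" if y: "y \<in> outside" for y
    proof (rule connected_induction_simple[OF conn y0(1) y, of P])
      show "P (push tau)" using chain[OF a(1) a(1) y0(2) a(2) a(2)] a E(1) by (auto simp: P_def)
      fix x assume x: "x \<in> outside"
      obtain h where h: "h \<in> G" "hdist tau (h x) < R" using R[OF x] by blast
      have hy: "hdist tau (h y) < R \<longleftrightarrow> y \<in> hball (invf h tau) R" if "y \<in> Hyp" for y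
        using isoH_hdist[OF iso[OF h(1)], of "invf h tau" y] that by (simp add: isoH_inv_apply(2)[OF iso[OF h(1)]] mem_hball)
      have xh: "x \<in> hball (invf h tau) R" using hy x oH h(2) by blast
      obtain r where r: "0 < r" "hball x r \<subseteq> hball (invf h tau) R"
        using hball_sub_ex[OF xh isoH_Hyp[OF isoH_inv[OF iso[OF h(1)]] hyp0_Hyp]] by blast
      have "P z" if yz: "y \<in> outside \<inter> hball x r" "z \<in> outside \<inter> hball x r" and p: "P y" for y z
      proof -
        have H: "y \<in> Hyp" "hdist tau (h y) < R" "hdist tau (h z) < R" using yz oH r(2) hy by blast+
        obtain h' where h': "h' \<in> G" "h' \<circ> invf a \<in> E" "hdist tau (h' y) < R" using p by (auto simp: P_def)
        have "(h \<circ> invf h') \<circ> (h' \<circ> invf a) \<in> E" using E chain[OF h'(1) h(1) H(1) h'(3) H(2)] h'(2) by blast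
        moreover have "(h \<circ> invf h') \<circ> (h' \<circ> invf a) = h \<circ> invf a"
          by (rule ext) (simp add: isoH_inv_apply(1)[OF iso[OF h'(1)]])
        ultimately show ?thesis using h(1) H(3) by (auto simp: P_def)
      qed
      then show "\<exists>T. openin (top_of_set outside) T \<and> x \<in> T \<and> (\<forall>y\<in>T. \<forall>z\<in>T. P y --> P z)"
        using openin_hball_Int[OF oH x r(1)] by blast
    qed
    \<comment> \<open>With this conjugate of the inverse of \<open>g\<close>, the elements collected
      on the way from \<open>push tau\<close> to its image under \<open>k\<close> multiply, after
      one more factor in \<open>S\<close>, to \<open>g\<close> itself.\<close>
    define k where "k = invf a \<circ> invf g \<circ> a"
    have k: "k \<in> G" unfolding k_def by (intro comp_in inv_in a g)
    obtain h where h: "h \<in> G" "h \<circ> invf a \<in> E" "hdist tau (h (k (push tau))) < R"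
      using P[OF outside_invariant[OF k y0(1)]] by (auto simp: P_def)
    have hk: "h \<circ> k \<in> G" using comp_in h k by blast
    have "(a \<circ> invf (h \<circ> k)) \<circ> (h \<circ> invf a) \<in> E"
      using E chain[OF hk a(1) y0(2)] h a(2) by auto
    moreover have "((a \<circ> invf (h \<circ> k)) \<circ> (h \<circ> invf a)) z = g z" for z
    proof -
      have "(h \<circ> k) (invf a (g z)) = h (invf a z)"
        by (simp add: k_def isoH_inv_apply[OF ia] isoH_inv_apply(1)[OF iso[OF g]])
      then have "invf (h \<circ> k) (h (invf a z)) = invf a (g z)" using isoH_inv_apply(1)[OF iso[OF hk]] by metis
      then show ?thesis by (simp add: isoH_inv_apply(2)[OF ia])
    qed
    ultimately show ?thesis by (metis ext)
  qed
  then have "\<forall>E. S \<subseteq> E \<and> (\<forall>A\<in>E. \<forall>B\<in>E. A \<circ> B \<in> E) --> G \<subseteq> E" by (intro allI impI subsetI) simp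
  moreover have "S \<subseteq> G" by (simp add: S_def)
  ultimately show ?thesis using finS by (intro exI[of _ S] conjI)
qed

end

section \<open>Finite volume and the thick part\<close>

text \<open>If \<open>A\<close> almost fixes a basis made of points of the ball, it is almost the
  identity. \<open>C\<close> bounds the coordinates of the standard basis with respect to
  \<open>Z\<close>, and \<open>e\<close> is chosen so that moving the points of \<open>Z\<close> by
  at most \<open>e\<close> gives \<open>dnorm\<close> at most \<open>d / 2\<close>.\<close>

lemma moved_spanning_set:
  fixes z0 :: "'v::lorentz_space"
  assumes z0: "z0 \<in> Hyp" "0 < r" and d: "0 < d"
  obtains Z \<eta> where "finite Z" "Z \<noteq> {}" "Z \<subseteq> hball z0 r" "0 < \<eta>"
    "\<And>A :: 'v => 'v. isoH A ==> d \<le> dnorm A tau ==> \<exists>z\<in>Z. \<eta> \<le> hdist z (A z)"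
proof -
  have sp: "span (hball z0 r) = UNIV" using Hyp_ball_span[OF z0(1,2), of "hball z0 r"] by (simp add: mem_hball)
  obtain Z where Z: "Z \<subseteq> hball z0 r" "independent Z" "hball z0 r \<subseteq> span Z"
    using maximal_independent_subset[of "hball z0 r"] by blast
  have fin: "finite Z" using Z(2) by (rule independent_imp_finite)
  have spZ: "span Z = UNIV" using sp Z(3) span_minimal[OF Z(3) subspace_span] by blast
  have ne: "Z \<noteq> {}"
  proof
    assume "Z = {}" then have "(tau :: 'v) \<in> {0}" using spZ by simp
    then have "(tau :: 'v) = 0" by simp
    then show False using tau_tau(2) by (metis norm_zero zero_neq_one)
  qed
  have ZH: "z \<in> Hyp" if "z \<in> Z" for z using Z(1) that by (auto simp: mem_hball)
  define cf where "cf b = representation Z b" for b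
  have rep: "b = (\<Sum>z\<in>Z. cf b z *\<^sub>R z)" for b
    using sum_representation_eq[OF Z(2) _ fin subset_refl, of b] spZ by (simp add: cf_def)
  define C where "C = (\<Sum>b\<in>Basis. (\<Sum>z\<in>Z. \<bar>cf b z\<bar>)\<^sup>2) + 1"
  have C: "0 < C" unfolding C_def by (intro add_nonneg_pos sum_nonneg) auto
  define e where "e = sqrt (d / (2 * C))"
  have e: "0 < e" "e\<^sup>2 = d / (2 * C)" using d C by (simp_all add: e_def)
  have "\<exists>f. \<forall>z\<in>Z. 0 < f z \<and> (\<forall>x\<in>hball z (f z). norm (x - z) < e)"
  proof (rule bchoice, rule ballI)
    fix z assume "z \<in> Z"
    then obtain s where "0 < s" "\<And>x. x \<in> hball z s ==> norm (x - z) < e" using hball_nbhd[OF ZH e(1)] by metis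
    then show "\<exists>y>0. \<forall>x\<in>hball z y. norm (x - z) < e" by blast
  qed
  then obtain f where f: "\<And>z. z \<in> Z ==> 0 < f z" "\<And>z x. z \<in> Z ==> x \<in> hball z (f z) ==> norm (x - z) < e" by blast
  define \<eta> where "\<eta> = Min (f ` Z)"
  have \<eta>: "0 < \<eta>" "\<And>z. z \<in> Z ==> \<eta> \<le> f z" using fin ne f(1) by (auto simp: \<eta>_def)
  have "\<exists>z\<in>Z. \<eta> \<le> hdist z (A z)" if A: "isoH A" "d \<le> dnorm A tau" for A :: "'v => 'v"
  proof (rule ccontr)
    assume n: "\<not> (\<exists>z\<in>Z. \<eta> \<le> hdist z (A z))"
    have small: "norm (A z - z) \<le> e" if z: "z \<in> Z" for z
    proof -
      have "hdist z (A z) < \<eta>" using n z by force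
      then have "A z \<in> hball z (f z)" using \<eta>(2)[OF z] isoH_Hyp[OF A(1) ZH[OF z]] by (simp add: mem_hball)
      then show ?thesis using f(2)[OF z] by (simp add: less_imp_le)
    qed
    note lin = isoH_linear[OF A(1)]
    have "norm (A b - b) \<le> (\<Sum>z\<in>Z. \<bar>cf b z\<bar>) * e" for b
    proof -
      have "A b - b = A (\<Sum>z\<in>Z. cf b z *\<^sub>R z) - (\<Sum>z\<in>Z. cf b z *\<^sub>R z)" using rep[of b] by simp
      also have "\<dots> = (\<Sum>z\<in>Z. cf b z *\<^sub>R (A z - z))"
        by (simp add: linear_sum[OF lin] linear_scale[OF lin] scaleR_diff_right sum_subtractf)
      also have "norm \<dots> \<le> (\<Sum>z\<in>Z. norm (cf b z *\<^sub>R (A z - z)))" by (rule norm_sum)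
      also have "\<dots> \<le> (\<Sum>z\<in>Z. \<bar>cf b z\<bar> * e)" by (intro sum_mono) (simp add: small mult_left_mono)
      finally show ?thesis by (simp add: sum_distrib_right)
    qed
    then have nb: "(norm (A b - b))\<^sup>2 \<le> (\<Sum>z\<in>Z. \<bar>cf b z\<bar>)\<^sup>2 * e\<^sup>2" for b
      using power_mono[of "norm (A b - b)" "(\<Sum>z\<in>Z. \<bar>cf b z\<bar>) * e" 2] by (simp add: power_mult_distrib)
    have "dnorm A tau = (\<Sum>b\<in>Basis. (norm (A b - b))\<^sup>2)" using dnorm_tau[OF A(1)] by (simp add: hs_sq)
    also have "\<dots> \<le> (\<Sum>b\<in>Basis. (\<Sum>z\<in>Z. \<bar>cf b z\<bar>)\<^sup>2 * e\<^sup>2)" by (intro sum_mono nb)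
    also have "\<dots> = (C - 1) * e\<^sup>2" by (simp add: C_def sum_distrib_right)
    also have "\<dots> \<le> C * e\<^sup>2" by (intro mult_right_mono) auto
    also have "\<dots> = d / 2" using e(2) C by simp
    finally show False using A(2) d by simp
  qed
  then show ?thesis using that[OF fin ne Z(1) \<eta>(1)] by blast
qed

text \<open>Induction on the number of elements: one of them moves some \<open>z\<close> of a finite
  set by \<open>e\<close>, hence moves every point within \<open>e / 4\<close> of \<open>z\<close>
  by at least \<open>e / 2\<close>, and the others are treated inside that smaller ball. As only
  finitely many \<open>z\<close> occur, the bound does not depend on the elements.\<close>

lemma moved_by_all:
  fixes z0 :: "'v::lorentz_space"
  assumes d: "0 < d" and z0: "z0 \<in> Hyp" "0 < r"
  shows "\<exists>\<eta>>0. \<forall>S :: ('v => 'v) set. finite S \<and> card S \<le> N \<and> (\<forall>A\<in>S. isoH A \<and> d \<le> dnorm A tau) -->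
    (\<exists>z\<in>hball z0 r. \<forall>A\<in>S. \<eta> \<le> hdist z (A z))"
  using z0
proof (induction N arbitrary: z0 r)
  case 0
  then show ?case by (intro exI[of _ 1]) (use center_hball in fastforce)
next
  case (Suc N)
  obtain Z e where Z: "finite Z" "Z \<noteq> {}" "Z \<subseteq> hball z0 r" "0 < e"
    "\<And>A :: 'v => 'v. isoH A ==> d \<le> dnorm A tau ==> \<exists>z\<in>Z. e \<le> hdist z (A z)"
    using moved_spanning_set[OF Suc.prems d] by blast
  have ZH: "z \<in> Hyp" if "z \<in> Z" for z using Z(3) that by (auto simp: mem_hball)
  have "\<exists>f. \<forall>z\<in>Z. 0 < f z \<and> (\<forall>S :: ('v => 'v) set. finite S \<and> card S \<le> N \<and> (\<forall>A\<in>S. isoH A \<and> d \<le> dnorm A tau) -->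
    (\<exists>x\<in>hball z (min (e / 4) (r - hdist z0 z)). \<forall>A\<in>S. f z \<le> hdist x (A x)))"
  proof (rule bchoice, rule ballI)
    fix z assume z: "z \<in> Z"
    then have "0 < min (e / 4) (r - hdist z0 z)" using Z(3,4) by (auto simp: mem_hball)
    from Suc.IH[OF ZH[OF z] this]
    show "\<exists>y>0. \<forall>S :: ('v => 'v) set. finite S \<and> card S \<le> N \<and> (\<forall>A\<in>S. isoH A \<and> d \<le> dnorm A tau) -->
    (\<exists>x\<in>hball z (min (e / 4) (r - hdist z0 z)). \<forall>A\<in>S. y \<le> hdist x (A x))" .
  qed
  then obtain f where f: "\<And>z. z \<in> Z ==> 0 < f z"
    "\<And>z S. z \<in> Z ==> finite S ==> card S \<le> N ==> (\<forall>A\<in>S. isoH (A :: 'v => 'v) \<and> d \<le> dnorm A tau) ==>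
       \<exists>x\<in>hball z (min (e / 4) (r - hdist z0 z)). \<forall>A\<in>S. f z \<le> hdist x (A x)" by metis
  define \<eta> where "\<eta> = min (e / 2) (Min (f ` Z))"
  have \<eta>: "0 < \<eta>" "\<eta> \<le> e / 2" "\<And>z. z \<in> Z ==> \<eta> \<le> f z" using Z f(1) by (auto simp: \<eta>_def min_le_iff_disj)
  show ?case
  proof (intro exI[of _ \<eta>] conjI \<eta>(1) allI impI)
    fix S :: "('v => 'v) set"
    assume S: "finite S \<and> card S \<le> Suc N \<and> (\<forall>A\<in>S. isoH A \<and> d \<le> dnorm A tau)"
    show "\<exists>z\<in>hball z0 r. \<forall>A\<in>S. \<eta> \<le> hdist z (A z)"
    proof (cases "S = {}")
      case True
      then show ?thesis using Suc.prems center_hball by blast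
    next
      case False
      then obtain A0 where A0: "A0 \<in> S" by blast
      then obtain z where z: "z \<in> Z" "e \<le> hdist z (A0 z)" using Z(5) S by blast
      have "card S \<le> Suc N" "finite S" using S by auto
      then have "card (S - {A0}) \<le> N" using A0 by (simp add: card_Diff_singleton)
      then obtain x where x: "x \<in> hball z (min (e / 4) (r - hdist z0 z))" "\<And>A. A \<in> S - {A0} ==> f z \<le> hdist x (A x)"
        using f(2)[OF z(1), of "S - {A0}"] S by auto
      have xH: "x \<in> Hyp" "hdist z x < e / 4" "hdist z x < r - hdist z0 z" using x(1) by (auto simp: mem_hball)
      have zH: "z \<in> Hyp" using ZH z(1) by blast
      have iA0: "isoH A0" using S A0 by blast
      have "hdist z (A0 z) \<le> hdist x (A0 x) + 2 * hdist z x" by (rule isoH_displacement[OF iA0 zH xH(1)])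
      then have "\<eta> \<le> hdist x (A0 x)" using z(2) xH(2) \<eta>(2) by simp
      moreover have "\<eta> \<le> hdist x (A x)" if "A \<in> S" "A \<noteq> A0" for A using x(2)[of A] \<eta>(3)[OF z(1)] that by simp
      moreover have "hdist z0 x \<le> hdist z0 z + hdist z x" by (rule hdist_triangle[OF Suc.prems(1) zH xH(1)])
      then have "x \<in> hball z0 r" using xH by (simp add: mem_hball)
      ultimately show ?thesis by blast
    qed
  qed
qed

text \<open>Each element is recorded by the positions of the images of \<open>Z\<close> in a finite
  net. Two elements with the same record differ by an isometry moving every point of
  \<open>Z\<close> by less than \<open>\<eta>\<close>, so they coincide; the number of records is
  the bound.\<close>

lemma finite_separated_bound:
  assumes d: "0 < d"
  shows "\<exists>N. \<forall>S :: ('v::lorentz_space => 'v) set. (\<forall>A\<in>S. isoH A \<and> hdist tau (A tau) \<le> R) \<and>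
    (\<forall>A\<in>S. \<forall>B\<in>S. A \<noteq> B --> d \<le> dnorm (invf A \<circ> B) tau) --> finite S \<and> card S \<le> N"
proof -
  obtain Z \<eta> where Z: "finite Z" "Z \<noteq> {}" "Z \<subseteq> hball (tau :: 'v) 1" "0 < \<eta>"
    "\<And>A :: 'v => 'v. isoH A ==> d \<le> dnorm A tau ==> \<exists>z\<in>Z. \<eta> \<le> hdist z (A z)"
    using moved_spanning_set[OF hyp0_Hyp zero_less_one d] by blast
  have ZH: "z \<in> Hyp" "hdist tau z < 1" if "z \<in> Z" for z using Z(3) that by (auto simp: mem_hball)
  define K where "K = {z \<in> Hyp. hdist (tau :: 'v) z \<le> R + 1}"
  have K: "compact K" unfolding K_def by (rule compact_hcball[OF hyp0_Hyp])
  have "\<exists>P. finite P \<and> P \<subseteq> Hyp \<and> K \<subseteq> (\<Union>p\<in>P. hball p (\<eta> / 2))"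
  proof -
    have "\<exists>T. open T \<and> hball p (\<eta> / 2) = Hyp \<inter> T" if "p \<in> Hyp" for p :: 'v
      using openin_hball[OF that, of "\<eta> / 2"] by (auto simp: openin_open)
    then obtain T where T: "\<And>p::'v. p \<in> Hyp ==> open (T p)" "\<And>p::'v. p \<in> Hyp ==> hball p (\<eta> / 2) = Hyp \<inter> T p" by metis
    have KH: "K \<subseteq> Hyp" by (auto simp: K_def)
    have in_T: "p \<in> T p" if "p \<in> Hyp" for p :: 'v using T(2)[OF that] center_hball[OF that, of "\<eta> / 2"] Z(4) that by auto
    have "K \<subseteq> (\<Union>p\<in>K. T p)" using in_T KH by blast
    then obtain P where P: "P \<subseteq> K" "finite P" "K \<subseteq> (\<Union>p\<in>P. T p)"
      using compactE_image[OF K, of K T] T(1) KH by blast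
    have "K \<subseteq> (\<Union>p\<in>P. hball p (\<eta> / 2))"
    proof
      fix x assume x: "x \<in> K"
      then obtain p where "p \<in> P" "x \<in> T p" using P(3) by blast
      then show "x \<in> (\<Union>p\<in>P. hball p (\<eta> / 2))" using T(2)[of p] x KH P(1) by blast
    qed
    then show ?thesis using P KH by blast
  qed
  then obtain P where P: "finite P" "P \<subseteq> Hyp" "K \<subseteq> (\<Union>p\<in>P. hball p (\<eta> / 2))" by blast
  have finE: "finite (Z \<rightarrow>\<^sub>E P)" using Z(1) P(1) by (simp add: finite_PiE)
  show ?thesis
  proof (intro exI[of _ "card (Z \<rightarrow>\<^sub>E P)"] allI impI)
    fix S :: "('v => 'v) set"
    assume S: "(\<forall>A\<in>S. isoH A \<and> hdist tau (A tau) \<le> R) \<and> (\<forall>A\<in>S. \<forall>B\<in>S. A \<noteq> B --> d \<le> dnorm (invf A \<circ> B) tau)"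
    have AK: "A z \<in> K" if "A \<in> S" "z \<in> Z" for A z
    proof -
      have iA: "isoH A" "hdist tau (A tau) \<le> R" using S that by auto
      have "hdist tau (A z) \<le> hdist tau (A tau) + hdist (A tau) (A z)"
        by (rule hdist_triangle[OF hyp0_Hyp isoH_Hyp[OF iA(1) hyp0_Hyp] isoH_Hyp[OF iA(1) ZH(1)[OF that(2)]]])
      also have "hdist (A tau) (A z) = hdist tau z" by (rule isoH_hdist[OF iA(1)])
      finally show ?thesis using iA ZH[OF that(2)] isoH_Hyp[OF iA(1)] by (simp add: K_def)
    qed
    define c where "c A = (\<lambda>z\<in>Z. SOME p. p \<in> P \<and> A z \<in> hball p (\<eta> / 2))" for A :: "'v => 'v"
    have c: "c A z \<in> P" "A z \<in> hball (c A z) (\<eta> / 2)" if "A \<in> S" "z \<in> Z" for A z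
    proof -
      have "\<exists>p. p \<in> P \<and> A z \<in> hball p (\<eta> / 2)" using AK[OF that] P(3) by blast
      then have "(SOME p. p \<in> P \<and> A z \<in> hball p (\<eta> / 2)) \<in> P \<and> A z \<in> hball (SOME p. p \<in> P \<and> A z \<in> hball p (\<eta> / 2)) (\<eta> / 2)"
        by (rule someI_ex)
      then show "c A z \<in> P" "A z \<in> hball (c A z) (\<eta> / 2)" using that(2) by (simp_all add: c_def)
    qed
    have sub: "c ` S \<subseteq> Z \<rightarrow>\<^sub>E P" using c(1) by (auto simp: c_def PiE_def extensional_def)
    have inj: "inj_on c S"
    proof (rule inj_onI, rule ccontr)
      fix A B assume AB: "A \<in> S" "B \<in> S" "c A = c B" "A \<noteq> B"
      have i: "isoH A" "isoH B" "isoH (invf A \<circ> B)" using S AB isoH_inv isoH_comp by blast+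
      obtain z where z: "z \<in> Z" "\<eta> \<le> hdist z ((invf A \<circ> B) z)" using Z(5)[OF i(3)] S AB by blast
      have H: "c A z \<in> Hyp" "A z \<in> Hyp" "B z \<in> Hyp" using c(1)[OF AB(1) z(1)] P(2) isoH_Hyp i ZH z(1) by blast+
      have "hdist z ((invf A \<circ> B) z) = hdist (A z) (B z)" using isoH_hdist_inv[OF i(1)] by simp
      also have "\<dots> \<le> hdist (A z) (c A z) + hdist (c A z) (B z)" by (rule hdist_triangle[OF H(2,1,3)])
      also have "\<dots> < \<eta>" using c(2)[OF AB(1) z(1)] c(2)[OF AB(2) z(1)] AB(3) by (simp add: mem_hball hdist_commute[of "A z"])
      finally show False using z(2) by simp
    qed
    have "finite (c ` S)" using sub finE finite_subset by blast
    then show "finite S \<and> card S \<le> card (Z \<rightarrow>\<^sub>E P)"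
      using inj card_image[OF inj] card_mono[OF finE sub] finite_imageD by force
  qed
qed

text \<open>A point where every \<open>dnorm\<close> is large may still be fixed, for instance by a
  reflection. Only elements moving \<open>y\<close> by at most 3 can cause this; their number is
  bounded, and some nearby point is moved by all of them. The others move every point within
  distance 1 by at least 1.\<close>

lemma thick_point:
  assumes G: "id \<in> G" "\<And>A B. A \<in> G ==> B \<in> G ==> invf A \<circ> B \<in> G" "\<And>A. A \<in> G ==> isoH (A :: 'v::lorentz_space => 'v)" and d: "0 < d"
  obtains \<eta> where "0 < \<eta>" "\<eta> \<le> 1" "\<And>y. y \<in> Hyp ==> (\<And>A. A \<in> G ==> A \<noteq> id ==> d \<le> dnorm A y) ==>
    \<exists>z\<in>hball y 1. \<forall>A\<in>G. A \<noteq> id --> \<eta> \<le> hdist z (A z)"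
proof -
  obtain N where N: "\<And>S :: ('v => 'v) set. (\<And>A. A \<in> S ==> isoH A \<and> hdist tau (A tau) \<le> 3) ==>
    (\<And>A B. A \<in> S ==> B \<in> S ==> A \<noteq> B ==> d \<le> dnorm (invf A \<circ> B) tau) ==> finite S \<and> card S \<le> N"
    using finite_separated_bound[OF d, of 3] by metis
  obtain e where e: "0 < e" "\<And>S :: ('v => 'v) set. finite S ==> card S \<le> N ==> (\<And>A. A \<in> S ==> isoH A \<and> d \<le> dnorm A tau) ==>
    \<exists>z\<in>hball tau 1. \<forall>A\<in>S. e \<le> hdist z (A z)"
    using moved_by_all[OF d hyp0_Hyp zero_less_one, of N] by metis
  have "\<exists>z\<in>hball y 1. \<forall>A\<in>G. A \<noteq> id --> min e 1 \<le> hdist z (A z)"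
    if y: "y \<in> Hyp" and th: "\<And>A. A \<in> G ==> A \<noteq> id ==> d \<le> dnorm A y" for y
  proof -
    obtain h where h: "isoH h" "h tau = y" using isoH_transitive[OF hyp0_Hyp y] .
    have ih: "isoH (invf h)" "invf (invf h) = h" using isoH_inv[OF h(1)] isoH_bij[OF h(1)] by (simp_all add: inv_inv_eq)
    have hy: "invf h y = tau" using isoH_inv_apply(1)[OF h(1), of tau] h(2) by simp
    define cj where "cj A = invf h \<circ> A \<circ> h" for A
    have cj: "isoH (cj A)" if "A \<in> G" for A unfolding cj_def by (intro isoH_comp ih h G(3) that)
    have dn: "dnorm (cj A) tau = dnorm A y" if "A \<in> G" for A
      using dnorm_conj[OF ih(1) G(3)[OF that], of y] unfolding ih(2) hy cj_def by simp
    have hd: "hdist (invf h x) (cj A (invf h x)) = hdist x (A x)" for A x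
      unfolding cj_def by (simp add: isoH_hdist[OF ih(1)] isoH_inv_apply(2)[OF h(1)])
    define S where "S = cj ` {A \<in> G. hdist y (A y) \<le> 3}"
    have S1: "isoH A \<and> hdist tau (A tau) \<le> 3" if "A \<in> S" for A
      using that cj hd[of y] hy by (auto simp: S_def)
    have S2: "d \<le> dnorm (invf A \<circ> B) tau" if AB: "A \<in> S" "B \<in> S" "A \<noteq> B" for A B
    proof -
      obtain A' B' where A': "A' \<in> G" "A = cj A'" and B': "B' \<in> G" "B = cj B'" using AB by (auto simp: S_def)
      have AB': "invf A' \<circ> B' \<in> G" using G(2) A' B' by blast
      have "invf A \<circ> B = cj (invf A' \<circ> B')"
      proof
        fix x
        have "A (cj (invf A' \<circ> B') x) = B x"
          by (simp add: A'(2) B'(2) cj_def isoH_inv_apply[OF h(1)] isoH_inv_apply[OF G(3)[OF A'(1)]])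
        then have "cj (invf A' \<circ> B') x = invf A (B x)" using isoH_inv_apply(1)[OF cj[OF A'(1)]] A'(2) by metis
        then show "(invf A \<circ> B) x = cj (invf A' \<circ> B') x" by simp
      qed
      moreover have "invf A' \<circ> B' \<noteq> id"
      proof
        assume "invf A' \<circ> B' = id"
        then have "A' x = B' x" for x using isoH_inv_apply(2)[OF G(3)[OF A'(1)], of "B' x"] by (metis comp_apply id_apply)
        then show False using AB(3) A' B' by (auto simp: cj_def fun_eq_iff)
      qed
      ultimately show ?thesis using dn[OF AB'] th[OF AB'] by simp
    qed
    have fS: "finite S" "card S \<le> N" using N[OF S1 S2] by auto
    have "finite (S - {id})" "card (S - {id}) \<le> N" using fS card_Diff1_le[of S id] by auto
    moreover have "isoH A \<and> d \<le> dnorm A tau" if A: "A \<in> S - {id}" for A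
    proof -
      obtain A' where A': "A' \<in> G" "A = cj A'" using A by (auto simp: S_def)
      have "cj id = id" by (rule ext) (simp add: cj_def isoH_inv_apply(1)[OF h(1)])
      then have "A' \<noteq> id" using A A'(2) by auto
      then show ?thesis using cj dn th A' by simp
    qed
    ultimately obtain x where x: "x \<in> hball tau 1" "\<And>A. A \<in> S - {id} ==> e \<le> hdist x (A x)" using e(2)[of "S - {id}"] by blast
    have xH: "x \<in> Hyp" "hdist tau x < 1" using x(1) by (auto simp: mem_hball)
    define z where "z = h x"
    have z: "z \<in> Hyp" "hdist y z < 1" using isoH_Hyp[OF h(1) xH(1)] isoH_hdist[OF h(1), of tau x] h(2) xH(2) by (simp_all add: z_def)
    have xz: "x = invf h z" using isoH_inv_apply(1)[OF h(1)] by (simp add: z_def)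
    have "min e 1 \<le> hdist z (A z)" if A: "A \<in> G" "A \<noteq> id" for A
    proof (cases "hdist y (A y) \<le> 3")
      case True
      have "cj A \<noteq> id"
      proof
        assume c: "cj A = id"
        have "A w = w" for w
        proof -
          have "invf h (A w) = invf h w" using fun_cong[OF c, of "invf h w"] by (simp add: cj_def isoH_inv_apply(2)[OF h(1)])
          then show ?thesis using isoH_inv_apply(2)[OF h(1)] by metis
        qed
        then show False using A(2) by (auto simp: fun_eq_iff)
      qed
      then have "e \<le> hdist x (cj A x)" using x(2)[of "cj A"] A(1) True by (auto simp: S_def)
      then show ?thesis using hd[of z A] xz by simp
    next
      case False
      have iA: "isoH A" using G(3) A by blast
      have "hdist y (A y) \<le> hdist z (A z) + 2 * hdist y z" by (rule isoH_displacement[OF iA y z(1)])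
      then show ?thesis using False z(2) by simp
    qed
    then show ?thesis using z by (intro bexI[of _ z]) (simp_all add: mem_hball)
  qed
  then show ?thesis using that[of "min e 1"] e(1) by simp
qed

text \<open>The bound on the number of disjoint isometric balls is all that is used of the finiteness of the volume.\<close>

locale finvol = folding wn M F for wn :: "'v::lorentz_space" and M :: "'m::metric_space set" and F +
  assumes short_path: "\<And>p q L. p \<in> M ==> q \<in> M ==> dist p q < L ==> \<exists>g. path g \<and> path_image g \<subseteq> M \<and> g 0 = p \<and> g 1 = q \<and>
      (\<forall>n. (\<Sum>i<n. dist (g (real i / real n)) (g (real (Suc i) / real n))) \<le> L)"
    and packing: "\<And>\<zeta> r. \<zeta> \<in> Hyp ==> 0 < r ==> hball \<zeta> r \<subseteq> Hhalf ==>
      \<exists>N. \<forall>\<U>. finite \<U> \<and> disjoint \<U> \<and> (\<forall>U\<in>\<U>. \<exists>\<psi>. lchart U \<psi> \<and> \<psi> ` U = hball \<zeta> r) --> card \<U> \<le> N"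
    and dim3: "3 \<le> DIM('v)"
begin

lemma lift_near:
  assumes a: "a \<in> Hyp" and q: "q \<in> M" and d: "dist (F a) q < L"
  obtains x where "x \<in> Hyp" "F x = q" "hdist a x \<le> L"
proof -
  obtain g where g: "path g" "path_image g \<subseteq> M" "g 0 = F a" "g 1 = q"
    "\<And>n. (\<Sum>i<n. dist (g (real i / real n)) (g (real (Suc i) / real n))) \<le> L"
    using short_path[OF F_M[OF a] q d] by blast
  obtain z where "z \<in> Hyp" "F z = g 1" "hdist a z \<le> L" using lift_partition[OF g(1,2) a g(3)[symmetric] g(5)] by blast
  then show ?thesis using that g(4) by simp
qed

text \<open>The centre is placed at distance \<open>r\<close> from the wall, on a geodesic normal to
  it.\<close>

lemma deep_point: assumes "0 < r" obtains \<zeta> where "\<zeta> \<in> Hyp" "hball \<zeta> r \<subseteq> Hhalf"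
proof -
  obtain y where y: "y \<in> Hyp" "lor y wn = 0" using spacelike_perp_Hyp[OF wn] .
  have e: "lor wn y = 0" using y(2) by (simp add: lor_commute)
  define \<zeta> where "\<zeta> = geo y wn r"
  have z: "\<zeta> \<in> Hyp" unfolding \<zeta>_def by (rule geo_Hyp[OF y(1) e wn])
  have "0 \<le> lor x wn" if x: "x \<in> hball \<zeta> r" for x
  proof (rule ccontr)
    assume n: "\<not> 0 \<le> lor x wn"
    have xH: "x \<in> Hyp" "hdist \<zeta> x < r" using x by (auto simp: mem_hball)
    define p where "p = x - lor x wn *\<^sub>R wn"
    have p: "lor p wn = 0" "lor wn p = 0" "lor p p = - 1 - (lor x wn)\<^sup>2"
      using wn HypD(1)[OF xH(1)] by (simp_all add: p_def lor_simps power2_eq_square lor_commute[of wn x])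
    have "- lor y x = - lor y p" using y(2) by (simp add: p_def lor_simps)
    moreover have "- lor y x \<ge> 1" using Hyp_lor_le[OF y(1) xH(1)] by simp
    moreover have "- lor \<zeta> x = cosh r * (- lor y x) - sinh r * lor x wn"
      by (simp add: \<zeta>_def geo_def lor_simps lor_commute[of wn x])
    moreover have "0 \<le> - (sinh r * lor x wn)" using n assms by (simp add: mult_nonneg_nonpos)
    moreover have "cosh r * 1 \<le> cosh r * (- lor y x)" using \<open>- lor y x \<ge> 1\<close> by (intro mult_left_mono) auto
    ultimately have "cosh r \<le> - lor \<zeta> x" by simp
    then show False using hdist_less_iff[OF z xH(1), of r] xH(2) assms by simp
  qed
  then have "hball \<zeta> r \<subseteq> Hhalf" using hball_Hyp by (auto simp: Hhalf_def)
  then show ?thesis by (rule that[OF z])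
qed

text \<open>If \<open>F\<close> shortened the distance of two points of the ball, a nearly shortest
  path downstairs would lift to one ending at \<open>A a'\<close> for some nontrivial
  \<open>A\<close>, which would move \<open>z\<close> by less than \<open>6 * r\<close>, whereas
  \<open>\<eta>\<close> is \<open>8 * r\<close>. So \<open>F\<close> is isometric on the ball and
  its inverse yields a chart.\<close>

lemma thick_chart:
  assumes z: "z \<in> Hyp" and \<eta>: "0 < \<eta>" "\<And>A. A \<in> GT ==> A \<noteq> id ==> \<eta> \<le> hdist z (A z)"
    and \<zeta>: "\<zeta> \<in> Hyp" "hball \<zeta> (\<eta> / 8) \<subseteq> Hhalf"
  shows "\<exists>\<psi>. lchart (F ` hball z (\<eta> / 8)) \<psi> \<and> \<psi> ` F ` hball z (\<eta> / 8) = hball \<zeta> (\<eta> / 8)"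
proof -
  define r where "r = \<eta> / 8"
  have r: "0 < r" using \<eta> by (simp add: r_def)
  have key: "dist (F a) (F a') = hdist a a'" if a: "a \<in> hball z r" "a' \<in> hball z r" for a a'
  proof (rule antisym)
    have H: "a \<in> Hyp" "a' \<in> Hyp" "hdist z a < r" "hdist z a' < r" using a by (auto simp: mem_hball)
    show "dist (F a) (F a') \<le> hdist a a'" by (rule F_lipschitz[OF H(1,2)])
    show "hdist a a' \<le> dist (F a) (F a')"
    proof (rule ccontr)
      assume n: "\<not> hdist a a' \<le> dist (F a) (F a')"
      define L where "L = (dist (F a) (F a') + hdist a a') / 2"
      have L: "dist (F a) (F a') < L" "L < hdist a a'" using n by (auto simp: L_def)
      obtain x where x: "x \<in> Hyp" "F x = F a'" "hdist a x \<le> L" using lift_near[OF H(1) F_M[OF H(2)] L(1)] .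
      obtain A where A: "A \<in> GT" "A a' = x" using GT_transitive[OF H(2) x(1)] x(2) by metis
      have "A \<noteq> id" using A(2) x(3) L(2) by auto
      then have "\<eta> \<le> hdist z (A z)" using \<eta>(2)[OF A(1)] by blast
      also have "\<dots> \<le> hdist a' x + 2 * hdist z a'" using isoH_displacement[OF GT_isoH[OF A(1)] z H(2)] A(2) by simp
      also have "hdist a' x \<le> hdist a' a + hdist a x" by (rule hdist_triangle[OF H(2,1) x(1)])
      finally have "\<eta> \<le> hdist a a' + L + 2 * hdist z a'" using x(3) by (simp add: hdist_commute)
      moreover have "hdist a a' \<le> hdist z a + hdist z a'" using hdist_triangle[OF H(1) z H(2)] by (simp add: hdist_commute)
      ultimately show False using H(3,4) L(2) r by (simp add: r_def)
    qed
  qed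
  obtain B where B: "isoH B" "B z = \<zeta>" using isoH_transitive[OF z \<zeta>(1)] .
  define sel where "sel q = (SOME a. a \<in> hball z r \<and> F a = q)" for q
  have sel: "sel (F a) = a" if "a \<in> hball z r" for a
  proof -
    have "sel (F a) \<in> hball z r \<and> F (sel (F a)) = F a" unfolding sel_def by (rule someI[of "\<lambda>x. x \<in> hball z r \<and> F x = F a" a]) (use that in simp)
    then have "hdist (sel (F a)) a = 0" "sel (F a) \<in> Hyp" using key[OF _ that, of "sel (F a)"] by (auto simp: mem_hball)
    then show ?thesis using hdist_eq_0 that by (auto simp: mem_hball)
  qed
  define U where "U = F ` hball z r"
  have img: "(B \<circ> sel) ` U = hball \<zeta> r"
  proof -
    have "(B \<circ> sel) ` U = B ` hball z r" unfolding U_def image_image comp_def by (rule image_cong) (simp_all add: sel)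
    then show ?thesis using hball_image[OF B(1)] B(2) by simp
  qed
  have "openin (top_of_set M) U"
  proof (rule openin_M_I)
    show "U \<subseteq> M" unfolding U_def using F_M by (auto simp: mem_hball)
    fix p assume "p \<in> U"
    then obtain a where a: "p = F a" "a \<in> Hyp" "hdist z a < r" by (auto simp: U_def mem_hball)
    show "\<exists>e>0. \<forall>q\<in>M. dist p q < e --> q \<in> U"
    proof (intro exI[of _ "(r - hdist z a) / 2"] conjI ballI impI)
      show "0 < (r - hdist z a) / 2" using a(3) by simp
      fix q assume q: "q \<in> M" "dist p q < (r - hdist z a) / 2"
      obtain x where x: "x \<in> Hyp" "F x = q" "hdist a x \<le> (r - hdist z a) / 2" using lift_near[OF a(2) q(1) q(2)[unfolded a(1)]] .
      have "hdist z x < r" using hdist_triangle[OF z a(2) x(1)] x(3) a(3) by (simp add: field_simps)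
      then show "q \<in> U" using x by (auto simp: U_def mem_hball)
    qed
  qed
  moreover have "\<forall>p\<in>U. \<forall>q\<in>U. hdist ((B \<circ> sel) p) ((B \<circ> sel) q) = dist p q"
    using key by (auto simp: U_def sel isoH_hdist[OF B(1)])
  moreover have "\<exists>e>0. hball y e \<inter> Hhalf \<subseteq> hball \<zeta> r" if yb: "y \<in> hball \<zeta> r" for y
  proof -
    obtain e where "0 < e" "hball y e \<subseteq> hball \<zeta> r" using hball_sub_ex[OF yb \<zeta>(1)] .
    then show ?thesis by blast
  qed
  ultimately have "lchart U (B \<circ> sel)" unfolding lchart_def img using \<zeta>(2) by (auto simp: r_def)
  then show ?thesis using img unfolding U_def r_def by blast
qed

text \<open>Thick points whose images are at mutual distance at least \<open>2 * r\<close> have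
  disjoint image balls, all isometric to a fixed one, so \<open>packing\<close> bounds their number.
  By maximality of such a family every thick point is near a translate of one of its
  members.\<close>

lemma thick_cobounded:
  assumes \<eta>: "0 < \<eta>"
  shows "\<exists>R. \<forall>z\<in>Hyp. (\<forall>A\<in>GT. A \<noteq> id --> \<eta> \<le> hdist z (A z)) --> (\<exists>A\<in>GT. hdist tau (A z) \<le> R)"
proof -
  define r where "r = \<eta> / 8"
  have r: "0 < r" using \<eta> by (simp add: r_def)
  obtain \<zeta> where \<zeta>: "\<zeta> \<in> Hyp" "hball \<zeta> r \<subseteq> Hhalf" using deep_point[OF r] .
  obtain N where N: "\<And>\<U>. finite \<U> ==> disjoint \<U> ==> (\<And>U. U \<in> \<U> ==> \<exists>\<psi>. lchart U \<psi> \<and> \<psi> ` U = hball \<zeta> r) ==> card \<U> \<le> N"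
    using packing[OF \<zeta>(1) r \<zeta>(2)] by metis
  define Th where "Th = {z \<in> Hyp. \<forall>A\<in>GT. A \<noteq> id --> \<eta> \<le> hdist z (A z)}"
  define ok where "ok S \<longleftrightarrow> finite S \<and> S \<subseteq> Th \<and> (\<forall>x\<in>S. \<forall>y\<in>S. x \<noteq> y --> 2 * r \<le> dist (F x) (F y))" for S
  have bound: "card S \<le> N" if S: "ok S" for S
  proof -
    define \<U> where "\<U> = (\<lambda>z. F ` hball z r) ` S"
    have H: "z \<in> Hyp" if "z \<in> S" for z using S that by (auto simp: ok_def Th_def)
    have dj: "F ` hball x r \<inter> F ` hball y r = {}" if xy: "x \<in> S" "y \<in> S" "x \<noteq> y" for x y
    proof (rule ccontr)
      assume "F ` hball x r \<inter> F ` hball y r \<noteq> {}"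
      then obtain a b where ab: "a \<in> Hyp" "hdist x a < r" "b \<in> Hyp" "hdist y b < r" "F a = F b" by (auto simp: mem_hball)
      have "dist (F x) (F y) \<le> dist (F x) (F a) + dist (F y) (F b)" using dist_triangle2[of "F x" "F y" "F a"] ab(5) by simp
      also have "\<dots> < 2 * r" using F_lipschitz[OF H[OF xy(1)] ab(1)] F_lipschitz[OF H[OF xy(2)] ab(3)] ab by simp
      finally show False using S xy by (force simp: ok_def)
    qed
    have ne: "F z \<in> F ` hball z r" if "z \<in> S" for z using H[OF that] r by (intro imageI) simp
    have inj: "inj_on (\<lambda>z. F ` hball z r) S"
    proof (rule inj_onI, rule ccontr)
      fix x y assume xy: "x \<in> S" "y \<in> S" "F ` hball x r = F ` hball y r" "x \<noteq> y"
      then show False using dj[OF xy(1,2,4)] ne[OF xy(1)] by blast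
    qed
    have "disjoint \<U>" unfolding disjoint_def \<U>_def using dj by blast
    moreover have "\<exists>\<psi>. lchart U \<psi> \<and> \<psi> ` U = hball \<zeta> r" if U: "U \<in> \<U>" for U
    proof -
      obtain z where z: "z \<in> S" "U = F ` hball z r" using U by (auto simp: \<U>_def)
      have "\<eta> \<le> hdist z (A z)" if "A \<in> GT" "A \<noteq> id" for A using S z(1) that by (auto simp: ok_def Th_def)
      then show ?thesis using thick_chart[OF H[OF z(1)] \<eta> _ \<zeta>(1) \<zeta>(2)[unfolded r_def]] z(2) by (simp add: r_def)
    qed
    ultimately have "card \<U> \<le> N" using N[of \<U>] S by (auto simp: \<U>_def ok_def)
    then show ?thesis using card_image[OF inj] by (simp add: \<U>_def)
  qed
  have "ok {}" by (simp add: ok_def)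
  then obtain S where S: "ok S" "\<And>T. ok T ==> card T \<le> card S"
    using ex_has_greatest_nat[of ok "{}" card "Suc N"] bound le_imp_less_Suc by metis
  have fS: "finite S" using S(1) by (simp add: ok_def)
  define R where "R = Max (insert 0 (hdist tau ` S)) + 2 * r"
  have "\<exists>A\<in>GT. hdist tau (A z) \<le> R" if z: "z \<in> Th" for z
  proof -
    have zH: "z \<in> Hyp" using z by (simp add: Th_def)
    have "\<exists>s\<in>S. dist (F z) (F s) < 2 * r"
    proof (rule ccontr)
      assume n: "\<not> (\<exists>s\<in>S. dist (F z) (F s) < 2 * r)"
      then have "z \<notin> S" using r by force
      moreover have "ok (insert z S)" using S(1) n z unfolding ok_def by (auto simp: not_less dist_commute)
      then have "card (insert z S) \<le> card S" by (rule S(2))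
      ultimately show False using fS by simp
    qed
    then obtain s where s: "s \<in> S" "dist (F z) (F s) < 2 * r" by blast
    have sH: "s \<in> Hyp" using s S(1) by (auto simp: ok_def Th_def)
    obtain x where x: "x \<in> Hyp" "F x = F s" "hdist z x \<le> 2 * r" using lift_near[OF zH F_M[OF sH] s(2)] .
    obtain A where A: "A \<in> GT" "A x = s" using GT_transitive[OF x(1) sH x(2)] .
    have "hdist tau (A z) \<le> hdist tau s + hdist z x" using isoH_hdist_triangle[OF GT_isoH[OF A(1)] hyp0_Hyp zH x(1)] A(2) by simp
    also have "hdist tau s \<le> Max (insert 0 (hdist tau ` S))" using fS s(1) by (intro Max_ge) auto
    finally have "hdist tau (A z) \<le> R" using x(3) by (simp add: R_def)
    then show ?thesis using A(1) by blast
  qed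
  then show ?thesis by (auto simp: Th_def)
qed

lemma GT_thick:
  assumes d: "0 < d" shows "\<exists>R. \<forall>y\<in>Hyp. (\<forall>A\<in>GT. A \<noteq> id --> d \<le> dnorm A y) --> (\<exists>A\<in>GT. hdist tau (A y) \<le> R)"
proof -
  obtain \<eta> where \<eta>: "0 < \<eta>" "\<eta> \<le> 1" "\<And>y. y \<in> Hyp ==> (\<And>A. A \<in> GT ==> A \<noteq> id ==> d \<le> dnorm A y) ==>
    \<exists>z\<in>hball y 1. \<forall>A\<in>GT. A \<noteq> id --> \<eta> \<le> hdist z (A z)"
    using thick_point[OF GT_id _ GT_isoH d] GT_comp GT_inv by metis
  obtain R where R: "\<And>z. z \<in> Hyp ==> (\<forall>A\<in>GT. A \<noteq> id --> \<eta> \<le> hdist z (A z)) ==> \<exists>A\<in>GT. hdist tau (A z) \<le> R"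
    using thick_cobounded[OF \<eta>(1)] by blast
  have "\<exists>A\<in>GT. hdist tau (A y) \<le> R + 1" if y: "y \<in> Hyp" "\<forall>A\<in>GT. A \<noteq> id --> d \<le> dnorm A y" for y
  proof -
    obtain z where z: "z \<in> hball y 1" "\<forall>A\<in>GT. A \<noteq> id --> \<eta> \<le> hdist z (A z)" using \<eta>(3)[OF y(1)] y(2) by blast
    have zH: "z \<in> Hyp" "hdist y z < 1" using z(1) by (auto simp: mem_hball)
    obtain A where A: "A \<in> GT" "hdist tau (A z) \<le> R" using R[OF zH(1) z(2)] by blast
    have "hdist tau (A y) \<le> hdist tau (A z) + hdist y z" by (rule isoH_hdist_triangle[OF GT_isoH[OF A(1)] hyp0_Hyp y(1) zH(1)])
    then show ?thesis using A zH(2) by (intro bexI[of _ A]) auto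
  qed
  then show ?thesis by blast
qed

sublocale kleinian GT
proof
  show "\<exists>w. lor w w = 1 \<and> A = reflH w" if "A \<in> GT" "A \<noteq> id" "y \<in> Hyp" "A y = y" for A y
    using GT_fixed_point[OF that] wallsD(1) by metis
qed (use GT_id GT_comp GT_inv GT_isoH GT_discrete GT_thick dim3 in blast)+

end

section \<open>The upper half-space and the hyperboloid\<close>

lemma tau_real [simp]: "(tau :: 'b::euclidean_space \<times> real) = (0, 1)"
  by (simp add: tau_prod_def)

lemma lor_real: "lor v w = fst v \<bullet> fst w - snd v * snd w" for v w :: "'b::euclidean_space \<times> real"
  by (simp add: lor_inner inner_prod_def)

text \<open>The standard isometry from the upper half-space onto the hyperboloid and its inverse; \<open>upw\<close> is the
  unit normal of the wall, \<open>upv\<close> the null vector of the ideal point at infinity.\<close>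

definition upJ :: "'a::euclidean_space \<times> real => ('a \<times> real) \<times> real" where
  "upJ z = (((1 / snd z) *\<^sub>R fst z, (1 - fst z \<bullet> fst z - (snd z)\<^sup>2) / (2 * snd z)), (1 + fst z \<bullet> fst z + (snd z)\<^sup>2) / (2 * snd z))"

definition upI :: "('a::euclidean_space \<times> real) \<times> real => 'a \<times> real" where
  "upI y = ((1 / (snd (fst y) + snd y)) *\<^sub>R fst (fst y), 1 / (snd (fst y) + snd y))"

definition upw :: "('a::euclidean_space \<times> real) \<times> real" where "upw = ((wall_normal, 0), 0)"

definition upv :: "('a::euclidean_space \<times> real) \<times> real" where "upv = ((0, - 1), 1)"

lemma wall_normal: "wall_normal \<in> Basis" "wall_normal \<bullet> wall_normal = 1"
proof -
  show 1: "wall_normal \<in> Basis" unfolding wall_normal_def using nonempty_Basis by (simp add: some_in_eq)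
  show "wall_normal \<bullet> wall_normal = 1" using 1 by (rule inner_same_Basis)
qed

lemma upw: "lor upw upw = 1" "lor upv upw = 0"
  by (simp_all add: lor_real upw_def upv_def inner_prod_def wall_normal)

lemma null_upv: "null upv"
  by (simp add: null_def lor_real upv_def inner_prod_def)

lemma lor_upJ:
  assumes "snd z \<noteq> 0" "snd z' \<noteq> 0"
  shows "- lor (upJ z) (upJ z') = 1 + ((dist (fst z) (fst z'))\<^sup>2 + (snd z - snd z')\<^sup>2) / (2 * snd z * snd z')"
proof -
  obtain x t y s where z: "z = (x, t)" "z' = (y, s)" by (meson surj_pair)
  have ne: "t \<noteq> 0" "s \<noteq> 0" using assms z by auto
  have "(dist x y)\<^sup>2 = x \<bullet> x - 2 * (x \<bullet> y) + y \<bullet> y"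
    by (simp add: dist_norm power2_norm_eq_inner inner_diff_left inner_diff_right inner_commute)
  then have d: "(dist x y)\<^sup>2 = x \<bullet> x - 2 * (x \<bullet> y) + y \<bullet> y" by simp
  show ?thesis using ne unfolding z fst_conv snd_conv d by (simp add: upJ_def lor_real inner_prod_def field_simps power2_eq_square)
qed

lemma upJ_Hyp: assumes "0 < snd z" shows "upJ z \<in> Hyp"
proof -
  have "lor (upJ z) (upJ z) = - 1" using lor_upJ[of z z] assms by simp
  moreover have "0 < 1 + fst z \<bullet> fst z + (snd z)\<^sup>2" by (intro add_pos_nonneg) auto
  then have "0 < tim (upJ z)" using assms by (simp add: upJ_def inner_prod_def)
  ultimately show ?thesis by (simp add: Hyp_def)
qed

lemma hdist_upJ:
  assumes "0 < snd z" "0 < snd z'" shows "hdist (upJ z) (upJ z') = upper_dist dist z z'"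
  using lor_upJ[of z z'] assms by (simp add: hdist_def upper_dist_def case_prod_beta)

text \<open>Minus the reciprocal of the height is the restriction of a linear functional to the
  hyperboloid. This is what makes heights in a cusp comparable across charts by linear maps.\<close>

lemma lor_upv: "lor (upJ z) upv = - 1 / snd z"
  by (cases "snd z = 0") (simp_all add: upJ_def upv_def lor_real inner_prod_def field_simps)

lemma lor_upw: "lor (upJ z) upw = (fst z \<bullet> wall_normal) / snd z"
  by (simp add: upJ_def upw_def lor_real inner_prod_def)

lemma upI_pos: fixes y :: "('a::euclidean_space \<times> real) \<times> real" assumes "y \<in> Hyp" shows "0 < snd (fst y) + snd y"
  using null_lor_Hyp[OF null_upv assms] by (simp add: upv_def lor_real inner_prod_def)

lemma upI_upJ: assumes "0 < snd z" shows "upI (upJ z) = z"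
proof -
  have "snd (fst (upJ z)) + snd (upJ z) = 1 / snd z" using assms by (simp add: upJ_def field_simps)
  then show ?thesis using assms by (simp add: upI_def) (simp add: upJ_def)
qed

lemma upJ_upI: assumes y: "y \<in> Hyp" shows "upJ (upI y) = y" "0 < snd (upI y)"
proof -
  obtain a s u where [simp]: "y = ((a, s), u)" by (metis surj_pair)
  define k where "k = s + u"
  have k: "0 < k" using upI_pos[OF y] by (simp add: k_def)
  show "0 < snd (upI y)" using k by (simp add: upI_def k_def)
  have "a \<bullet> a + s * s - u * u = - 1" using HypD(1)[OF y] by (simp add: lor_real inner_prod_def)
  then have aa: "a \<bullet> a = (u - s) * k - 1" by (simp add: k_def algebra_simps)
  have us: "u = k - s" by (simp add: k_def)
  have I: "upI y = ((1 / k) *\<^sub>R a, 1 / k)" by (simp add: upI_def k_def)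
  have "(1 - (a \<bullet> a) / (k * k) - (1 / k)\<^sup>2) / (2 * (1 / k)) = s" "(1 + (a \<bullet> a) / (k * k) + (1 / k)\<^sup>2) / (2 * (1 / k)) = u"
    unfolding aa us using k by (simp_all add: field_simps power2_eq_square)
  then show "upJ (upI y) = y" unfolding upJ_def I using k by simp
qed

lemma continuous_on_upJ: "continuous_on {z. 0 < snd z} upJ"
  unfolding upJ_def by (intro continuous_intros) auto

lemma open_upJ:
  assumes "open T" shows "open ({z :: 'a::euclidean_space \<times> real. 0 < snd z} \<inter> upJ -` T)"
proof (rule continuous_open_preimage[OF continuous_on_upJ _ assms])
  show "open {z :: 'a \<times> real. 0 < snd z}" by (intro open_Collect_less continuous_intros)
qed

lemma continuous_on_upI: "continuous_on Hyp upI"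
  unfolding upI_def using upI_pos by (intro continuous_intros) force+

interpretation up: wall "upw :: ('a::euclidean_space \<times> real) \<times> real"
  by standard (rule upw)

lemma hyp_half_iff: "z \<in> hyp_half \<longleftrightarrow> 0 < snd z \<and> 0 \<le> fst z \<bullet> wall_normal"
  by (auto simp: hyp_half_def euc_half_def mem_Times_iff)

lemma upJ_Hhalf: assumes "z \<in> hyp_half" shows "upJ z \<in> up.Hhalf"
  using assms upJ_Hyp[of z] by (simp add: hyp_half_iff up.Hhalf_def lor_upw)

lemma upI_half: assumes "y \<in> up.Hhalf" shows "upI y \<in> hyp_half"
proof -
  have y: "y \<in> Hyp" "0 \<le> lor y upw" using assms by (auto simp: up.Hhalf_def)
  have "0 \<le> (fst (upI y) \<bullet> wall_normal) / snd (upI y)" using y(2) lor_upw[of "upI y"] upJ_upI[OF y(1)] by simp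
  then show ?thesis using upJ_upI(2)[OF y(1)] by (simp add: hyp_half_iff zero_le_divide_iff)
qed

section \<open>Charts in the two models\<close>

context
  fixes M :: "'m::metric_space set" and T :: "'a::euclidean_space itself"
begin

interpretation mc: charted "upw :: ('a \<times> real) \<times> real" M by standard

lemma submetric_topology: "mtopology_of (submetric euclidean_metric M) = top_of_set M"
  by (simp add: mtopology_of_submetric)

lemma hyp_chart_alt:
  "hyp_chart M U \<phi> \<longleftrightarrow> openin (top_of_set M) U \<and> openin (top_of_set hyp_half) (\<phi> ` U) \<and>
     (\<forall>x\<in>U. \<forall>y\<in>U. upper_dist dist (\<phi> x) (\<phi> y) = dist x y)"
  by (simp add: hyp_chart_def isometric_chart_def submetric_topology)

lemma hyp_chart_lchart:
  fixes \<phi> :: "'m => 'a \<times> real"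
  assumes c: "hyp_chart M U \<phi>" shows "mc.lchart U (upJ \<circ> \<phi>)"
proof -
  have U: "openin (top_of_set M) U" and V: "openin (top_of_set hyp_half) (\<phi> ` U)"
    and d: "\<And>x y. x \<in> U ==> y \<in> U ==> upper_dist dist (\<phi> x) (\<phi> y) = dist x y"
    using c by (auto simp: hyp_chart_alt)
  have h: "\<phi> p \<in> hyp_half" if "p \<in> U" for p using openin_imp_subset[OF V] that by blast
  obtain T where T: "open T" "\<phi> ` U = hyp_half \<inter> T" using V by (auto simp: openin_open)
  obtain S where S: "open S" "S \<inter> Hyp = upI -` T \<inter> Hyp" using continuous_on_open_invariant[THEN iffD1, OF continuous_on_upI] T(1) by blast
  have "\<exists>r>0. hball y r \<inter> up.Hhalf \<subseteq> (upJ \<circ> \<phi>) ` U" if y: "y \<in> (upJ \<circ> \<phi>) ` U" for y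
  proof -
    obtain p where p: "p \<in> U" "y = upJ (\<phi> p)" using y by auto
    have sp: "0 < snd (\<phi> p)" using h[OF p(1)] by (simp add: hyp_half_iff)
    have yH: "y \<in> Hyp" using upJ_Hyp[OF sp] p(2) by simp
    have "upI y \<in> T" using upI_upJ[OF sp] p T(2) by auto
    then have yS: "y \<in> Hyp \<inter> S" using S(2) yH by blast
    have "openin (top_of_set Hyp) (Hyp \<inter> S)" using S(1) by (rule openin_open_Int)
    then obtain r where r: "0 < r" "hball y r \<subseteq> Hyp \<inter> S" using yS unfolding openin_Hyp_iff by blast
    have "x \<in> (upJ \<circ> \<phi>) ` U" if x: "x \<in> hball y r" "x \<in> up.Hhalf" for x
    proof -
      have xH: "x \<in> Hyp" "upI x \<in> T" using x(1) r(2) S(2) by blast+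
      then have "upI x \<in> \<phi> ` U" using T(2) upI_half[OF x(2)] by blast
      then obtain q where "q \<in> U" "upI x = \<phi> q" by blast
      then show ?thesis using upJ_upI(1)[OF xH(1)] by (intro image_eqI[of _ _ q]) auto
    qed
    then show ?thesis using r(1) by blast
  qed
  moreover have "(upJ \<circ> \<phi>) ` U \<subseteq> up.Hhalf" by (intro image_subsetI) (simp add: upJ_Hhalf h)
  moreover have "hdist ((upJ \<circ> \<phi>) p) ((upJ \<circ> \<phi>) q) = dist p q" if "p \<in> U" "q \<in> U" for p q
    using hdist_upJ[of "\<phi> p" "\<phi> q"] h[OF that(1)] h[OF that(2)] d[OF that] by (simp add: hyp_half_iff)
  ultimately show ?thesis using U by (simp add: mc.lchart_def)
qed

text \<open>The volume measure is specified on charts in the upper half-space, while the packing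
  argument produces charts in the hyperboloid. The image is open only relative to the half;
  \<open>V\<close> collects the balls that witness this.\<close>

lemma lchart_hyp_chart:
  fixes \<psi> :: "'m => ('a \<times> real) \<times> real"
  assumes c: "mc.lchart U \<psi>" shows "hyp_chart M U (upI \<circ> \<psi>)"
proof -
  have h: "\<psi> p \<in> up.Hhalf" "\<psi> p \<in> Hyp" if "p \<in> U" for p using mc.lchart_Hhalf[OF c that] mc.lchart_Hyp[OF c that] by auto
  define V where "V = (\<Union>y\<in>\<psi> ` U. \<Union>r\<in>{r. 0 < r \<and> hball y r \<inter> up.Hhalf \<subseteq> \<psi> ` U}. hball y r)"
  have "openin (top_of_set Hyp) V" unfolding V_def using h(2) by (intro openin_Union ballI) (auto intro!: openin_Union openin_hball simp del: SUP_upper)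
  then obtain T where T: "open T" "V = Hyp \<inter> T" by (auto simp: openin_open)
  have V: "\<psi> ` U = V \<inter> up.Hhalf"
  proof
    show "\<psi> ` U \<subseteq> V \<inter> up.Hhalf"
    proof
      fix y assume y: "y \<in> \<psi> ` U"
      then obtain r where r: "0 < r" "hball y r \<inter> up.Hhalf \<subseteq> \<psi> ` U" using c unfolding mc.lchart_def by blast
      have yH: "y \<in> up.Hhalf" "y \<in> Hyp" using y h by auto
      have "y \<in> hball y r" using yH(2) r(1) by simp
      then show "y \<in> V \<inter> up.Hhalf" unfolding V_def using y r yH by blast
    qed
  qed (auto simp: V_def)
  have half: "open ({z :: 'a \<times> real. 0 < snd z} \<inter> upJ -` T)" using T(1) by (rule open_upJ)
  have "(upI \<circ> \<psi>) ` U = hyp_half \<inter> ({z. 0 < snd z} \<inter> upJ -` T)"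
  proof
    show "(upI \<circ> \<psi>) ` U \<subseteq> hyp_half \<inter> ({z. 0 < snd z} \<inter> upJ -` T)"
    proof
      fix z assume "z \<in> (upI \<circ> \<psi>) ` U"
      then obtain p where p: "p \<in> U" "z = upI (\<psi> p)" by auto
      have "\<psi> p \<in> T" using V p T(2) by blast
      then show "z \<in> hyp_half \<inter> ({z. 0 < snd z} \<inter> upJ -` T)"
        using upI_half[OF h(1)[OF p(1)]] upJ_upI[OF h(2)[OF p(1)]] p(2) by simp
    qed
    show "hyp_half \<inter> ({z. 0 < snd z} \<inter> upJ -` T) \<subseteq> (upI \<circ> \<psi>) ` U"
    proof
      fix z :: "'a \<times> real" assume z: "z \<in> hyp_half \<inter> ({z. 0 < snd z} \<inter> upJ -` T)"
      then have "upJ z \<in> V \<inter> up.Hhalf" using upJ_Hyp[of z] upJ_Hhalf[of z] T(2) by auto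
      then obtain p where "p \<in> U" "upJ z = \<psi> p" using V by blast
      then show "z \<in> (upI \<circ> \<psi>) ` U" using upI_upJ[of z] z by (intro image_eqI[of _ _ p]) auto
    qed
  qed
  then have "openin (top_of_set hyp_half) ((upI \<circ> \<psi>) ` U)" using half by (auto simp: openin_open)
  moreover have "upper_dist dist ((upI \<circ> \<psi>) p) ((upI \<circ> \<psi>) q) = dist p q" if "p \<in> U" "q \<in> U" for p q
    using hdist_upJ[of "upI (\<psi> p)" "upI (\<psi> q)"] upJ_upI[OF h(2)[OF that(1)]] upJ_upI[OF h(2)[OF that(2)]] mc.lchart_dist[OF c that] by simp
  ultimately show ?thesis using c by (simp add: hyp_chart_alt mc.lchart_def)
qed

lemma hyp_boundary_bd: "hyp_boundary TYPE('a) M = mc.bd"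
proof
  show "hyp_boundary TYPE('a) M \<subseteq> mc.bd"
  proof
    fix p assume "p \<in> hyp_boundary TYPE('a) M"
    then obtain U and \<phi> :: "'m => 'a \<times> real" where c: "hyp_chart M U \<phi>" "p \<in> U" "\<phi> p \<in> hyp_wall" "p \<in> M"
      by (auto simp: hyp_boundary_def wall_points_def hyp_chart_def)
    have "lor ((upJ \<circ> \<phi>) p) upw = 0" using c(3) by (auto simp: lor_upw hyp_wall_def euc_wall_def)
    then show "p \<in> mc.bd" using mc.bd_iff[OF hyp_chart_lchart[OF c(1)] c(2)] by blast
  qed
  show "mc.bd \<subseteq> hyp_boundary TYPE('a) M"
  proof
    fix p assume "p \<in> mc.bd"
    then obtain U \<psi> where c: "p \<in> M" "mc.lchart U \<psi>" "p \<in> U" "lor (\<psi> p) upw = 0" by (auto simp: mc.bd_def)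
    have H: "\<psi> p \<in> Hyp" using mc.lchart_Hyp c by blast
    have "(fst (upI (\<psi> p)) \<bullet> wall_normal) / snd (upI (\<psi> p)) = 0" using lor_upw[of "upI (\<psi> p)"] upJ_upI(1)[OF H] c(4) by simp
    then have "(upI \<circ> \<psi>) p \<in> hyp_wall" using upJ_upI(2)[OF H] by (simp add: hyp_wall_def euc_wall_def mem_Times_iff)
    then show "p \<in> hyp_boundary TYPE('a) M"
      using lchart_hyp_chart[OF c(2)] c(1,3) unfolding hyp_boundary_def wall_points_def hyp_chart_def by (simp del: comp_apply) blast
  qed
qed

lemma upper_volume_pos:
  assumes S: "open S" "S \<noteq> {}" "S \<subseteq> {z :: 'a \<times> real. 0 < snd z}" shows "0 < emeasure upper_volume S"
proof (rule ccontr)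
  assume n: "\<not> 0 < emeasure upper_volume S"
  define g :: "'a \<times> real => ennreal" where "g = (\<lambda>(x, t). if 0 < t then ennreal (1 / t ^ (DIM('a) + 1)) else 0)"
  have "g = (\<lambda>z. if 0 < snd z then ennreal (1 / snd z ^ (DIM('a) + 1)) else 0)" by (auto simp: g_def)
  moreover have "(\<lambda>z :: 'a \<times> real. snd z) \<in> borel_measurable borel" by (intro borel_measurable_continuous_onI continuous_intros)
  ultimately have gm: "g \<in> borel_measurable lborel" by simp
  have Sm: "S \<in> sets lborel" using S(1) by simp
  have "emeasure (density lborel g) S = 0" using n by (simp add: upper_volume_def g_def)
  then have "(\<integral>\<^sup>+ z. g z * indicator S z \<partial>lborel) = 0" using emeasure_density[OF gm Sm] by simp
  then have "AE z in lborel. g z * indicator S z = 0" using gm Sm by (subst (asm) nn_integral_0_iff_AE) auto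
  then have "AE z in lborel. z \<notin> S"
  proof eventually_elim
    case (elim z)
    then show ?case using S(3) by (cases z) (auto simp: g_def indicator_def split: if_splits)
  qed
  then have "S \<in> null_sets lborel" using Sm AE_iff_null_sets by blast
  then have "negligible S" using negligible_iff_null_sets null_sets_completionI by blast
  then show False using open_not_negligible S by blast
qed

text \<open>All members of the family have the same positive volume, that of the ball, and lie
  disjointly in \<open>M\<close>.\<close>

lemma hyp_packing:
  fixes \<zeta> :: "('a \<times> real) \<times> real"
  assumes M: "finite_volume_hyperbolic_manifold TYPE('a) M" and \<zeta>: "\<zeta> \<in> Hyp" "0 < r" "hball \<zeta> r \<subseteq> up.Hhalf"
  shows "\<exists>N. \<forall>\<U>. finite \<U> \<and> disjoint \<U> \<and> (\<forall>U\<in>\<U>. \<exists>\<psi>. mc.lchart U \<psi> \<and> \<psi> ` U = hball \<zeta> r) --> card \<U> \<le> N"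
proof -
  obtain \<mu> where mu: "hyp_volume_measure TYPE('a) M \<mu>" "emeasure \<mu> M < \<infinity>"
    using M by (auto simp: finite_volume_hyperbolic_manifold_def)
  have sets: "sets \<mu> = sets (restrict_space borel M)" using mu(1) by (simp add: hyp_volume_measure_def)
  have sp: "M \<in> sets \<mu>" unfolding sets by (metis space_restrict_space2 sets.top inf_top_right space_borel space_restrict_space)
  define S where "S = upI ` hball \<zeta> r"
  define c where "c = emeasure upper_volume S"
  obtain T where T: "open T" "hball \<zeta> r = Hyp \<inter> T" using openin_hball[OF \<zeta>(1), of r] by (auto simp: openin_open)
  have "S = {z. 0 < snd z} \<inter> upJ -` T"
  proof
    show "S \<subseteq> {z. 0 < snd z} \<inter> upJ -` T" unfolding S_def T(2) by (intro image_subsetI) (simp add: upJ_upI)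
    show "{z. 0 < snd z} \<inter> upJ -` T \<subseteq> S"
    proof
      fix z :: "'a \<times> real" assume "z \<in> {z. 0 < snd z} \<inter> upJ -` T"
      then show "z \<in> S" unfolding S_def T(2) using upI_upJ[of z] upJ_Hyp[of z] by (intro image_eqI[of _ _ "upJ z"]) auto
    qed
  qed
  moreover have "open ({z :: 'a \<times> real. 0 < snd z} \<inter> upJ -` T)" using T(1) by (rule open_upJ)
  moreover have "S \<noteq> {}" using \<zeta> center_hball[OF \<zeta>(1), of r] unfolding S_def by blast
  ultimately have c: "0 < c" unfolding c_def by (intro upper_volume_pos) auto
  have cardle: "of_nat (card \<U>) * c \<le> emeasure \<mu> M"
    if U: "finite \<U>" "disjoint \<U>" "\<And>U. U \<in> \<U> ==> \<exists>\<psi>. mc.lchart U \<psi> \<and> \<psi> ` U = hball \<zeta> r" for \<U>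
  proof -
    have UM: "U \<in> sets \<mu>" "emeasure \<mu> U = c" "U \<subseteq> M" if UU: "U \<in> \<U>" for U
    proof -
      obtain \<psi> where psi: "mc.lchart U \<psi>" "\<psi> ` U = hball \<zeta> r" using U(3)[OF UU] by blast
      have o: "openin (top_of_set M) U" using psi(1) by (simp add: mc.lchart_def)
      then show "U \<subseteq> M" by (rule openin_imp_subset)
      obtain V where V: "open V" "U = M \<inter> V" using o by (auto simp: openin_open)
      show "U \<in> sets \<mu>" unfolding sets sets_restrict_space using V by (intro image_eqI[of _ _ V]) auto
      have "\<forall>B\<in>sets borel. emeasure \<mu> {x \<in> U. (upI \<circ> \<psi>) x \<in> B} = emeasure upper_volume (B \<inter> (upI \<circ> \<psi>) ` U)"
        using mu(1) lchart_hyp_chart[OF psi(1)] unfolding hyp_volume_measure_def by blast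
      from bspec[OF this, of UNIV] have "emeasure \<mu> U = emeasure upper_volume ((upI \<circ> \<psi>) ` U)" by simp
      also have "(upI \<circ> \<psi>) ` U = S" unfolding S_def psi(2)[symmetric] by (rule image_comp[symmetric])
      finally show "emeasure \<mu> U = c" by (simp add: c_def)
    qed
    have "of_nat (card \<U>) * c = (\<Sum>U\<in>\<U>. emeasure \<mu> U)" using UM(2) by simp
    also have "\<dots> = emeasure \<mu> (\<Union>\<U>)"
      using sum_emeasure[of "\<lambda>U. U" \<U> \<mu>] U(1,2) UM(1) by (simp add: disjoint_family_on_def disjoint_def image_subset_iff subset_iff)
    also have "\<dots> \<le> emeasure \<mu> M" using UM(3) sp by (intro emeasure_mono) auto
    finally show ?thesis .
  qed
  \<comment> \<open>No upper bound on the volume of the ball has been established; a positive real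
    lower bound suffices.\<close>
  obtain c' where c': "0 < c'" "ennreal c' \<le> c"
  proof (cases c)
    case (real x)
    then show ?thesis using that[of x] c by auto
  next
    case top
    then show ?thesis using that[of 1] by auto
  qed
  obtain m where m: "0 \<le> m" "emeasure \<mu> M = ennreal m" using mu(2) by (cases "emeasure \<mu> M") auto
  have "card \<U> \<le> nat \<lceil>m / c'\<rceil>"
    if U: "finite \<U> \<and> disjoint \<U> \<and> (\<forall>U\<in>\<U>. \<exists>\<psi>. mc.lchart U \<psi> \<and> \<psi> ` U = hball \<zeta> r)" for \<U>
  proof -
    have "ennreal (real (card \<U>) * c') = of_nat (card \<U>) * ennreal c'" by (simp add: ennreal_mult' ennreal_of_nat_eq_real_of_nat)
    also have "\<dots> \<le> of_nat (card \<U>) * c" by (intro mult_left_mono c') simp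
    also have "\<dots> \<le> ennreal m" using cardle[of \<U>] U m(2) by simp
    finally have "real (card \<U>) * c' \<le> m" using m(1) by (simp add: ennreal_le_iff)
    then have "real (card \<U>) \<le> m / c'" using c'(1) by (simp add: pos_le_divide_eq)
    then show ?thesis by linarith
  qed
  then show ?thesis by blast
qed

lemma hyp_short_path:
  assumes M: "length_space (submetric euclidean_metric M)" and p: "p \<in> M" and q: "q \<in> M" and L: "dist p q < L"
  shows "\<exists>g. path g \<and> path_image g \<subseteq> M \<and> g 0 = p \<and> g 1 = q \<and>
      (\<forall>n. (\<Sum>i<n. dist (g (real i / real n)) (g (real (Suc i) / real n))) \<le> L)"
proof -
  let ?X = "submetric euclidean_metric M"
  let ?P = "{g. pathin (mtopology_of ?X) g \<and> g 0 = p \<and> g 1 = q}"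
  have L0: "0 < L" using L zero_le_dist[of p q] by linarith
  have "ennreal (dist p q) = (INF g\<in>?P. curve_length ?X g)"
    using M p q by (simp add: length_space_def)
  moreover have "ennreal (dist p q) < ennreal L" using L by (simp add: ennreal_less_iff)
  ultimately obtain g where g: "pathin (mtopology_of ?X) g" "g 0 = p" "g 1 = q" "curve_length ?X g < ennreal L"
    by (auto simp: INF_less_iff)
  have g1: "continuous_on {0..1} g" "g ` {0..1} \<subseteq> M"
    using g(1) by (auto simp: pathin_def submetric_topology continuous_map_in_subtopology)
  have "(\<Sum>i<n. dist (g (real i / real n)) (g (real (Suc i) / real n))) \<le> L" for n
  proof (cases "n = 0")
    case False
    define ts where "ts = map (\<lambda>i. real i / real n) [0..<Suc n]"
    have ts: "sorted ts" "set ts \<subseteq> {0..1}" "length ts - 1 = n"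
      unfolding ts_def using False by (auto simp: sorted_iff_nth_mono divide_right_mono simp del: upt_Suc)
    have "ennreal (\<Sum>i<length ts - 1. mdist ?X (g (ts ! i)) (g (ts ! Suc i))) \<le> curve_length ?X g"
      unfolding curve_length_def using ts by (intro SUP_upper) auto
    also have "(\<Sum>i<length ts - 1. mdist ?X (g (ts ! i)) (g (ts ! Suc i))) = (\<Sum>i<n. dist (g (real i / real n)) (g (real (Suc i) / real n)))"
      unfolding ts(3) by (rule sum.cong) (auto simp: ts_def nth_append simp del: upt_Suc)
    finally have "ennreal (\<Sum>i<n. dist (g (real i / real n)) (g (real (Suc i) / real n))) \<le> ennreal L" using g(4) by simp
    then show ?thesis using L0 by (simp add: ennreal_le_iff)
  qed (use L0 in simp)
  then show ?thesis using g g1 by (intro exI[of _ g]) (simp add: path_def path_image_def)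
qed

text \<open>The folding map is based at a point off the boundary, so that \<open>tau\<close> can
  serve as the point \<open>b\<close> that selects the chamber.\<close>

theorem hyp_manifold_folding:
  assumes M: "finite_volume_hyperbolic_manifold TYPE('a) M"
  obtains F where "finvol (upw :: ('a \<times> real) \<times> real) M F" "chamber (upw :: ('a \<times> real) \<times> real) M F tau"
proof -
  have M': "M \<noteq> {}" "connected M" "complete M" "length_space (submetric euclidean_metric M)"
    "locally_isometric_to (submetric euclidean_metric M) (hyp_half :: ('a \<times> real) set) (upper_dist dist)"
    using M by (auto simp: finite_volume_hyperbolic_manifold_def)
  have atlas: "\<exists>U \<psi>. mc.lchart U \<psi> \<and> p \<in> U" if "p \<in> M" for p
  proof -
    obtain U and \<phi> :: "'m => 'a \<times> real" where "hyp_chart M U \<phi>" "p \<in> U"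
      using M'(5) \<open>p \<in> M\<close> by (auto simp: locally_isometric_to_def hyp_chart_def)
    then show ?thesis using hyp_chart_lchart by blast
  qed
  interpret hypmfd "upw :: ('a \<times> real) \<times> real" M
    by standard (use M' atlas in auto)
  obtain p where p: "p \<in> M" using M'(1) by blast
  obtain U \<psi> where c: "mc.lchart U \<psi>" "p \<in> U" using atlas[OF p] by blast
  obtain y e where y: "y \<in> Hyp" "0 < e" "hball y e \<subseteq> \<psi> ` U" using mc.lchart_interior_ball[OF c] .
  obtain z where z: "z \<in> hball y e" "lor z upw \<noteq> 0" using off_hyperplane[OF y(1,2) up.wn0] .
  then obtain q where q: "q \<in> U" "z = \<psi> q" using y(3) by blast
  have qb: "q \<notin> mc.bd" using mc.bd_iff[OF c(1) q(1)] z(2) q(2) by blast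
  have qM: "q \<in> M" using mc.lchart_sub[OF c(1)] q(1) by blast
  obtain F where F: "F tau = q" "\<And>z. z \<in> Hyp ==> mc.foldat F z" using fold_exists[OF qM hyp0_Hyp] by blast
  have "finvol (upw :: ('a \<times> real) \<times> real) M F"
  proof unfold_locales
    show "3 \<le> DIM(('a \<times> real) \<times> real)" using DIM_positive[where 'a = 'a] by simp
  qed (use F(2) hyp_short_path[OF M'(4)] hyp_packing[OF M] in auto)
  moreover have "chamber (upw :: ('a \<times> real) \<times> real) M F tau"
  proof unfold_locales
    show "F tau \<notin> mc.bd" using F(1) qb by simp
  qed (use F(2) in blast, rule hyp0_Hyp)
  ultimately show ?thesis using that by blast
qed

end

section \<open>The fundamental group\<close>

lemma loops_atD:
  assumes "p \<in> loops_at S x" shows "path p" "path_image p \<subseteq> S" "pathstart p = x" "pathfinish p = x"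
  using assms by (auto simp: loops_at_def)

lemma loops_atI: "path p ==> path_image p \<subseteq> S ==> pathstart p = x ==> pathfinish p = x ==> p \<in> loops_at S x"
  by (simp add: loops_at_def)

lemma loops_at_join: "p \<in> loops_at S x ==> q \<in> loops_at S x ==> p +++ q \<in> loops_at S x"
  by (auto simp: loops_at_def path_image_join)

lemma path_class_eqI: "homotopic_paths S p q ==> path_class S p = path_class S q"
  unfolding path_class_def using homotopic_paths_sym homotopic_paths_trans by blast

lemma path_class_eqD:
  assumes "path_class S p = path_class S q" "path q" "path_image q \<subseteq> S" shows "homotopic_paths S p q"
proof -
  have "q \<in> path_class S q" using assms by (simp add: path_class_def)
  then show ?thesis using assms(1) by (auto simp: path_class_def)
qed

text \<open>Homotopies made in the unit interval are carried along \<open>p\<close>; this yields the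
  group laws in spaces without linear structure.\<close>

lemma push_homotopy:
  fixes q q' :: "real => real"
  assumes p: "path p" "path_image p \<subseteq> S" and h: "homotopic_paths {0..1} q q'"
  shows "homotopic_paths S (p \<circ> q) (p \<circ> q')"
  using homotopic_paths_continuous_image[OF h, of p S] p by (auto simp: path_def path_image_def)

lemma homotopic_lid:
  assumes p: "path p" "path_image p \<subseteq> S" shows "homotopic_paths S ((\<lambda>_. pathstart p) +++ p) p"
proof -
  have i: "path (\<lambda>t::real. t)" "path_image (\<lambda>t::real. t) \<subseteq> {0..1}" by (auto simp: path_def path_image_def)
  have "homotopic_paths S (p \<circ> (linepath (pathstart (\<lambda>t. t)) (pathstart (\<lambda>t. t)) +++ (\<lambda>t. t))) (p \<circ> (\<lambda>t. t))"
    by (rule push_homotopy[OF p homotopic_paths_lid[OF i]])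
  then show ?thesis by (simp add: path_compose_join) (simp add: comp_def pathstart_def linepath_def)
qed

lemma homotopic_linv:
  assumes p: "path p" "path_image p \<subseteq> S" shows "homotopic_paths S (reversepath p +++ p) (\<lambda>_. pathfinish p)"
proof -
  have i: "path (\<lambda>t::real. t)" "path_image (\<lambda>t::real. t) \<subseteq> {0..1}" by (auto simp: path_def path_image_def)
  have "homotopic_paths S (p \<circ> (reversepath (\<lambda>t. t) +++ (\<lambda>t. t))) (p \<circ> linepath (pathfinish (\<lambda>t. t)) (pathfinish (\<lambda>t. t)))"
    by (rule push_homotopy[OF p homotopic_paths_linv[OF i]])
  then show ?thesis by (simp add: path_compose_join path_compose_reversepath) (simp add: comp_def pathfinish_def linepath_def)
qed

lemma fundamental_group_simps:
  "carrier (fundamental_group S x) = path_class S ` loops_at S x" "\<one>\<^bsub>fundamental_group S x\<^esub> = path_class S (\<lambda>_. x)"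
  by (simp_all add: fundamental_group_def)

lemma fundamental_group_mult:
  assumes p: "p \<in> loops_at S x" and q: "q \<in> loops_at S x"
  shows "path_class S p \<otimes>\<^bsub>fundamental_group S x\<^esub> path_class S q = path_class S (p +++ q)"
proof -
  have "path_class S (p' +++ q') = path_class S (p +++ q)" if "p' \<in> path_class S p" "q' \<in> path_class S q" for p' q'
  proof -
    have "homotopic_paths S p p'" "homotopic_paths S q q'" using that by (auto simp: path_class_def)
    then have "homotopic_paths S (p +++ q) (p' +++ q')" using loops_atD[OF p] loops_atD[OF q] by (intro homotopic_paths_join) auto
    then show ?thesis using path_class_eqI by metis
  qed
  moreover have "p \<in> path_class S p" "q \<in> path_class S q"
    using loops_atD[OF p] loops_atD[OF q] by (auto simp: path_class_def)
  ultimately have "(\<Union>p'\<in>path_class S p. \<Union>q'\<in>path_class S q. path_class S (p' +++ q')) = path_class S (p +++ q)" by blast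
  then show ?thesis by (simp add: fundamental_group_def)
qed

lemma const_loop: "x \<in> S ==> (\<lambda>_. x) \<in> loops_at S x"
  by (auto simp: loops_at_def path_def path_image_def pathstart_def pathfinish_def)

lemma group_fundamental_group: assumes x: "x \<in> S" shows "group (fundamental_group S x)"
proof (rule groupI)
  let ?G = "fundamental_group S x"
  show "a \<otimes>\<^bsub>?G\<^esub> b \<in> carrier ?G" if ab: "a \<in> carrier ?G" "b \<in> carrier ?G" for a b
  proof -
    obtain p q where "p \<in> loops_at S x" "q \<in> loops_at S x" "a = path_class S p" "b = path_class S q"
      using ab unfolding fundamental_group_simps by blast
    then show ?thesis using fundamental_group_mult loops_at_join unfolding fundamental_group_simps by (metis imageI)
  qed
  show "\<one>\<^bsub>?G\<^esub> \<in> carrier ?G" unfolding fundamental_group_simps using const_loop[OF x] by blast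
  show "a \<otimes>\<^bsub>?G\<^esub> b \<otimes>\<^bsub>?G\<^esub> c = a \<otimes>\<^bsub>?G\<^esub> (b \<otimes>\<^bsub>?G\<^esub> c)" if abc: "a \<in> carrier ?G" "b \<in> carrier ?G" "c \<in> carrier ?G" for a b c
  proof -
    obtain p q r where p: "p \<in> loops_at S x" "q \<in> loops_at S x" "r \<in> loops_at S x"
      "a = path_class S p" "b = path_class S q" "c = path_class S r"
      using abc unfolding fundamental_group_simps by blast
    have "homotopic_paths S (p +++ (q +++ r)) ((p +++ q) +++ r)"
      using loops_atD[OF p(1)] loops_atD[OF p(2)] loops_atD[OF p(3)] by (intro homotopic_paths_assoc) auto
    then show ?thesis using p(1-3) by (simp add: p(4-6) fundamental_group_mult loops_at_join path_class_eqI)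
  qed
  show "\<one>\<^bsub>?G\<^esub> \<otimes>\<^bsub>?G\<^esub> a = a" if a: "a \<in> carrier ?G" for a
  proof -
    obtain p where p: "p \<in> loops_at S x" "a = path_class S p" using a unfolding fundamental_group_simps by blast
    have "homotopic_paths S ((\<lambda>_. x) +++ p) p" using homotopic_lid[of p S] loops_atD[OF p(1)] by simp
    then show ?thesis using fundamental_group_mult[OF const_loop[OF x] p(1)] by (simp add: p(2) fundamental_group_simps path_class_eqI)
  qed
  show "\<exists>b\<in>carrier ?G. b \<otimes>\<^bsub>?G\<^esub> a = \<one>\<^bsub>?G\<^esub>" if a: "a \<in> carrier ?G" for a
  proof -
    obtain p where p: "p \<in> loops_at S x" "a = path_class S p" using a unfolding fundamental_group_simps by blast
    have r: "reversepath p \<in> loops_at S x" using loops_atD[OF p(1)] by (intro loops_atI) auto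
    have "homotopic_paths S (reversepath p +++ p) (\<lambda>_. x)" using homotopic_linv[of p S] loops_atD[OF p(1)] by simp
    then have "path_class S (reversepath p) \<otimes>\<^bsub>?G\<^esub> a = \<one>\<^bsub>?G\<^esub>"
      using fundamental_group_mult[OF r p(1)] by (simp add: p(2) fundamental_group_simps path_class_eqI)
    then show ?thesis using r unfolding fundamental_group_simps by blast
  qed
qed

section \<open>Lifting paths to coverings of metric spaces\<close>

text \<open>The lifting theorems of the library need a normed base space; the Kuratowski embedding provides one.\<close>

lemma kuratowski_embedding:
  obtains \<kappa> :: "'m::metric_space => 'm \<Rightarrow>\<^sub>C real" where "\<And>p q. dist (\<kappa> p) (\<kappa> q) = dist p q"
proof -
  define o0 :: 'm where "o0 = undefined"
  \<comment> \<open>Subtracting the distance to a base point makes the distance function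
    bounded.\<close>
  define f where "f p q = dist p q - dist o0 q" for p q :: 'm
  have f: "f p \<in> bcontfun" for p
  proof (rule bcontfun_normI)
    show "continuous_on UNIV (f p)" unfolding f_def by (intro continuous_intros)
    show "norm (f p q) \<le> dist p o0" for q
      using dist_triangle[of p q o0] dist_triangle[of o0 q p] by (simp add: f_def dist_commute abs_le_iff)
  qed
  define \<kappa> where "\<kappa> p = Bcontfun (f p)" for p
  have ap: "apply_bcontfun (\<kappa> p) = f p" for p using Bcontfun_inverse[OF f] by (simp add: \<kappa>_def)
  have "dist (\<kappa> p) (\<kappa> q) = dist p q" for p q
  proof (rule antisym)
    show "dist (\<kappa> p) (\<kappa> q) \<le> dist p q"
    proof (rule dist_bound)
      show "dist (apply_bcontfun (\<kappa> p) x) (apply_bcontfun (\<kappa> q) x) \<le> dist p q" for x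
        using dist_triangle[of p x q] dist_triangle[of q x p] by (simp add: ap f_def dist_real_def dist_commute abs_le_iff)
    qed
    have "dist p q = dist (apply_bcontfun (\<kappa> p) q) (apply_bcontfun (\<kappa> q) q)" by (simp add: ap f_def dist_real_def)
    then show "dist p q \<le> dist (\<kappa> p) (\<kappa> q)" using dist_bounded by metis
  qed
  then show ?thesis using that by blast
qed

context
  fixes p :: "'v::real_normed_vector => 'm::metric_space" and C S
  assumes cov: "covering_space C p S"
begin

lemma kuratowski_covering:
  assumes k: "\<And>x y. dist (\<kappa> x) (\<kappa> y) = dist (x :: 'm) y"
  shows "covering_space C (\<kappa> \<circ> p) ((\<kappa> :: 'm => 'm \<Rightarrow>\<^sub>C real) ` S)" "continuous_on A \<kappa>" "inj \<kappa>"
proof -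
  show ck: "continuous_on A \<kappa>" for A unfolding continuous_on_iff using k by metis
  show inj: "inj \<kappa>" using k by (metis dist_eq_0_iff injI)
  define l where "l = invf \<kappa>"
  have l: "l (\<kappa> x) = x" for x using inj by (simp add: l_def)
  have cl: "continuous_on (\<kappa> ` A) l" for A unfolding continuous_on_iff using k l by (metis (no_types, lifting) imageE)
  have hom: "homeomorphism A (\<kappa> ` A) \<kappa> l" for A unfolding homeomorphism_def using ck cl l by (auto simp: image_iff)
  show "covering_space C (\<kappa> \<circ> p) (\<kappa> ` S)"
  proof
    show "continuous_on C (\<kappa> \<circ> p)" by (rule continuous_on_compose[OF covering_space_imp_continuous[OF cov] ck])
    show "(\<kappa> \<circ> p) ` C = \<kappa> ` S" using covering_space_imp_surjective[OF cov] by (metis image_comp)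
    fix y assume "y \<in> \<kappa> ` S"
    then obtain x where x: "x \<in> S" "y = \<kappa> x" by blast
    obtain T v where T: "x \<in> T" "openin (top_of_set S) T" "\<Union>v = C \<inter> p -` T" "\<And>u. u \<in> v ==> openin (top_of_set C) u"
      "pairwise disjnt v" "\<And>u. u \<in> v ==> \<exists>q. homeomorphism u T p q"
      using cov x(1) unfolding covering_space_def by metis
    have "openin (top_of_set (\<kappa> ` S)) (\<kappa> ` T)" by (rule homeomorphism_imp_open_map[OF hom T(2)])
    moreover have "\<Union>v = C \<inter> (\<kappa> \<circ> p) -` (\<kappa> ` T)" unfolding T(3) by (auto simp: inj_eq[OF inj])
    moreover have "\<exists>q. homeomorphism u (\<kappa> ` T) (\<kappa> \<circ> p) q" if "u \<in> v" for u
      using homeomorphism_compose[OF _ hom] T(6)[OF that] by blast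
    ultimately show "\<exists>T. y \<in> T \<and> openin (top_of_set (\<kappa> ` S)) T \<and> (\<exists>v. \<Union>v = C \<inter> (\<kappa> \<circ> p) -` T \<and>
        (\<forall>u\<in>v. openin (top_of_set C) u) \<and> pairwise disjnt v \<and> (\<forall>u\<in>v. \<exists>q. homeomorphism u T (\<kappa> \<circ> p) q))"
      using T x(2) by (intro exI[of _ "\<kappa> ` T"] conjI exI[of _ v]) auto
  qed
qed

lemma covering_lift_path:
  assumes g: "path g" "path_image g \<subseteq> S" and a: "a \<in> C" "p a = pathstart g"
  obtains h where "path h" "path_image h \<subseteq> C" "pathstart h = a" "\<And>t. t \<in> {0..1} ==> p (h t) = g t"
proof -
  obtain \<kappa> :: "'m => 'm \<Rightarrow>\<^sub>C real" where k: "\<And>x y. dist (\<kappa> x) (\<kappa> y) = dist x y" using kuratowski_embedding by blast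
  note K = kuratowski_covering[OF k]
  have "path (\<kappa> \<circ> g)" using g(1) K(2) unfolding path_def by (intro continuous_on_compose)
  moreover have "path_image (\<kappa> \<circ> g) \<subseteq> \<kappa> ` S" using g(2) by (auto simp: path_image_compose)
  moreover have "pathstart (\<kappa> \<circ> g) = (\<kappa> \<circ> p) a" using a(2) by (simp add: pathstart_compose)
  ultimately obtain h where h: "path h" "path_image h \<subseteq> C" "pathstart h = a" "\<And>t. t \<in> {0..1} ==> (\<kappa> \<circ> p) (h t) = (\<kappa> \<circ> g) t"
    using covering_space_lift_path_strong[OF K(1) a(1)] by metis
  have "p (h t) = g t" if "t \<in> {0..1}" for t using h(4)[OF that] K(3) by (simp add: inj_eq)
  then show ?thesis using that h by blast
qed

lemma covering_monodromy:
  assumes h: "path h" "path_image h \<subseteq> C" and h': "path h'" "path_image h' \<subseteq> C"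
    and hom: "homotopic_paths S (p \<circ> h) (p \<circ> h')" and eq: "pathstart h = pathstart h'"
  shows "pathfinish h = pathfinish h'"
proof -
  obtain \<kappa> :: "'m => 'm \<Rightarrow>\<^sub>C real" where k: "\<And>x y. dist (\<kappa> x) (\<kappa> y) = dist x y" using kuratowski_embedding by blast
  note K = kuratowski_covering[OF k]
  have hk: "homotopic_paths (\<kappa> ` S) (\<kappa> \<circ> (p \<circ> h)) (\<kappa> \<circ> (p \<circ> h'))"
    by (rule homotopic_paths_continuous_image[OF hom K(2)]) auto
  show ?thesis
    by (rule covering_space_monodromy[OF K(1) _ _ _ _ hk h _ h' _ eq])
      (use homotopic_paths_imp_path[OF hk] homotopic_paths_imp_subset[OF hk] in auto)
qed

end

section \<open>Finite quotients of finitely generated domains\<close>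

definition subring_of :: "'k::field_char_0 set => bool" where
  "subring_of R \<longleftrightarrow> 1 \<in> R \<and> (\<forall>x\<in>R. \<forall>y\<in>R. x - y \<in> R \<and> x * y \<in> R)"

definition ideal_of :: "'k::field_char_0 set => 'k set => bool" where
  "ideal_of I R \<longleftrightarrow> I \<subseteq> R \<and> 0 \<in> I \<and> (\<forall>x\<in>I. \<forall>y\<in>I. x - y \<in> I) \<and> (\<forall>x\<in>R. \<forall>y\<in>I. x * y \<in> I)"

definition finite_index :: "'k::field_char_0 set => 'k set => bool" where
  "finite_index R I \<longleftrightarrow> (\<exists>S. finite S \<and> S \<subseteq> R \<and> (\<forall>x\<in>R. \<exists>s\<in>S. x - s \<in> I))"

text \<open>Asking for a finite quotient in which \<open>r\<close> is a unit, rather than merely nonzero, is what makes the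
  induction on the number of generators go through.\<close>

definition finite_quotients :: "'k::field_char_0 set => bool" where
  "finite_quotients R \<longleftrightarrow> (\<forall>r\<in>R. r \<noteq> 0 -->
     (\<exists>I. ideal_of I R \<and> finite_index R I \<and> 1 \<notin> I \<and> (\<exists>s\<in>R. r * s - 1 \<in> I)))"

lemma subringD:
  assumes "subring_of R"
  shows "1 \<in> R" "0 \<in> R" "x \<in> R ==> y \<in> R ==> x - y \<in> R" "x \<in> R ==> y \<in> R ==> x * y \<in> R"
    "x \<in> R ==> - x \<in> R" "x \<in> R ==> y \<in> R ==> x + y \<in> R"
proof -
  have a: "1 \<in> R" "\<And>x y. x \<in> R ==> y \<in> R ==> x - y \<in> R" "\<And>x y. x \<in> R ==> y \<in> R ==> x * y \<in> R"
    using assms by (auto simp: subring_of_def)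
  have z: "0 \<in> R" using a(2)[OF a(1) a(1)] by simp
  have m: "- x \<in> R" if "x \<in> R" for x using a(2)[OF z that] by simp
  show "1 \<in> R" "0 \<in> R" "x \<in> R ==> y \<in> R ==> x - y \<in> R" "x \<in> R ==> y \<in> R ==> x * y \<in> R"
    "x \<in> R ==> - x \<in> R" using a z m by auto
  show "x \<in> R ==> y \<in> R ==> x + y \<in> R" using a(2)[of x "- y"] m by simp
qed

lemma subring_sum: "subring_of R ==> (\<And>i. i \<in> A ==> f i \<in> R) ==> sum f A \<in> R"
  by (induction A rule: infinite_finite_induct) (auto simp: subringD)

lemma subring_power: "subring_of R ==> x \<in> R ==> x ^ n \<in> R"
  by (induction n) (auto simp: subringD)

lemma idealD:
  assumes "ideal_of I R"
  shows "I \<subseteq> R" "0 \<in> I" "x \<in> I ==> y \<in> I ==> x - y \<in> I" "x \<in> R ==> y \<in> I ==> x * y \<in> I"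
    "y \<in> I ==> x \<in> R ==> y * x \<in> I" "x \<in> I ==> - x \<in> I" "x \<in> I ==> y \<in> I ==> x + y \<in> I"
proof -
  have a: "I \<subseteq> R" "0 \<in> I" "\<And>x y. x \<in> I ==> y \<in> I ==> x - y \<in> I" "\<And>x y. x \<in> R ==> y \<in> I ==> x * y \<in> I"
    using assms by (auto simp: ideal_of_def)
  have m: "- x \<in> I" if "x \<in> I" for x using a(3)[OF a(2) that] by simp
  show "I \<subseteq> R" "0 \<in> I" "x \<in> I ==> y \<in> I ==> x - y \<in> I" "x \<in> R ==> y \<in> I ==> x * y \<in> I" "x \<in> I ==> - x \<in> I"
    using a m by auto
  show "y \<in> I ==> x \<in> R ==> y * x \<in> I" using a(4)[of x y] by (simp add: mult.commute)
  show "x \<in> I ==> y \<in> I ==> x + y \<in> I" using a(3)[of x "- y"] m by simp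
qed

lemma ideal_sum: "ideal_of I R ==> (\<And>i. i \<in> A ==> f i \<in> I) ==> sum f A \<in> I"
  by (induction A rule: infinite_finite_induct) (auto simp: idealD)

section \<open>Polynomials over a subring, and adjoining one element\<close>

definition polys :: "'k::field_char_0 set => 'k poly set" where
  "polys B = {f. \<forall>i. coeff f i \<in> B}"

lemma polys_ring:
  assumes B: "subring_of B" and f: "f \<in> polys B" "g \<in> polys B"
  shows "f + g \<in> polys B" "f - g \<in> polys B" "f * g \<in> polys B"
  using f subringD[OF B] by (auto simp: polys_def coeff_mult intro!: subring_sum[OF B])

lemma polys_basic:
  assumes B: "subring_of B"
  shows "0 \<in> polys B" "1 \<in> polys B" "c \<in> B ==> monom c n \<in> polys B" "c \<in> B ==> f \<in> polys B ==> smult c f \<in> polys B"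
    "c \<in> B ==> f \<in> polys B ==> pCons c f \<in> polys B"
  using subringD[OF B] by (auto simp: polys_def coeff_pCons split: nat.split)

lemma polys_ideal:
  assumes I: "ideal_of I B"
  shows "0 \<in> polys I" "f \<in> polys I ==> g \<in> polys I ==> f + g \<in> polys I" "f \<in> polys I ==> g \<in> polys I ==> f - g \<in> polys I"
    "f \<in> polys B ==> g \<in> polys I ==> f * g \<in> polys I" "f \<in> polys I ==> f \<in> polys B"
    "c \<in> I ==> f \<in> polys B ==> smult c f \<in> polys I" "c \<in> B ==> f \<in> polys I ==> smult c f \<in> polys I"
  using idealD[OF I] by (auto simp: polys_def coeff_mult intro!: ideal_sum[OF I])

text \<open>Modulo \<open>I\<close> the leading coefficient of \<open>g\<close> is a unit, and
  \<open>g\<close> has positive degree, so a multiple of \<open>g\<close> can be constant only if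
  the cofactor vanishes modulo \<open>I\<close>.\<close>

lemma unit_leading_coeff:
  assumes I: "ideal_of I B" and B: "subring_of B" and g: "g \<in> polys B" "0 < degree g" and c: "s \<in> B" "lead_coeff g * s - 1 \<in> I"
    and h: "h \<in> polys B" and e: "h * g - [:e:] \<in> polys I"
  shows "e \<in> I"
proof -
  have hI: "h \<in> polys I"
  proof (rule ccontr)
    assume "h \<notin> polys I"
    then have ex: "\<exists>j. coeff h j \<notin> I" by (auto simp: polys_def)
    have bd: "\<forall>j. coeff h j \<notin> I --> j \<le> degree h" using idealD(2)[OF I] by (metis coeff_eq_0 not_le)
    \<comment> \<open>The degree of \<open>h\<close> modulo \<open>I\<close>.\<close>
    define j where "j = (GREATEST j. coeff h j \<notin> I)"
    have j: "coeff h j \<notin> I" unfolding j_def using ex bd by (metis (mono_tags, lifting) GreatestI_ex_nat)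
    have max: "coeff h i \<in> I" if "j < i" for i
      using Greatest_le_nat[of "\<lambda>j. coeff h j \<notin> I" i "degree h"] bd that by (auto simp: j_def)
    define n where "n = j + degree g"
    have "coeff (h * g) n = (\<Sum>i\<le>n. coeff h i * coeff g (n - i))" by (simp add: coeff_mult)
    also have "\<dots> = coeff h j * lead_coeff g + (\<Sum>i\<in>{..n} - {j}. coeff h i * coeff g (n - i))"
      by (subst sum.remove[of _ j]) (auto simp: n_def)
    finally have eq: "coeff (h * g) n = coeff h j * lead_coeff g + (\<Sum>i\<in>{..n} - {j}. coeff h i * coeff g (n - i))" .
    have "(\<Sum>i\<in>{..n} - {j}. coeff h i * coeff g (n - i)) \<in> I"
    proof (rule ideal_sum[OF I])
      fix i assume i: "i \<in> {..n} - {j}"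
      show "coeff h i * coeff g (n - i) \<in> I"
      proof (cases "j < i")
        case True then show ?thesis using max idealD(5)[OF I] g(1) by (auto simp: polys_def)
      next
        case False
        then have "degree g < n - i" using i by (auto simp: n_def)
        then show ?thesis using idealD(2)[OF I] by (simp add: coeff_eq_0)
      qed
    qed
    moreover have "coeff (h * g) n \<in> I"
    proof -
      have "coeff (h * g - [:e:]) n \<in> I" using e by (auto simp: polys_def)
      moreover have "coeff [:e:] n = 0" using g(2) by (cases n) (auto simp: n_def)
      ultimately show ?thesis by simp
    qed
    ultimately have l: "coeff h j * lead_coeff g \<in> I" using eq idealD(3)[OF I] by (metis add_diff_cancel_right')
    have hB: "coeff h j \<in> B" using h by (simp add: polys_def)
    have "coeff h j = coeff h j * lead_coeff g * s - coeff h j * (lead_coeff g * s - 1)" by (simp add: algebra_simps)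
    also have "\<dots> \<in> I" using idealD(3)[OF I idealD(5)[OF I l c(1)] idealD(4)[OF I hB c(2)]] .
    finally show False using j by blast
  qed
  then have "g * h \<in> polys I" using polys_ideal(4)[OF I g(1)] by blast
  then have "g * h - (h * g - [:e:]) \<in> polys I" by (rule polys_ideal(3)[OF I _ e])
  moreover have "g * h - (h * g - [:e:]) = [:e:]" by (simp add: mult.commute)
  ultimately have "[:e:] \<in> polys I" by metis
  then have "coeff [:e:] 0 \<in> I" unfolding polys_def by blast
  then show ?thesis by simp
qed

text \<open>Division with remainder when the leading coefficient of \<open>g\<close> is not
  invertible: each reduction step multiplies \<open>f\<close> by it once more.\<close>

lemma pseudo_division:
  assumes B: "subring_of B" and g: "g \<in> polys B" "g \<noteq> 0" and f: "f \<in> polys B"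
  obtains N q r where "q \<in> polys B" "r \<in> polys B" "smult (lead_coeff g ^ N) f = q * g + r" "r = 0 \<or> degree r < degree g"
proof -
  have "\<exists>N q r. q \<in> polys B \<and> r \<in> polys B \<and> smult (lead_coeff g ^ N) f = q * g + r \<and> (r = 0 \<or> degree r < degree g)"
    using f
  proof (induction "degree f" arbitrary: f rule: less_induct)
    case less
    show ?case
    proof (cases "f = 0 \<or> degree f < degree g")
      case True
      then show ?thesis using less.prems polys_basic(1)[OF B]
        by (intro exI[of _ 0] exI[of _ "0 :: 'a poly"] exI[of _ f]) auto
    next
      case False
      define m where "m = monom (lead_coeff f) (degree f - degree g)"
      have mB: "m \<in> polys B" using polys_basic(3)[OF B] less.prems by (auto simp: m_def polys_def)
      define f' where "f' = smult (lead_coeff g) f - m * g"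
      have lB: "lead_coeff g \<in> B" using g(1) by (simp add: polys_def)
      have f'B: "f' \<in> polys B" using polys_ring[OF B] polys_basic[OF B] mB g(1) lB less.prems by (simp add: f'_def)
      have d: "f' = 0 \<or> degree f' < degree f"
      proof (rule ccontr)
        assume n: "\<not> (f' = 0 \<or> degree f' < degree f)"
        have l1: "degree (smult (lead_coeff g) f) \<le> degree f" by simp
        have "degree (m * g) \<le> degree m + degree g" by (rule degree_mult_le)
        also have "\<dots> \<le> degree f" using False degree_monom_le[of "lead_coeff f" "degree f - degree g"] unfolding m_def by linarith
        finally have "degree f' \<le> degree f" using l1 degree_diff_le[of "smult (lead_coeff g) f" "degree f" "m * g"] by (simp add: f'_def)
        then have df: "degree f' = degree f" using n by simp
        have "coeff (m * g) (degree f) = lead_coeff f * lead_coeff g"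
          using False by (simp add: m_def coeff_monom_mult)
        then have "coeff f' (degree f) = 0" by (simp add: f'_def mult.commute)
        then show False using df n leading_coeff_0_iff[of f'] by simp
      qed
      have "\<exists>N q r. q \<in> polys B \<and> r \<in> polys B \<and> smult (lead_coeff g ^ N) f' = q * g + r \<and> (r = 0 \<or> degree r < degree g)"
      proof (cases "f' = 0")
        case True
        then show ?thesis using polys_basic(1)[OF B]
          by (intro exI[of _ 0] exI[of _ "0 :: 'a poly"]) auto
      next
        case False then show ?thesis using less.hyps[of f'] d f'B by blast
      qed
      then obtain N q r where q: "q \<in> polys B" "r \<in> polys B" "smult (lead_coeff g ^ N) f' = q * g + r" "r = 0 \<or> degree r < degree g"
        by blast
      have "smult (lead_coeff g ^ Suc N) f = smult (lead_coeff g ^ N) (f' + m * g)"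
        by (simp add: f'_def mult.commute)
      also have "\<dots> = (q + smult (lead_coeff g ^ N) m) * g + r" using q(3) by (simp add: smult_add_right algebra_simps)
      finally have "smult (lead_coeff g ^ Suc N) f = (q + smult (lead_coeff g ^ N) m) * g + r" .
      moreover have "q + smult (lead_coeff g ^ N) m \<in> polys B"
        using polys_ring(1)[OF B q(1)] polys_basic(4)[OF B subring_power[OF B lB] mB] by blast
      ultimately show ?thesis using q(2,4) by blast
    qed
  qed
  then show ?thesis using that by blast
qed

definition adjoin :: "'k::field_char_0 set => 'k => 'k set" where
  "adjoin B x = {poly f x | f. f \<in> polys B}"

lemma subring_adjoin: assumes B: "subring_of B" shows "subring_of (adjoin B x)" "B \<subseteq> adjoin B x" "x \<in> adjoin B x"
proof -
  show "subring_of (adjoin B x)"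
    unfolding subring_of_def adjoin_def using polys_ring[OF B] polys_basic(2)[OF B]
    by (auto simp flip: poly_diff poly_mult) (metis poly_1)
  show "B \<subseteq> adjoin B x"
  proof
    fix c assume "c \<in> B"
    then have "monom c 0 \<in> polys B" using polys_basic(3)[OF B] by blast
    moreover have "poly (monom c 0) x = c" by (simp add: monom_0)
    ultimately show "c \<in> adjoin B x" unfolding adjoin_def by (intro CollectI exI[of _ "monom c 0"]) simp
  qed
  have "[:0, 1:] \<in> polys B" using polys_basic[OF B] subringD[OF B] by simp
  then show "x \<in> adjoin B x" unfolding adjoin_def by (force intro: exI[of _ "[:0, 1:]"])
qed

text \<open>The ideal generated by \<open>I\<close> and by the value of \<open>g\<close> at
  \<open>x\<close> in the ring obtained by adjoining \<open>x\<close> to \<open>B\<close>. It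
  consists of values of polynomials, since \<open>x\<close> may be algebraic over
  \<open>B\<close>.\<close>

definition adjoin_ideal :: "'k::field_char_0 set => 'k set => 'k => 'k poly => 'k set" where
  "adjoin_ideal B I x g = {poly (i + h * g) x | i h. i \<in> polys I \<and> h \<in> polys B}"

lemma adjoin_idealI: "i \<in> polys I ==> h \<in> polys B ==> y = poly (i + h * g) x ==> y \<in> adjoin_ideal B I x g"
  unfolding adjoin_ideal_def by blast

lemma adjoin_idealE:
  assumes "y \<in> adjoin_ideal B I x g" obtains i h where "i \<in> polys I" "h \<in> polys B" "y = poly (i + h * g) x"
  using assms unfolding adjoin_ideal_def by blast

lemma ideal_adjoin_ideal:
  assumes B: "subring_of B" and I: "ideal_of I B" and g: "g \<in> polys B"
  shows "ideal_of (adjoin_ideal B I x g) (adjoin B x)"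
proof -
  have 1: "adjoin_ideal B I x g \<subseteq> adjoin B x"
  proof
    fix y assume "y \<in> adjoin_ideal B I x g"
    then obtain i h where ih: "i \<in> polys I" "h \<in> polys B" "y = poly (i + h * g) x" by (rule adjoin_idealE)
    have "i + h * g \<in> polys B" by (intro polys_ring[OF B] polys_ideal(5)[OF I] ih g)
    then show "y \<in> adjoin B x" unfolding adjoin_def ih(3) by blast
  qed
  have 2: "0 \<in> adjoin_ideal B I x g"
    by (rule adjoin_idealI[OF polys_ideal(1)[OF I] polys_basic(1)[OF B]]) simp
  have 3: "a - a' \<in> adjoin_ideal B I x g" if a: "a \<in> adjoin_ideal B I x g" and a': "a' \<in> adjoin_ideal B I x g" for a a'
  proof -
    obtain i h where ih: "i \<in> polys I" "h \<in> polys B" "a = poly (i + h * g) x" using a by (rule adjoin_idealE)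
    obtain i' h' where ih': "i' \<in> polys I" "h' \<in> polys B" "a' = poly (i' + h' * g) x" using a' by (rule adjoin_idealE)
    show ?thesis
      by (rule adjoin_idealI[OF polys_ideal(3)[OF I ih(1) ih'(1)] polys_ring(2)[OF B ih(2) ih'(2)]]) (simp add: ih ih' algebra_simps)
  qed
  have 4: "a * a' \<in> adjoin_ideal B I x g" if a: "a \<in> adjoin B x" and a': "a' \<in> adjoin_ideal B I x g" for a a'
  proof -
    obtain f where f: "f \<in> polys B" "a = poly f x" using a unfolding adjoin_def by blast
    obtain i' h' where ih': "i' \<in> polys I" "h' \<in> polys B" "a' = poly (i' + h' * g) x" using a' by (rule adjoin_idealE)
    show ?thesis
      by (rule adjoin_idealI[OF polys_ideal(4)[OF I f(1) ih'(1)] polys_ring(3)[OF B f(1) ih'(2)]]) (simp add: f ih' algebra_simps)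
  qed
  show ?thesis unfolding ideal_of_def using 1 2 3 4 by blast
qed

text \<open>As \<open>g\<close> is monic up to a unit modulo \<open>I\<close>, every polynomial
  reduces to one of degree less than \<open>degree g\<close>, and its coefficients may be replaced
  by representatives from the finite set for \<open>I\<close>.\<close>

lemma finite_index_adjoin_ideal:
  assumes B: "subring_of B" and I: "ideal_of I B" and g: "g \<in> polys B" and c: "s \<in> B" "lead_coeff g * s - 1 \<in> I"
    and fin: "finite_index B I"
  shows "finite_index (adjoin B x) (adjoin_ideal B I x g)"
proof -
  let ?J = "adjoin_ideal B I x g"
  have J: "ideal_of ?J (adjoin B x)" by (rule ideal_adjoin_ideal[OF B I g])
  have red: "\<exists>f'\<in>polys B. (f' = 0 \<or> degree f' < degree g) \<and> poly f x - poly f' x \<in> ?J" if "f \<in> polys B" for f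
    using that
  proof (induction "degree f" arbitrary: f rule: less_induct)
    case less
    show ?case
    proof (cases "f = 0 \<or> degree f < degree g")
      case True then show ?thesis using less.prems idealD(2)[OF J] by (intro bexI[of _ f]) auto
    next
      case False
      define a where "a = lead_coeff f"
      define k where "k = degree f - degree g"
      have aB: "a \<in> B" using less.prems by (simp add: a_def polys_def)
      \<comment> \<open>\<open>s\<close> inverts the leading coefficient of \<open>g\<close> only modulo \<open>I\<close>; the defect \<open>u\<close> of the leading term is removed separately.\<close>
      define u where "u = monom (a * (lead_coeff g * s - 1)) (degree f)"
      define m where "m = monom (a * s) k"
      define f' where "f' = f - m * g + u"
      have mB: "m \<in> polys B" using polys_basic(3)[OF B] subringD(4)[OF B aB c(1)] by (simp add: m_def)
      have uI: "u \<in> polys I" using idealD(2,4)[OF I] aB c(2) by (auto simp: u_def polys_def)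
      have uB: "u \<in> polys B" using polys_ideal(5)[OF I uI] .
      have f'B: "f' \<in> polys B" using polys_ring[OF B] mB g uB less.prems by (simp add: f'_def)
      have d: "f' = 0 \<or> degree f' < degree f"
      proof (rule ccontr)
        assume n: "\<not> (f' = 0 \<or> degree f' < degree f)"
        have "degree (m * g) \<le> degree m + degree g" by (rule degree_mult_le)
        also have "\<dots> \<le> degree f" using False degree_monom_le[of "a * s" k] unfolding m_def k_def by linarith
        finally have "degree (f - m * g) \<le> degree f" by (intro degree_diff_le) auto
        then have "degree f' \<le> degree f" using degree_monom_le[of "a * (lead_coeff g * s - 1)" "degree f"]
          by (simp add: f'_def u_def degree_add_le)
        then have df: "degree f' = degree f" using n by simp
        have "coeff (m * g) (degree f) = a * s * lead_coeff g"
          using False by (simp add: m_def k_def coeff_monom_mult)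
        then have "coeff f' (degree f) = 0" by (simp add: f'_def u_def a_def algebra_simps)
        then show False using df n leading_coeff_0_iff[of f'] by simp
      qed
      have "\<exists>f''\<in>polys B. (f'' = 0 \<or> degree f'' < degree g) \<and> poly f' x - poly f'' x \<in> ?J"
      proof (cases "f' = 0")
        case True then show ?thesis using idealD(2)[OF J] polys_basic(1)[OF B] by (intro bexI[of _ 0]) auto
      next
        case False then show ?thesis using less.hyps[of f'] d f'B by blast
      qed
      then obtain f'' where f'': "f'' \<in> polys B" "f'' = 0 \<or> degree f'' < degree g" "poly f' x - poly f'' x \<in> ?J" by blast
      have "0 - u \<in> polys I" using polys_ideal(1,3)[OF I] uI by blast
      then have "poly ((0 - u) + m * g) x \<in> ?J" by (rule adjoin_idealI[OF _ mB refl])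
      then have "poly (0 - u + m * g) x + (poly f' x - poly f'' x) \<in> ?J" using idealD(7)[OF J] f''(3) by blast
      then have "poly f x - poly f'' x \<in> ?J" by (simp add: f'_def algebra_simps)
      then show ?thesis using f'' by blast
    qed
  qed
  obtain S where S: "finite S" "S \<subseteq> B" "\<And>y. y \<in> B ==> \<exists>s\<in>S. y - s \<in> I" using fin unfolding finite_index_def by blast
  define T where "T = (\<lambda>cs. \<Sum>j<degree g. cs j * x ^ j) ` PiE {..<degree g} (\<lambda>_. S)"
  have xA: "x ^ j \<in> adjoin B x" for j using subring_power[OF subring_adjoin(1,3)[OF B]] .
  have IJ: "i \<in> ?J" if "i \<in> I" for i
  proof -
    have "monom i 0 \<in> polys I" using that idealD(2)[OF I] by (auto simp: polys_def)
    then have "poly (monom i 0 + 0 * g) x \<in> ?J" by (rule adjoin_idealI[OF _ polys_basic(1)[OF B] refl])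
    then show ?thesis by (simp add: monom_0)
  qed
  have "finite T" unfolding T_def using S(1) by (intro finite_imageI finite_PiE) auto
  moreover have "T \<subseteq> adjoin B x"
  proof
    fix t assume "t \<in> T"
    then obtain cs where cs: "cs \<in> PiE {..<degree g} (\<lambda>_. S)" "t = (\<Sum>j<degree g. cs j * x ^ j)" by (auto simp: T_def)
    have "cs j * x ^ j \<in> adjoin B x" if "j \<in> {..<degree g}" for j
    proof -
      have "cs j \<in> S" using PiE_mem[OF cs(1) that] .
      then show ?thesis using S(2) subringD(4)[OF subring_adjoin(1)[OF B] _ xA] subring_adjoin(2)[OF B] by blast
    qed
    then show "t \<in> adjoin B x" unfolding cs(2) by (rule subring_sum[OF subring_adjoin(1)[OF B]])
  qed
  moreover have "\<exists>t\<in>T. y - t \<in> ?J" if y: "y \<in> adjoin B x" for y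
  proof -
    obtain f where f: "f \<in> polys B" "y = poly f x" using y by (auto simp: adjoin_def)
    obtain f' where f': "f' \<in> polys B" "f' = 0 \<or> degree f' < degree g" "poly f x - poly f' x \<in> ?J" using red[OF f(1)] by blast
    have "\<exists>s\<in>S. coeff f' j - s \<in> I" for j using S(3) f'(1) by (simp add: polys_def)
    then obtain cs where cs: "\<And>j. cs j \<in> S" "\<And>j. coeff f' j - cs j \<in> I" by metis
    define t where "t = (\<Sum>j<degree g. cs j * x ^ j)"
    have "t \<in> T"
      unfolding T_def t_def by (intro image_eqI[of _ _ "restrict cs {..<degree g}"]) (use cs in auto)
    moreover have "poly f' x = (\<Sum>j<degree g. coeff f' j * x ^ j)"
    proof -
      have "poly f' x = (\<Sum>j\<le>degree f'. coeff f' j * x ^ j)" by (simp add: poly_altdef)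
      also have "\<dots> = (\<Sum>j<degree g. coeff f' j * x ^ j)"
      proof (cases "f' = 0")
        case False
        then show ?thesis using f'(2) by (intro sum.mono_neutral_left) (auto simp: coeff_eq_0)
      qed simp
      finally show ?thesis .
    qed
    then have d: "poly f' x - t = (\<Sum>j<degree g. (coeff f' j - cs j) * x ^ j)"
      by (simp add: t_def sum_subtractf algebra_simps)
    have "poly f' x - t \<in> ?J" unfolding d using idealD(5)[OF J IJ[OF cs(2)] xA] by (intro ideal_sum[OF J]) auto
    then have "(poly f x - poly f' x) + (poly f' x - t) \<in> ?J" using idealD(7)[OF J f'(3)] by blast
    then have "y - t \<in> ?J" by (simp add: f)
    ultimately show ?thesis by blast
  qed
  ultimately show ?thesis unfolding finite_index_def by blast
qed

lemma finite_quotients_int: "finite_quotients (range (of_int :: int => 'k::field_char_0))"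
  unfolding finite_quotients_def
proof (intro ballI impI)
  fix r :: 'k assume "r \<in> range of_int" "r \<noteq> 0"
  then obtain m :: int where m: "r = of_int m" "m \<noteq> 0" by auto
  \<comment> \<open>Modulo \<open>m * m + 1\<close> the integer \<open>m\<close> is a unit with
    inverse \<open>- m\<close>.\<close>
  define n where "n = m * m + 1"
  have n: "2 \<le> n" using m(2) zero_less_mult_iff[of m m] by (simp add: n_def) linarith
  let ?R = "range (of_int :: int => 'k)"
  let ?I = "range (\<lambda>k. of_int (n * k) :: 'k)"
  have "ideal_of ?I ?R"
    unfolding ideal_of_def
  proof (intro conjI ballI)
    show "0 \<in> ?I" by (rule range_eqI[of _ _ 0]) simp
    show "?I \<subseteq> ?R" by (metis image_subsetI rangeI)
    show "a - a' \<in> ?I" if aa: "a \<in> ?I" "a' \<in> ?I" for a a'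
    proof -
      obtain k k' where "a = of_int (n * k)" "a' = of_int (n * k')" using aa by blast
      then show ?thesis by (intro range_eqI[of _ _ "k - k'"]) (simp add: algebra_simps)
    qed
    show "a * a' \<in> ?I" if aa: "a \<in> ?R" "a' \<in> ?I" for a a'
    proof -
      obtain k k' where "a = of_int k" "a' = of_int (n * k')" using aa by blast
      then show ?thesis by (intro range_eqI[of _ _ "k * k'"]) (simp add: algebra_simps)
    qed
  qed
  moreover have "finite_index ?R ?I"
    unfolding finite_index_def
  proof (intro exI[of _ "of_int ` {0..<n}"] conjI ballI)
    fix x :: 'k assume "x \<in> ?R"
    then obtain k where k: "x = of_int k" by blast
    have "k - k mod n = n * (k div n)" by (simp add: minus_mod_eq_mult_div)
    then have "x - of_int (k mod n) = of_int (n * (k div n))" unfolding k by (metis of_int_diff)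
    then have "x - of_int (k mod n) \<in> ?I" by (rule range_eqI)
    then show "\<exists>s\<in>of_int ` {0..<n}. x - s \<in> ?I" using n by (intro bexI[of _ "of_int (k mod n)"]) auto
  qed auto
  moreover have "1 \<notin> ?I"
  proof
    assume "1 \<in> ?I"
    then obtain k where "of_int (n * k) = (1 :: 'k)" by (metis imageE)
    then have "n * k = 1" by (metis of_int_eq_1_iff)
    then show False using n by (auto simp: zmult_eq_1_iff)
  qed
  moreover have "\<exists>s\<in>?R. r * s - 1 \<in> ?I"
  proof
    show "r * of_int (- m) - 1 \<in> ?I" by (rule range_eqI[of _ _ "- 1"]) (simp add: m n_def)
  qed (rule rangeI)
  ultimately show "\<exists>I. ideal_of I ?R \<and> finite_index ?R I \<and> 1 \<notin> I \<and> (\<exists>s\<in>?R. r * s - 1 \<in> I)" by blast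
qed

text \<open>Bezout's identity without denominators: an element \<open>d\<close> of least degree in
  the ideal of \<open>f\<close> and \<open>g\<close> divides both up to powers of its leading
  coefficient. It does not vanish at \<open>x\<close>, so the cofactor of \<open>g\<close> does;
  minimality of \<open>g\<close> then leaves degree 0 for \<open>d\<close>.\<close>

lemma bezout_constant:
  assumes B: "subring_of B" and f: "f \<in> polys B" "poly f x \<noteq> 0" and g: "g \<in> polys B" "g \<noteq> 0" "poly g x = 0"
    and min: "\<And>h. h \<in> polys B ==> h \<noteq> 0 ==> poly h x = 0 ==> degree g \<le> degree h"
  obtains a e where "a \<in> polys B" "e \<in> B" "e \<noteq> 0" "poly a x * poly f x = e"
proof -
  define S where "S = {a * f + h * g | a h. a \<in> polys B \<and> h \<in> polys B}"
  have SB: "S \<subseteq> polys B" using polys_ring[OF B] f g by (auto simp: S_def)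
  have gS: "g \<in> S" "f \<in> S"
    unfolding S_def using polys_basic(1,2)[OF B] by (force intro: exI[of _ 0] exI[of _ 1])+
  have S_comb: "smult c p - q * d \<in> S" if c: "c \<in> B" and pS: "p \<in> S" and q: "q \<in> polys B" and dS: "d \<in> S" for c p q d
  proof -
    obtain a h a' h' where a: "a \<in> polys B" "h \<in> polys B" "p = a * f + h * g" "a' \<in> polys B" "h' \<in> polys B" "d = a' * f + h' * g"
      using pS dS unfolding S_def by blast
    have "smult c p - q * d = (smult c a - q * a') * f + (smult c h - q * h') * g"
      by (simp add: a smult_add_right algebra_simps)
    moreover have "smult c a - q * a' \<in> polys B" "smult c h - q * h' \<in> polys B"
      by (intro polys_ring[OF B] polys_basic(4)[OF B] a c q)+
    ultimately show ?thesis unfolding S_def by blast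
  qed
  obtain d where d: "d \<in> S" "d \<noteq> 0" "\<And>p. p \<in> S ==> p \<noteq> 0 ==> degree d \<le> degree p"
    using ex_has_least_nat[of "\<lambda>p. p \<in> S \<and> p \<noteq> 0" g degree] gS(1) g(2) by blast
  have dB: "d \<in> polys B" "lead_coeff d \<in> B" using d SB by (auto simp: polys_def)
  have div: "\<exists>N q. q \<in> polys B \<and> smult (lead_coeff d ^ N) p = q * d" if p: "p \<in> S" for p
  proof -
    obtain N q r where q: "q \<in> polys B" "r \<in> polys B" "smult (lead_coeff d ^ N) p = q * d + r" "r = 0 \<or> degree r < degree d"
      using pseudo_division[OF B dB(1) d(2)] p SB by (metis subsetD)
    have "r = smult (lead_coeff d ^ N) p - q * d" using q(3) by simp
    then have "r \<in> S" using S_comb[OF subring_power[OF B dB(2)] p q(1) d(1)] by simp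
    then have "r = 0" using q(4) d(3) by (meson linorder_not_le)
    then show ?thesis using q by auto
  qed
  obtain N q where q: "q \<in> polys B" "smult (lead_coeff d ^ N) g = q * d" using div[OF gS(1)] by blast
  obtain N' q' where q': "q' \<in> polys B" "smult (lead_coeff d ^ N') f = q' * d" using div[OF gS(2)] by blast
  have dx: "poly d x \<noteq> 0"
  proof
    assume "poly d x = 0"
    then have "lead_coeff d ^ N' * poly f x = 0" using arg_cong[OF q'(2), of "\<lambda>p. poly p x"] by simp
    then show False using f(2) d(2) by simp
  qed
  have qx: "poly q x = 0" using arg_cong[OF q(2), of "\<lambda>p. poly p x"] g(3) dx by simp
  have q0: "q \<noteq> 0" using q(2) g(2) d(2) by auto
  have "degree g = degree q + degree d" using arg_cong[OF q(2), of degree] degree_mult_eq[OF q0 d(2)] d(2) by simp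
  then have "degree d = 0" using min[OF q(1) q0 qx] by simp
  then obtain e where e: "d = [:e:]" by (rule degree_eq_zeroE)
  obtain a h where a: "a \<in> polys B" "d = a * f + h * g" using d(1) unfolding S_def by blast
  have "poly a x * poly f x = e" using arg_cong[OF a(2), of "\<lambda>p. poly p x"] g(3) by (simp add: e)
  moreover have "e \<in> B" "e \<noteq> 0" using dB d(2) e by auto
  ultimately show ?thesis using that a(1) by blast
qed

text \<open>If \<open>x\<close> satisfies no equation over \<open>B\<close>, the relation
  \<open>r * x = 1\<close> is imposed, making \<open>r\<close> a unit. Otherwise a polynomial of
  least degree vanishing at \<open>x\<close> is used, and both its leading coefficient and a nonzero
  multiple of \<open>r\<close> lying in \<open>B\<close> are made units modulo
  \<open>I\<close>.\<close>

lemma finite_quotients_adjoin: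
  assumes B: "subring_of B" and Q: "finite_quotients B"
  shows "finite_quotients (adjoin B x)"
  unfolding finite_quotients_def
proof (intro ballI impI)
  fix r assume r: "r \<in> adjoin B x" "r \<noteq> 0"
  then obtain f where f: "f \<in> polys B" "r = poly f x" by (auto simp: adjoin_def)
  have f0: "f \<noteq> 0" using r(2) f(2) by auto
  show "\<exists>I. ideal_of I (adjoin B x) \<and> finite_index (adjoin B x) I \<and> 1 \<notin> I \<and> (\<exists>s\<in>adjoin B x. r * s - 1 \<in> I)"
  proof (cases "\<exists>g\<in>polys B. g \<noteq> 0 \<and> poly g x = 0")
    case False
    have lB: "lead_coeff f \<in> B" using f(1) by (simp add: polys_def)
    then obtain I s where I: "ideal_of I B" "finite_index B I" "1 \<notin> I" "s \<in> B" "lead_coeff f * s - 1 \<in> I"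
      using Q f0 unfolding finite_quotients_def by (metis leading_coeff_0_iff)
    \<comment> \<open>This is the variable times \<open>f\<close>, minus 1.\<close>
    define g where "g = pCons (- 1) f"
    have g: "g \<in> polys B" "0 < degree g" "lead_coeff g = lead_coeff f"
      using polys_basic(5)[OF B subringD(5)[OF B subringD(1)[OF B]] f(1)] f0 by (simp_all add: g_def)
    have "1 \<notin> adjoin_ideal B I x g"
    proof
      assume "1 \<in> adjoin_ideal B I x g"
      then obtain i h where ih: "i \<in> polys I" "h \<in> polys B" "1 = poly (i + h * g) x" by (auto simp: adjoin_ideal_def)
      have "1 - (i + h * g) \<in> polys B" by (intro polys_ring[OF B] polys_basic(2)[OF B] polys_ideal(5)[OF I(1)] ih(1,2) g(1))
      moreover have "poly (1 - (i + h * g)) x = 0" using ih(3) by simp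
      ultimately have "1 - (i + h * g) = 0" using False by blast
      then have "h * g - [:1:] = 0 - i" by (simp add: algebra_simps one_pCons)
      then have "h * g - [:1:] \<in> polys I" using polys_ideal(1,3)[OF I(1)] ih(1) by metis
      then show False using unit_leading_coeff[OF I(1) B g(1,2) I(4) _ ih(2)] I(5) g(3) I(3) by simp
    qed
    moreover have "r * x - 1 \<in> adjoin_ideal B I x g"
    proof -
      have "poly (0 + 1 * g) x \<in> adjoin_ideal B I x g"
        by (rule adjoin_idealI[OF polys_ideal(1)[OF I(1)] polys_basic(2)[OF B] refl])
      then show ?thesis by (simp add: g_def f mult.commute)
    qed
    ultimately show ?thesis
      using ideal_adjoin_ideal[OF B I(1) g(1)] finite_index_adjoin_ideal[OF B I(1) g(1) I(4) _ I(2)] I(5) g(3) subring_adjoin(3)[OF B]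
      by (metis (no_types, lifting))
  next
    case True
    then obtain g where g: "g \<in> polys B" "g \<noteq> 0" "poly g x = 0"
      and min: "\<And>h. h \<in> polys B ==> h \<noteq> 0 ==> poly h x = 0 ==> degree g \<le> degree h"
      using ex_has_least_nat[of "\<lambda>g. g \<in> polys B \<and> g \<noteq> 0 \<and> poly g x = 0" _ degree] by metis
    have dg: "0 < degree g"
    proof (rule ccontr)
      assume "\<not> 0 < degree g"
      then obtain e where "g = [:e:]" by (metis degree_eq_zeroE neq0_conv)
      then show False using g by simp
    qed
    obtain a e where a: "a \<in> polys B" "e \<in> B" "e \<noteq> 0" "poly a x * poly f x = e"
      using bezout_constant[OF B f(1) _ g] min r(2) f(2) by blast
    define c where "c = lead_coeff g"
    have c: "c \<in> B" "c \<noteq> 0" using g by (auto simp: c_def polys_def)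
    obtain I u where I: "ideal_of I B" "finite_index B I" "1 \<notin> I" "u \<in> B" "e * c * u - 1 \<in> I"
      using Q subringD(4)[OF B a(2) c(1)] a(3) c(2) unfolding finite_quotients_def by (metis no_zero_divisors)
    have eu: "e * u \<in> B" "c * (e * u) - 1 \<in> I" using subringD(4)[OF B a(2) I(4)] I(5) by (simp_all add: ac_simps)
    have cN: "c ^ N \<notin> I" for N
    proof (induction N)
      case (Suc N)
      show ?case
      proof
        assume h: "c ^ Suc N \<in> I"
        have "c ^ N = c ^ Suc N * (e * u) - c ^ N * (c * (e * u) - 1)" by (simp add: algebra_simps)
        also have "\<dots> \<in> I" using idealD(3)[OF I(1) idealD(5)[OF I(1) h eu(1)] idealD(4)[OF I(1) subring_power[OF B c(1)] eu(2)]] .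
        finally show False using Suc by blast
      qed
    qed (use I in simp)
    have "1 \<notin> adjoin_ideal B I x g"
    proof
      assume "1 \<in> adjoin_ideal B I x g"
      then obtain i h where ih: "i \<in> polys I" "h \<in> polys B" "1 = poly (i + h * g) x" by (auto simp: adjoin_ideal_def)
      \<comment> \<open>The polynomial \<open>1 - i\<close> vanishes at \<open>x\<close>, so up to a
        power of \<open>c\<close> it is a multiple of \<open>g\<close>. That power would then lie in
        \<open>I\<close>, although \<open>c\<close> is a unit modulo \<open>I\<close>.\<close>
      have kB: "1 - i \<in> polys B" by (intro polys_ring[OF B] polys_basic(2)[OF B] polys_ideal(5)[OF I(1) ih(1)])
      have kx: "poly (1 - i) x = 0" using ih(3) g(3) by simp
      obtain N q s where q: "q \<in> polys B" "s \<in> polys B" "smult (c ^ N) (1 - i) = q * g + s" "s = 0 \<or> degree s < degree g"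
        using pseudo_division[OF B g(1,2) kB] unfolding c_def by metis
      have "poly s x = 0" using arg_cong[OF q(3), of "\<lambda>p. poly p x"] kx g(3) by simp
      then have "s = 0" using q(2,4) min by (meson linorder_not_le)
      then have "q * g - [:c ^ N:] = 0 - smult (c ^ N) i" using q(3) by (simp add: smult_diff_right one_pCons algebra_simps)
      then have "q * g - [:c ^ N:] \<in> polys I"
        using polys_ideal(1,3)[OF I(1)] polys_ideal(7)[OF I(1) subring_power[OF B c(1)] ih(1)] by metis
      then have "c ^ N \<in> I" using unit_leading_coeff[OF I(1) B g(1) dg eu(1) _ q(1)] eu(2) by (simp add: c_def)
      then show False using cN by blast
    qed
    moreover have "r * (poly a x * (c * u)) - 1 \<in> adjoin_ideal B I x g"
    proof -
      have "[:e * c * u - 1:] \<in> polys I" using I(5) idealD(2)[OF I(1)] by (auto simp: polys_def coeff_pCons split: nat.split)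
      then have "poly ([:e * c * u - 1:] + 0 * g) x \<in> adjoin_ideal B I x g"
        by (rule adjoin_idealI[OF _ polys_basic(1)[OF B] refl])
      then have "e * c * u - 1 \<in> adjoin_ideal B I x g" by simp
      moreover have "r * (poly a x * (c * u)) = (poly a x * poly f x) * c * u" by (simp only: f ac_simps)
      ultimately show ?thesis by (simp only: a(4))
    qed
    moreover have "poly a x * (c * u) \<in> adjoin B x"
    proof -
      have "poly a x \<in> adjoin B x" using a(1) by (auto simp: adjoin_def)
      then show ?thesis using subringD(4)[OF subring_adjoin(1)[OF B]] subringD(4)[OF B c(1) I(4)] subring_adjoin(2)[OF B] by blast
    qed
    ultimately show ?thesis
      using ideal_adjoin_ideal[OF B I(1) g(1)] finite_index_adjoin_ideal[OF B I(1) g(1) eu(1) _ I(2)] eu(2) unfolding c_def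
      by (metis (no_types, lifting))
  qed
qed

theorem finitely_generated_finite_quotients:
  fixes S :: "'k::field_char_0 set"
  assumes "finite S" obtains R where "subring_of R" "S \<subseteq> R" "finite_quotients R"
proof -
  have "\<exists>R. subring_of R \<and> S \<subseteq> R \<and> finite_quotients R"
    using assms
  proof induction
    case empty
    have "1 = (of_int 1 :: 'k)" by simp
    then have "subring_of (range (of_int :: int => 'k))"
      unfolding subring_of_def by (auto simp flip: of_int_diff of_int_mult)
    then show ?case using finite_quotients_int by blast
  next
    case (insert x S)
    then obtain R where R: "subring_of R" "S \<subseteq> R" "finite_quotients R" by blast
    then show ?case using subring_adjoin[OF R(1), of x] finite_quotients_adjoin[OF R(1,3), of x] by blast
  qed
  then show ?thesis using that by blast
qed

section \<open>Matrix entries\<close>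

definition fun_group :: "('v => 'v) set => bool" where
  "fun_group G \<longleftrightarrow> id \<in> G \<and> (\<forall>A\<in>G. \<forall>B\<in>G. A \<circ> B \<in> G) \<and> (\<forall>A\<in>G. bij A \<and> inv_into UNIV A \<in> G)"

lemma fun_groupD:
  assumes "fun_group G"
  shows "id \<in> G" "A \<in> G ==> B \<in> G ==> A \<circ> B \<in> G" "A \<in> G ==> inv_into UNIV A \<in> G"
    "A \<in> G ==> inv_into UNIV A (A x) = x" "A \<in> G ==> A (inv_into UNIV A x) = x"
  using assms unfolding fun_group_def by (auto simp: bij_def surj_f_inv_f)

definition entries_in :: "('v::euclidean_space => 'v) => real set => bool" where
  "entries_in A R \<longleftrightarrow> (\<forall>i\<in>Basis. \<forall>j\<in>Basis. A i \<bullet> j \<in> R)"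

lemma linear_entry: "linear A ==> A v \<bullet> j = (\<Sum>k\<in>Basis. (v \<bullet> k) * (A k \<bullet> j))" for v :: "'v::euclidean_space"
proof -
  assume A: "linear A"
  have "A v = A (\<Sum>k\<in>Basis. (v \<bullet> k) *\<^sub>R k)" by (simp add: euclidean_representation)
  also have "\<dots> = (\<Sum>k\<in>Basis. (v \<bullet> k) *\<^sub>R A k)" using A by (simp add: linear_sum linear_scale)
  finally show ?thesis by (simp add: inner_sum_left)
qed

lemma entries_in_comp:
  assumes R: "subring_of R" and A: "linear A" "entries_in A R" and B: "entries_in B R"
  shows "entries_in (A \<circ> B) R"
  unfolding entries_in_def
proof (intro ballI)
  fix i j :: 'a assume ij: "i \<in> Basis" "j \<in> Basis"
  have "A (B i) \<bullet> j = (\<Sum>k\<in>Basis. (B i \<bullet> k) * (A k \<bullet> j))" by (rule linear_entry[OF A(1)])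
  also have "\<dots> \<in> R" using ij A(2) B unfolding entries_in_def by (intro subring_sum[OF R] subringD(4)[OF R]) auto
  finally show "(A \<circ> B) i \<bullet> j \<in> R" by simp
qed

section \<open>The fundamental group as a linear group\<close>

context chamber
begin

lemma push_path: "path p ==> path_image p \<subseteq> X ==> path (F \<circ> p) \<and> path_image (F \<circ> p) \<subseteq> M"
  using covering_space_imp_continuous[OF covering_F] F_X
  by (auto simp: path_image_compose intro: path_continuous_image continuous_on_subset)

lemma push_homotopic:
  assumes "path p" "path_image p \<subseteq> X" "path q" "path_image q \<subseteq> X" "pathstart p = pathstart q" "pathfinish p = pathfinish q"
  shows "homotopic_paths M (F \<circ> p) (F \<circ> q)"
proof (rule homotopic_paths_continuous_image)
  show "homotopic_paths X p q" by (rule nconvex_homotopic_paths[OF nconvex_X assms])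
  show "continuous_on X F" using covering_space_imp_continuous[OF covering_F] .
  show "F \<in> X \<rightarrow> M" using F_X by auto
qed

lemma GX_path:
  assumes A: "A \<in> GX" and p: "path p" "path_image p \<subseteq> X"
  shows "path (A \<circ> p)" "path_image (A \<circ> p) \<subseteq> X"
proof -
  have "continuous_on (path_image p) A"
    using linear_continuous_on[OF linear_conv_bounded_linear[THEN iffD1, OF isoH_linear[OF GX_isoH[OF A]]]] .
  then show "path (A \<circ> p)" by (rule path_continuous_image[OF p(1)])
  show "path_image (A \<circ> p) \<subseteq> X" using p(2) GX_X[OF A] by (auto simp: path_image_compose)
qed

lemma GX_push_homotopic:
  assumes A: "A \<in> GX" and p: "path p" "path_image p \<subseteq> X" and q: "path q" "path_image q \<subseteq> X"
    and e: "A (pathstart p) = pathstart q" "A (pathfinish p) = pathfinish q"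
  shows "homotopic_paths M (F \<circ> p) (F \<circ> q)"
proof -
  have "homotopic_paths M (F \<circ> p) (F \<circ> (A \<circ> p))"
  proof (rule homotopic_paths_eq)
    fix t :: real assume "t \<in> {0..1}"
    then have "p t \<in> X" using p(2) by (auto simp: path_image_def)
    then show "(F \<circ> p) t = (F \<circ> (A \<circ> p)) t" using GX_F[OF A] by simp
  qed (use push_path[OF p] in auto)
  also have "homotopic_paths M \<dots> (F \<circ> q)"
    using e by (intro push_homotopic GX_path[OF A p] q) (auto simp: pathstart_compose pathfinish_compose)
  finally show ?thesis .
qed

text \<open>The loop below the segment from \<open>a\<close> to its image. Since \<open>X\<close> is
  convex, any other path in \<open>X\<close> between these points gives the same class.\<close>

definition deck_class :: "'v => ('v => 'v) => (real => 'm) set" where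
  "deck_class a A = path_class M (F \<circ> nseg a (A a))"

lemma nseg_X: "y \<in> X ==> z \<in> X ==> path (nseg y z) \<and> path_image (nseg y z) \<subseteq> X \<and> pathstart (nseg y z) = y \<and> pathfinish (nseg y z) = z"
  by (simp add: path_nseg path_image_nseg[OF nconvex_X] X_Hyp)

context
  fixes a assumes a: "a \<in> X"
begin

lemma deck_loop: assumes A: "A \<in> GX" shows "F \<circ> nseg a (A a) \<in> loops_at M (F a)"
  using push_path[of "nseg a (A a)"] nseg_X[OF a GX_X[OF A a]] GX_F[OF A a]
  by (simp add: loops_at_def pathstart_compose pathfinish_compose)

lemma deck_class_path:
  assumes A: "A \<in> GX" and p: "path p" "path_image p \<subseteq> X" "pathstart p = a" "pathfinish p = A a"
  shows "path_class M (F \<circ> p) = deck_class a A"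
  unfolding deck_class_def using nseg_X[OF a GX_X[OF A a]] p by (intro path_class_eqI push_homotopic) auto

text \<open>The lift of the second loop is moved by \<open>A\<close> so as to start at
  \<open>A a\<close>; the two lifts then compose to a path from \<open>a\<close> to
  \<open>A (B a)\<close>.\<close>

lemma deck_class_mult:
  assumes A: "A \<in> GX" and B: "B \<in> GX"
  shows "deck_class a (A \<circ> B) = deck_class a A \<otimes>\<^bsub>fundamental_group M (F a)\<^esub> deck_class a B"
proof -
  have X: "A a \<in> X" "B a \<in> X" "A (B a) \<in> X" using GX_X a A B by auto
  note n = nseg_X[OF a X(1)] nseg_X[OF a X(2)] nseg_X[OF X(1,3)]
  have "deck_class a A \<otimes>\<^bsub>fundamental_group M (F a)\<^esub> deck_class a B = path_class M ((F \<circ> nseg a (A a)) +++ (F \<circ> nseg a (B a)))"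
    unfolding deck_class_def by (rule fundamental_group_mult[OF deck_loop[OF A] deck_loop[OF B]])
  also have "\<dots> = path_class M ((F \<circ> nseg a (A a)) +++ (F \<circ> nseg (A a) (A (B a))))"
  proof (rule path_class_eqI, rule homotopic_paths_join)
    show "homotopic_paths M (F \<circ> nseg a (A a)) (F \<circ> nseg a (A a))" using n push_path by simp
    show "homotopic_paths M (F \<circ> nseg a (B a)) (F \<circ> nseg (A a) (A (B a)))" using n by (intro GX_push_homotopic[OF A]) auto
    show "pathfinish (F \<circ> nseg a (A a)) = pathstart (F \<circ> nseg a (B a))" using n GX_F[OF A a] by (simp add: pathfinish_compose pathstart_compose)
  qed
  also have "\<dots> = path_class M (F \<circ> (nseg a (A a) +++ nseg (A a) (A (B a))))" by (simp add: path_compose_join)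
  also have "\<dots> = deck_class a (A \<circ> B)"
    using n by (intro deck_class_path GX_comp A B) (auto simp: path_image_join)
  finally show ?thesis by simp
qed

lemma deck_class_inj: assumes A: "A \<in> GX" and B: "B \<in> GX" and eq: "deck_class a A = deck_class a B" shows "A = B"
proof -
  have X: "A a \<in> X" "B a \<in> X" using GX_X a A B by auto
  note n = nseg_X[OF a X(1)] nseg_X[OF a X(2)]
  have "homotopic_paths M (F \<circ> nseg a (A a)) (F \<circ> nseg a (B a))"
    using eq push_path n unfolding deck_class_def by (intro path_class_eqD) auto
  then have "pathfinish (nseg a (A a)) = pathfinish (nseg a (B a))" using n by (intro covering_monodromy[OF covering_F]) auto
  then have "A a = B a" using n by simp
  moreover have "F a = F (B a)" using GX_F[OF B a] by simp
  ultimately show ?thesis using GX_simply_transitive[OF a X(2)] A B by blast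
qed

lemma deck_class_surj: "deck_class a ` GX = carrier (fundamental_group M (F a))"
proof
  show "deck_class a ` GX \<subseteq> carrier (fundamental_group M (F a))"
    unfolding fundamental_group_simps deck_class_def using deck_loop by blast
  show "carrier (fundamental_group M (F a)) \<subseteq> deck_class a ` GX"
  proof
    fix c assume "c \<in> carrier (fundamental_group M (F a))"
    then obtain p where p: "p \<in> loops_at M (F a)" "c = path_class M p" unfolding fundamental_group_simps by blast
    note l = loops_atD[OF p(1)]
    obtain h where h: "path h" "path_image h \<subseteq> X" "pathstart h = a" "\<And>t. t \<in> {0..1} ==> F (h t) = p t"
      using covering_lift_path[OF covering_F l(1,2) a] l(3) by metis
    have X: "pathfinish h \<in> X" using h(2) pathfinish_in_path_image by blast
    have "F (pathfinish h) = F a" using h(4)[of 1] l(4) by (simp add: pathfinish_def)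
    then obtain A where A: "A \<in> GX" "A a = pathfinish h" using GX_simply_transitive[OF a X] by auto
    have "homotopic_paths M p (F \<circ> h)" using l h(4) by (intro homotopic_paths_eq) auto
    then have "c = path_class M (F \<circ> h)" unfolding p(2) by (rule path_class_eqI)
    also have "\<dots> = deck_class a A" using h A by (intro deck_class_path) auto
    finally show "c \<in> deck_class a ` GX" using A by blast
  qed
qed

text \<open>The hypothesis gives finitely many left cosets of \<open>K\<close>, while the index is
  counted by right cosets; applying it to inverses exchanges the two.\<close>

lemma deck_separable:
  assumes G: "fun_group S" "S \<subseteq> GX"
    and sep: "\<And>g. g \<in> GX ==> g \<notin> S ==> \<exists>K T. K \<subseteq> GX \<and> fun_group K \<and> S \<subseteq> K \<and> g \<notin> K \<and> finite T \<and> T \<subseteq> GX \<and> (\<forall>A\<in>GX. \<exists>B\<in>T. invf B \<circ> A \<in> K)"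
  shows "separable_subgroup (fundamental_group M (F a)) (deck_class a ` S)"
proof -
  let ?P = "fundamental_group M (F a)"
  let ?\<pi> = "deck_class a"
  have FM: "F a \<in> M" using F_M X_Hyp a by blast
  interpret P: group ?P by (rule group_fundamental_group[OF FM])
  have car: "?\<pi> A \<in> carrier ?P" if "A \<in> GX" for A using deck_class_surj that by blast
  have one: "?\<pi> id = \<one>\<^bsub>?P\<^esub>"
  proof -
    have "?\<pi> id \<otimes>\<^bsub>?P\<^esub> ?\<pi> id = ?\<pi> id" using deck_class_mult[OF GX_id GX_id] by simp
    then show ?thesis using car[OF GX_id] P.r_cancel_one by blast
  qed
  have inv: "?\<pi> (invf A) = inv\<^bsub>?P\<^esub> ?\<pi> A" if A: "A \<in> GX" for A
  proof -
    have "invf A \<circ> A = id" using isoH_inv_apply(1)[OF GX_isoH[OF A]] by (auto simp: fun_eq_iff)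
    then have "?\<pi> (invf A) \<otimes>\<^bsub>?P\<^esub> ?\<pi> A = \<one>\<^bsub>?P\<^esub>" using deck_class_mult[OF GX_inv[OF A] A] one by simp
    then show ?thesis using P.inv_equality car A GX_inv by metis
  qed
  have sub: "subgroup (?\<pi> ` K) ?P" if K: "fun_group K" "K \<subseteq> GX" for K
  proof (rule P.subgroupI)
    show "?\<pi> ` K \<subseteq> carrier ?P" using K car by blast
    show "?\<pi> ` K \<noteq> {}" using fun_groupD(1)[OF K(1)] by blast
    fix x assume "x \<in> ?\<pi> ` K"
    then obtain A where A: "A \<in> K" "x = ?\<pi> A" by blast
    show "inv\<^bsub>?P\<^esub> x \<in> ?\<pi> ` K" using inv[of A] A K(2) fun_groupD(3)[OF K(1) A(1)] by (metis image_eqI subsetD)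
    fix y assume "y \<in> ?\<pi> ` K"
    then obtain B where B: "B \<in> K" "y = ?\<pi> B" by blast
    show "x \<otimes>\<^bsub>?P\<^esub> y \<in> ?\<pi> ` K"
      using deck_class_mult[of A B] A B K(2) fun_groupD(2)[OF K(1) A(1) B(1)] by (metis image_eqI subsetD)
  qed
  have "\<exists>K. subgroup K ?P \<and> finite (rcosets\<^bsub>?P\<^esub> K) \<and> ?\<pi> ` S \<subseteq> K \<and> x \<notin> K" if x: "x \<in> carrier ?P - ?\<pi> ` S" for x
  proof -
    obtain g where g: "g \<in> GX" "x = ?\<pi> g" using x deck_class_surj by blast
    have "g \<notin> S" using x g by blast
    then obtain K T where K: "K \<subseteq> GX" "fun_group K" "S \<subseteq> K" "g \<notin> K" and T: "finite T" "T \<subseteq> GX" "\<And>A. A \<in> GX ==> \<exists>B\<in>T. invf B \<circ> A \<in> K"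
      using sep[OF g(1)] by metis
    have sK: "subgroup (?\<pi> ` K) ?P" by (rule sub[OF K(2,1)])
    have "rcosets\<^bsub>?P\<^esub> (?\<pi> ` K) \<subseteq> (\<lambda>B. ?\<pi> ` K #>\<^bsub>?P\<^esub> ?\<pi> (invf B)) ` T"
    proof
      fix c assume "c \<in> rcosets\<^bsub>?P\<^esub> (?\<pi> ` K)"
      then obtain y where y: "y \<in> carrier ?P" "c = ?\<pi> ` K #>\<^bsub>?P\<^esub> y" by (auto simp: RCOSETS_def)
      obtain A where A: "A \<in> GX" "y = ?\<pi> A" using y(1) deck_class_surj by blast
      obtain B where B: "B \<in> T" "invf B \<circ> invf A \<in> K" using T(3)[OF GX_inv[OF A(1)]] by blast
      have BG: "B \<in> GX" using B T by blast
      have k: "?\<pi> (invf B) \<otimes>\<^bsub>?P\<^esub> inv\<^bsub>?P\<^esub> y \<in> ?\<pi> ` K"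
        using deck_class_mult[OF GX_inv[OF BG] GX_inv[OF A(1)]] inv[OF A(1)] A(2) B(2) by (metis image_eqI)
      have cB: "?\<pi> (invf B) \<in> carrier ?P" using car GX_inv BG by blast
      have "?\<pi> (invf B) = (?\<pi> (invf B) \<otimes>\<^bsub>?P\<^esub> inv\<^bsub>?P\<^esub> y) \<otimes>\<^bsub>?P\<^esub> y"
        using cB y(1) by (simp add: P.m_assoc)
      then have "?\<pi> (invf B) \<in> ?\<pi> ` K #>\<^bsub>?P\<^esub> y" using k unfolding r_coset_def by blast
      then have "c = ?\<pi> ` K #>\<^bsub>?P\<^esub> ?\<pi> (invf B)" using P.repr_independence[OF _ y(1) sK] y(2) by metis
      then show "c \<in> (\<lambda>B. ?\<pi> ` K #>\<^bsub>?P\<^esub> ?\<pi> (invf B)) ` T" using B(1) by blast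
    qed
    then have "finite (rcosets\<^bsub>?P\<^esub> (?\<pi> ` K))" using T(1) finite_surj by blast
    moreover have "x \<notin> ?\<pi> ` K" using deck_class_inj[OF g(1)] K(1,4) g(2) by blast
    ultimately show ?thesis using sK K(3) by blast
  qed
  then show ?thesis using sub[OF G] by (simp add: separable_subgroup_def)
qed

text \<open>The tail \<open>\<gamma>\<close> is lifted to a path from \<open>a\<close> to
  \<open>c\<close>. A loop in \<open>C\<close> lifts to a path from \<open>c\<close> to
  \<open>A c\<close> inside the preimage of \<open>C\<close>, and going back along the translate by
  \<open>A\<close> of the lifted tail ends at \<open>A a\<close>.\<close>

lemma pi1_image_deck:
  assumes C: "C \<subseteq> M" and \<gamma>: "path \<gamma>" "path_image \<gamma> \<subseteq> M" "pathstart \<gamma> = F a" "pathfinish \<gamma> \<in> C"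
  obtains c where "c \<in> X" "F c = pathfinish \<gamma>"
    "pi1_image M C \<gamma> = deck_class a ` {A \<in> GX. path_component (X \<inter> F -` C) c (A c)}"
proof -
  obtain h where h: "path h" "path_image h \<subseteq> X" "pathstart h = a" "\<And>t. t \<in> {0..1} ==> F (h t) = \<gamma> t"
    using covering_lift_path[OF covering_F \<gamma>(1,2) a] \<gamma>(3) by metis
  define c where "c = pathfinish h"
  have c: "c \<in> X" using h(2) pathfinish_in_path_image by (auto simp: c_def)
  have Fc: "F c = pathfinish \<gamma>" using h(4)[of 1] by (simp add: c_def pathfinish_def)
  have key: "path_class M (\<gamma> +++ \<delta> +++ reversepath \<gamma>) = deck_class a A"
    if A: "A \<in> GX" and d: "path d" "path_image d \<subseteq> X" "pathstart d = c" "pathfinish d = A c"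
      and de: "path \<delta>" "path_image \<delta> \<subseteq> M" "\<And>t. t \<in> {0..1} ==> F (d t) = \<delta> t" for A d \<delta>
  proof -
    have r: "path (reversepath h)" "path_image (reversepath h) \<subseteq> X" using h by auto
    note Ar = GX_path[OF A r]
    have ends: "pathstart (A \<circ> reversepath h) = A c" "pathfinish (A \<circ> reversepath h) = A a"
      using h(3) by (simp_all add: pathstart_compose pathfinish_compose c_def)
    have 1: "homotopic_paths M \<gamma> (F \<circ> h)" using \<gamma> h(4) by (intro homotopic_paths_eq) auto
    have 2: "homotopic_paths M \<delta> (F \<circ> d)" using de by (intro homotopic_paths_eq) auto
    have 3: "homotopic_paths M (reversepath \<gamma>) (F \<circ> (A \<circ> reversepath h))"
    proof (rule homotopic_paths_eq)
      fix t :: real assume t: "t \<in> {0..1}"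
      have "reversepath h t \<in> X" using r(2) t by (auto simp: path_image_def)
      then have "(F \<circ> (A \<circ> reversepath h)) t = F (reversepath h t)" using GX_F[OF A] by simp
      then show "reversepath \<gamma> t = (F \<circ> (A \<circ> reversepath h)) t" using h(4)[of "1 - t"] t by (simp add: reversepath_def)
    qed (use \<gamma> in auto)
    have de01: "pathstart \<delta> = F c" "pathfinish \<delta> = F (A c)" using de(3)[of 0] de(3)[of 1] d by (simp_all add: pathstart_def pathfinish_def)
    have "homotopic_paths M (\<gamma> +++ \<delta> +++ reversepath \<gamma>) ((F \<circ> h) +++ (F \<circ> d) +++ (F \<circ> (A \<circ> reversepath h)))"
      using de01 Fc GX_F[OF A c] by (intro homotopic_paths_join 1 2 3) auto
    then have "path_class M (\<gamma> +++ \<delta> +++ reversepath \<gamma>) = path_class M (F \<circ> (h +++ d +++ (A \<circ> reversepath h)))"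
      by (simp add: path_compose_join path_class_eqI)
    also have "\<dots> = deck_class a A"
      using h d Ar ends by (intro deck_class_path[OF A]) (auto simp: path_image_join c_def)
    finally show ?thesis .
  qed
  have "pi1_image M C \<gamma> = deck_class a ` {A \<in> GX. path_component (X \<inter> F -` C) c (A c)}"
  proof (intro equalityI subsetI)
    fix x assume "x \<in> pi1_image M C \<gamma>"
    then obtain \<delta> where x: "x = path_class M (\<gamma> +++ \<delta> +++ reversepath \<gamma>)" "\<delta> \<in> loops_at C (pathfinish \<gamma>)" by (auto simp: pi1_image_def)
    note l = loops_atD[OF x(2)]
    have lM: "path_image \<delta> \<subseteq> M" using l(2) C by blast
    obtain d where d: "path d" "path_image d \<subseteq> X" "pathstart d = c" "\<And>t. t \<in> {0..1} ==> F (d t) = \<delta> t"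
      using covering_lift_path[OF covering_F l(1) lM c] l(3) Fc by metis
    have X: "pathfinish d \<in> X" using d(2) pathfinish_in_path_image by blast
    have "F (pathfinish d) = F c" using d(4)[of 1] l(4) Fc by (simp add: pathfinish_def)
    then obtain A where A: "A \<in> GX" "A c = pathfinish d" using GX_simply_transitive[OF c X] by auto
    have "path_image d \<subseteq> F -` C" using d(4) l(2) by (auto simp: path_image_def)
    then show "x \<in> deck_class a ` {A \<in> GX. path_component (X \<inter> F -` C) c (A c)}"
      using A d x(1) key[OF A(1) d(1-3) A(2)[symmetric] l(1) lM d(4)]
      by (intro image_eqI[of _ _ A]) (auto simp: path_component_def intro!: exI[of _ d])
  next
    fix x assume "x \<in> deck_class a ` {A \<in> GX. path_component (X \<inter> F -` C) c (A c)}"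
    then obtain A d where A: "A \<in> GX" "x = deck_class a A" and d: "path d" "path_image d \<subseteq> X \<inter> F -` C" "pathstart d = c" "pathfinish d = A c"
      unfolding path_component_def by blast
    have dX: "path_image d \<subseteq> X" using d(2) by blast
    note Fd = push_path[OF d(1) dX]
    have "F \<circ> d \<in> loops_at C (pathfinish \<gamma>)"
      using Fd d Fc GX_F[OF A(1) c] by (auto simp: loops_at_def pathstart_compose pathfinish_compose path_image_compose)
    moreover have "x = path_class M (\<gamma> +++ (F \<circ> d) +++ reversepath \<gamma>)"
      using key[OF A(1) d(1) dX d(3,4)] Fd A(2) by simp
    ultimately show "x \<in> pi1_image M C \<gamma>" by (auto simp: pi1_image_def)
  qed
  then show ?thesis using that c Fc by blast
qed

end

end

section \<open>Stabilisers in the deck group\<close>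

locale finvol_chamber = finvol wn M F + chamber wn M F b for wn :: "'v::lorentz_space" and M :: "'m::metric_space set" and F b
begin

text \<open>Entries of matrices in the deck group lie in a finitely generated ring; the stabiliser of \<open>v\<close> is cut
  out by the finite index subgroups fixing \<open>v\<close> modulo ideals of finite index.\<close>

lemma stabilizer_separable:
  assumes a: "a \<in> X"
  shows "separable_subgroup (fundamental_group M (F a)) (deck_class a ` {A \<in> GX. A v = v})"
proof (rule deck_separable[OF a])
  note lin = isoH_linear[OF GX_isoH]
  show "fun_group {A \<in> GX. A v = v}"
    unfolding fun_group_def using GX_id GX_comp GX_inv isoH_bij[OF GX_isoH] isoH_inv_apply(1)[OF GX_isoH]
    by (auto intro: GX_comp) metis+
  show "{A \<in> GX. A v = v} \<subseteq> GX" by blast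
  fix g assume g: "g \<in> GX" "g \<notin> {A \<in> GX. A v = v}"
  obtain S where S: "finite S" "S \<subseteq> GT" "\<And>E. S \<subseteq> E ==> (\<And>A B. A \<in> E ==> B \<in> E ==> A \<circ> B \<in> E) ==> GT \<subseteq> E"
    using finitely_generated by metis
  \<comment> \<open>The coordinates of \<open>v\<close> may be any real numbers; they are adjoined
    as further generators of the ring.\<close>
  define N where "N = (\<Union>A\<in>S. \<Union>i\<in>Basis. (\<lambda>j. A i \<bullet> j) ` Basis) \<union> (\<lambda>j. v \<bullet> j) ` Basis"
  have "finite N" unfolding N_def using S(1) by simp
  then obtain R where R: "subring_of R" "N \<subseteq> R" "finite_quotients R" using finitely_generated_finite_quotients by blast
  have "GT \<subseteq> {A. linear A \<and> entries_in A R}"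
  proof (rule S(3))
    show "S \<subseteq> {A. linear A \<and> entries_in A R}"
    proof
      fix A assume A: "A \<in> S"
      have "A i \<bullet> j \<in> N" if "i \<in> Basis" "j \<in> Basis" for i j unfolding N_def using A that by blast
      then show "A \<in> {A. linear A \<and> entries_in A R}" using isoH_linear[OF GT_isoH, of A] A S(2) R(2) by (auto simp: entries_in_def)
    qed
    show "A \<circ> B \<in> {A. linear A \<and> entries_in A R}" if "A \<in> {A. linear A \<and> entries_in A R}" "B \<in> {A. linear A \<and> entries_in A R}" for A B
      using that entries_in_comp[OF R(1)] linear_compose by blast
  qed
  then have ent: "A i \<bullet> j \<in> R" if "A \<in> GX" "i \<in> Basis" "j \<in> Basis" for A i j using that GX_GT unfolding entries_in_def by blast
  have v: "v \<bullet> j \<in> R" if "j \<in> Basis" for j using R(2) that by (auto simp: N_def)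
  have vR: "A v \<bullet> k \<in> R" if "A \<in> GX" "k \<in> Basis" for A k
    unfolding linear_entry[OF lin[OF that(1)], of v k] using that by (intro subring_sum[OF R(1)] subringD(4)[OF R(1)] v ent)
  obtain k where k: "k \<in> Basis" "(g v - v) \<bullet> k \<noteq> 0" using g euclidean_eqI[of "g v - v" 0] by auto
  have "(g v - v) \<bullet> k \<in> R" unfolding inner_diff_left by (intro subringD(3)[OF R(1)] vR v g k)
  then obtain I s where I: "ideal_of I R" "finite_index R I" "1 \<notin> I" "s \<in> R" "(g v - v) \<bullet> k * s - 1 \<in> I"
    using R(3) k(2) unfolding finite_quotients_def by blast
  have gI: "(g v - v) \<bullet> k \<notin> I"
    using idealD(3)[OF I(1) idealD(5)[OF I(1) _ I(4)] I(5), of "(g v - v) \<bullet> k"] I(3) by auto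
  define inI where "inI u \<longleftrightarrow> (\<forall>k\<in>Basis. u \<bullet> k \<in> I)" for u :: 'v
  have inI_lin: "inI (A u)" if "A \<in> GX" "inI u" for A u
    unfolding inI_def linear_entry[OF lin[OF that(1)], of u]
    using that unfolding inI_def by (intro ballI ideal_sum[OF I(1)] idealD(5)[OF I(1)] ent) auto
  have inI_add: "inI (u + w)" "inI (- u)" if "inI u" "inI w" for u w
    using that idealD(6,7)[OF I(1)] by (auto simp: inI_def inner_add_left)
  have inI_0: "inI 0" using idealD(2)[OF I(1)] by (simp add: inI_def)
  define K where "K = {A \<in> GX. inI (A v - v)}"
  have K: "fun_group K" unfolding fun_group_def
  proof (intro conjI ballI)
    show "id \<in> K" using GX_id inI_0 by (simp add: K_def)
    fix A assume "A \<in> K"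
    then have A: "A \<in> GX" "inI (A v - v)" by (auto simp: K_def)
    show "bij A" using isoH_bij GX_isoH A by blast
    have "invf A v - v = - invf A (A v - v)"
      using linear_diff[OF lin[OF GX_inv[OF A(1)]], of "A v" v] isoH_inv_apply(1)[OF GX_isoH[OF A(1)]] by simp
    then show "invf A \<in> K" using inI_add(2)[OF inI_lin[OF GX_inv[OF A(1)] A(2)]] inI_0 GX_inv[OF A(1)] by (simp add: K_def)
    fix B assume "B \<in> K"
    then have B: "B \<in> GX" "inI (B v - v)" by (auto simp: K_def)
    have "(A \<circ> B) v - v = A (B v - v) + (A v - v)" using linear_diff[OF lin[OF A(1)], of "B v" v] by simp
    then have "inI ((A \<circ> B) v - v)" using inI_add(1)[OF inI_lin[OF A(1) B(2)] A(2)] by (rule ssubst)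
    then show "A \<circ> B \<in> K" using GX_comp[OF A(1) B(1)] by (simp add: K_def)
  qed
  obtain Q where Q: "finite Q" "\<And>y. y \<in> R ==> \<exists>s\<in>Q. y - s \<in> I" using I(2) unfolding finite_index_def by blast
  then obtain \<rho> where \<rho>: "\<And>y. y \<in> R ==> \<rho> y \<in> Q \<and> y - \<rho> y \<in> I" by metis
  \<comment> \<open>The residue class of \<open>A v\<close> modulo \<open>I\<close>. Finitely many
    classes occur, and elements with equal class lie in the same left coset of
    \<open>K\<close>.\<close>
  define cl where "cl A = (\<lambda>k\<in>Basis. \<rho> (A v \<bullet> k))" for A :: "'v => 'v"
  have "cl ` GX \<subseteq> Basis \<rightarrow>\<^sub>E Q" using \<rho>[OF vR] by (auto simp: cl_def PiE_iff)
  then have "finite (cl ` GX)" using Q(1) finite_PiE finite_Basis finite_subset by metis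
  then obtain T where T: "T \<subseteq> GX" "finite T" "cl ` GX = cl ` T" using finite_subset_image by (metis order_refl)
  have "\<exists>B\<in>T. invf B \<circ> A \<in> K" if A: "A \<in> GX" for A
  proof -
    obtain B where B: "B \<in> T" "cl A = cl B" using T(3) A by blast
    have BG: "B \<in> GX" using B T by blast
    have "inI (A v - B v)" unfolding inI_def
    proof
      fix k :: 'v assume k: "k \<in> Basis"
      have "\<rho> (A v \<bullet> k) = \<rho> (B v \<bullet> k)" using fun_cong[OF B(2), of k] k by (simp add: cl_def)
      then show "(A v - B v) \<bullet> k \<in> I"
        using idealD(3)[OF I(1) conjunct2[OF \<rho>[OF vR[OF A k]]] conjunct2[OF \<rho>[OF vR[OF BG k]]]] by (simp add: inner_diff_left)
    qed
    then have "inI (invf B (A v - B v))" by (rule inI_lin[OF GX_inv[OF BG]])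
    moreover have "invf B (A v - B v) = (invf B \<circ> A) v - v"
      using linear_diff[OF lin[OF GX_inv[OF BG]], of "A v" "B v"] isoH_inv_apply(1)[OF GX_isoH[OF BG]] by simp
    ultimately show ?thesis using B(1) GX_comp[OF GX_inv[OF BG] A] by (auto simp: K_def)
  qed
  moreover have "{A \<in> GX. A v = v} \<subseteq> K" "K \<subseteq> GX" using inI_0 by (auto simp: K_def)
  moreover have "g \<notin> K" using gI k(1) by (auto simp: K_def inI_def)
  ultimately show "\<exists>K T. K \<subseteq> GX \<and> fun_group K \<and> {A \<in> GX. A v = v} \<subseteq> K \<and> g \<notin> K \<and> finite T \<and> T \<subseteq> GX \<and> (\<forall>A\<in>GX. \<exists>B\<in>T. invf B \<circ> A \<in> K)"
    using K T(1,2) by blast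
qed

end

section \<open>Boundary components\<close>

lemma lor_eq_on_ball:
  fixes y u u' :: "'v::lorentz_space"
  assumes y: "y \<in> Hyp" "0 < e" and eq: "\<And>z. z \<in> hball y e ==> lor z u = lor z u'" shows "u = u'"
proof -
  have lin: "linear (\<lambda>z. lor z v)" for v :: 'v by (rule linearI) (simp_all add: lor_simps)
  have "(\<lambda>z. lor z u) = (\<lambda>z. lor z u')"
    by (rule linear_eq_on_ball[OF lin lin y]) (use eq in \<open>simp add: mem_hball\<close>)
  then have "lor z u = lor z u'" for z by (rule fun_cong)
  then have "lor (u - u') z = 0" for z by (simp add: lor_simps lor_commute[of _ z])
  then show ?thesis using lor_nondegenerate[of "u - u'"] by simp
qed

context finvol_chamber
begin

text \<open>Near \<open>y\<close> the map folds along a single hyperplane, and this is the wall of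
  \<open>w\<close> because walls through \<open>y\<close> coincide.\<close>

lemma bd_near_wall:
  assumes w: "w \<in> walls" and y: "y \<in> Hyp" "lor y w = 0"
  obtains e where "0 < e" "\<And>z. z \<in> hball y e ==> F z \<in> bd ==> lor z w = 0"
proof -
  obtain U \<psi> B e where U: "lchart U \<psi>" and B: "isoH B" and e: "0 < e" "\<And>z. z \<in> hball y e ==> F z \<in> U \<and> \<psi> (F z) = fold (B z)"
    using foldF[OF y(1)] unfolding foldat_def by blast
  have bdB: "F z \<in> bd \<longleftrightarrow> lor (B z) wn = 0" if "z \<in> hball y e" for z
    using bd_iff[OF U, of "F z"] e(2)[OF that] lor_fold_wn[of "B z"] by simp
  have yb: "y \<in> hball y e" using y e by simp
  have 0: "lor (B y) wn = 0" using walls_bd[OF w y] bdB[OF yb] by simp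
  have "invf B wn \<in> walls" by (rule walls_chart[OF B U y(1) e(1) 0 e(2)])
  moreover have eqB: "lor z (invf B wn) = lor (B z) wn" for z using isoH_lor_inv[OF B] by simp
  ultimately have "invf B wn = w \<or> invf B wn = - w" using walls_unique[OF w _ y(1,2)] 0 by simp
  then have "lor z w = 0" if "z \<in> hball y e" "F z \<in> bd" for z
    using bdB[OF that(1)] that(2) eqB[of z] by (auto simp: lor_simps)
  then show ?thesis using that e(1) by blast
qed

text \<open>Membership in the subgroup is decided by paths, while the converse implication is
  convenient to prove for connected sets. As path components lie in components, the two implications
  together give exactly the stabiliser of \<open>v\<close>.\<close>

lemma peripheral_separable:
  assumes a: "a \<in> X" and C: "C \<subseteq> M"
    and \<gamma>: "path \<gamma>" "path_image \<gamma> \<subseteq> M" "pathstart \<gamma> = F a" "pathfinish \<gamma> \<in> C"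
    and st: "\<And>c. c \<in> X ==> F c \<in> C ==> \<exists>v. \<forall>A\<in>GX. (A v = v --> path_component (X \<inter> F -` C) c (A c)) \<and>
      (connected_component (X \<inter> F -` C) c (A c) --> A v = v)"
  shows "separable_subgroup (fundamental_group M (F a)) (pi1_image M C \<gamma>)"
proof -
  obtain c where c: "c \<in> X" "F c = pathfinish \<gamma>"
    and eq: "pi1_image M C \<gamma> = deck_class a ` {A \<in> GX. path_component (X \<inter> F -` C) c (A c)}"
    using pi1_image_deck[OF a C \<gamma>] by blast
  obtain v where "\<forall>A\<in>GX. (A v = v --> path_component (X \<inter> F -` C) c (A c)) \<and> (connected_component (X \<inter> F -` C) c (A c) --> A v = v)"
    using st[of c] c \<gamma>(4) by auto
  then have "{A \<in> GX. path_component (X \<inter> F -` C) c (A c)} = {A \<in> GX. A v = v}"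
    using path_component_subset_connected_component[of "X \<inter> F -` C" c] by blast
  then show ?thesis using stabilizer_separable[OF a, of v] eq by simp
qed

lemma nseg_component: "nconvex Y ==> Y \<subseteq> S ==> y \<in> Y ==> z \<in> Y ==> path_component S y z"
  unfolding path_component_def using nconvex_Hyp_sub[of Y] path_image_nseg[of Y y z] path_nseg[of y z]
  by (intro exI[of _ "nseg y z"]) auto

text \<open>The relevant part of the preimage of \<open>C\<close> is the face of \<open>X\<close> on
  one wall: this face is convex and so lies over \<open>C\<close>, and a connected set over
  \<open>C\<close> cannot leave it because walls are isolated from each other. An element preserving
  the wall cannot reverse \<open>w\<close>, since it keeps \<open>b\<close> on the same
  side.\<close>

theorem wall_separable:
  assumes a: "a \<in> X" and C: "C \<in> components bd"
    and \<gamma>: "path \<gamma>" "path_image \<gamma> \<subseteq> M" "pathstart \<gamma> = F a" "pathfinish \<gamma> \<in> C"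
  shows "separable_subgroup (fundamental_group M (F a)) (pi1_image M C \<gamma>)"
proof (rule peripheral_separable[OF a _ \<gamma>])
  have Cbd: "C \<subseteq> bd" using C in_components_subset by blast
  then show "C \<subseteq> M" by (auto simp: bd_def)
  fix c assume c: "c \<in> X" "F c \<in> C"
  have cH: "c \<in> Hyp" using X_Hyp c by blast
  obtain w where w: "w \<in> walls" "lor c w = 0" using bd_walls[OF cH] c(2) Cbd by blast
  let ?Y = "X \<inter> {y \<in> Hyp. lor y w = 0}"
  have nc: "nconvex ?Y" by (rule nconvex_Int[OF nconvex_X nconvex_hyperplane])
  have cY: "c \<in> ?Y" using c w(2) cH by simp
  have "F ` ?Y \<subseteq> C"
  proof (rule components_maximal[OF C])
    show "connected (F ` ?Y)"
      by (rule connected_continuous_image[OF continuous_on_subset[OF continuous_on_F] nconvex_connected[OF nc]]) blast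
    show "F ` ?Y \<subseteq> bd" using walls_bd[OF w(1)] by auto
    show "C \<inter> F ` ?Y \<noteq> {}" using cY c(2) by blast
  qed
  then have sub: "?Y \<subseteq> X \<inter> F -` C" by blast
  have "path_component (X \<inter> F -` C) c (A c)" if "A \<in> GX" "A w = w" for A
    by (rule nseg_component[OF nc sub cY])
       (use GX_X[OF that(1) c(1)] X_Hyp isoH_lor[OF GX_isoH[OF that(1)], of c w] that(2) w(2) in simp)
  moreover have "A w = w" if A: "A \<in> GX" and cc: "connected_component (X \<inter> F -` C) c (A c)" for A
  proof -
    obtain D where D: "connected D" "D \<subseteq> X \<inter> F -` C" "c \<in> D" "A c \<in> D" using cc unfolding connected_component_def by blast
    have DH: "y \<in> Hyp" "F y \<in> bd" if "y \<in> D" for y using that D(2) Cbd X_Hyp by blast+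
    have "lor (A c) w = 0"
    proof (rule hball_continuation[where P = "\<lambda>y. lor y w = 0", OF D(1) _ D(3,4) w(2)])
      show "\<exists>e>0. \<forall>z\<in>D \<inter> hball x e. lor z w = 0" if "x \<in> D" "lor x w = 0" for x
        using bd_near_wall[OF w(1) DH(1)[OF that(1)] that(2)] DH(2) by (metis IntE)
      show "lor x w = 0" if x: "x \<in> D" and near: "\<And>e. 0 < e ==> \<exists>z\<in>D \<inter> hball x e. lor z w = 0" for x
      proof (rule ccontr)
        assume "lor x w \<noteq> 0"
        then have "0 < lor x (lor x w *\<^sub>R w)" by (simp add: lor_simps flip: power2_eq_square)
        then obtain e where e: "0 < e" "\<And>z. z \<in> hball x e ==> 0 < lor z (lor x w *\<^sub>R w)" using hball_sign[OF DH(1)[OF x]] by blast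
        then show False using near[OF e(1)] by (force simp: lor_simps)
      qed
    qed (use DH in blast)
    moreover have "lor (A c) (A w) = 0" using isoH_lor[OF GX_isoH[OF A]] w(2) by simp
    ultimately have "A w = w \<or> A w = - w"
      using walls_unique[OF w(1) walls_image[OF GX_GT[OF A] w(1)] isoH_Hyp[OF GX_isoH[OF A] cH]] by blast
    moreover have "A w \<noteq> - w"
    proof
      assume "A w = - w"
      then have "lor (A b) w = - lor b w" using isoH_lor[OF GX_isoH[OF A], of b w] by (simp add: lor_simps)
      then show False using X_walls[OF GX_X[OF A b_X] w(1)] b_walls[OF w(1)] by (auto simp: mult_le_0_iff)
    qed
    ultimately show ?thesis by blast
  qed
  ultimately show "\<exists>v. \<forall>A\<in>GX. (A v = v --> path_component (X \<inter> F -` C) c (A c)) \<and>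
      (connected_component (X \<inter> F -` C) c (A c) --> A v = v)" by blast
qed

section \<open>Cusps\<close>

lemma path_start_hball:
  assumes g: "path g" "path_image g \<subseteq> Hyp" "pathstart g = y" and e: "0 < e" obtains s where "0 < s" "s \<le> 1" "g s \<in> hball y e"
proof -
  have gH: "g s \<in> Hyp" if "s \<in> {0..1}" for s using g(2) that by (auto simp: path_image_def)
  have y: "y \<in> Hyp" "g 0 = y" using gH[of 0] g(3) by (auto simp: pathstart_def)
  obtain d where d: "0 < d" "\<forall>x\<in>Hyp. dist x y < d --> x \<in> hball y e"
    using openin_hball[OF y(1), of e] y(1) e unfolding openin_euclidean_subtopology_iff by (metis center_hball)
  obtain k where k: "0 < k" "\<And>s. s \<in> {0..1} ==> dist s 0 < k ==> dist (g s) y < d"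
    using g(1) d(1) y(2) unfolding path_def continuous_on_iff by (metis atLeastAtMost_iff order_refl zero_le_one)
  then show ?thesis using that[of "min 1 (k / 2)"] d(2) gH by auto
qed

text \<open>Moving from \<open>y\<close> slightly towards \<open>b\<close> leaves all walls at once,
  as \<open>b\<close> lies on none of them and \<open>y\<close> is never on the opposite
  side.\<close>

lemma interior_point:
  assumes y: "y \<in> X" and e: "0 < e" obtains z d where "z \<in> Hyp" "0 < d" "hball z d \<subseteq> X \<inter> hball y e"
proof -
  have yH: "y \<in> Hyp" using y X_Hyp by blast
  have n: "path (nseg y b)" "path_image (nseg y b) \<subseteq> Hyp" "pathstart (nseg y b) = y" using nseg_X[OF y b_X] X_Hyp by auto
  obtain t where t: "0 < t" "t \<le> 1" "nseg y b t \<in> hball y e" using path_start_hball[OF n e] by blast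
  define z where "z = nseg y b t"
  have z: "z \<in> X" "z \<in> hball y e" "z \<in> Hyp" using nconvexD[OF nconvex_X y b_X] t X_Hyp by (auto simp: z_def)
  obtain q where q: "0 < q" "\<And>v. lor z v = q * ((1 - t) * lor y v + t * lor b v)"
    using nseg_lor[OF yH b(1), of t] t unfolding z_def by (metis less_imp_le)
  have "F z \<notin> bd"
  proof
    assume "F z \<in> bd"
    then obtain w where w: "w \<in> walls" "lor z w = 0" using bd_walls[OF z(3)] by blast
    have "0 \<le> (1 - t) * (lor b w * lor y w)" using X_walls[OF y w(1)] t by simp
    moreover have "0 < t * (lor b w * lor b w)" using t b_walls[OF w(1)] by (auto simp: zero_less_mult_iff)
    moreover have "lor b w * ((1 - t) * lor y w + t * lor b w) = 0" using q w(2) by simp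
    ultimately show False by (simp add: algebra_simps)
  qed
  then obtain r where r: "0 < r" "hball z r \<subseteq> X" using X_chart[OF z(1)] by metis
  obtain d where "0 < d" "hball z d \<subseteq> hball y e" using hball_sub_ex[OF z(2) yH] by blast
  then show ?thesis using that[of z "min r d"] r z(3) by (auto simp: mem_hball subset_iff)
qed

text \<open>In an end of \<open>M\<close> whose charts take a height function \<open>h\<close> to the height above an ideal point, every
  lift is, locally and hence on horoballs, the height above an ideal point of the universal cover.\<close>

theorem horocusp_separable:
  assumes a: "a \<in> X"
    and ch: "\<And>p U \<psi>. p \<in> C ==> lchart U \<psi> ==> p \<in> U ==>
      \<exists>u r. (\<forall>z\<in>Hyp. lor z u < 0) \<and> 0 < r \<and> (\<forall>q\<in>C \<inter> U. dist p q < r --> lor (\<psi> q) u = - 1 / h q)"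
    and C: "closedin (top_of_set M) C" "openin (top_of_set M) {p \<in> C. 1 < h p}"
    and up: "\<And>p. p \<in> C ==> \<exists>\<kappa>. path \<kappa> \<and> path_image \<kappa> \<subseteq> C \<and> pathstart \<kappa> = p \<and> (\<forall>s. 0 < s --> s \<le> 1 --> 1 < h (\<kappa> s))"
    and \<gamma>: "path \<gamma>" "path_image \<gamma> \<subseteq> M" "pathstart \<gamma> = F a" "pathfinish \<gamma> \<in> C"
  shows "separable_subgroup (fundamental_group M (F a)) (pi1_image M C \<gamma>)"
proof (rule peripheral_separable[OF a _ \<gamma>])
  show CM: "C \<subseteq> M" using C(1) closedin_subset by force
  let ?S = "X \<inter> F -` C"
  have SH: "y \<in> Hyp" if "y \<in> ?S" for y using that X_Hyp by blast
  have lift: "\<exists>g. path g \<and> path_image g \<subseteq> ?S \<and> pathstart g = y \<and> (\<forall>s. 0 < s --> s \<le> 1 --> 1 < h (F (g s)))" if y: "y \<in> ?S" for y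
  proof -
    obtain \<kappa> where k: "path \<kappa>" "path_image \<kappa> \<subseteq> C" "pathstart \<kappa> = F y" "\<And>s. 0 < s ==> s \<le> 1 ==> 1 < h (\<kappa> s)" using up[of "F y"] y by auto
    have kM: "path_image \<kappa> \<subseteq> M" using k(2) CM by blast
    obtain g where g: "path g" "path_image g \<subseteq> X" "pathstart g = y" "\<And>t. t \<in> {0..1} ==> F (g t) = \<kappa> t"
      using covering_lift_path[OF covering_F k(1) kM _ k(3)[symmetric]] y by auto
    have "F (g t) \<in> C" if "t \<in> {0..1}" for t using g(4)[OF that] k(2) that by (auto simp: path_image_def)
    then show ?thesis using g k(4) by (intro exI[of _ g]) (auto simp: path_image_def)
  qed
  have high: "\<exists>e>0. F ` hball y e \<subseteq> C" if y: "y \<in> ?S" "1 < h (F y)" for y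
  proof -
    obtain r where r: "0 < r" "\<forall>q\<in>M. dist (F y) q < r --> q \<in> {p \<in> C. 1 < h p}" using openin_M_ball[OF C(2), of "F y"] y by blast
    have "F z \<in> C" if "z \<in> hball y r" for z
      using that r(2) F_M[of z] F_lipschitz[OF SH[OF y(1)], of z] by (auto simp: mem_hball)
    then show ?thesis using r(1) by blast
  qed
  define good where "good y u \<longleftrightarrow> (\<exists>e>0. \<forall>z\<in>?S \<inter> hball y e. lor z u = - 1 / h (F z))" for y u
  have good_ex: "\<exists>u. good y u \<and> (\<forall>z\<in>Hyp. lor z u < 0)" if y: "y \<in> ?S" for y
  proof -
    obtain U \<psi> B r where U: "lchart U \<psi>" "F y \<in> U" and B: "isoH B" "0 < r" "\<And>x. x \<in> X ==> hdist y x < r ==> F x \<in> U \<and> \<psi> (F x) = B x"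
      using X_chart y by (metis IntD1)
    obtain u r' where u: "\<forall>z\<in>Hyp. lor z u < 0" "0 < r'" "\<forall>q\<in>C \<inter> U. dist (F y) q < r' --> lor (\<psi> q) u = - 1 / h q"
      using ch[OF _ U] y by blast
    have l: "lor z (invf B u) = lor (B z) u" for z using isoH_lor_inv[OF B(1)] by simp
    have "lor z (invf B u) = - 1 / h (F z)" if z: "z \<in> ?S \<inter> hball y (min r r')" for z
      using z B(3)[of z] u(3) F_lipschitz[OF SH[OF y], of z] by (force simp: l mem_hball)
    moreover have "\<forall>z\<in>Hyp. lor z (invf B u) < 0" using u(1) isoH_Hyp[OF B(1)] by (simp add: l)
    ultimately show ?thesis using B(2) u(2) unfolding good_def by (intro exI[of _ "invf B u"] conjI exI[of _ "min r r'"]) auto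
  qed
  have good_nbhd: "\<exists>e>0. \<forall>z\<in>?S \<inter> hball y e. good z u" if "good y u" "y \<in> ?S" for y u
  proof -
    obtain e where e: "0 < e" "\<forall>z\<in>?S \<inter> hball y e. lor z u = - 1 / h (F z)" using \<open>good y u\<close> unfolding good_def by blast
    have "good z u" if z: "z \<in> ?S \<inter> hball y e" for z
    proof -
      obtain d where "0 < d" "hball z d \<subseteq> hball y e" using hball_sub_ex[OF _ SH[OF \<open>y \<in> ?S\<close>]] z by blast
      then show ?thesis using e(2) unfolding good_def by blast
    qed
    then show ?thesis using e(1) by blast
  qed
  have goodD: "lor y u = - 1 / h (F y)" if "good y u" "y \<in> ?S" for y u
    using that center_hball[OF SH[OF that(2)]] unfolding good_def by blast
  \<comment> \<open>The point \<open>y\<close> may lie over the frontier of \<open>C\<close>, where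
    the preimage need not be a neighbourhood in \<open>X\<close>. The path going up leads to points
    that have a ball mapped into \<open>C\<close>, and \<open>interior_point\<close> finds a smaller
    ball inside \<open>X\<close>; there the two functionals agree.\<close>
  have good_unique: "u = u'" if g: "good y u" "good y u'" and y: "y \<in> ?S" for y u u'
  proof -
    obtain e e' where e: "0 < e" "\<forall>z\<in>?S \<inter> hball y e. lor z u = - 1 / h (F z)" "0 < e'" "\<forall>z\<in>?S \<inter> hball y e'. lor z u' = - 1 / h (F z)"
      using g unfolding good_def by blast
    obtain g where g: "path g" "path_image g \<subseteq> ?S" "pathstart g = y" "\<And>s. 0 < s ==> s \<le> 1 ==> 1 < h (F (g s))" using lift[OF y] by blast
    have gH: "path_image g \<subseteq> Hyp" using g(2) X_Hyp by blast
    obtain s where s: "0 < s" "s \<le> 1" "g s \<in> hball y (min e e')" using path_start_hball[OF g(1) gH g(3), of "min e e'"] e(1,3) by auto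
    have gs: "g s \<in> ?S" using g(2) s(1,2) unfolding path_image_def by (metis atLeastAtMost_iff image_eqI less_imp_le subsetD)
    obtain r where r: "0 < r" "F ` hball (g s) r \<subseteq> C" using high[OF gs g(4)[OF s(1,2)]] by blast
    obtain d where d: "0 < d" "hball (g s) d \<subseteq> hball y (min e e')" using hball_sub_ex[OF s(3) SH[OF y]] by blast
    obtain z k where z: "z \<in> Hyp" "0 < k" "hball z k \<subseteq> X \<inter> hball (g s) (min r d)" using interior_point[of "g s" "min r d"] gs r(1) d(1) by auto
    show ?thesis
    proof (rule lor_eq_on_ball[OF z(1,2)])
      fix x assume "x \<in> hball z k"
      then have x: "x \<in> X" "x \<in> hball (g s) r" "x \<in> hball (g s) d" using z(3) by (auto simp: mem_hball)
      then have "x \<in> ?S" "x \<in> hball y e" "x \<in> hball y e'" using r(2) d(2) by (auto simp: mem_hball subset_iff)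
      then show "lor x u = lor x u'" using e by simp
    qed
  qed
  have good_close: "good y v" if y: "y \<in> ?S" and near: "\<And>e. 0 < e ==> \<exists>z\<in>?S \<inter> hball y e. good z v" for y v
  proof -
    obtain u e where u: "good y u" "0 < e" "\<forall>z\<in>?S \<inter> hball y e. good z u" using good_ex[OF y] good_nbhd[OF _ y] by metis
    then obtain z where "z \<in> ?S" "good z v" "good z u" using near by blast
    then show ?thesis using good_unique u(1) by metis
  qed
  fix c assume c: "c \<in> X" "F c \<in> C"
  then have cS: "c \<in> ?S" by blast
  obtain v where v: "good c v" "\<And>z. z \<in> Hyp ==> lor z v < 0" using good_ex[OF cS] by blast
  have good_D: "good y v" if D: "connected D" "D \<subseteq> ?S" "c \<in> D" "y \<in> D" for D y
  proof (rule hball_continuation[where P = "\<lambda>y. good y v", OF D(1) _ D(3,4) v(1)])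
    show "D \<subseteq> Hyp" using D(2) SH by blast
    show "\<exists>e>0. \<forall>z\<in>D \<inter> hball x e. good z v" if "x \<in> D" "good x v" for x using good_nbhd[OF that(2)] that(1) D(2) by blast
    show "good x v" if x: "x \<in> D" and near: "\<And>e. 0 < e ==> \<exists>z\<in>D \<inter> hball x e. good z v" for x
    proof (rule good_close)
      show "x \<in> ?S" using x D(2) by blast
      show "\<exists>z\<in>?S \<inter> hball x e. good z v" if "0 < e" for e using near[OF that] D(2) by blast
    qed
  qed
  obtain g where g: "path g" "path_image g \<subseteq> ?S" "pathstart g = c" "\<And>s. 0 < s ==> s \<le> 1 ==> 1 < h (F (g s))" using lift[OF cS] by blast
  \<comment> \<open>The height over \<open>c\<close> need not exceed 1; a point higher up is used,
    which lies in the open horoball.\<close>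
  define c' where "c' = pathfinish g"
  have c': "c' \<in> ?S" using g(2) pathfinish_in_path_image by (auto simp: c'_def)
  have "good c' v" unfolding c'_def using g by (intro good_D[OF connected_path_image[OF g(1)]]) auto
  define \<Omega> where "\<Omega> = X \<inter> {y \<in> Hyp. - lor y v < 1}"
  have nc: "nconvex \<Omega>" unfolding \<Omega>_def by (intro nconvex_Int nconvex_X nconvex_horoball) simp
  have c1: "- lor c' v < 1" using goodD[OF \<open>good c' v\<close> c'] g(4)[of 1] by (simp add: c'_def pathfinish_def)
  have c\<Omega>: "c' \<in> \<Omega>" using c' SH c1 by (simp add: \<Omega>_def)
  have \<Omega>H: "\<Omega> \<subseteq> Hyp" by (auto simp: \<Omega>_def)
  \<comment> \<open>Continuation over the convex set \<open>\<Omega>\<close>: openness holds because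
    the heights stay above 1, where the cusp is open in \<open>M\<close>, and closedness because
    \<open>C\<close> is closed.\<close>
  have "F y \<in> C \<and> good y v" if y: "y \<in> \<Omega>" for y
  proof (rule hball_continuation[where P = "\<lambda>y. F y \<in> C \<and> good y v", OF nconvex_connected[OF nc] \<Omega>H c\<Omega> y])
    show "F c' \<in> C \<and> good c' v" using c' \<open>good c' v\<close> by blast
    fix x assume x: "x \<in> \<Omega>"
    have xH: "x \<in> Hyp" "- lor x v < 1" "lor x v < 0" using x v(2) by (auto simp: \<Omega>_def)
    {
      assume P: "F x \<in> C \<and> good x v"
      then have xS: "x \<in> ?S" using x by (simp add: \<Omega>_def)
      have "1 < h (F x)" using goodD[OF _ xS] P xH by (force simp: field_simps)
      then obtain e e' where "0 < e" "F ` hball x e \<subseteq> C" "0 < e'" "\<forall>z\<in>?S \<inter> hball x e'. good z v" using high[OF xS] good_nbhd[OF _ xS] P by metis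
      then show "\<exists>e>0. \<forall>z\<in>\<Omega> \<inter> hball x e. F z \<in> C \<and> good z v"
        by (intro exI[of _ "min e e'"]) (auto simp: \<Omega>_def mem_hball image_subset_iff)
    }
    assume near: "\<And>e. 0 < e ==> \<exists>z\<in>\<Omega> \<inter> hball x e. F z \<in> C \<and> good z v"
    have "F x \<in> C"
    proof (rule ccontr)
      assume n: "F x \<notin> C"
      have "openin (top_of_set M) (M - C)" using C(1) by (simp add: openin_diff)
      then obtain s where s: "0 < s" "\<forall>q\<in>M. dist (F x) q < s --> q \<in> M - C"
        using openin_M_ball[of "M - C" "F x"] n F_M[OF xH(1)] by blast
      then show False using near[OF s(1)] F_lipschitz[OF xH(1)] F_M by (force simp: mem_hball)
    qed
    moreover have "good x v"
    proof (rule good_close)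
      show "x \<in> ?S" using x \<open>F x \<in> C\<close> by (simp add: \<Omega>_def)
      show "\<exists>z\<in>?S \<inter> hball x e. good z v" if "0 < e" for e using near[OF that] by (auto simp: \<Omega>_def)
    qed
    ultimately show "F x \<in> C \<and> good x v" by blast
  qed
  then have \<Omega>S: "\<Omega> \<subseteq> ?S" by (auto simp: \<Omega>_def)
  have "path_component ?S c (A c)" if A: "A \<in> GX" "A v = v" for A
  proof -
    have "A c' \<in> \<Omega>" using GX_X[OF A(1)] c' SH X_Hyp isoH_lor[OF GX_isoH[OF A(1)], of c' v] A(2) c1 by (simp add: \<Omega>_def)
    then have "path_component ?S c' (A c')" by (rule nseg_component[OF nc \<Omega>S c\<Omega>])
    moreover have "path_component ?S c c'" unfolding path_component_def using g by (auto simp: c'_def)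
    moreover have "path_image (A \<circ> g) \<subseteq> ?S" using g(2) GX_X[OF A(1)] GX_F[OF A(1)] by (force simp: path_image_compose)
    then have "path_component ?S (A c) (A c')" unfolding path_component_def using GX_path(1)[OF A(1) g(1)] g(2,3)
      by (intro exI[of _ "A \<circ> g"]) (auto simp: c'_def pathstart_compose pathfinish_compose)
    ultimately show ?thesis using path_component_trans path_component_sym by metis
  qed
  moreover have "A v = v" if A: "A \<in> GX" and cc: "connected_component ?S c (A c)" for A
  proof -
    have iA: "isoH A" using GX_isoH A by blast
    obtain D where D: "connected D" "D \<subseteq> ?S" "c \<in> D" "A c \<in> D" using cc unfolding connected_component_def by blast
    obtain e where e: "0 < e" "\<And>z. z \<in> ?S \<inter> hball c e ==> lor z v = - 1 / h (F z)" using v(1) unfolding good_def by blast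
    have "lor z (A v) = - 1 / h (F z)" if z: "z \<in> ?S \<inter> hball (A c) e" for z
    proof -
      obtain z' where z': "z' \<in> hball c e" "z = A z'" using z hball_image[OF iA, of c e] by blast
      then have "z' \<in> X" using GX_X[OF GX_inv[OF A], of z] z isoH_inv_apply(1)[OF iA, of z'] by simp
      then show ?thesis using e(2)[of z'] z' z GX_F[OF A] isoH_lor[OF iA, of z' v] by simp
    qed
    then have "good (A c) (A v)" using e(1) unfolding good_def by blast
    then show ?thesis using good_unique good_D[OF D] D(2,4) by blast
  qed
  ultimately show "\<exists>v. \<forall>A\<in>GX. (A v = v --> path_component ?S c (A c)) \<and> (connected_component ?S c (A c) --> A v = v)" by blast
qed

end

section \<open>Cusps in the upper half-space\<close>

context
  fixes M :: "'m::metric_space set" and T :: "'a::euclidean_space itself" and E :: "'e metric" and f :: "'e \<times> real => 'm"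
  assumes par: "cusp_parametrization TYPE('a) M E f"
begin

interpretation mc: charted "upw :: ('a \<times> real) \<times> real" M by standard

abbreviation "cusp_end \<equiv> mspace E \<times> {1..}"

definition cinv :: "'m => 'e \<times> real" where
  "cinv = inv_into cusp_end f"

lemma topspace_cusp: "topspace (cusp_topology E) = cusp_end"
  by (simp add: cusp_topology_def)

lemma cusp_closed: "closedin (top_of_set M) (f ` cusp_end)"
  using par by (simp add: cusp_parametrization_def)

lemma cusp_homeo: "homeomorphic_map (cusp_topology E) (top_of_set (f ` cusp_end)) f"
  using par closedin_subset[OF cusp_closed]
  by (simp add: cusp_parametrization_def embedding_map_def topspace_cusp subtopology_subtopology inf.absorb2)

lemma cinv: "z \<in> cusp_end ==> cinv (f z) = z"
  using homeomorphic_imp_injective_map[OF cusp_homeo] by (simp add: cinv_def topspace_cusp)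

lemma cusp_path:
  assumes "e \<in> mspace E" "1 \<le> t" shows "path (\<lambda>s. f (e, t + s))"
proof -
  have "continuous_map (top_of_set {0..1}) (top_of_set {1..}) (\<lambda>s. t + s)"
    using assms by (auto simp: continuous_map_in_subtopology intro!: continuous_intros)
  then have "continuous_map (top_of_set {0..1}) (cusp_topology E) (\<lambda>s. (e, t + s))"
    using assms unfolding cusp_topology_def by (intro continuous_map_pairedI) auto
  from continuous_map_compose[OF this homeomorphic_imp_continuous_map[OF cusp_homeo]] show ?thesis
    by (simp add: comp_def continuous_map_in_subtopology path_def)
qed

lemma cusp_high: "openin (top_of_set M) {p \<in> f ` cusp_end. 1 < snd (cinv p)}"
proof -
  have "{p \<in> f ` cusp_end. 1 < snd (cinv p)} = f ` (mspace E \<times> {1<..})"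
    using cinv by (force simp: image_iff)
  then show ?thesis using par by (simp add: cusp_parametrization_def)
qed

text \<open>The coordinates of the cusp over a small part of \<open>E\<close> form an isometric map
  into the upper half-space, so they differ from the given chart by one isometry; pulling back the
  null vector of the point at infinity gives \<open>u\<close>.\<close>

lemma cusp_chart:
  assumes p: "p \<in> f ` cusp_end" and U: "mc.lchart U \<psi>" "p \<in> U"
  shows "\<exists>u r. (\<forall>z\<in>Hyp. lor z u < 0) \<and> 0 < r \<and> (\<forall>q\<in>f ` cusp_end \<inter> U. dist p q < r --> lor (\<psi> q) u = - 1 / snd (cinv q))"
proof -
  obtain e t where et: "e \<in> mspace E" "1 \<le> t" "p = f (e, t)" using p by auto
  obtain W where W: "openin (cusp_topology E) W" "(e, t) \<in> W" "\<And>u v. u \<in> W ==> v \<in> W ==> dist (f u) (f v) = upper_dist (mdist E) u v"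
    using par et unfolding cusp_parametrization_def by (metis SigmaI atLeast_iff)
  have "\<exists>V (\<theta> :: 'e => 'a). isometric_chart E euc_half dist V \<theta> \<and> e \<in> V"
    using par et(1) by (simp add: cusp_parametrization_def compact_euclidean_manifold_def locally_isometric_to_def)
  then obtain V and \<theta> :: "'e => 'a" where V: "openin (mtopology_of E) V" "e \<in> V"
    "\<And>x y. x \<in> V ==> y \<in> V ==> dist (\<theta> x) (\<theta> y) = mdist E x y"
    by (auto simp: isometric_chart_def)
  define N where "N = W \<inter> (V \<times> {1..})"
  have "openin (cusp_topology E) (V \<times> {1..})" unfolding cusp_topology_def using V(1) openin_subtopology_self by (simp add: openin_prod_Times_iff)
  then have N: "openin (cusp_topology E) N" "(e, t) \<in> N" using W V(2) et(2) by (auto simp: N_def openin_Int)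
  have NE: "N \<subseteq> cusp_end" using openin_subset[OF N(1)] by (simp add: topspace_cusp)
  have "openin (top_of_set (f ` cusp_end)) (f ` N)" using homeomorphic_map_openness_eq[OF cusp_homeo] N(1) by blast
  then obtain Q where Q: "open Q" "f ` N = f ` cusp_end \<inter> Q" by (auto simp: openin_open)
  define S where "S = U \<inter> f ` N"
  \<comment> \<open>The image of the cusp is closed and \<open>p\<close> may lie at its bottom, so
    \<open>S\<close> need not be open in \<open>M\<close>; its part above height 1 near
    \<open>p\<close> contains an open set.\<close>
  define V' where "V' = U \<inter> ({p \<in> f ` cusp_end. 1 < snd (cinv p)} \<inter> Q)"
  have Uo: "openin (top_of_set M) U" using U(1) by (simp add: mc.lchart_def)
  then have V': "openin (top_of_set M) V'" "V' \<subseteq> S" using Q cusp_high unfolding V'_def S_def by (auto simp: openin_Int openin_Int_open)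
  obtain Q' where Q': "open Q'" "U = M \<inter> Q'" using Uo by (auto simp: openin_open)
  have "p \<in> Q \<inter> Q'" using N(2) Q(2) Q'(2) U(2) et(3) by blast
  then obtain r where r: "0 < r" "ball p r \<subseteq> Q \<inter> Q'" using open_contains_ball Q(1) Q'(1) by (metis open_Int)
  obtain d where d: "0 < d" "\<And>s. s \<in> {0..1} ==> dist s 0 < d ==> dist (f (e, t + s)) p < r"
    using cusp_path[OF et(1,2)] r(1) et(3) unfolding path_def continuous_on_iff by (metis add_0_right atLeastAtMost_iff order_refl zero_le_one)
  \<comment> \<open>A point slightly above \<open>p\<close> shows that \<open>V'\<close> is
    nonempty.\<close>
  define s where "s = min 1 (d / 2)"
  have s: "0 < s" "(e, t + s) \<in> cusp_end" "f (e, t + s) \<in> ball p r" using d et(1,2) by (auto simp: s_def dist_commute)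
  then have "f (e, t + s) \<in> V'" unfolding V'_def Q'(2) using r(2) closedin_subset[OF cusp_closed] cinv[OF s(2)] et(2) by auto
  moreover define \<phi> where "\<phi> p = (\<theta> (fst (cinv p)), snd (cinv p))" for p
  have \<phi>: "\<exists>z\<in>N. q = f z \<and> \<phi> q = (\<theta> (fst z), snd z) \<and> 0 < snd (\<phi> q)" if "q \<in> S" for q
    using that NE cinv by (force simp: S_def \<phi>_def)
  have "hdist (upJ (\<phi> q)) (upJ (\<phi> q')) = dist q q'" if q: "q \<in> S" "q' \<in> S" for q q'
  proof -
    obtain z z' where z: "z \<in> N" "q = f z" "\<phi> q = (\<theta> (fst z), snd z)" "z' \<in> N" "q' = f z'" "\<phi> q' = (\<theta> (fst z'), snd z')"
      and pos: "0 < snd (\<phi> q)" "0 < snd (\<phi> q')" using \<phi>[OF q(1)] \<phi>[OF q(2)] by blast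
    have "upper_dist dist (\<phi> q) (\<phi> q') = upper_dist (mdist E) z z'"
      using V(3)[of "fst z" "fst z'"] z(1,4) unfolding z(3,6) by (auto simp: N_def upper_dist_def case_prod_beta)
    then show ?thesis using hdist_upJ[OF pos] W(3)[of z z'] z by (simp add: N_def)
  qed
  ultimately obtain T where T: "isoH T" "\<And>q. q \<in> S ==> upJ (\<phi> q) = T (\<psi> q)"
    using mc.lchart_extends[OF U(1) V'(1) _ V'(2), of "\<lambda>q. upJ (\<phi> q)"] upJ_Hyp \<phi> unfolding S_def by (metis (no_types, lifting) Int_lower1 empty_iff)
  have l: "lor z (invf T upv) = lor (T z) upv" for z using isoH_lor_inv[OF T(1)] by simp
  have "lor (\<psi> q) (invf T upv) = - 1 / snd (cinv q)" if q: "q \<in> f ` cusp_end \<inter> U" "dist p q < r" for q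
  proof -
    have "q \<in> S" using q r(2) Q(2) by (auto simp: S_def)
    then show ?thesis using T(2)[of q] lor_upv[of "\<phi> q"] by (simp add: l \<phi>_def)
  qed
  moreover have "\<forall>z\<in>Hyp. lor z (invf T upv) < 0" by (simp add: l null_lor_Hyp[OF null_upv] isoH_Hyp[OF T(1)])
  ultimately show ?thesis using r(1) by blast
qed

lemma cusp_separable:
  assumes F: "finvol_chamber (upw :: ('a \<times> real) \<times> real) M F b" and a: "a \<in> chamber.X F b"
    and \<gamma>: "path \<gamma>" "path_image \<gamma> \<subseteq> M" "pathstart \<gamma> = F a" "pathfinish \<gamma> \<in> f ` cusp_end"
  shows "separable_subgroup (fundamental_group M (F a)) (pi1_image M (f ` cusp_end) \<gamma>)"
proof -
  interpret FC: finvol_chamber "upw :: ('a \<times> real) \<times> real" M F b by (rule F)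
  show ?thesis
  proof (rule FC.horocusp_separable[OF a cusp_chart cusp_closed cusp_high _ \<gamma>])
    fix p assume "p \<in> f ` cusp_end"
    then obtain e t where et: "e \<in> mspace E" "1 \<le> t" "p = f (e, t)" by auto
    have "1 < snd (cinv (f (e, t + s)))" if "0 < s" for s using cinv[of "(e, t + s)"] et that by simp
    then show "\<exists>\<kappa>. path \<kappa> \<and> path_image \<kappa> \<subseteq> f ` cusp_end \<and> pathstart \<kappa> = p \<and> (\<forall>s. 0 < s --> s \<le> 1 --> 1 < snd (cinv (\<kappa> s)))"
      using cusp_path[OF et(1,2)] et by (intro exI[of _ "\<lambda>s. f (e, t + s)"]) (auto simp: path_image_def pathstart_def)
  qed
qed

end

theorem theorem4:
  fixes M :: "'m::metric_space set" and x :: 'm and H :: "(real \<Rightarrow> 'm) set set"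
  assumes "finite_volume_hyperbolic_manifold TYPE('a::euclidean_space) M"
    and "x \<in> M"
    and "peripheral_subgroup TYPE('a) M x H"
  shows "separable_subgroup (fundamental_group M x) H"
proof -
  obtain F where F: "finvol (upw :: ('a \<times> real) \<times> real) M F" "chamber (upw :: ('a \<times> real) \<times> real) M F tau"
    using hyp_manifold_folding[OF assms(1)] by blast
  have FC: "finvol_chamber (upw :: ('a \<times> real) \<times> real) M F tau" using F by (simp add: finvol_chamber_def)
  interpret finvol_chamber "upw :: ('a \<times> real) \<times> real" M F tau by (rule FC)
  obtain a where a: "a \<in> X" "F a = x" using F_X assms(2) by blast
  obtain C \<gamma> where C: "C \<in> components (hyp_boundary TYPE('a) M) \<or> internal_cusp TYPE('a) M C \<or> boundary_cusp TYPE('a) M C"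
    and \<gamma>: "path \<gamma>" "path_image \<gamma> \<subseteq> M" "pathstart \<gamma> = F a" "pathfinish \<gamma> \<in> C" and H: "H = pi1_image M C \<gamma>"
    using assms(3) a(2) by (auto simp: peripheral_subgroup_def)
  have "separable_subgroup (fundamental_group M (F a)) (pi1_image M C \<gamma>)"
  proof (cases "C \<in> components (hyp_boundary TYPE('a) M)")
    case True
    then show ?thesis using wall_separable[OF a(1) _ \<gamma>] hyp_boundary_bd by metis
  next
    case False
    then obtain E :: "'m metric" and f where "cusp_parametrization TYPE('a) M E f" "C = f ` (mspace E \<times> {1..})"
      using C by (auto simp: internal_cusp_def boundary_cusp_def)
    then show ?thesis using cusp_separable[OF _ FC a(1) \<gamma>(1-3)] \<gamma>(4) by metis
  qed
  then show ?thesis using a(2) H by simp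
qed

end
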